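(* Let $\Pi=\{\mathcal H_0\oplus\mathcal H_1,\Gamma_0,\Gamma_1\}$ be a decomposing $D$-triplet for $L$ ($\mathcal H_j=H^n\oplus\mathcal H_j'$), let $\theta=\{(C_0,C_1);\mathcal K\}\in\widetilde{\mathcal C}(\mathcal H_0,\mathcal H_1)$ be an operator pair with block representations $$C_0=(\hat C_2\;\;C_0'):H^n\oplus\mathcal H_0'\to\mathcal K,\qquad C_1=(-\hat C_1\;\;C_1'):H^n\oplus\mathcal H_1'\to\mathcal K,$$ and let $\widetilde A\in Ext_{L_0}$ be the proper extension given by the boundary conditions $$\mathcal D(\widetilde A)=\{y\in\mathcal D:\hat C_1y^{(1)}(0)+\hat C_2y^{(2)}(0)+C_0'\Gamma_0'y+C_1'\Gamma_1'y=0\},\qquad\widetilde A=L\upharpoonright\mathcal D(\widetilde A).$$ For $\lambda\in\mathbb C$ let $Z(\cdot,\lambda):\Delta\to[\mathcal K',H]$ be a fundamental solution of $l[y]-\lambda y=0$ and define $T\in[\mathcal K',\mathcal K]$ by $$Th'=\big(\hat C_1Z^{(1)}(0,\lambda)+\hat C_2Z^{(2)}(0,\lambda)\big)h'+(C_0'\Gamma_0'+C_1'\Gamma_1')(Z(\cdot,\lambda)h'),\qquad h'\in\mathcal K'.$$ Then for every $\lambda\in\hat\rho(L_0)$: $$\lambda\in\rho(\widetilde A)\iff0\in\rho(T),\qquad\lambda\in\sigma_j(\widetilde A)\iff0\in\sigma_j(T),\quad j\in\{p,c,r\},$$ $$\lambda\in\hat\rho(\widetilde A)\iff0\in\hat\rho(T),\qquad\overline{\mathcal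 R(\widetilde A-\lambda)}=\mathcal R(\widetilde A-\lambda)\iff\overline{\mathcal R(T)}=\mathcal R(T).$$
   Context: **Setting.** $[X,Y]$ is the set of bounded linear operators from a Hilbert space $X$ to a Hilbert space $Y$, $[X]=[X,X]$. $\Delta=[0,b\rangle$ with $0<b\le\infty$ (if $b<\infty$, $b$ may or may not belong to $\Delta$), $H$ is a separable complex Hilbert space ($\dim H\le\infty$), $D=d/dt$, and $$l[y]=\sum_{k=1}^n(-1)^k\Big(D^k(p_{n-k}D^ky)-\tfrac i2\big[D^{k-1}(q_{n-k}^*D^ky)+D^k(q_{n-k}D^{k-1}y)\big]\Big)+p_ny$$ with sufficiently smooth coefficients $p_k,q_k:\Delta\to[H]$, $p_k(t)=p_k^*(t)$, $p_0(t)^{-1}\in[H]$. Quasi-derivatives: $y^{[k]}=D^ky$ ($0\le k\le n-1$), $y^{[n]}=p_0D^ny-\frac i2q_0D^{n-1}y$, $y^{[n+k]}=-Dy^{[n+k-1]}+p_kD^{n-k}y+\frac i2(q_{k-1}^*D^{n-k+1}y-q_kD^{n-k-1}y)$ ($1\le k\le n-1$), $y^{[2n]}=-Dy^{[2n-1]}+p_ny+\frac i2q_{n-1}^*Dy=l[y]$; the same formulas apply to operator functions $Y:\Delta\to[\mathcal K,H]$. Put $y^{(1)}(t)=(y^{[0]}(t),\dots,y^{[n-1]}(t))$, $y^{(2)}(t)=(y^{[2n-1]}(t),\dots,y^{[n]}(t))$ (columns, in $H^n$, resp. $[\mathcal K,H^n]$), $\widetilde y(t)=\{y^{(1)}(t),y^{(2)}(t)\}$.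 $\mathfrak H=L_2(\Delta;H)$. The maximal operator $L$ has domain $\mathcal D=\{y\in\mathfrak H:\ y^{[k]}\ (0\le k\le2n-2)$ continuously differentiable, $y^{[2n-1]}$ (locally) absolutely continuous, $l[y]\in\mathfrak H\}$ and $Ly=l[y]$. Put $[y,z](t)=(y^{(1)}(t),z^{(2)}(t))-(y^{(2)}(t),z^{(1)}(t))$, $[y,z](b)=\lim_{t\uparrow b}[y,z](t)$. The minimal operator $L_0$ is the restriction of $L$ to $\{y\in\mathcal D:\widetilde y(0)=0,\ [y,z](b)=0\ \forall z\in\mathcal D\}$; it is closed, densely defined, symmetric and $L_0^*=L$. $\mathfrak N_\lambda(L_0)=\mathrm{Ker}(L-\lambda)$. $Ext_{L_0}$ is the set of closed operators $\widetilde A$ with $L_0\subset\widetilde A\subset L$. **Decomposing $D$-triplet.** $\mathcal H_1'$ is a subspace of a Hilbert space $\mathcal H_0'$, $\mathcal H_2'=\mathcal H_0'\ominus\mathcal H_1'$, $P_2'$ is the orthoprojector in $\mathcal H_0'$ onto $\mathcal H_2'$, $\Gamma_j':\mathcal D\to\mathcal H_j'$ ($j=0,1$) are linear, $\mathcal H_j=H^n\oplus\mathcal H_j'$, $\Gamma_0y=\{y^{(2)}(0),\Gamma_0'y\}$, $\Gamma_1y=\{-y^{(1)}(0),\Gamma_1'y\}$. $\Pi=\{\mathcal H_0\oplus\mathcal H_1,\Gamma_0,\Gamma_1\}$ is a decomposing $D$-triplet for $L$ if $(\Gamma_0'\;\Gamma_1')^\top:\mathcal D\to\mathcal H_0'\oplus\mathcal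 H_1'$ is surjective and $[y,z](b)=(\Gamma_1'y,\Gamma_0'z)-(\Gamma_0'y,\Gamma_1'z)+i(P_2'\Gamma_0'y,P_2'\Gamma_0'z)$, $y,z\in\mathcal D$. **Operator pairs.** $\theta=\{(C_0,C_1);\mathcal K\}\in\widetilde{\mathcal C}(\mathcal H_0,\mathcal H_1)$ means $C_j\in[\mathcal H_j,\mathcal K]$ ($\mathcal K$ a Hilbert space) with $(C_0\;C_1):\mathcal H_0\oplus\mathcal H_1\to\mathcal K$ surjective. **Fundamental solution.** $Z(\cdot,\lambda):\Delta\to[\mathcal K',H]$ ($\mathcal K'$ a Hilbert space) is a fundamental solution of $l[y]-\lambda y=0$ if it is an operator-valued solution, $Z(\cdot,\lambda)h'\in\mathfrak H$ for all $h'\in\mathcal K'$, and for every $y\in\mathfrak N_\lambda(L_0)$ there is a unique $h'\in\mathcal K'$ with $y(t)=Z(t,\lambda)h'$. **Spectral notation.** For a closed operator $T$ from $X$ to $Y$ with kernel $\mathrm{Ker}T$ and range $\mathcal R(T)$: $0\in\rho(T)$ iff $\mathrm{Ker}T=\{0\}$ and $\mathcal R(T)=Y$; $0\in\hat\rho(T)$ iff $\mathrm{Ker}T=\{0\}$ and $\mathcal R(T)$ is closed; $0\in\sigma_p(T)$ iff $\mathrm{Ker}T\ne\{0\}$; $0\in\sigma_c(T)$ iff $\mathrm{Ker}T=\{0\}$ and $\overline{\mathcal R(T)}=Y\ne\mathcal R(T)$; $0\in\sigma_r(T)$ iff $\mathrm{Ker}T=\{0\}$ and $\overline{\mathcal R(T)}\ne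 Y$. For an operator $A$ in $\mathfrak H$, $\lambda$ belongs to $\rho(A),\hat\rho(A),\sigma_j(A)$ iff $0$ belongs to the corresponding set for $A-\lambda$. *)

theory Defs
  imports "HOL-Analysis.Analysis"
begin

section \<open>Complex Hilbert spaces\<close>

text \<open>
  The inner product is linear in its first argument.  The real inner product and the norm are those
  of the underlying real space, so that the real analysis library applies unchanged.
\<close>

class complex_inner = real_inner +
  fixes scaleC :: "complex \<Rightarrow> 'a \<Rightarrow> 'a"  (infixr \<open>*\<^sub>C\<close> 75)
    and cinner :: "'a \<Rightarrow> 'a \<Rightarrow> complex"
  assumes scaleC_add_right: "c *\<^sub>C (x + y) = c *\<^sub>C x + c *\<^sub>C y"
    and scaleC_add_left: "(c + d) *\<^sub>C x = c *\<^sub>C x + d *\<^sub>C x"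
    and scaleC_scaleC: "c *\<^sub>C d *\<^sub>C x = (c * d) *\<^sub>C x"
    and scaleC_of_real: "complex_of_real r *\<^sub>C x = r *\<^sub>R x"
    and cinner_commute: "cinner x y = cnj (cinner y x)"
    and cinner_add_left: "cinner (x + y) z = cinner x z + cinner y z"
    and cinner_scaleC_left: "cinner (c *\<^sub>C x) y = c * cinner x y"
    and Re_cinner: "Re (cinner x y) = inner x y"

class complex_hilbert = complex_inner + banach

lemma cinner_scaleC_right: "cinner x (c *\<^sub>C y) = cnj c * cinner x y"
  by (metis cinner_commute cinner_scaleC_left complex_cnj_mult)

lemma cinner_self: "cinner x x = complex_of_real (inner x x)"
proof -
  have "Im (cinner x x) = 0"
    by (metis cinner_commute cnj.simps(2) equation_minus_iff neg_equal_zero)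
  then show ?thesis
    by (simp add: complex_eq_iff Re_cinner)
qed

lemma norm_scaleC: "norm (c *\<^sub>C x) = cmod c * norm x"
proof -
  have "complex_of_real (inner (c *\<^sub>C x) (c *\<^sub>C x)) = (c * cnj c) * complex_of_real (inner x x)"
    by (simp only: cinner_self[symmetric] cinner_scaleC_left cinner_scaleC_right ac_simps)
  also have "\<dots> = complex_of_real ((cmod c)\<^sup>2 * inner x x)"
    by (simp only: complex_norm_square of_real_mult)
  finally have "inner (c *\<^sub>C x) (c *\<^sub>C x) = (cmod c)\<^sup>2 * inner x x"
    by (simp only: of_real_eq_iff)
  then show ?thesis
    by (simp add: norm_eq_sqrt_inner real_sqrt_mult)
qed

lemma bounded_linear_scaleC: "bounded_linear (\<lambda>x :: 'a :: complex_inner. c *\<^sub>C x)"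
proof (rule bounded_linear_intro)
  fix x y :: 'a and r :: real
  show "c *\<^sub>C (x + y) = c *\<^sub>C x + c *\<^sub>C y" by (rule scaleC_add_right)
  show "c *\<^sub>C r *\<^sub>R x = r *\<^sub>R c *\<^sub>C x"
    by (metis mult.commute scaleC_of_real scaleC_scaleC)
  show "norm (c *\<^sub>C x) \<le> norm x * cmod c"
    by (simp add: norm_scaleC mult.commute)
qed

lemma cinner_eq_Complex: "cinner x y = Complex (inner x y) (inner x (\<i> *\<^sub>C y))"
  by (simp add: complex_eq_iff Re_cinner[symmetric] cinner_scaleC_right)

text \<open>Finite orthogonal sums: \<open>'a ^ 'n\<close> is $H^n$ and \<open>'a \<times> 'b\<close> is $H \oplus K$.\<close>

instantiation vec :: (complex_inner, finite) complex_inner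
begin

definition "c *\<^sub>C x = (\<chi> i. c *\<^sub>C x $ i)"
definition "cinner x y = (\<Sum>i\<in>UNIV. cinner (x $ i) (y $ i))"

instance
proof
  fix x y z :: "('a, 'b) vec" and c d :: complex and r :: real
  show "c *\<^sub>C (x + y) = c *\<^sub>C x + c *\<^sub>C y"
    by (simp add: scaleC_vec_def vec_eq_iff scaleC_add_right)
  show "(c + d) *\<^sub>C x = c *\<^sub>C x + d *\<^sub>C x"
    by (simp add: scaleC_vec_def vec_eq_iff scaleC_add_left)
  show "c *\<^sub>C d *\<^sub>C x = (c * d) *\<^sub>C x"
    by (simp add: scaleC_vec_def vec_eq_iff scaleC_scaleC)
  show "complex_of_real r *\<^sub>C x = r *\<^sub>R x"
    by (simp add: scaleC_vec_def vec_eq_iff scaleC_of_real)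
  show "cinner x y = cnj (cinner y x)"
    by (simp add: cinner_vec_def cnj_sum cinner_commute[symmetric])
  show "cinner (x + y) z = cinner x z + cinner y z"
    by (simp add: cinner_vec_def cinner_add_left sum.distrib)
  show "cinner (c *\<^sub>C x) y = c * cinner x y"
    by (simp add: cinner_vec_def scaleC_vec_def cinner_scaleC_left sum_distrib_left)
  show "Re (cinner x y) = inner x y"
    by (simp add: cinner_vec_def inner_vec_def Re_cinner)
qed

end

instance vec :: (complex_hilbert, finite) complex_hilbert ..

instantiation prod :: (complex_inner, complex_inner) complex_inner
begin

definition "c *\<^sub>C x = (c *\<^sub>C fst x, c *\<^sub>C snd x)"
definition "cinner x y = cinner (fst x) (fst y) + cinner (snd x) (snd y)"

instance
proof
  fix x y z :: "'a \<times> 'b" and c d :: complex and r :: real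
  show "c *\<^sub>C (x + y) = c *\<^sub>C x + c *\<^sub>C y"
    by (simp add: scaleC_prod_def scaleC_add_right)
  show "(c + d) *\<^sub>C x = c *\<^sub>C x + d *\<^sub>C x"
    by (simp add: scaleC_prod_def scaleC_add_left)
  show "c *\<^sub>C d *\<^sub>C x = (c * d) *\<^sub>C x"
    by (simp add: scaleC_prod_def scaleC_scaleC)
  show "complex_of_real r *\<^sub>C x = r *\<^sub>R x"
    by (simp add: scaleC_prod_def prod_eq_iff scaleC_of_real)
  show "cinner x y = cnj (cinner y x)"
    by (simp add: cinner_prod_def cinner_commute[symmetric])
  show "cinner (x + y) z = cinner x z + cinner y z"
    by (simp add: cinner_prod_def cinner_add_left)
  show "cinner (c *\<^sub>C x) y = c * cinner x y"
    by (simp add: cinner_prod_def scaleC_prod_def cinner_scaleC_left distrib_left)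
  show "Re (cinner x y) = inner x y"
    by (simp add: cinner_prod_def inner_prod_def Re_cinner)
qed

end

instance prod :: (complex_hilbert, complex_hilbert) complex_hilbert ..

definition csubspace :: "'a::complex_inner set \<Rightarrow> bool" where
  "csubspace S \<longleftrightarrow>
     0 \<in> S \<and> (\<forall>x\<in>S. \<forall>y\<in>S. x + y \<in> S) \<and> (\<forall>c. \<forall>x\<in>S. c *\<^sub>C x \<in> S)"

definition orth_complement :: "'a::complex_inner set \<Rightarrow> 'a set" where
  "orth_complement S = {x. \<forall>y\<in>S. cinner x y = 0}"

definition orth_projector :: "'a::complex_inner set \<Rightarrow> 'a \<Rightarrow> 'a" where
  "orth_projector S x = (THE y. y \<in> S \<and> x - y \<in> orth_complement S)"

text \<open>
  Bounded complex-linear operators occur in two forms.  Operators on a whole space that are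
  differentiated with respect to a parameter are complex-linear elements of the (real) Banach space
  of bounded operators \<open>'a \<Rightarrow>\<^sub>L 'b\<close>, whose norm is the operator norm; operators on a closed subspace
  \<open>S\<close> are functions, constrained on \<open>S\<close> only.
\<close>

definition complex_linear :: "('a::complex_inner \<Rightarrow>\<^sub>L 'b::complex_inner) \<Rightarrow> bool" where
  "complex_linear A \<longleftrightarrow> (\<forall>c x. A (c *\<^sub>C x) = c *\<^sub>C A x)"

definition bounded_operator_on ::
    "'a::complex_inner set \<Rightarrow> ('a \<Rightarrow> 'b::complex_inner) \<Rightarrow> bool" where
  "bounded_operator_on S A \<longleftrightarrow>
     (\<forall>x\<in>S. \<forall>y\<in>S. A (x + y) = A x + A y) \<and>
     (\<forall>c. \<forall>x\<in>S. A (c *\<^sub>C x) = c *\<^sub>C A x) \<and>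
     (\<exists>M. \<forall>x\<in>S. norm (A x) \<le> M * norm x)"

definition adjoint_op :: "('a::complex_inner \<Rightarrow>\<^sub>L 'b::complex_inner) \<Rightarrow> 'b \<Rightarrow>\<^sub>L 'a" where
  "adjoint_op A = (THE B :: 'b \<Rightarrow>\<^sub>L 'a. \<forall>x y. cinner (A x) y = cinner x (B y))"

definition scalar_op :: "complex \<Rightarrow> 'a::complex_inner \<Rightarrow>\<^sub>L 'a" where
  "scalar_op c = Blinfun (\<lambda>x. c *\<^sub>C x)"


section \<open>The space of square-integrable functions\<close>

definition square_integrable :: "(real \<Rightarrow> 'a::{complex_inner, second_countable_topology}) \<Rightarrow> bool"
  where "square_integrable f \<longleftrightarrow>
    f \<in> borel_measurable lebesgue \<and> integrable lebesgue (\<lambda>t. (norm (f t))\<^sup>2)"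

lemma square_integrable_zero: "square_integrable (\<lambda>_. 0)"
  by (simp add: square_integrable_def)

lemma square_integrable_scaleC:
  assumes "square_integrable f"
  shows "square_integrable (\<lambda>t. c *\<^sub>C f t)"
proof -
  have "continuous_on UNIV (\<lambda>x::'a. c *\<^sub>C x)"
    by (rule linear_continuous_on[OF bounded_linear_scaleC])
  then have "(\<lambda>x::'a. c *\<^sub>C x) \<in> borel_measurable borel"
    by (rule borel_measurable_continuous_onI)
  then have "(\<lambda>t. c *\<^sub>C f t) \<in> borel_measurable lebesgue"
    using assms measurable_compose unfolding square_integrable_def by blast
  then show ?thesis
    using assms by (simp add: square_integrable_def norm_scaleC power_mult_distrib)
qed

lemma square_integrable_scaleR: "square_integrable f \<Longrightarrow> square_integrable (\<lambda>t. r *\<^sub>R f t)"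
  using square_integrable_scaleC[of f "complex_of_real r"] by (simp add: scaleC_of_real)

lemma square_integrable_add:
  assumes "square_integrable f" "square_integrable g"
  shows "square_integrable (\<lambda>t. f t + g t)"
proof -
  have meas: "(\<lambda>t. f t + g t) \<in> borel_measurable lebesgue"
    using assms by (auto simp: square_integrable_def)
  have bound: "(norm (x + y))\<^sup>2 \<le> 2 * (norm x)\<^sup>2 + 2 * (norm y)\<^sup>2" for x y :: 'a
  proof -
    have "(norm (x + y))\<^sup>2 \<le> (norm x + norm y)\<^sup>2"
      by (intro power_mono norm_triangle_ineq) simp
    also have "\<dots> \<le> 2 * (norm x)\<^sup>2 + 2 * (norm y)\<^sup>2"
      using sum_squares_bound[of "norm x" "norm y"] by (simp add: power2_sum)
    finally show ?thesis .
  qed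
  have "integrable lebesgue (\<lambda>t. (norm (f t + g t))\<^sup>2)"
  proof (rule Bochner_Integration.integrable_bound)
    show "integrable lebesgue (\<lambda>t. 2 * (norm (f t))\<^sup>2 + 2 * (norm (g t))\<^sup>2)"
      using assms by (auto simp: square_integrable_def)
    show "(\<lambda>t. (norm (f t + g t))\<^sup>2) \<in> borel_measurable lebesgue"
      using meas by simp
    show "AE t in lebesgue. norm ((norm (f t + g t))\<^sup>2) \<le>
        norm (2 * (norm (f t))\<^sup>2 + 2 * (norm (g t))\<^sup>2)"
      using bound by (auto intro!: AE_I2)
  qed
  with meas show ?thesis by (simp add: square_integrable_def)
qed

lemma square_integrable_uminus: "square_integrable f \<Longrightarrow> square_integrable (\<lambda>t. - f t)"
  using square_integrable_scaleR[of f "-1"] by simp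

lemma square_integrable_diff:
  "square_integrable f \<Longrightarrow> square_integrable g \<Longrightarrow> square_integrable (\<lambda>t. f t - g t)"
  using square_integrable_add[of f "\<lambda>t. - g t"] by (simp add: square_integrable_uminus)

lemma integrable_inner:
  assumes "square_integrable f" "square_integrable g"
  shows "integrable lebesgue (\<lambda>t. inner (f t) (g t))"
proof (rule Bochner_Integration.integrable_bound)
  show "integrable lebesgue (\<lambda>t. (norm (f t))\<^sup>2 + (norm (g t))\<^sup>2)"
    using assms by (auto simp: square_integrable_def)
  show "(\<lambda>t. inner (f t) (g t)) \<in> borel_measurable lebesgue"
    using assms by (auto simp: square_integrable_def)
  have "norm (inner x y) \<le> norm ((norm x)\<^sup>2 + (norm y)\<^sup>2)" for x y :: 'a
  proof -
    have "\<bar>inner x y\<bar> \<le> norm x * norm y" by (rule Cauchy_Schwarz_ineq2)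
    moreover have "2 * (norm x * norm y) \<le> (norm x)\<^sup>2 + (norm y)\<^sup>2"
      using sum_squares_bound[of "norm x" "norm y"] by simp
    moreover have "0 \<le> norm x * norm y" by simp
    ultimately show ?thesis by simp
  qed
  then show "AE t in lebesgue. norm (inner (f t) (g t)) \<le> norm ((norm (f t))\<^sup>2 + (norm (g t))\<^sup>2)"
    by simp
qed

lemma integrable_cinner:
  assumes "square_integrable f" "square_integrable g"
  shows "integrable lebesgue (\<lambda>t. cinner (f t) (g t))"
proof -
  have "integrable lebesgue
      (\<lambda>t. complex_of_real (inner (f t) (g t)) + \<i> * complex_of_real (inner (f t) (\<i> *\<^sub>C g t)))"
    by (intro Bochner_Integration.integrable_add integrable_mult_right integrable_of_real
        integrable_inner assms square_integrable_scaleC)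
  then show ?thesis
    by (simp only: cinner_eq_Complex Complex_eq)
qed

text \<open>
  \<open>'a L2\<close> is $L_2(\mathbb R; H)$; the space $L_2(\Delta; H)$ is identified below with its subspace of
  classes vanishing almost everywhere outside $\Delta$.
\<close>

quotient_type (overloaded) 'a L2 = "real \<Rightarrow> 'a :: {complex_inner, second_countable_topology}" /
  partial: "\<lambda>f g. square_integrable f \<and> square_integrable g \<and> (AE t in lebesgue. f t = g t)"
proof (rule part_equivpI)
  show "\<exists>f::real \<Rightarrow> 'a. square_integrable f \<and> square_integrable f \<and> (AE t in lebesgue. f t = f t)"
    using square_integrable_zero by auto
qed (auto simp: symp_def transp_def elim: AE_mp)

instantiation L2 :: ("{complex_inner, second_countable_topology}") real_vector
begin

lift_definition zero_L2 :: "'a L2" is "\<lambda>_. 0"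
  by (simp add: square_integrable_zero)

lift_definition plus_L2 :: "'a L2 \<Rightarrow> 'a L2 \<Rightarrow> 'a L2" is "\<lambda>f g t. f t + g t"
  by (auto simp: square_integrable_add)

lift_definition uminus_L2 :: "'a L2 \<Rightarrow> 'a L2" is "\<lambda>f t. - f t"
  by (auto simp: square_integrable_uminus)

lift_definition minus_L2 :: "'a L2 \<Rightarrow> 'a L2 \<Rightarrow> 'a L2" is "\<lambda>f g t. f t - g t"
  by (auto simp: square_integrable_diff)

lift_definition scaleR_L2 :: "real \<Rightarrow> 'a L2 \<Rightarrow> 'a L2" is "\<lambda>r f t. r *\<^sub>R f t"
  by (auto simp: square_integrable_scaleR)

instance
proof
  fix x y z :: "'a L2" and r s :: real
  show "x + y + z = x + (y + z)"
    by transfer (auto simp: algebra_simps square_integrable_add)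
  show "x + y = y + x"
    by transfer (auto simp: algebra_simps square_integrable_add)
  show "0 + x = x" by transfer auto
  show "- x + x = 0" by transfer (auto simp: square_integrable_zero)
  show "x - y = x + - y" by transfer (auto simp: square_integrable_diff)
  show "r *\<^sub>R (x + y) = r *\<^sub>R x + r *\<^sub>R y"
    by transfer (auto simp: scaleR_add_right square_integrable_add square_integrable_scaleR)
  show "(r + s) *\<^sub>R x = r *\<^sub>R x + s *\<^sub>R x"
    by transfer (auto simp: scaleR_add_left square_integrable_add square_integrable_scaleR)
  show "r *\<^sub>R s *\<^sub>R x = (r * s) *\<^sub>R x"
    by transfer (auto simp: square_integrable_scaleR)
  show "1 *\<^sub>R x = x" by transfer auto
qed

end

instantiation L2 :: ("{complex_inner, second_countable_topology}") complex_inner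
begin

lift_definition scaleC_L2 :: "complex \<Rightarrow> 'a L2 \<Rightarrow> 'a L2" is "\<lambda>c f t. c *\<^sub>C f t"
  by (auto simp: square_integrable_scaleC)

lift_definition inner_L2 :: "'a L2 \<Rightarrow> 'a L2 \<Rightarrow> real" is
  "\<lambda>f g. integral\<^sup>L lebesgue (\<lambda>t. inner (f t) (g t))"
  by (rule integral_cong_AE) (auto simp: integrable_inner borel_measurable_integrable)

lift_definition cinner_L2 :: "'a L2 \<Rightarrow> 'a L2 \<Rightarrow> complex" is
  "\<lambda>f g. integral\<^sup>L lebesgue (\<lambda>t. cinner (f t) (g t))"
  by (rule integral_cong_AE) (auto simp: integrable_cinner borel_measurable_integrable)

definition "norm_L2 (f :: 'a L2) = sqrt (inner f f)"
definition "sgn_L2 (f :: 'a L2) = f /\<^sub>R norm f"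
definition "dist_L2 (f :: 'a L2) g = norm (f - g)"
definition "(uniformity :: ('a L2 \<times> 'a L2) filter) =
  (INF e\<in>{0 <..}. principal {(x, y). dist x y < e})"
definition "open_L2 (U :: 'a L2 set) \<longleftrightarrow>
  (\<forall>x\<in>U. eventually (\<lambda>(x', y). x' = x \<longrightarrow> y \<in> U) uniformity)"

instance
proof
  fix x y z :: "'a L2" and r :: real and c d :: complex
  show "sgn x = x /\<^sub>R norm x" by (rule sgn_L2_def)
  show "dist x y = norm (x - y)" by (rule dist_L2_def)
  show "(uniformity :: ('a L2 \<times> 'a L2) filter) =
      (INF e\<in>{0 <..}. principal {(x, y). dist x y < e})"
    by (rule uniformity_L2_def)
  show "open U \<longleftrightarrow> (\<forall>x\<in>U. eventually (\<lambda>(x', y). x' = x \<longrightarrow> y \<in> U) uniformity)" for U :: "'a L2 set"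
    by (rule open_L2_def)
  show "inner x y = inner y x" by transfer (simp add: inner_commute)
  show "inner (x + y) z = inner x z + inner y z"
    by transfer (simp add: inner_add_left integrable_inner)
  show "inner (r *\<^sub>R x) y = r * inner x y"
    by transfer simp
  show "0 \<le> inner x x" by transfer (simp add: integral_nonneg_AE)
  show "inner x x = 0 \<longleftrightarrow> x = 0"
    by transfer (simp add: integral_nonneg_eq_0_iff_AE integrable_inner square_integrable_zero)
  show "norm x = sqrt (inner x x)" by (rule norm_L2_def)
  show "c *\<^sub>C (x + y) = c *\<^sub>C x + c *\<^sub>C y"
    by transfer (auto simp: scaleC_add_right square_integrable_add square_integrable_scaleC)
  show "(c + d) *\<^sub>C x = c *\<^sub>C x + d *\<^sub>C x"
    by transfer (auto simp: scaleC_add_left square_integrable_add square_integrable_scaleC)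
  show "c *\<^sub>C d *\<^sub>C x = (c * d) *\<^sub>C x"
    by transfer (auto simp: scaleC_scaleC square_integrable_scaleC)
  show "complex_of_real r *\<^sub>C x = r *\<^sub>R x"
    by transfer (auto simp: scaleC_of_real square_integrable_scaleR)
  show "cinner x y = cnj (cinner y x)"
  proof transfer
    fix f g :: "real \<Rightarrow> 'a"
    have "(\<lambda>t. cinner (f t) (g t)) = (\<lambda>t. cnj (cinner (g t) (f t)))"
      by (rule ext) (rule cinner_commute)
    then show "integral\<^sup>L lebesgue (\<lambda>t. cinner (f t) (g t)) =
        cnj (integral\<^sup>L lebesgue (\<lambda>t. cinner (g t) (f t)))"
      by (simp only: Bochner_Integration.integral_cnj)
  qed
  show "cinner (x + y) z = cinner x z + cinner y z"
    by transfer (simp add: cinner_add_left integrable_cinner)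
  show "cinner (c *\<^sub>C x) y = c * cinner x y"
    by transfer (simp add: cinner_scaleC_left)
  show "Re (cinner x y) = inner x y"
    by transfer (simp add: integrable_cinner Re_cinner flip: integral_Re)
qed

end

text \<open>Functions on \<open>\<Delta>\<close> are represented by their extension by zero to the real line.\<close>

definition zero_ext :: "real set \<Rightarrow> (real \<Rightarrow> 'a::zero) \<Rightarrow> real \<Rightarrow> 'a" where
  "zero_ext \<Delta> f = (\<lambda>t. if t \<in> \<Delta> then f t else 0)"

definition L2_on :: "real set \<Rightarrow> 'a::{complex_inner, second_countable_topology} L2 set" where
  "L2_on \<Delta> = {abs_L2 (zero_ext \<Delta> f) | f. square_integrable (zero_ext \<Delta> f)}"


section \<open>Spectral notions\<close>

text \<open>
  A (not necessarily everywhere defined) operator from \<open>X\<close> to \<open>Y\<close> is given by its graph \<open>T\<close>.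
  The target \<open>Y\<close> is a closed subspace of the ambient type, so closures may be taken in the latter.
\<close>

definition op_ker :: "('a \<times> 'b::zero) set \<Rightarrow> 'a set" where
  "op_ker T = {x. (x, 0) \<in> T}"

definition zero_in_rho :: "'b::complex_inner set \<Rightarrow> ('a::complex_inner \<times> 'b) set \<Rightarrow> bool" where
  "zero_in_rho Y T \<longleftrightarrow> op_ker T = {0} \<and> Range T = Y"

definition zero_in_rho_hat :: "('a::complex_inner \<times> 'b::complex_inner) set \<Rightarrow> bool" where
  "zero_in_rho_hat T \<longleftrightarrow> op_ker T = {0} \<and> closed (Range T)"

definition zero_in_sigma_p :: "('a::complex_inner \<times> 'b::complex_inner) set \<Rightarrow> bool" where
  "zero_in_sigma_p T \<longleftrightarrow> op_ker T \<noteq> {0}"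

definition zero_in_sigma_c :: "'b::complex_inner set \<Rightarrow> ('a::complex_inner \<times> 'b) set \<Rightarrow> bool" where
  "zero_in_sigma_c Y T \<longleftrightarrow> op_ker T = {0} \<and> closure (Range T) = Y \<and> Range T \<noteq> Y"

definition zero_in_sigma_r :: "'b::complex_inner set \<Rightarrow> ('a::complex_inner \<times> 'b) set \<Rightarrow> bool" where
  "zero_in_sigma_r Y T \<longleftrightarrow> op_ker T = {0} \<and> closure (Range T) \<noteq> Y"

definition op_minus :: "('a::complex_inner \<times> 'a) set \<Rightarrow> complex \<Rightarrow> ('a \<times> 'a) set" where
  "op_minus A lam = {(x, y - lam *\<^sub>C x) | x y. (x, y) \<in> A}"

definition rho :: "'a::complex_inner set \<Rightarrow> ('a \<times> 'a) set \<Rightarrow> complex set" where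
  "rho X A = {lam. zero_in_rho X (op_minus A lam)}"

definition rho_hat :: "('a::complex_inner \<times> 'a) set \<Rightarrow> complex set" where
  "rho_hat A = {lam. zero_in_rho_hat (op_minus A lam)}"

definition sigma_p :: "('a::complex_inner \<times> 'a) set \<Rightarrow> complex set" where
  "sigma_p A = {lam. zero_in_sigma_p (op_minus A lam)}"

definition sigma_c :: "'a::complex_inner set \<Rightarrow> ('a \<times> 'a) set \<Rightarrow> complex set" where
  "sigma_c X A = {lam. zero_in_sigma_c X (op_minus A lam)}"

definition sigma_r :: "'a::complex_inner set \<Rightarrow> ('a \<times> 'a) set \<Rightarrow> complex set" where
  "sigma_r X A = {lam. zero_in_sigma_r X (op_minus A lam)}"

definition op_graph :: "('a \<Rightarrow> 'b) \<Rightarrow> ('a \<times> 'b) set" where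
  "op_graph T = {(x, T x) | x. True}"


section \<open>Calculus on the interval\<close>

definition is_interval_to :: "real set \<Rightarrow> ereal \<Rightarrow> bool" where
  "is_interval_to \<Delta> b \<longleftrightarrow> 0 < b \<and>
     (\<Delta> = {t. 0 \<le> t \<and> ereal t < b} \<or> \<Delta> = {t. 0 \<le> t \<and> ereal t \<le> b})"

definition end_filter :: "ereal \<Rightarrow> real filter" where
  "end_filter b = (if b = \<infinity> then at_top else at_left (real_of_ereal b))"

text \<open>Derivatives on \<open>\<Delta>\<close> are one-sided at end points belonging to \<open>\<Delta>\<close>.\<close>

definition deriv_on :: "real set \<Rightarrow> (real \<Rightarrow> 'a::real_normed_vector) \<Rightarrow> real \<Rightarrow> 'a" where
  "deriv_on \<Delta> f t = vector_derivative f (at t within \<Delta>)"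

abbreviation Dpow :: "real set \<Rightarrow> nat \<Rightarrow> (real \<Rightarrow> 'a::real_normed_vector) \<Rightarrow> real \<Rightarrow> 'a" where
  "Dpow \<Delta> k f \<equiv> (deriv_on \<Delta> ^^ k) f"

primrec Ck_on :: "nat \<Rightarrow> real set \<Rightarrow> (real \<Rightarrow> 'a::real_normed_vector) \<Rightarrow> bool" where
  "Ck_on 0 \<Delta> f \<longleftrightarrow> continuous_on \<Delta> f"
| "Ck_on (Suc k) \<Delta> f \<longleftrightarrow> f differentiable_on \<Delta> \<and> Ck_on k \<Delta> (deriv_on \<Delta> f)"

definition abs_continuous_on :: "real set \<Rightarrow> (real \<Rightarrow> 'a::real_normed_vector) \<Rightarrow> bool" where
  "abs_continuous_on S f \<longleftrightarrow>
     (\<forall>\<epsilon>>0. \<exists>\<delta>>0. \<forall>(m::nat) u v.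
        (\<forall>i<m. u i \<le> v i \<and> {u i..v i} \<subseteq> S) \<and>
        (\<forall>i<m. \<forall>j<m. i \<noteq> j \<longrightarrow> {u i<..<v i} \<inter> {u j<..<v j} = {}) \<and>
        (\<Sum>i<m. v i - u i) < \<delta>
        \<longrightarrow> (\<Sum>i<m. norm (f (v i) - f (u i))) < \<epsilon>)"

text \<open>
  Almost everywhere differentiability is automatic for functions with values in a Hilbert space;
  it is a genuine part of the notion for operator-valued functions.
\<close>

definition loc_abs_continuous_on :: "real set \<Rightarrow> (real \<Rightarrow> 'a::real_normed_vector) \<Rightarrow> bool" where
  "loc_abs_continuous_on \<Delta> f \<longleftrightarrow>
     (\<forall>c d. {c..d} \<subseteq> \<Delta> \<longrightarrow> abs_continuous_on {c..d} f) \<and>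
     (AE t in lebesgue. t \<in> \<Delta> \<longrightarrow> f differentiable (at t within \<Delta>))"


section \<open>The differential expression\<close>

text \<open>
  The coefficients are functions \<open>p, q :: nat \<Rightarrow> real \<Rightarrow> 'h \<Rightarrow>\<^sub>L 'h\<close>; only \<open>p k\<close> for \<open>k \<le> n\<close> and
  \<open>q k\<close> for \<open>k < n\<close>, on \<open>\<Delta>\<close>, matter.  The smoothness required is what is needed for the
  differentiations of the coefficients displayed in \<open>diff_expr\<close>.
\<close>

definition coefficients ::
    "nat \<Rightarrow> real set \<Rightarrow> (nat \<Rightarrow> real \<Rightarrow> 'h::complex_hilbert \<Rightarrow>\<^sub>L 'h) \<Rightarrow>
     (nat \<Rightarrow> real \<Rightarrow> 'h \<Rightarrow>\<^sub>L 'h) \<Rightarrow> bool" where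
  "coefficients n \<Delta> p q \<longleftrightarrow>
     (\<forall>k\<le>n. Ck_on (n - k) \<Delta> (p k) \<and>
        (\<forall>t\<in>\<Delta>. complex_linear (p k t) \<and> p k t = adjoint_op (p k t))) \<and>
     (\<forall>k<n. Ck_on (n - k) \<Delta> (q k) \<and> (\<forall>t\<in>\<Delta>. complex_linear (q k t))) \<and>
     (\<forall>t\<in>\<Delta>. \<exists>R. complex_linear R \<and> p 0 t o\<^sub>L R = id_blinfun \<and> R o\<^sub>L p 0 t = id_blinfun)"

text \<open>
  Everything below is applied both to vector functions \<open>y : \<Delta> \<rightarrow> H\<close> and to operator functions
  \<open>Y : \<Delta> \<rightarrow> [K, H]\<close>.  The parameter \<open>act\<close> is the action of an operator in \<open>H\<close> on the values:
  application (\<open>blinfun_apply\<close>) in the first case, composition (\<open>(o\<^sub>L)\<close>) in the second.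
\<close>

definition diff_expr ::
    "('h::complex_hilbert \<Rightarrow>\<^sub>L 'h \<Rightarrow> 'v \<Rightarrow> 'v::real_normed_vector) \<Rightarrow> nat \<Rightarrow> real set \<Rightarrow>
     (nat \<Rightarrow> real \<Rightarrow> 'h \<Rightarrow>\<^sub>L 'h) \<Rightarrow> (nat \<Rightarrow> real \<Rightarrow> 'h \<Rightarrow>\<^sub>L 'h) \<Rightarrow> (real \<Rightarrow> 'v) \<Rightarrow> real \<Rightarrow> 'v" where
  "diff_expr act n \<Delta> p q y t =
     (\<Sum>k=1..n. (-1) ^ k *\<^sub>R
        (Dpow \<Delta> k (\<lambda>s. act (p (n - k) s) (Dpow \<Delta> k y s)) t
         - act (scalar_op (\<i> / 2))
             (Dpow \<Delta> (k - 1) (\<lambda>s. act (adjoint_op (q (n - k) s)) (Dpow \<Delta> k y s)) t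
              + Dpow \<Delta> k (\<lambda>s. act (q (n - k) s) (Dpow \<Delta> (k - 1) y s)) t)))
     + act (p n t) (y t)"

text \<open>
  \<open>upper_quasi_deriv act n \<Delta> p q y k\<close> is $y^{[n+k]}$.  For \<open>k = n\<close> the term with $q_n$ is absent,
  which gives the value $l[y]$.
\<close>

primrec upper_quasi_deriv ::
    "('h::complex_hilbert \<Rightarrow>\<^sub>L 'h \<Rightarrow> 'v \<Rightarrow> 'v::real_normed_vector) \<Rightarrow> nat \<Rightarrow> real set \<Rightarrow>
     (nat \<Rightarrow> real \<Rightarrow> 'h \<Rightarrow>\<^sub>L 'h) \<Rightarrow> (nat \<Rightarrow> real \<Rightarrow> 'h \<Rightarrow>\<^sub>L 'h) \<Rightarrow> (real \<Rightarrow> 'v) \<Rightarrow> nat \<Rightarrow> real \<Rightarrow> 'v"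
  where
  "upper_quasi_deriv act n \<Delta> p q y 0 =
     (\<lambda>t. act (p 0 t) (Dpow \<Delta> n y t)
          - act (scalar_op (\<i> / 2)) (act (q 0 t) (Dpow \<Delta> (n - 1) y t)))"
| "upper_quasi_deriv act n \<Delta> p q y (Suc k) =
     (\<lambda>t. - deriv_on \<Delta> (upper_quasi_deriv act n \<Delta> p q y k) t
          + act (p (Suc k) t) (Dpow \<Delta> (n - Suc k) y t)
          + act (scalar_op (\<i> / 2))
              (act (adjoint_op (q k t)) (Dpow \<Delta> (n - Suc k + 1) y t)
               - (if Suc k < n then act (q (Suc k) t) (Dpow \<Delta> (n - Suc k - 1) y t) else 0)))"

definition quasi_deriv ::
    "('h::complex_hilbert \<Rightarrow>\<^sub>L 'h \<Rightarrow> 'v \<Rightarrow> 'v::real_normed_vector) \<Rightarrow> nat \<Rightarrow> real set \<Rightarrow>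
     (nat \<Rightarrow> real \<Rightarrow> 'h \<Rightarrow>\<^sub>L 'h) \<Rightarrow> (nat \<Rightarrow> real \<Rightarrow> 'h \<Rightarrow>\<^sub>L 'h) \<Rightarrow> (real \<Rightarrow> 'v) \<Rightarrow> nat \<Rightarrow> real \<Rightarrow> 'v"
  where
  "quasi_deriv act n \<Delta> p q y j =
     (if j < n then Dpow \<Delta> j y else upper_quasi_deriv act n \<Delta> p q y (j - n))"

definition quasi_regular ::
    "('h::complex_hilbert \<Rightarrow>\<^sub>L 'h \<Rightarrow> 'v \<Rightarrow> 'v::real_normed_vector) \<Rightarrow> nat \<Rightarrow> real set \<Rightarrow>
     (nat \<Rightarrow> real \<Rightarrow> 'h \<Rightarrow>\<^sub>L 'h) \<Rightarrow> (nat \<Rightarrow> real \<Rightarrow> 'h \<Rightarrow>\<^sub>L 'h) \<Rightarrow> (real \<Rightarrow> 'v) \<Rightarrow> bool" where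
  "quasi_regular act n \<Delta> p q y \<longleftrightarrow>
     (\<forall>k\<le>2 * n - 2. Ck_on 1 \<Delta> (quasi_deriv act n \<Delta> p q y k)) \<and>
     loc_abs_continuous_on \<Delta> (quasi_deriv act n \<Delta> p q y (2 * n - 1))"

text \<open>
  The order parameter \<open>n\<close> is \<open>CARD('n)\<close>.  The index type of $H^n$ is linearly ordered and
  \<open>pos i\<close> is the (zero-based) position of the index \<open>i\<close>, so that the two columns are
  $(y^{[0]}, \dots, y^{[n-1]})$ and $(y^{[2n-1]}, \dots, y^{[n]})$.
\<close>

definition pos :: "'n::{finite, linorder} \<Rightarrow> nat" where
  "pos i = card {j. j < i}"

definition column1 ::
    "('h::complex_hilbert \<Rightarrow>\<^sub>L 'h \<Rightarrow> 'v \<Rightarrow> 'v::real_normed_vector) \<Rightarrow> real set \<Rightarrow>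
     (nat \<Rightarrow> real \<Rightarrow> 'h \<Rightarrow>\<^sub>L 'h) \<Rightarrow> (nat \<Rightarrow> real \<Rightarrow> 'h \<Rightarrow>\<^sub>L 'h) \<Rightarrow> (real \<Rightarrow> 'v) \<Rightarrow> real \<Rightarrow>
     'v ^ 'n::{finite, linorder}" where
  "column1 act \<Delta> p q y t = (\<chi> i. quasi_deriv act CARD('n) \<Delta> p q y (pos i) t)"

definition column2 ::
    "('h::complex_hilbert \<Rightarrow>\<^sub>L 'h \<Rightarrow> 'v \<Rightarrow> 'v::real_normed_vector) \<Rightarrow> real set \<Rightarrow>
     (nat \<Rightarrow> real \<Rightarrow> 'h \<Rightarrow>\<^sub>L 'h) \<Rightarrow> (nat \<Rightarrow> real \<Rightarrow> 'h \<Rightarrow>\<^sub>L 'h) \<Rightarrow> (real \<Rightarrow> 'v) \<Rightarrow> real \<Rightarrow>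
     'v ^ 'n::{finite, linorder}" where
  "column2 act \<Delta> p q y t = (\<chi> i. quasi_deriv act CARD('n) \<Delta> p q y (2 * CARD('n) - 1 - pos i) t)"

definition column_apply ::
    "('a::real_normed_vector \<Rightarrow>\<^sub>L 'h::real_normed_vector) ^ 'n \<Rightarrow> 'a \<Rightarrow> 'h ^ 'n" where
  "column_apply A x = (\<chi> i. (A $ i) x)"


section \<open>Maximal and minimal operators, extensions\<close>

definition max_domain ::
    "nat \<Rightarrow> real set \<Rightarrow> (nat \<Rightarrow> real \<Rightarrow> 'h::{complex_hilbert, second_countable_topology} \<Rightarrow>\<^sub>L 'h) \<Rightarrow>
     (nat \<Rightarrow> real \<Rightarrow> 'h \<Rightarrow>\<^sub>L 'h) \<Rightarrow> (real \<Rightarrow> 'h) set" where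
  "max_domain n \<Delta> p q =
     {y. (\<forall>t. t \<notin> \<Delta> \<longrightarrow> y t = 0) \<and> square_integrable y \<and>
         quasi_regular blinfun_apply n \<Delta> p q y \<and>
         square_integrable (zero_ext \<Delta> (diff_expr blinfun_apply n \<Delta> p q y))}"

text \<open>The restriction of the maximal operator to a set \<open>S\<close> of functions in its domain.\<close>

definition restricted_op ::
    "nat \<Rightarrow> real set \<Rightarrow> (nat \<Rightarrow> real \<Rightarrow> 'h::{complex_hilbert, second_countable_topology} \<Rightarrow>\<^sub>L 'h) \<Rightarrow>
     (nat \<Rightarrow> real \<Rightarrow> 'h \<Rightarrow>\<^sub>L 'h) \<Rightarrow> (real \<Rightarrow> 'h) set \<Rightarrow> ('h L2 \<times> 'h L2) set" where
  "restricted_op n \<Delta> p q S =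
     {(abs_L2 y, abs_L2 (zero_ext \<Delta> (diff_expr blinfun_apply n \<Delta> p q y))) | y. y \<in> S}"

definition max_op ::
    "nat \<Rightarrow> real set \<Rightarrow> (nat \<Rightarrow> real \<Rightarrow> 'h::{complex_hilbert, second_countable_topology} \<Rightarrow>\<^sub>L 'h) \<Rightarrow>
     (nat \<Rightarrow> real \<Rightarrow> 'h \<Rightarrow>\<^sub>L 'h) \<Rightarrow> ('h L2 \<times> 'h L2) set" where
  "max_op n \<Delta> p q = restricted_op n \<Delta> p q (max_domain n \<Delta> p q)"

definition boundary_form ::
    "'n::{finite, linorder} itself \<Rightarrow> real set \<Rightarrow> (nat \<Rightarrow> real \<Rightarrow> 'h::complex_hilbert \<Rightarrow>\<^sub>L 'h) \<Rightarrow>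
     (nat \<Rightarrow> real \<Rightarrow> 'h \<Rightarrow>\<^sub>L 'h) \<Rightarrow> (real \<Rightarrow> 'h) \<Rightarrow> (real \<Rightarrow> 'h) \<Rightarrow> real \<Rightarrow> complex" where
  "boundary_form _ \<Delta> p q y z t =
     cinner (column1 blinfun_apply \<Delta> p q y t :: ('h, 'n) vec) (column2 blinfun_apply \<Delta> p q z t)
     - cinner (column2 blinfun_apply \<Delta> p q y t :: ('h, 'n) vec) (column1 blinfun_apply \<Delta> p q z t)"

definition boundary_form_at_b ::
    "'n::{finite, linorder} itself \<Rightarrow> real set \<Rightarrow> ereal \<Rightarrow>
     (nat \<Rightarrow> real \<Rightarrow> 'h::complex_hilbert \<Rightarrow>\<^sub>L 'h) \<Rightarrow> (nat \<Rightarrow> real \<Rightarrow> 'h \<Rightarrow>\<^sub>L 'h) \<Rightarrow>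
     (real \<Rightarrow> 'h) \<Rightarrow> (real \<Rightarrow> 'h) \<Rightarrow> complex" where
  "boundary_form_at_b N \<Delta> b p q y z = Lim (end_filter b) (boundary_form N \<Delta> p q y z)"

definition min_op ::
    "'n::{finite, linorder} itself \<Rightarrow> real set \<Rightarrow> ereal \<Rightarrow>
     (nat \<Rightarrow> real \<Rightarrow> 'h::{complex_hilbert, second_countable_topology} \<Rightarrow>\<^sub>L 'h) \<Rightarrow>
     (nat \<Rightarrow> real \<Rightarrow> 'h \<Rightarrow>\<^sub>L 'h) \<Rightarrow> ('h L2 \<times> 'h L2) set" where
  "min_op N \<Delta> b p q = restricted_op CARD('n) \<Delta> p q
     {y \<in> max_domain CARD('n) \<Delta> p q.
        column1 blinfun_apply \<Delta> p q y 0 = (0 :: ('h, 'n) vec) \<and>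
        column2 blinfun_apply \<Delta> p q y 0 = (0 :: ('h, 'n) vec) \<and>
        (\<forall>z\<in>max_domain CARD('n) \<Delta> p q. boundary_form_at_b N \<Delta> b p q y z = 0)}"

definition proper_extensions ::
    "'n::{finite, linorder} itself \<Rightarrow> real set \<Rightarrow> ereal \<Rightarrow>
     (nat \<Rightarrow> real \<Rightarrow> 'h::{complex_hilbert, second_countable_topology} \<Rightarrow>\<^sub>L 'h) \<Rightarrow>
     (nat \<Rightarrow> real \<Rightarrow> 'h \<Rightarrow>\<^sub>L 'h) \<Rightarrow> ('h L2 \<times> 'h L2) set set" where
  "proper_extensions N \<Delta> b p q =
     {A. csubspace A \<and> closed A \<and> min_op N \<Delta> b p q \<subseteq> A \<and> A \<subseteq> max_op CARD('n) \<Delta> p q}"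


section \<open>Decomposing D-triplets, operator pairs, fundamental solutions\<close>

definition linear_on_functions ::
    "(real \<Rightarrow> 'h::complex_inner) set \<Rightarrow> ((real \<Rightarrow> 'h) \<Rightarrow> 'a::complex_inner) \<Rightarrow> bool" where
  "linear_on_functions S G \<longleftrightarrow>
     (\<forall>y\<in>S. \<forall>z\<in>S. G (\<lambda>t. y t + z t) = G y + G z) \<and>
     (\<forall>c. \<forall>y\<in>S. G (\<lambda>t. c *\<^sub>C y t) = c *\<^sub>C G y)"

text \<open>
  The type \<open>'a\<close> is the space $\mathcal H_0'$, and \<open>H1'\<close> is its subspace $\mathcal H_1'$; thus
  $\mathcal H_0$ is the type \<open>'h ^ 'n \<times> 'a\<close> and $\mathcal H_1$ is \<open>UNIV \<times> H1'\<close> in it.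
\<close>

definition decomposing_D_triplet ::
    "real set \<Rightarrow> ereal \<Rightarrow>
     (nat \<Rightarrow> real \<Rightarrow> 'h::{complex_hilbert, second_countable_topology} \<Rightarrow>\<^sub>L 'h) \<Rightarrow>
     (nat \<Rightarrow> real \<Rightarrow> 'h \<Rightarrow>\<^sub>L 'h) \<Rightarrow> 'a::complex_hilbert set \<Rightarrow>
     ((real \<Rightarrow> 'h) \<Rightarrow> ('h, 'n::{finite, linorder}) vec \<times> 'a) \<Rightarrow> ((real \<Rightarrow> 'h) \<Rightarrow> ('h, 'n) vec \<times> 'a) \<Rightarrow>
     ((real \<Rightarrow> 'h) \<Rightarrow> 'a) \<Rightarrow> ((real \<Rightarrow> 'h) \<Rightarrow> 'a) \<Rightarrow> bool" where
  "decomposing_D_triplet \<Delta> b p q H1' \<Gamma>0 \<Gamma>1 \<Gamma>0' \<Gamma>1' \<longleftrightarrow>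
     (let D = max_domain CARD('n) \<Delta> p q; P2' = orth_projector (orth_complement H1') in
       csubspace H1' \<and> closed H1' \<and>
       linear_on_functions D \<Gamma>0' \<and> linear_on_functions D \<Gamma>1' \<and>
       (\<forall>y\<in>D. \<Gamma>0 y = (column2 blinfun_apply \<Delta> p q y 0, \<Gamma>0' y) \<and>
              \<Gamma>1 y = (- column1 blinfun_apply \<Delta> p q y 0, \<Gamma>1' y)) \<and>
       (\<lambda>y. (\<Gamma>0' y, \<Gamma>1' y)) ` D = UNIV \<times> H1' \<and>
       (\<forall>y\<in>D. \<forall>z\<in>D. boundary_form_at_b TYPE('n) \<Delta> b p q y z =
          cinner (\<Gamma>1' y) (\<Gamma>0' z) - cinner (\<Gamma>0' y) (\<Gamma>1' z)
          + \<i> * cinner (P2' (\<Gamma>0' y)) (P2' (\<Gamma>0' z))))"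

definition operator_pair ::
    "'a::complex_hilbert set \<Rightarrow> 'b::complex_hilbert set \<Rightarrow> ('a \<Rightarrow> 'k::complex_hilbert) \<Rightarrow> ('b \<Rightarrow> 'k) \<Rightarrow>
     bool" where
  "operator_pair H0 H1 C0 C1 \<longleftrightarrow>
     bounded_operator_on H0 C0 \<and> bounded_operator_on H1 C1 \<and>
     {C0 x0 + C1 x1 | x0 x1. x0 \<in> H0 \<and> x1 \<in> H1} = UNIV"

definition fundamental_solution ::
    "nat \<Rightarrow> real set \<Rightarrow> (nat \<Rightarrow> real \<Rightarrow> 'h::{complex_hilbert, second_countable_topology} \<Rightarrow>\<^sub>L 'h) \<Rightarrow>
     (nat \<Rightarrow> real \<Rightarrow> 'h \<Rightarrow>\<^sub>L 'h) \<Rightarrow> complex \<Rightarrow> (real \<Rightarrow> 'a::complex_hilbert \<Rightarrow>\<^sub>L 'h) \<Rightarrow> bool" where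
  "fundamental_solution n \<Delta> p q lam Z \<longleftrightarrow>
     (\<forall>t\<in>\<Delta>. complex_linear (Z t)) \<and>
     quasi_regular (o\<^sub>L) n \<Delta> p q Z \<and>
     (AE t in lebesgue. t \<in> \<Delta> \<longrightarrow> diff_expr (o\<^sub>L) n \<Delta> p q Z t = scalar_op lam o\<^sub>L Z t) \<and>
     (\<forall>h. square_integrable (zero_ext \<Delta> (\<lambda>t. Z t h))) \<and>
     (\<forall>y\<in>max_domain n \<Delta> p q. abs_L2 y \<in> op_ker (op_minus (max_op n \<Delta> p q) lam) \<longrightarrow>
        (\<exists>!h. \<forall>t\<in>\<Delta>. y t = Z t h))"

end

theory Submission
  imports Defs
begin

text \<open>
  Write $\Gamma y$ for all boundary values of \<open>y\<close>, $B y$ for the left-hand side of the boundary condition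
  and $F y = L y - \lambda y$.  By Green's formula and the nondegeneracy of the boundary form, the set \<open>E\<close> of
  all $(y, L y, \Gamma y)$ is closed, so it is a Hilbert space on which \<open>B\<close> and \<open>F\<close> are bounded.  Both
  are surjective: \<open>B\<close> because $(C_0\;C_1)$ and $\Gamma$ are, \<open>F\<close> because $|(L_0 - \lambda) y| =
  |(L_0 - \bar\lambda) y|$ and $L = L_0^*$.  The open mapping theorem then shows that $B y$ lies in
  $B(\mathrm{Ker} F)$ or in its closure if and only if $F y$ lies in $F(\mathrm{Ker} B)$ or in its closure.
  These two sets are the ranges of \<open>T\<close> and of the extension minus $\lambda$, and both kernels are
  identified with $\mathrm{Ker} B \cap \mathrm{Ker} F$.

  What is needed of $L = L_0^*$ is that a weak solution is a genuine one.  It is tested with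
  $\varphi - \Psi$, where $\varphi$ solves $l[\varphi] = f$ and vanishes near \<open>b\<close>, and $\Psi$ is a smooth
  function that vanishes near \<open>b\<close> and has the quasi-derivatives of $\varphi$ at \<open>0\<close>.
\<close>

section \<open>Hilbert space preliminaries\<close>

text \<open>The obstacle is that the maps \<open>\<Gamma>0'\<close> and \<open>\<Gamma>1'\<close>
  are only known to be linear. Their continuity in the graph norm is never proved separately: the
  boundary values are carried along as extra coordinates, in which they are bounded trivially, and
  closedness of the enlarged graph comes from describing it by equations tested against fixed
  elements of the maximal domain.

  The hypothesis on \<lambda> enters at one point only. Injectivity and closed range give a lower
  bound for the minimal operator minus \<lambda>; symmetry moves this bound to the conjugate number,
  and there the Riesz theorem produces a weak solution of the equation with an arbitrary right-hand
  side.

  Most of the length is spent on the weak solution. The last quasi-derivative is merely absolutely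
  continuous, so l[y] exists only almost everywhere. The calculus is therefore developed with an
  exceptional set built in, and identities for l are proved pointwise off a null set before they are
  integrated. Open mapping and Riesz are stated for maps that are linear on a subset, since every
  space in question is a graph or a range.\<close>

lemma linear_complete_image_bound:
  fixes f :: "'a::real_normed_vector \<Rightarrow> 'b::real_normed_vector"
  assumes S: "subspace S" "complete S" and V: "subspace V" "complete V"
    and add: "\<And>x y. x \<in> S \<Longrightarrow> y \<in> S \<Longrightarrow> f (x + y) = f x + f y"
    and scale: "\<And>r x. x \<in> S \<Longrightarrow> f (r *\<^sub>R x) = r *\<^sub>R f x"
    and bound: "\<And>x. x \<in> S \<Longrightarrow> norm (f x) \<le> C * norm x"
    and onto: "f ` S = V"
  shows "\<exists>M>0. \<forall>v\<in>V. \<exists>x\<in>S. f x = v \<and> norm x \<le> M * norm v"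
proof -
  \<comment> \<open>Baire's theorem is wanted for the set V rather than for a type, so V is viewed
    as an abstract metric space; its metric topology is the subspace topology, and completeness of V
    is completeness of this space.\<close>
  interpret SV: Submetric UNIV dist V by unfold_locales auto
  have top: "SV.sub.mtopology = top_of_set V"
    using SV.mtopology_submetric by (simp add: mtopology_is_euclidean)
  have diff: "f (x - y) = f x - f y" if "x \<in> S" "y \<in> S" for x y
    using add[of x "-1 *\<^sub>R y"] scale[of y "-1"] that S(1) by (simp add: subspace_neg)
  have f0: "f 0 = 0" using scale[of 0 0] S(1) by (simp add: subspace_0)
  have mcomp: "SV.sub.mcomplete"
    unfolding SV.sub.mcomplete_def
  proof (intro allI impI)
    fix s assume "SV.sub.MCauchy s"
    then have "range s \<subseteq> V" "Cauchy s"
      by (auto simp: SV.sub.MCauchy_def Cauchy_def)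
    then obtain l where "l \<in> V" "s \<longlonglongrightarrow> l"
      by (meson completeE[OF V(2)] range_subsetD)
    then show "\<exists>x. limitin SV.sub.mtopology s x sequentially"
      using \<open>range s \<subseteq> V\<close> unfolding top limitin_subtopology
      by (intro exI[of _ l]) (auto simp: limitin_canonical_iff image_subset_iff)
  qed
  \<comment> \<open>The closures of the images of balls cover V, so by Baire one of them contains a
    ball of V around some y.\<close>
  define T where "T n = closure (f ` (S \<inter> cball 0 (real n))) \<inter> V" for n
  have UT: "\<Union>(range T) = V"
  proof -
    have "v \<in> \<Union>(range T)" if v: "v \<in> V" for v
    proof -
      obtain x where x: "x \<in> S" "f x = v" using v onto by blast
      obtain n where "norm x \<le> real n" using real_arch_simple by blast
      with x v have "v \<in> T n"
        unfolding T_def using closure_subset by fastforce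
      then show ?thesis by blast
    qed
    then show ?thesis by (auto simp: T_def)
  qed
  have "\<exists>n. SV.sub.mtopology interior_of (T n) \<noteq> {}"
  proof (rule ccontr)
    assume "\<not> ?thesis"
    then have "SV.sub.mtopology interior_of \<Union>(range T) = {}"
      by (intro SV.sub.metric_Baire_category_alt[OF mcomp])
        (auto simp: top T_def closedin_closed Int_commute intro!: exI[of _ "closure _"])
    then have "V = {}"
      unfolding UT top using interior_of_topspace[of "top_of_set V"] by simp
    then show False using V(1) subspace_0 by blast
  qed
  then obtain n y where "y \<in> SV.sub.mtopology interior_of (T n)" by blast
  then obtain r where yV: "y \<in> V" and r: "r > 0" and ball: "SV.sub.mball y r \<subseteq> T n"
    unfolding SV.sub.in_interior_of_mball using SV.sub.in_interior_of_mball by auto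
  \<comment> \<open>The ball is moved to the origin by subtracting an approximant of y from one of y
    + v. Each has a preimage of norm at most n and error below e / 2, hence the bound 2 n.\<close>
  have appr: "\<exists>x\<in>S. norm x \<le> 2 * real n \<and> norm (v - f x) < e" if v: "v \<in> V" "norm v < r" and e: "e > 0" for v e
  proof -
    have "y \<in> T n" using ball r yV by (auto simp: SV.sub.mball_def)
    then obtain x1 where x1: "x1 \<in> S" "norm x1 \<le> real n" "dist (f x1) y < e / 2"
      unfolding T_def using e closure_approachableD[of y "f ` (S \<inter> cball 0 (real n))" "e / 2"] by (auto simp: dist_commute)
    have "y + v \<in> T n" using ball v yV V(1) by (auto simp: SV.sub.mball_def subspace_add dist_norm)
    then obtain x2 where x2: "x2 \<in> S" "norm x2 \<le> real n" "dist (f x2) (y + v) < e / 2"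
      unfolding T_def using e closure_approachableD[of "y + v" "f ` (S \<inter> cball 0 (real n))" "e / 2"] by (auto simp: dist_commute)
    have "v - f (x2 - x1) = (f x1 - y) - (f x2 - (y + v))"
      using x1 x2 by (simp add: diff)
    moreover have "norm (f x1 - y) < e / 2" "norm (f x2 - (y + v)) < e / 2"
      using x1(3) x2(3) by (simp_all add: dist_norm norm_minus_commute)
    then have "norm ((f x1 - y) - (f x2 - (y + v))) < e"
      using norm_triangle_ineq4[of "f x1 - y" "f x2 - (y + v)"] by linarith
    ultimately have "norm (v - f (x2 - x1)) < e" by (simp only:)
    moreover have "norm (x2 - x1) \<le> 2 * real n"
      using norm_triangle_ineq4[of x2 x1] x1 x2 by simp
    moreover have "x2 - x1 \<in> S" using x1 x2 S(1) by (simp add: subspace_diff)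
    ultimately show ?thesis by blast
  qed
  \<comment> \<open>A vector v is scaled to norm r / 2, approximated there with error r / 4 at the
    cost 2 n, and scaled back. The error becomes half the norm of v and the cost becomes 4 n / r
    times that norm.\<close>
  define K where "K = 4 * real n / r"
  have K: "K \<ge> 0" using r by (simp add: K_def)
  have half: "\<exists>x. x \<in> S \<and> norm x \<le> K * norm v \<and> norm (v - f x) \<le> norm v / 2" if v: "v \<in> V" for v
  proof (cases "v = 0")
    case True
    then show ?thesis using S(1) f0 by (intro exI[of _ 0]) (auto simp: subspace_0)
  next
    case False
    define a where "a = r / (2 * norm v)"
    have a: "a > 0" using r False by (simp add: a_def)
    have "a *\<^sub>R v \<in> V" "norm (a *\<^sub>R v) < r"
      using v V(1) r False by (auto simp: subspace_scale a_def)
    then obtain x where x: "x \<in> S" "norm x \<le> 2 * real n" "norm (a *\<^sub>R v - f x) < r / 4"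
      using appr[of "a *\<^sub>R v" "r / 4"] r by auto
    let ?x = "inverse a *\<^sub>R x"
    have "?x \<in> S" using x S(1) by (simp add: subspace_scale)
    moreover have "norm ?x \<le> K * norm v"
    proof -
      have "norm ?x \<le> inverse a * (2 * real n)" using x a by (simp add: mult_left_mono)
      also have "\<dots> = K * norm v" using r False by (simp add: a_def K_def field_simps)
      finally show ?thesis .
    qed
    moreover have "norm (v - f ?x) \<le> norm v / 2"
    proof -
      have "v - f ?x = inverse a *\<^sub>R (a *\<^sub>R v - f x)"
        using a x by (simp add: scale scaleR_right_diff_distrib)
      then have "norm (v - f ?x) \<le> inverse a * (r / 4)" using x a by (simp add: mult_left_mono less_imp_le)
      also have "\<dots> = norm v / 2" using r False by (simp add: a_def field_simps)
      finally show ?thesis .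
    qed
    ultimately show ?thesis by blast
  qed
  then obtain g where g: "\<And>v. v \<in> V \<Longrightarrow> g v \<in> S \<and> norm (g v) \<le> K * norm v \<and> norm (v - f (g v)) \<le> norm v / 2"
    by metis
  have "\<exists>x\<in>S. f x = v \<and> norm x \<le> (2 * K + 1) * norm v" if v: "v \<in> V" for v
  proof -
    \<comment> \<open>Successive correction: \<open>w k\<close> is the residue left after k steps
      and is halved each time. The corrections are dominated by a geometric series, so their partial
      sums converge in the complete set S, and the limit is an exact preimage.\<close>
    define w where "w k = ((\<lambda>u. u - f (g u)) ^^ k) v" for k
    have w0: "w 0 = v" and wS: "w (Suc k) = w k - f (g (w k))" for k by (auto simp: w_def)
    have wV: "w k \<in> V" for k
      by (induction k) (use v w0 wS g onto V(1) in \<open>auto intro!: subspace_diff\<close>)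
    have wn: "norm (w k) \<le> norm v * (1 / 2) ^ k" for k
    proof (induction k)
      case (Suc k)
      have "norm (w (Suc k)) \<le> norm (w k) / 2" using g[OF wV[of k]] by (simp add: wS)
      then show ?case using Suc by simp
    qed (simp add: w0)
    define s where "s k = (\<Sum>i<k. g (w i))" for k
    have sS: "s k \<in> S" for k unfolding s_def using S(1) g wV by (auto intro!: subspace_sum)
    have fs: "f (s k) = v - w k" for k
    proof (induction k)
      case (Suc k)
      have "f (s (Suc k)) = f (s k) + f (g (w k))" using add[OF sS] g wV by (simp add: s_def)
      then show ?case using Suc by (simp add: wS)
    qed (simp add: s_def f0 w0)
    have gn: "norm (g (w i)) \<le> K * norm v * (1 / 2) ^ i" for i
    proof -
      have "norm (g (w i)) \<le> K * norm (w i)" using g wV by blast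
      also have "\<dots> \<le> K * (norm v * (1 / 2) ^ i)" using wn K by (intro mult_left_mono)
      finally show ?thesis by (simp add: mult.assoc)
    qed
    have sd: "norm (s m - s k) \<le> 2 * K * norm v * (1 / 2) ^ k" if "k \<le> m" for k m
    proof -
      have "s m - s k = (\<Sum>i\<in>{k..<m}. g (w i))"
        unfolding s_def using that sum_diff_nat_ivl[of 0 k m "\<lambda>i. g (w i)"] by (simp add: atLeast0LessThan)
      also have "norm \<dots> \<le> (\<Sum>i\<in>{k..<m}. K * norm v * (1 / 2) ^ i)"
        by (intro order.trans[OF norm_sum] sum_mono gn)
      also have "\<dots> = K * norm v * (\<Sum>i\<in>{k..<m}. (1 / 2) ^ i)" by (simp add: sum_distrib_left)
      also have "(\<Sum>i\<in>{k..<m}. (1 / 2) ^ i :: real) = 2 * ((1 / 2) ^ k - (1 / 2) ^ m)"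
        using that by (induction m rule: dec_induct) auto
      also have "K * norm v * (2 * ((1 / 2) ^ k - (1 / 2) ^ m)) \<le> K * norm v * (2 * (1 / 2) ^ k)"
        using K by (intro mult_left_mono) auto
      finally show ?thesis by (simp add: mult_ac)
    qed
    have geo: "(\<lambda>k. c * (1 / 2 :: real) ^ k) \<longlonglongrightarrow> 0" for c
      by (intro tendsto_mult_right_zero LIMSEQ_power_zero) auto
    have "Cauchy s"
    proof (rule CauchyI')
      fix e :: real assume "e > 0"
      then obtain N where N: "\<And>k. k \<ge> N \<Longrightarrow> 2 * K * norm v * (1 / 2) ^ k < e"
        using order_tendstoD(2)[OF geo[of "2 * K * norm v"] \<open>e > 0\<close>] by (auto simp: eventually_sequentially)
      show "\<exists>M. \<forall>m\<ge>M. \<forall>n>m. dist (s m) (s n) < e"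
      proof (intro exI[of _ N] allI impI)
        fix m j assume "N \<le> m" "m < j"
        then have "norm (s j - s m) < e" using sd[of m j] N[of m] by linarith
        then show "dist (s m) (s j) < e" by (simp add: dist_norm norm_minus_commute)
      qed
    qed
    then obtain x where x: "x \<in> S" "s \<longlonglongrightarrow> x" using completeE[OF S(2)] sS by metis
    have "(\<lambda>k. f (s k)) \<longlonglongrightarrow> f x"
    proof -
      have "(\<lambda>k. \<bar>C\<bar> * norm (s k - x)) \<longlonglongrightarrow> 0"
        using x(2) by (intro tendsto_mult_right_zero tendsto_norm_zero) (simp add: LIM_zero)
      then have "(\<lambda>k. f (s k) - f x) \<longlonglongrightarrow> 0"
      proof (rule Lim_null_comparison[rotated], intro eventuallyI)
        fix k
        have "norm (f (s k) - f x) = norm (f (s k - x))" using sS x by (simp add: diff)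
        also have "\<dots> \<le> C * norm (s k - x)" using sS x S(1) by (intro bound) (simp add: subspace_diff)
        also have "\<dots> \<le> \<bar>C\<bar> * norm (s k - x)" by (simp add: mult_right_mono)
        finally show "norm (f (s k) - f x) \<le> \<bar>C\<bar> * norm (s k - x)" .
      qed
      then show ?thesis by (simp add: LIM_zero_iff)
    qed
    moreover have "(\<lambda>k. f (s k)) \<longlonglongrightarrow> v"
    proof -
      have "w \<longlonglongrightarrow> 0"
        by (rule Lim_null_comparison[OF _ geo[of "norm v"]]) (use wn in auto)
      then show ?thesis unfolding fs using tendsto_diff[of "\<lambda>_. v" v sequentially w 0] by simp
    qed
    ultimately have "f x = v" by (rule LIMSEQ_unique)
    moreover have "norm x \<le> 2 * K * norm v"
    proof (rule LIMSEQ_le_const2[OF tendsto_norm[OF x(2)]])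
      show "\<exists>N. \<forall>k\<ge>N. norm (s k) \<le> 2 * K * norm v"
        using sd[of 0] by (auto simp: s_def)
    qed
    \<comment> \<open>The constant \<open>2 * K\<close> may be zero, for instance when V is trivial;
      adding 1 makes it positive as claimed.\<close>
    moreover have "2 * K * norm v \<le> (2 * K + 1) * norm v" by (simp add: mult_right_mono)
    ultimately show ?thesis using x(1) by (intro bexI[of _ x]) auto
  qed
  then show ?thesis using K by (intro exI[of _ "2 * K + 1"]) auto
qed

text \<open>The minimizer over S of the energy \<open>inner x x - 2 * f x\<close> represents f. The
  real form suffices throughout: the complex inner product is made of the values of the real one at
  y and at \<i> y, so complex conclusions follow on spaces closed under multiplication by
  \<i>.\<close>

lemma riesz_on_subspace:
  fixes f :: "'a::real_inner \<Rightarrow> real"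
  assumes S: "subspace S" "complete S"
    and add: "\<And>x y. x \<in> S \<Longrightarrow> y \<in> S \<Longrightarrow> f (x + y) = f x + f y"
    and scale: "\<And>r x. x \<in> S \<Longrightarrow> f (r *\<^sub>R x) = r * f x"
    and bound: "\<And>x. x \<in> S \<Longrightarrow> \<bar>f x\<bar> \<le> C * norm x"
  shows "\<exists>z\<in>S. \<forall>x\<in>S. f x = inner z x"
proof -
  define J where "J x = inner x x - 2 * f x" for x
  have low: "- (C\<^sup>2) \<le> J x" if "x \<in> S" for x
  proof -
    have "0 \<le> (norm x - C)\<^sup>2" by simp
    then have "2 * (C * norm x) \<le> (norm x)\<^sup>2 + C\<^sup>2" by (simp add: power2_diff mult_ac)
    moreover have "f x \<le> C * norm x" using bound[OF that] by simp
    ultimately show ?thesis by (simp add: J_def power2_norm_eq_inner)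
  qed
  define m where "m = Inf (J ` S)"
  have bdd: "bdd_below (J ` S)" using low by (auto intro!: bdd_belowI)
  have ne: "J ` S \<noteq> {}" using S(1) subspace_0 by blast
  have mle: "m \<le> J x" if "x \<in> S" for x unfolding m_def using that bdd by (intro cInf_lower) auto
  have "\<exists>x\<in>S. J x < m + inverse (real (Suc k))" for k
    using cInf_lessD[OF ne, of "m + inverse (real (Suc k))"] unfolding m_def by auto
  then obtain s where s: "\<And>k. s k \<in> S" "\<And>k. J (s k) < m + inverse (real (Suc k))" by metis
  \<comment> \<open>Parallelogram law: the midpoint lies in S, so its energy is at least the infimum
    m. This makes every minimizing sequence Cauchy.\<close>
  have par: "inner (x - y) (x - y) \<le> 2 * (J x - m) + 2 * (J y - m)" if "x \<in> S" "y \<in> S" for x y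
  proof -
    have xy: "(1 / 2) *\<^sub>R (x + y) \<in> S" using that S(1) by (simp add: subspace_scale subspace_add)
    have "f ((1 / 2) *\<^sub>R (x + y)) = (f x + f y) / 2"
      using that S(1) by (simp add: scale add subspace_add)
    then have "J ((1 / 2) *\<^sub>R (x + y)) = inner (x + y) (x + y) / 4 - (f x + f y)" by (simp add: J_def)
    with mle[OF xy] show ?thesis by (simp add: J_def algebra_simps inner_commute)
  qed
  have "Cauchy s"
  proof (rule CauchyI')
    fix e :: real assume e: "e > 0"
    obtain N where N: "inverse (real (Suc N)) < e\<^sup>2 / 4" using reals_Archimedean[of "e\<^sup>2 / 4"] e by auto
    show "\<exists>M. \<forall>i\<ge>M. \<forall>j>i. dist (s i) (s j) < e"
    proof (intro exI[of _ N] allI impI)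
      fix i j assume ij: "N \<le> i" "i < j"
      have "inverse (real (Suc i)) \<le> inverse (real (Suc N))" "inverse (real (Suc j)) \<le> inverse (real (Suc N))"
        using ij by (auto intro!: le_imp_inverse_le)
      then have "J (s i) - m < e\<^sup>2 / 4" "J (s j) - m < e\<^sup>2 / 4" using s(2)[of i] s(2)[of j] N by linarith+
      then have "(norm (s i - s j))\<^sup>2 < e\<^sup>2" using par[OF s(1)[of i] s(1)[of j]] by (simp add: power2_norm_eq_inner)
      then show "dist (s i) (s j) < e" unfolding dist_norm using e by (simp add: power2_less_imp_less)
    qed
  qed
  then obtain z where z: "z \<in> S" "s \<longlonglongrightarrow> z" using completeE[OF S(2)] s(1) by metis
  have Jz: "J z \<le> m"
  proof -
    have fl: "(\<lambda>k. f (s k)) \<longlonglongrightarrow> f z"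
    proof -
      have fd: "f (s k) - f z = f (s k - z)" for k
        using add[of "s k" "-1 *\<^sub>R z"] scale[of z "-1"] s z S(1) by (simp add: subspace_neg)
      have "(\<lambda>k. C * norm (s k - z)) \<longlonglongrightarrow> 0"
        using z(2) by (intro tendsto_mult_right_zero tendsto_norm_zero) (simp add: LIM_zero)
      then have "(\<lambda>k. f (s k) - f z) \<longlonglongrightarrow> 0"
        by (rule Lim_null_comparison[rotated]) (use bound s z S(1) in \<open>auto simp: fd subspace_diff\<close>)
      then show ?thesis by (simp add: LIM_zero_iff)
    qed
    have "(\<lambda>k. J (s k)) \<longlonglongrightarrow> J z" unfolding J_def by (intro tendsto_intros fl z(2))
    moreover have "(\<lambda>k. m + inverse (real (Suc k))) \<longlonglongrightarrow> m + 0"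
      by (intro tendsto_intros LIMSEQ_inverse_real_of_nat)
    ultimately have "J z \<le> m + 0" by (rule LIMSEQ_le) (use s(2) less_imp_le in blast)
    then show ?thesis by simp
  qed
  have "f x = inner z x" if x: "x \<in> S" for x
  proof (rule ccontr)
    define d where "d = inner z x - f x"
    assume "f x \<noteq> inner z x"
    then have d: "d \<noteq> 0" by (simp add: d_def)
    have q: "0 \<le> t * t * inner x x + 2 * t * d" for t
    proof -
      have "z + t *\<^sub>R x \<in> S" using x z S(1) by (simp add: subspace_add subspace_scale)
      from mle[OF this] Jz have "J z \<le> J (z + t *\<^sub>R x)" by simp
      moreover have "f (z + t *\<^sub>R x) = f z + t * f x" using x z S(1) by (simp add: add scale subspace_scale)
      ultimately show ?thesis by (simp add: J_def d_def algebra_simps inner_commute)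
    qed
    \<comment> \<open>With this t one has
      \<open>t * t * inner x x + 2 * t * d = t * d - t * t\<close>, which is negative for d
      different from 0. The added 1 covers x = 0.\<close>
    define t where "t = - d / (inner x x + 1)"
    have p: "inner x x + 1 > 0" by (simp add: add_nonneg_pos)
    have "t * t * inner x x + 2 * t * d < 0"
    proof -
      have "t * (inner x x + 1) = - d" using p by (simp add: t_def)
      then have "t * t * inner x x + 2 * t * d = t * d - t * t" by algebra
      moreover have "t * d < 0" using d p by (simp add: t_def divide_less_0_iff mult_less_0_iff zero_less_mult_iff power2_eq_square[symmetric])
      moreover have "t * t \<ge> 0" by simp
      ultimately show ?thesis by linarith
    qed
    with q[of t] show False by simp
  qed
  with z(1) show ?thesis by blast
qed

section \<open>Complex scalars and the complex inner product\<close>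

lemma complex_linearD: "complex_linear A \<Longrightarrow> blinfun_apply A (c *\<^sub>C x) = c *\<^sub>C blinfun_apply A x"
  by (simp add: complex_linear_def)

lemma scalar_op_apply [simp]: "blinfun_apply (scalar_op c) x = c *\<^sub>C x"
  by (simp add: scalar_op_def bounded_linear_Blinfun_apply[OF bounded_linear_scaleC])

lemma scaleC_minus_left [simp]: "(- c) *\<^sub>C (x::'a::complex_inner) = - (c *\<^sub>C x)"
proof -
  have "c *\<^sub>C x + (- c) *\<^sub>C x = 0"
    using scaleC_of_real[of 0 x] scaleC_add_left[of c "- c" x] by simp
  then show ?thesis by (simp add: eq_neg_iff_add_eq_0 add.commute)
qed

lemma scaleC_zero_left [simp]: "0 *\<^sub>C (x::'a::complex_inner) = 0"
  using scaleC_of_real[of 0 x] by simp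

lemma scaleC_one [simp]: "1 *\<^sub>C (x::'a::complex_inner) = x"
  using scaleC_of_real[of 1 x] by simp

lemma scaleC_zero_right [simp]: "c *\<^sub>C (0::'a::complex_inner) = 0"
  by (simp add: linear_simps bounded_linear_scaleC)

lemma scaleC_minus_right [simp]: "c *\<^sub>C (- x::'a::complex_inner) = - (c *\<^sub>C x)"
  using linear_neg[OF bounded_linear.linear[OF bounded_linear_scaleC]] .

lemma scaleC_diff_right: "c *\<^sub>C (x - y::'a::complex_inner) = c *\<^sub>C x - c *\<^sub>C y"
  using linear_diff[OF bounded_linear.linear[OF bounded_linear_scaleC]] .

lemma cinner_zero_left [simp]: "cinner 0 x = 0"
  using cinner_add_left[of 0 0 x] by simp

lemma cinner_minus_left [simp]: "cinner (- x) y = - cinner x y"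
  using cinner_add_left[of x "- x" y] by (simp add: eq_neg_iff_add_eq_0 add.commute)

lemma cinner_diff_left: "cinner (x - y) z = cinner x z - cinner y z"
  using cinner_add_left[of x "- y" z] by simp

lemma cinner_add_right: "cinner x (y + z) = cinner x y + cinner x z"
  by (metis cinner_add_left cinner_commute complex_cnj_add)

lemma cinner_zero_right [simp]: "cinner x 0 = 0"
  using cinner_add_right[of x 0 0] by simp

lemma cinner_minus_right [simp]: "cinner x (- y) = - cinner x y"
  using cinner_add_right[of x y "- y"] by (simp add: eq_neg_iff_add_eq_0 add.commute)

lemma cinner_diff_right: "cinner x (y - z) = cinner x y - cinner x z"
  using cinner_add_right[of x y "- z"] by simp

lemma cinner_scaleR_left: "cinner (r *\<^sub>R x) y = r *\<^sub>R cinner x y"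
  by (metis cinner_scaleC_left scaleC_of_real scaleR_conv_of_real)

lemma cinner_scaleR_right: "cinner x (r *\<^sub>R y) = r *\<^sub>R cinner x y"
  by (metis cinner_scaleC_right complex_cnj_complex_of_real scaleC_of_real scaleR_conv_of_real)

text \<open>The factor 2 comes from estimating real and imaginary part separately. Any constant
  serves the purpose, which is to apply the product rule for bounded bilinear maps to the complex
  inner product.\<close>

lemma norm_cinner_le: "cmod (cinner x y) \<le> 2 * (norm x * norm y)"
proof -
  have "cmod (cinner x y) \<le> \<bar>inner x y\<bar> + \<bar>inner x (\<i> *\<^sub>C y)\<bar>"
    using cmod_le[of "cinner x y"] by (simp add: cinner_eq_Complex)
  moreover have "\<bar>inner x y\<bar> \<le> norm x * norm y" by (rule Cauchy_Schwarz_ineq2)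
  moreover have "\<bar>inner x (\<i> *\<^sub>C y)\<bar> \<le> norm x * norm y"
    using Cauchy_Schwarz_ineq2[of x "\<i> *\<^sub>C y"] by (simp add: norm_scaleC)
  ultimately show ?thesis by linarith
qed

lemma bounded_bilinear_cinner: "bounded_bilinear cinner"
  by (standard; (simp add: cinner_add_left cinner_add_right cinner_scaleR_left cinner_scaleR_right)?)
    (rule exI[of _ 2], use norm_cinner_le in \<open>auto simp: mult_ac\<close>)

lemma csubspace_imp_subspace: "csubspace S \<Longrightarrow> subspace S"
  unfolding csubspace_def subspace_def by (metis scaleC_of_real)

text \<open>The imaginary part of \<open>cinner x y\<close> is the real inner product of x with \<i>
  y, and S contains \<i> y together with y.\<close>

lemma cinner_eq_zero_if_inner:
  assumes "csubspace S" "\<And>y. y \<in> S \<Longrightarrow> inner x y = 0" "y \<in> S"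
  shows "cinner x y = 0"
  using assms by (simp add: cinner_eq_Complex csubspace_def complex_eq_iff)

subsection \<open>Adjoints\<close>

lemma real_adjoint_exists:
  fixes A :: "'a::{real_inner,banach} \<Rightarrow>\<^sub>L 'b::{real_inner,banach}"
  shows "\<exists>B :: 'b \<Rightarrow>\<^sub>L 'a. \<forall>x y. inner (A x) y = inner x (B y)"
proof -
  have "\<exists>z. \<forall>x. inner (A x) y = inner z x" for y
  proof -
    have "\<exists>z\<in>UNIV. \<forall>x\<in>UNIV. (\<lambda>x. inner (A x) y) x = inner z x"
    proof (rule riesz_on_subspace[where C = "norm A * norm y"])
      show "\<bar>inner (A x) y\<bar> \<le> norm A * norm y * norm x" for x
      proof -
        have "\<bar>inner (A x) y\<bar> \<le> norm (A x) * norm y" by (rule Cauchy_Schwarz_ineq2)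
        also have "\<dots> \<le> (norm A * norm x) * norm y" by (intro mult_right_mono norm_blinfun) auto
        finally show ?thesis by (simp add: mult_ac)
      qed
    qed (auto simp: complete_UNIV blinfun.add_right blinfun.scaleR_right inner_add_left)
    then show ?thesis by auto
  qed
  then obtain B where B: "\<And>x y. inner (A x) y = inner (B y) x" by metis
  have "bounded_linear B"
  proof (rule bounded_linear_intro[where K = "norm A"])
    fix x y r
    have "inner (B (x + y) - (B x + B y)) z = 0" for z
      by (simp add: B[symmetric] inner_diff_left inner_add_left inner_add_right)
    then show "B (x + y) = B x + B y" using inner_eq_zero_iff[of "B (x + y) - (B x + B y)"] by auto
    have "inner (B (r *\<^sub>R x) - r *\<^sub>R B x) z = 0" for z by (simp add: B[symmetric] inner_diff_left)
    then show "B (r *\<^sub>R x) = r *\<^sub>R B x" using inner_eq_zero_iff[of "B (r *\<^sub>R x) - r *\<^sub>R B x"] by auto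
    have "norm (B x) * norm (B x) = inner (A (B x)) x" by (simp add: B power2_norm_eq_inner[symmetric] power2_eq_square)
    also have "\<dots> \<le> norm (A (B x)) * norm x" by (rule norm_cauchy_schwarz)
    also have "\<dots> \<le> (norm A * norm (B x)) * norm x" by (intro mult_right_mono norm_blinfun) auto
    finally show "norm (B x) \<le> norm x * norm A"
      by (cases "B x = 0") (auto simp: mult_ac)
  qed
  then show ?thesis by (intro exI[of _ "Blinfun B"]) (metis B bounded_linear_Blinfun_apply inner_commute)
qed

text \<open>\<open>adjoint_op\<close> has its meaning for complex-linear operators only. The adjoint
  with respect to the real inner product exists for every bounded operator and depends on it in a
  bounded linear way on the whole Banach space of operators, so derivatives with respect to t pass
  through it.\<close>

definition real_adjoint ::
    "('a::{real_inner,banach} \<Rightarrow>\<^sub>L 'b::{real_inner,banach}) \<Rightarrow> 'b \<Rightarrow>\<^sub>L 'a" where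
  "real_adjoint A = (SOME B. \<forall>x y. inner (blinfun_apply A x) y = inner x (blinfun_apply B y))"

lemma real_adjoint: "inner (blinfun_apply A x) y = inner x (blinfun_apply (real_adjoint A) y)"
  unfolding real_adjoint_def using someI_ex[OF real_adjoint_exists[of A]] by blast

lemma blinfun_eqI_inner:
  fixes B C :: "'b::real_normed_vector \<Rightarrow>\<^sub>L 'a::real_inner"
  assumes "\<And>x y. inner x (B y) = inner x (C y)"
  shows "B = C"
proof (rule blinfun_eqI)
  fix y
  have "inner (B y - C y) (B y - C y) = 0" using assms by (simp add: inner_diff_right)
  then show "B y = C y" by simp
qed

lemma bounded_linear_real_adjoint: "bounded_linear real_adjoint"
proof (rule bounded_linear_intro[where K = 1])
  fix A B :: "'a \<Rightarrow>\<^sub>L 'b" and r :: real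
  show "real_adjoint (A + B) = real_adjoint A + real_adjoint B"
    by (rule blinfun_eqI_inner)
      (simp add: real_adjoint[symmetric] blinfun.add_left inner_add_left inner_add_right)
  show "real_adjoint (r *\<^sub>R A) = r *\<^sub>R real_adjoint A"
    by (rule blinfun_eqI_inner) (simp add: real_adjoint[symmetric] blinfun.scaleR_left)
  show "norm (real_adjoint A) \<le> norm A * 1"
  proof (rule norm_blinfun_bound)
    fix x
    let ?B = "real_adjoint A"
    have "norm (?B x) * norm (?B x) = inner (A (?B x)) x"
      by (simp add: real_adjoint power2_norm_eq_inner[symmetric] power2_eq_square)
    also have "\<dots> \<le> norm (A (?B x)) * norm x" by (rule norm_cauchy_schwarz)
    also have "\<dots> \<le> (norm A * norm (?B x)) * norm x" by (intro mult_right_mono norm_blinfun) auto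
    finally show "norm (?B x) \<le> norm A * 1 * norm x"
      by (cases "?B x = 0") (auto simp: mult_ac)
  qed simp
qed

text \<open>The real adjoint of a complex-linear operator is complex-linear, hence it satisfies the
  complex adjoint identity in real and imaginary part. Since such an operator is unique, the
  definite description selects it.\<close>

lemma adjoint_op_props:
  fixes A :: "'a::complex_hilbert \<Rightarrow>\<^sub>L 'b::complex_hilbert"
  assumes A: "complex_linear A"
  shows adjoint_op_eq_real_adjoint: "adjoint_op A = real_adjoint A"
    and cinner_adjoint_op: "cinner (A x) y = cinner x (adjoint_op A y)"
    and complex_linear_adjoint_op: "complex_linear (adjoint_op A)"
proof -
  let ?B = "real_adjoint A"
  have i: "inner (\<i> *\<^sub>C u) v = - inner u (\<i> *\<^sub>C v)" for u v :: "'c::complex_inner"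
    by (simp flip: Re_cinner add: cinner_scaleC_left cinner_scaleC_right)
  have c: "inner u (c *\<^sub>C v) = inner (cnj c *\<^sub>C u) v" for u v :: "'c::complex_inner" and c
    by (simp flip: Re_cinner add: cinner_scaleC_left cinner_scaleC_right)
  have Bc: "?B (c *\<^sub>C y) = c *\<^sub>C ?B y" for c y
  proof -
    have "inner x (?B (c *\<^sub>C y) - c *\<^sub>C ?B y) = 0" for x
      by (simp add: inner_diff_right real_adjoint[symmetric] c complex_linearD[OF A])
    from this[of "?B (c *\<^sub>C y) - c *\<^sub>C ?B y"] show ?thesis by simp
  qed
  have ci: "cinner (A x) y = cinner x (?B y)" for x y
    by (simp add: cinner_eq_Complex real_adjoint Bc)
  have "adjoint_op A = ?B"
    unfolding adjoint_op_def
  proof (rule the_equality)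
    show "\<forall>x y. cinner (A x) y = cinner x (?B y)" using ci by blast
    fix B assume "\<forall>x y. cinner (A x) y = cinner x (blinfun_apply B y)"
    then show "B = ?B" by (intro blinfun_eqI_inner) (metis Re_cinner ci)
  qed
  then show "adjoint_op A = ?B" "cinner (A x) y = cinner x (adjoint_op A y)" "complex_linear (adjoint_op A)"
    using ci Bc by (auto simp: complex_linear_def)
qed

subsection \<open>Completeness of the space of square-integrable functions\<close>

lemma abs_L2_arith:
  assumes "square_integrable f" "square_integrable g"
  shows "abs_L2 f + abs_L2 g = abs_L2 (\<lambda>t. f t + g t)" "abs_L2 f - abs_L2 g = abs_L2 (\<lambda>t. f t - g t)"
    "c *\<^sub>C abs_L2 f = abs_L2 (\<lambda>t. c *\<^sub>C f t)" "r *\<^sub>R abs_L2 f = abs_L2 (\<lambda>t. r *\<^sub>R f t)"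
    "inner (abs_L2 f) (abs_L2 g) = integral\<^sup>L lebesgue (\<lambda>t. inner (f t) (g t))"
    "cinner (abs_L2 f) (abs_L2 g) = integral\<^sup>L lebesgue (\<lambda>t. cinner (f t) (g t))"
  using assms
  by (auto simp: plus_L2.abs_eq minus_L2.abs_eq scaleC_L2.abs_eq scaleR_L2.abs_eq inner_L2.abs_eq cinner_L2.abs_eq)

lemma abs_L2_eq_iff:
  assumes "square_integrable f" "square_integrable g"
  shows "abs_L2 f = abs_L2 g \<longleftrightarrow> (AE t in lebesgue. f t = g t)"
  using Quotient_rel[OF Quotient_L2, of f g] assms by (auto simp: square_integrable_def)

lemma abs_L2_zero: "abs_L2 (\<lambda>_. 0) = 0"
  by (simp add: zero_L2_def)

lemma L2_cases: obtains f where "square_integrable f" "x = abs_L2 f"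
  using Quotient_abs_rep[OF Quotient_L2, of x] Quotient_rep_reflp[OF Quotient_L2, of x] by metis

lemma norm_abs_L2:
  assumes "square_integrable f"
  shows "(norm (abs_L2 f))\<^sup>2 = integral\<^sup>L lebesgue (\<lambda>t. (norm (f t))\<^sup>2)"
    and "(\<integral>\<^sup>+ t. ennreal ((norm (f t))\<^sup>2) \<partial>lebesgue) = ennreal ((norm (abs_L2 f))\<^sup>2)"
proof -
  show 1: "(norm (abs_L2 f))\<^sup>2 = integral\<^sup>L lebesgue (\<lambda>t. (norm (f t))\<^sup>2)"
    using assms by (simp add: power2_norm_eq_inner abs_L2_arith)
  show "(\<integral>\<^sup>+ t. ennreal ((norm (f t))\<^sup>2) \<partial>lebesgue) = ennreal ((norm (abs_L2 f))\<^sup>2)"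
    unfolding 1 using assms by (intro nn_integral_eq_integral) (auto simp: square_integrable_def)
qed

text \<open>Riesz-Fischer along a rapidly converging sequence. The weights 2^k keep the sum of 2^k
  g_k^2 integrable, where g_k is the norm of the k-th increment, so it is finite almost everywhere.
  Because g_k is at most 2^k g_k^2 + 2^(-k), the increments are then summable pointwise. Fatou's
  lemma turns the pointwise limit into a limit in norm.\<close>

lemma square_integrable_limit:
  fixes f :: "nat \<Rightarrow> real \<Rightarrow> 'a::{complex_hilbert, second_countable_topology}"
  assumes f: "\<And>k. square_integrable (f k)"
    and d: "\<And>k. norm (abs_L2 (f (Suc k)) - abs_L2 (f k)) \<le> (1 / 2) ^ k"
  shows "\<exists>g. square_integrable g \<and> (\<lambda>k. abs_L2 (f k)) \<longlonglongrightarrow> abs_L2 g"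
proof -
  define g where "g k t = norm (f (Suc k) t - f k t)" for k t
  have meas [measurable]: "f k \<in> borel_measurable lebesgue" for k using f by (simp add: square_integrable_def)
  have [measurable]: "g k \<in> borel_measurable lebesgue" for k unfolding g_def by measurable
  have gi: "(\<integral>\<^sup>+ t. ennreal ((g k t)\<^sup>2) \<partial>lebesgue) \<le> ennreal ((1 / 4) ^ k)" for k
  proof -
    have "(\<integral>\<^sup>+ t. ennreal ((g k t)\<^sup>2) \<partial>lebesgue) = ennreal ((norm (abs_L2 (f (Suc k)) - abs_L2 (f k)))\<^sup>2)"
      unfolding g_def abs_L2_arith(2)[OF f f] by (rule norm_abs_L2) (intro square_integrable_diff f)
    also have "\<dots> \<le> ennreal (((1 / 2) ^ k)\<^sup>2)"
      by (intro ennreal_leI power_mono d) simp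
    also have "((1 / 2) ^ k)\<^sup>2 = (1 / 4 :: real) ^ k" by (simp add: power2_eq_square flip: power_mult_distrib)
    finally show ?thesis .
  qed
  have "(\<integral>\<^sup>+ t. (\<Sum>k. ennreal (2 ^ k * (g k t)\<^sup>2)) \<partial>lebesgue) = (\<Sum>k. \<integral>\<^sup>+ t. ennreal (2 ^ k * (g k t)\<^sup>2) \<partial>lebesgue)"
    by (intro nn_integral_suminf) measurable
  also have "\<dots> \<le> (\<Sum>k. ennreal ((1 / 2) ^ k))"
  proof (intro suminf_le summableI)
    fix k
    have "(\<integral>\<^sup>+ t. ennreal (2 ^ k * (g k t)\<^sup>2) \<partial>lebesgue) = ennreal (2 ^ k) * (\<integral>\<^sup>+ t. ennreal ((g k t)\<^sup>2) \<partial>lebesgue)"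
      by (simp add: ennreal_mult nn_integral_cmult)
    also have "\<dots> \<le> ennreal (2 ^ k) * ennreal ((1 / 4) ^ k)" by (intro mult_left_mono gi) simp
    also have "\<dots> = ennreal ((1 / 2) ^ k)" by (simp add: ennreal_mult[symmetric] flip: power_mult_distrib)
    finally show "(\<integral>\<^sup>+ t. ennreal (2 ^ k * (g k t)\<^sup>2) \<partial>lebesgue) \<le> ennreal ((1 / 2) ^ k)" .
  qed
  also have "\<dots> < \<infinity>"
  proof -
    have "(\<Sum>k. ennreal ((1 / 2) ^ k)) \<noteq> top"
      by (rule ennreal_suminf_neq_top) (auto intro: summable_geometric)
    then show ?thesis by (metis infinity_ennreal_def top.not_eq_extremum)
  qed
  finally have fin: "(\<integral>\<^sup>+ t. (\<Sum>k. ennreal (2 ^ k * (g k t)\<^sup>2)) \<partial>lebesgue) < \<infinity>" .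
  have "AE t in lebesgue. (\<Sum>k. ennreal (2 ^ k * (g k t)\<^sup>2)) \<noteq> \<infinity>"
  proof (rule nn_integral_PInf_AE)
    show "(\<lambda>t. \<Sum>k. ennreal (2 ^ k * (g k t)\<^sup>2)) \<in> borel_measurable lebesgue" by measurable
  qed (use fin in simp)
  then have conv: "AE t in lebesgue. convergent (\<lambda>k. f k t)"
  proof eventually_elim
    fix t assume "(\<Sum>k. ennreal (2 ^ k * (g k t)\<^sup>2)) \<noteq> \<infinity>"
    then have sm: "summable (\<lambda>k. 2 ^ k * (g k t)\<^sup>2)" by (intro summable_suminf_not_top) auto
    have "summable (\<lambda>k. g k t)"
    proof (rule summable_comparison_test')
      show "summable (\<lambda>k. (2 ^ k * (g k t)\<^sup>2 + (1 / 2) ^ k))"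
        by (intro summable_add sm summable_geometric) simp
      fix k :: nat
      assume "k \<ge> 0"
      have pw: "(1 / 2 :: real) ^ k * 2 ^ k = 1" by (simp flip: power_mult_distrib)
      have g0: "0 \<le> g k t" by (simp add: g_def)
      have "2 * (2 ^ k * g k t) \<le> (2 ^ k * g k t)\<^sup>2 + 1" using sum_squares_bound[of "2 ^ k * g k t" 1] by simp
      moreover have "0 \<le> 2 ^ k * g k t" using g0 by simp
      ultimately have "2 ^ k * g k t \<le> (2 ^ k * g k t)\<^sup>2 + 1" by linarith
      then have "(1 / 2) ^ k * (2 ^ k * g k t) \<le> (1 / 2) ^ k * ((2 ^ k * g k t)\<^sup>2 + 1)"
        by (intro mult_left_mono) auto
      moreover have "(1 / 2) ^ k * (2 ^ k * g k t) = g k t"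
        by (simp add: mult.assoc[symmetric] pw)
      moreover have "(1 / 2) ^ k * ((2 ^ k * g k t)\<^sup>2 + 1) = 2 ^ k * (g k t)\<^sup>2 + (1 / 2) ^ k"
        by (simp add: power2_eq_square algebra_simps power_one_over)
      ultimately show "norm (g k t) \<le> 2 ^ k * (g k t)\<^sup>2 + (1 / 2) ^ k" using g0 by simp
    qed
    then have "summable (\<lambda>k. f (Suc k) t - f k t)"
      unfolding g_def by (rule summable_norm_cancel)
    then show "convergent (\<lambda>k. f k t)"
      using summable_iff_convergent[of "\<lambda>k. f (Suc k) t - f k t"]
      by (simp add: sum_lessThan_telescope[of "\<lambda>i. f i t"] convergent_diff_const_right_iff)
  qed
  define h where "h t = lim (\<lambda>k. f k t)" for t
  have [measurable]: "h \<in> borel_measurable lebesgue"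
    unfolding h_def by (rule borel_measurable_lim_metric) measurable
  have lim: "AE t in lebesgue. (\<lambda>k. f k t) \<longlonglongrightarrow> h t"
    using conv by eventually_elim (simp add: h_def convergent_LIMSEQ_iff)
  have tail: "norm (abs_L2 (f (m + k)) - abs_L2 (f k)) \<le> 2 * (1 / 2) ^ k" for m k
  proof -
    have "norm (abs_L2 (f (m + k)) - abs_L2 (f k)) \<le> 2 * (1 / 2) ^ k - 2 * (1 / 2) ^ (m + k)"
    proof (induction m)
      case (Suc m)
      show ?case using norm_triangle_ineq[of "abs_L2 (f (Suc (m + k))) - abs_L2 (f (m + k))" "abs_L2 (f (m + k)) - abs_L2 (f k)"]
          d[of "m + k"] Suc by simp
    qed simp
    also have "\<dots> \<le> 2 * (1 / 2) ^ k" by simp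
    finally show ?thesis .
  qed
  have fatou: "(\<integral>\<^sup>+ t. ennreal ((norm (h t - f k t))\<^sup>2) \<partial>lebesgue) \<le> ennreal ((2 * (1 / 2) ^ k)\<^sup>2)" for k
  proof -
    have "(\<integral>\<^sup>+ t. ennreal ((norm (h t - f k t))\<^sup>2) \<partial>lebesgue)
        = (\<integral>\<^sup>+ t. liminf (\<lambda>m. ennreal ((norm (f (m + k) t - f k t))\<^sup>2)) \<partial>lebesgue)"
    proof (rule nn_integral_cong_AE, use lim in eventually_elim)
      fix t assume "(\<lambda>k. f k t) \<longlonglongrightarrow> h t"
      then have "(\<lambda>m. f (m + k) t) \<longlonglongrightarrow> h t" by (rule LIMSEQ_ignore_initial_segment)
      then have "(\<lambda>m. ennreal ((norm (f (m + k) t - f k t))\<^sup>2)) \<longlonglongrightarrow> ennreal ((norm (h t - f k t))\<^sup>2)"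
        by (intro tendsto_intros)
      then show "ennreal ((norm (h t - f k t))\<^sup>2) = liminf (\<lambda>m. ennreal ((norm (f (m + k) t - f k t))\<^sup>2))"
        by (metis lim_imp_Liminf trivial_limit_sequentially)
    qed
    also have "\<dots> \<le> liminf (\<lambda>m. \<integral>\<^sup>+ t. ennreal ((norm (f (m + k) t - f k t))\<^sup>2) \<partial>lebesgue)"
      by (intro nn_integral_liminf) measurable
    also have "\<dots> \<le> ennreal ((2 * (1 / 2) ^ k)\<^sup>2)"
    proof (rule Liminf_le[OF _ always_eventually], simp, rule allI)
      fix m
      have "(\<integral>\<^sup>+ t. ennreal ((norm (f (m + k) t - f k t))\<^sup>2) \<partial>lebesgue) = ennreal ((norm (abs_L2 (f (m + k)) - abs_L2 (f k)))\<^sup>2)"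
        unfolding abs_L2_arith(2)[OF f f] by (rule norm_abs_L2) (intro square_integrable_diff f)
      also have "\<dots> \<le> ennreal ((2 * (1 / 2) ^ k)\<^sup>2)"
        by (intro ennreal_leI power_mono tail) simp
      finally show "(\<integral>\<^sup>+ t. ennreal ((norm (f (m + k) t - f k t))\<^sup>2) \<partial>lebesgue) \<le> ennreal ((2 * (1 / 2) ^ k)\<^sup>2)" .
    qed
    finally show ?thesis .
  qed
  have hk: "square_integrable (\<lambda>t. h t - f k t)" for k
    unfolding square_integrable_def
  proof
    show "integrable lebesgue (\<lambda>t. (norm (h t - f k t))\<^sup>2)"
      using fatou[of k] by (intro integrableI_bounded) (auto simp: le_less_trans)
  qed measurable
  have "square_integrable (\<lambda>t. (h t - f 0 t) + f 0 t)" by (intro square_integrable_add hk f)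
  then have h: "square_integrable h" by simp
  have "norm (abs_L2 (f k) - abs_L2 h) \<le> 2 * (1 / 2) ^ k" for k
  proof -
    have "ennreal ((norm (abs_L2 h - abs_L2 (f k)))\<^sup>2) \<le> ennreal ((2 * (1 / 2) ^ k)\<^sup>2)"
      using fatou[of k] norm_abs_L2(2)[OF hk[of k]] by (simp add: abs_L2_arith(2)[OF h f])
    then have "(norm (abs_L2 h - abs_L2 (f k)))\<^sup>2 \<le> (2 * (1 / 2) ^ k)\<^sup>2"
      by (rule ennreal_le_iff[THEN iffD1, rotated]) (rule zero_le_power2)
    then have "norm (abs_L2 h - abs_L2 (f k)) \<le> 2 * (1 / 2) ^ k"
      by (rule power2_le_imp_le) simp
    then show ?thesis by (simp add: norm_minus_commute)
  qed
  moreover have "(\<lambda>k. 2 * (1 / 2 :: real) ^ k) \<longlonglongrightarrow> 0"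
    by (intro tendsto_mult_right_zero LIMSEQ_power_zero) simp
  ultimately have "(\<lambda>k. abs_L2 (f k) - abs_L2 h) \<longlonglongrightarrow> 0"
    using Lim_null_comparison[OF always_eventually[OF allI], of "\<lambda>k. abs_L2 (f k) - abs_L2 h" "\<lambda>k. 2 * (1 / 2 :: real) ^ k"]
    by blast
  then have "(\<lambda>k. abs_L2 (f k)) \<longlonglongrightarrow> abs_L2 h" by (simp add: LIM_zero_iff)
  with h show ?thesis by blast
qed

instance L2 :: ("{complex_hilbert, second_countable_topology}") complex_hilbert
proof
  fix X :: "nat \<Rightarrow> 'a L2" assume X: "Cauchy X"
  have "\<exists>N. \<forall>m\<ge>N. \<forall>n\<ge>N. norm (X m - X n) < (1 / 2) ^ k" for k :: nat
    using X unfolding Cauchy_iff by auto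
  then obtain N where N: "\<And>k m n. m \<ge> N k \<Longrightarrow> n \<ge> N k \<Longrightarrow> norm (X m - X n) < (1 / 2) ^ k" by metis
  \<comment> \<open>The indices dominate every \<open>N k\<close>, and the summand k keeps them
    strictly increasing where \<open>N\<close> vanishes.\<close>
  define r where "r k = (\<Sum>i\<le>k. N i) + k" for k
  have rN: "r k \<ge> N k" for k unfolding r_def using member_le_sum[of k "{..k}" N] by simp
  have rS: "strict_mono r" by (simp add: strict_mono_Suc_iff r_def)
  have "\<exists>f. square_integrable f \<and> X (r k) = abs_L2 f" for k using L2_cases by metis
  then obtain f where f: "\<And>k. square_integrable (f k)" "\<And>k. X (r k) = abs_L2 (f k)" by metis
  have "norm (abs_L2 (f (Suc k)) - abs_L2 (f k)) \<le> (1 / 2) ^ k" for k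
  proof -
    have "r k \<le> r (Suc k)" by (simp add: r_def)
    then have "N k \<le> r (Suc k)" using rN[of k] by linarith
    then show ?thesis using less_imp_le[OF N[of k "r (Suc k)" "r k"]] rN[of k] by (simp add: f(2))
  qed
  from square_integrable_limit[OF f(1) this] obtain g where "(\<lambda>k. X (r k)) \<longlonglongrightarrow> abs_L2 g" unfolding f(2) by blast
  then have "X \<longlonglongrightarrow> abs_L2 g" using Cauchy_converges_subseq[OF X rS, of "abs_L2 g"] by (simp add: comp_def)
  then show "convergent X" by (auto simp: convergent_def)
qed

section \<open>Absolutely continuous functions\<close>

text \<open>The premise in the definition of absolute continuity, named so that it can be handed on
  to a larger set or a larger bound as one fact.\<close>

definition disjoint_intervals :: "real set \<Rightarrow> real \<Rightarrow> nat \<Rightarrow> (nat \<Rightarrow> real) \<Rightarrow> (nat \<Rightarrow> real) \<Rightarrow> bool" where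
  "disjoint_intervals S d m u v \<longleftrightarrow>
     (\<forall>i<m. u i \<le> v i \<and> {u i..v i} \<subseteq> S) \<and>
     (\<forall>i<m. \<forall>j<m. i \<noteq> j \<longrightarrow> {u i<..<v i} \<inter> {u j<..<v j} = {}) \<and>
     (\<Sum>i<m. v i - u i) < d"

lemma abs_continuous_on_altdef:
  "abs_continuous_on S f \<longleftrightarrow>
     (\<forall>e>0. \<exists>d>0. \<forall>m u v. disjoint_intervals S d m u v \<longrightarrow> (\<Sum>i<m. norm (f (v i) - f (u i))) < e)"
  unfolding abs_continuous_on_def disjoint_intervals_def ..

lemma abs_continuous_onD:
  assumes "abs_continuous_on S f" "e > 0"
  obtains d where "d > 0" "\<And>m u v. disjoint_intervals S d m u v \<Longrightarrow> (\<Sum>i<m. norm (f (v i) - f (u i))) < e"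
  using assms unfolding abs_continuous_on_altdef by blast

lemma abs_continuous_onI:
  assumes "\<And>e. e > 0 \<Longrightarrow> \<exists>d>0. \<forall>m u v. disjoint_intervals S d m u v \<longrightarrow> (\<Sum>i<m. norm (f (v i) - f (u i))) < e"
  shows "abs_continuous_on S f"
  using assms unfolding abs_continuous_on_altdef by blast

lemma disjoint_intervals_mono:
  "disjoint_intervals S d m u v \<Longrightarrow> S \<subseteq> T \<Longrightarrow> d \<le> d' \<Longrightarrow> disjoint_intervals T d' m u v"
  unfolding disjoint_intervals_def by (meson less_le_trans order_trans)

lemma disjoint_intervals_mem:
  "disjoint_intervals S d m u v \<Longrightarrow> i < m \<Longrightarrow> u i \<in> S \<and> v i \<in> S \<and> u i \<le> v i"
  unfolding disjoint_intervals_def by (simp add: subset_iff)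

lemma abs_continuous_on_imp_continuous_on:
  assumes "abs_continuous_on {a..b} f"
  shows "continuous_on {a..b} f"
  unfolding continuous_on_iff
proof (intro ballI allI impI)
  fix x and e :: real assume x: "x \<in> {a..b}" and "e > 0"
  then obtain d where d: "d > 0"
    and D: "\<And>m u v. disjoint_intervals {a..b} d m u v \<Longrightarrow> (\<Sum>i<m. norm (f (v i) - f (u i))) < e"
    using abs_continuous_onD[OF assms] by metis
  show "\<exists>d>0. \<forall>y\<in>{a..b}. dist y x < d \<longrightarrow> dist (f y) (f x) < e"
  proof (intro exI[of _ d] conjI ballI impI d)
    fix y assume y: "y \<in> {a..b}" "dist y x < d"
    have "(\<Sum>i<1::nat. norm (f (max x y) - f (min x y))) < e"
    proof (rule D[of 1 "\<lambda>_. min x y" "\<lambda>_. max x y"])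
      have "max x y - min x y < d"
        using y(2) by (cases "x \<le> y") (simp_all add: dist_real_def)
      then show "disjoint_intervals {a..b} d 1 (\<lambda>_. min x y) (\<lambda>_. max x y)"
        using x y by (simp add: disjoint_intervals_def)
    qed
    then show "dist (f y) (f x) < e"
      by (cases "x \<le> y") (auto simp: dist_norm norm_minus_commute)
  qed
qed

text \<open>Common source of the closure properties. Sums, bilinear products, bounded linear images,
  Lipschitz functions and functions that agree on S all have increments dominated by those of two
  given functions.\<close>

lemma abs_continuous_on_compose_bound:
  fixes f :: "real \<Rightarrow> 'a::real_normed_vector" and g :: "real \<Rightarrow> 'b::real_normed_vector"
    and h :: "real \<Rightarrow> 'c::real_normed_vector"
  assumes f: "abs_continuous_on S f" and g: "abs_continuous_on S g"
    and K: "\<And>u v. u \<in> S \<Longrightarrow> v \<in> S \<Longrightarrow> norm (h v - h u) \<le> K * (norm (f v - f u) + norm (g v - g u))"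
  shows "abs_continuous_on S h"
proof (rule abs_continuous_onI)
  fix e :: real assume e: "e > 0"
  define e' where "e' = e / (2 * (\<bar>K\<bar> + 1))"
  have e': "e' > 0" using e by (simp add: e'_def add_nonneg_pos)
  have Ke: "(\<bar>K\<bar> + 1) * (e' + e') = e"
    using abs_ge_zero[of K] unfolding e'_def by (simp add: divide_simps) (simp add: algebra_simps)?
  obtain d1 where d1: "d1 > 0" "\<And>m u v. disjoint_intervals S d1 m u v \<Longrightarrow> (\<Sum>i<m. norm (f (v i) - f (u i))) < e'"
    using abs_continuous_onD[OF f e'] by metis
  obtain d2 where d2: "d2 > 0" "\<And>m u v. disjoint_intervals S d2 m u v \<Longrightarrow> (\<Sum>i<m. norm (g (v i) - g (u i))) < e'"
    using abs_continuous_onD[OF g e'] by metis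
  show "\<exists>d>0. \<forall>m u v. disjoint_intervals S d m u v \<longrightarrow> (\<Sum>i<m. norm (h (v i) - h (u i))) < e"
  proof (intro exI[of _ "min d1 d2"] conjI allI impI)
    show "0 < min d1 d2" using d1 d2 by simp
    fix m :: nat and u v :: "nat \<Rightarrow> real"
    assume *: "disjoint_intervals S (min d1 d2) m u v"
    have mem: "u i \<in> S \<and> v i \<in> S" if "i < m" for i
      using disjoint_intervals_mem[OF * that] by blast
    have 1: "(\<Sum>i<m. norm (f (v i) - f (u i))) < e'" by (intro d1 disjoint_intervals_mono[OF *]) auto
    have 2: "(\<Sum>i<m. norm (g (v i) - g (u i))) < e'" by (intro d2 disjoint_intervals_mono[OF *]) auto
    have "(\<Sum>i<m. norm (h (v i) - h (u i)))
        \<le> (\<Sum>i<m. (\<bar>K\<bar> + 1) * (norm (f (v i) - f (u i)) + norm (g (v i) - g (u i))))"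
    proof (rule sum_mono)
      fix i assume "i \<in> {..<m}"
      then have "norm (h (v i) - h (u i)) \<le> K * (norm (f (v i) - f (u i)) + norm (g (v i) - g (u i)))"
        using K mem by simp
      also have "\<dots> \<le> (\<bar>K\<bar> + 1) * (norm (f (v i) - f (u i)) + norm (g (v i) - g (u i)))"
        by (intro mult_right_mono) auto
      finally show "norm (h (v i) - h (u i)) \<le> (\<bar>K\<bar> + 1) * (norm (f (v i) - f (u i)) + norm (g (v i) - g (u i)))" .
    qed
    also have "\<dots> = (\<bar>K\<bar> + 1) * ((\<Sum>i<m. norm (f (v i) - f (u i))) + (\<Sum>i<m. norm (g (v i) - g (u i))))"
      by (simp add: sum.distrib flip: sum_distrib_left)
    also have "\<dots> < (\<bar>K\<bar> + 1) * (e' + e')" using 1 2 by (intro mult_strict_left_mono) auto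
    also have "\<dots> = e" by (rule Ke)
    finally show "(\<Sum>i<m. norm (h (v i) - h (u i))) < e" .
  qed
qed

lemma abs_continuous_on_lipschitz:
  assumes K: "\<And>u v. u \<in> S \<Longrightarrow> v \<in> S \<Longrightarrow> norm (f v - f u) \<le> K * \<bar>v - u\<bar>"
  shows "abs_continuous_on S f"
proof -
  have id: "abs_continuous_on S (\<lambda>t::real. t)"
  proof (rule abs_continuous_onI)
    fix e :: real assume "e > 0"
    moreover have "(\<Sum>i<m. norm (v i - u i)) < e" if "disjoint_intervals S e m u v" for m u v
    proof -
      have "(\<Sum>i<m. norm (v i - u i)) = (\<Sum>i<m. v i - u i)"
        using disjoint_intervals_mem[OF that] by (intro sum.cong) auto
      then show ?thesis using that by (simp add: disjoint_intervals_def)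
    qed
    ultimately show "\<exists>d>0. \<forall>m u v. disjoint_intervals S d m u v \<longrightarrow> (\<Sum>i<m. norm (v i - u i)) < e" by blast
  qed
  show ?thesis
  \<comment> \<open>The identity serves as both majorants and its increment is counted twice, hence
    K / 2.\<close>
  proof (rule abs_continuous_on_compose_bound[OF id id, where K = "K / 2"])
    fix u v assume "u \<in> S" "v \<in> S"
    then show "norm (f v - f u) \<le> K / 2 * (norm (v - u) + norm (v - u))" using K[of u v] by simp
  qed
qed

lemma continuous_on_Icc_bounded:
  fixes f :: "real \<Rightarrow> 'a::real_normed_vector"
  assumes "continuous_on {a..b} f"
  obtains K where "K \<ge> 0" "\<And>t. t \<in> {a..b} \<Longrightarrow> norm (f t) \<le> K"
proof -
  have "bounded (f ` {a..b})"
    by (intro compact_imp_bounded compact_continuous_image assms compact_Icc)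
  then obtain K where "\<forall>x\<in>f ` {a..b}. norm x \<le> K" unfolding bounded_iff by blast
  then show ?thesis by (intro that[of "max 0 K"]) (auto simp: max.coboundedI2)
qed

lemma abs_continuous_on_C1:
  fixes f :: "real \<Rightarrow> 'a::real_normed_vector"
  assumes d: "\<And>t. t \<in> {a..b} \<Longrightarrow> (f has_vector_derivative f' t) (at t within {a..b})"
    and c: "continuous_on {a..b} f'"
  shows "abs_continuous_on {a..b} f"
proof -
  obtain K where K: "\<And>t. t \<in> {a..b} \<Longrightarrow> norm (f' t) \<le> K"
    using continuous_on_Icc_bounded[OF c] by metis
  show ?thesis
  proof (rule abs_continuous_on_lipschitz)
    fix u v assume uv: "u \<in> {a..b}" "v \<in> {a..b}"
    have "norm (f v - f u) \<le> K * norm (v - u)"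
    proof (rule differentiable_bound[of "{a..b}" f "\<lambda>t h. h *\<^sub>R f' t"])
      show "(f has_derivative (\<lambda>h. h *\<^sub>R f' x)) (at x within {a..b})" if "x \<in> {a..b}" for x
        using d[OF that] by (simp add: has_vector_derivative_def)
      show "onorm (\<lambda>h. h *\<^sub>R f' x) \<le> K" if "x \<in> {a..b}" for x
        by (rule onorm_le) (use mult_right_mono[OF K[OF that] abs_ge_zero] in \<open>simp add: mult.commute\<close>)
    qed (use uv in auto)
    then show "norm (f v - f u) \<le> K * \<bar>v - u\<bar>" by simp
  qed
qed

lemma abs_continuous_on_bilinear:
  assumes "bounded_bilinear B" and f: "abs_continuous_on {a..b} f" and g: "abs_continuous_on {a..b} g"
  shows "abs_continuous_on {a..b} (\<lambda>t. B (f t) (g t))"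
proof -
  interpret bounded_bilinear B by fact
  obtain C where C: "C > 0" "\<And>x y. norm (B x y) \<le> norm x * norm y * C" using pos_bounded by auto
  have "\<exists>K. \<forall>t\<in>{a..b}. norm (h t) \<le> K" if "abs_continuous_on {a..b} h" for h :: "real \<Rightarrow> 'x::real_normed_vector"
    using continuous_on_Icc_bounded[OF abs_continuous_on_imp_continuous_on[OF that]] by metis
  from this[OF f] this[OF g] obtain K1 K2 where
    K: "\<And>t. t \<in> {a..b} \<Longrightarrow> norm (f t) \<le> K1" "\<And>t. t \<in> {a..b} \<Longrightarrow> norm (g t) \<le> K2" by blast
  define K where "K = max 0 (max K1 K2)"
  have K: "norm (f t) \<le> K" "norm (g t) \<le> K" if "t \<in> {a..b}" for t
    using K[OF that] by (auto simp: K_def)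
  show ?thesis
  proof (rule abs_continuous_on_compose_bound[OF f g, where K = "K * C"])
    fix u v assume uv: "u \<in> {a..b}" "v \<in> {a..b}"
    have "B (f v) (g v) - B (f u) (g u) = B (f v - f u) (g v) + B (f u) (g v - g u)"
      by (simp add: diff_left diff_right)
    then have "norm (B (f v) (g v) - B (f u) (g u)) \<le> norm (B (f v - f u) (g v)) + norm (B (f u) (g v - g u))"
      by (metis norm_triangle_ineq)
    also have "\<dots> \<le> norm (f v - f u) * norm (g v) * C + norm (f u) * norm (g v - g u) * C"
      by (intro add_mono C)
    also have "\<dots> \<le> norm (f v - f u) * K * C + K * norm (g v - g u) * C"
      using uv K C(1) by (intro add_mono mult_right_mono mult_left_mono) auto
    finally show "norm (B (f v) (g v) - B (f u) (g u)) \<le> K * C * (norm (f v - f u) + norm (g v - g u))"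
      by (simp add: algebra_simps)
  qed
qed

lemma abs_continuous_on_add:
  assumes "abs_continuous_on S f" "abs_continuous_on S g"
  shows "abs_continuous_on S (\<lambda>t. f t + g t)"
  by (rule abs_continuous_on_compose_bound[OF assms, where K = 1])
    (simp add: add_diff_add norm_triangle_ineq)

lemma abs_continuous_on_linear:
  assumes "bounded_linear L" "abs_continuous_on S f"
  shows "abs_continuous_on S (\<lambda>t. L (f t))"
proof -
  interpret bounded_linear L by fact
  obtain K where "K \<ge> 0" "\<And>x. norm (L x) \<le> norm x * K" using nonneg_bounded by blast
  then show ?thesis
    by (intro abs_continuous_on_compose_bound[OF assms(2) assms(2), where K = K])
      (smt (verit) diff mult.commute mult_left_mono norm_ge_zero)
qed

lemma abs_continuous_on_cong:
  assumes "\<And>t. t \<in> S \<Longrightarrow> f t = g t"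
  shows "abs_continuous_on S f \<longleftrightarrow> abs_continuous_on S g"
proof -
  have "abs_continuous_on S g" if "abs_continuous_on S f" "\<And>t. t \<in> S \<Longrightarrow> f t = g t"
    for f g :: "real \<Rightarrow> 'x::real_normed_vector"
    by (rule abs_continuous_on_compose_bound[OF that(1) that(1), where K = 1]) (simp add: that(2))
  from this[of f g] this[of g f] assms show ?thesis by auto
qed

text \<open>
  On the exceptional null set the increments are controlled by absolute continuity, elsewhere by
  differentiability; no integrability of the derivative has to be known beforehand.
\<close>

lemma abs_continuous_has_integral:
  fixes f :: "real \<Rightarrow> 'a::banach"
  assumes ab: "a \<le> b" and ac: "abs_continuous_on {a..b} f" and N: "negligible N"
    and der: "\<And>t. t \<in> {a..b} - N \<Longrightarrow> (f has_vector_derivative g t) (at t within {a..b})"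
  shows "(g has_integral (f b - f a)) {a..b}"
proof -
  define g' where "g' t = (if t \<in> N then 0 else g t)" for t
  have "(g' has_integral (f b - f a)) {a..b}"
    unfolding has_integral_real
  proof (intro allI impI)
    fix e :: real assume e: "e > 0"
    define e1 where "e1 = e / (2 * (b - a + 1))"
    have e1: "e1 > 0" using e ab by (simp add: e1_def)
    have "\<exists>d>0. \<forall>y\<in>{a..b}. \<bar>y - t\<bar> < d \<longrightarrow> norm (f y - f t - (y - t) *\<^sub>R g t) \<le> e1 * \<bar>y - t\<bar>"
      if "t \<in> {a..b} - N" for t
      using der[OF that] e1 unfolding has_vector_derivative_def has_derivative_within_alt by auto
    then obtain d where d: "\<And>t. t \<in> {a..b} - N \<Longrightarrow> d t > 0"
      and dD: "\<And>t y. t \<in> {a..b} - N \<Longrightarrow> y \<in> {a..b} \<Longrightarrow> \<bar>y - t\<bar> < d t \<Longrightarrow>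
          norm (f y - f t - (y - t) *\<^sub>R g t) \<le> e1 * \<bar>y - t\<bar>"
      by metis
    obtain dl where dl: "dl > 0"
      and DL: "\<And>m u v. disjoint_intervals {a..b} dl m u v \<Longrightarrow> (\<Sum>i<m. norm (f (v i) - f (u i))) < e / 2"
      using abs_continuous_onD[OF ac, of "e / 2"] e by (metis half_gt_zero)
    \<comment> \<open>The gauge at points of N forces their intervals into an open set G of measure
      below \<open>dl\<close>. Their total length is then small, and absolute continuity bounds the
      sum of the increments of f over them.\<close>
    obtain G where G: "open G" "N \<subseteq> G" "G - N \<in> lmeasurable" "emeasure lebesgue (G - N) < ennreal dl"
      using sets_lebesgue_outer_open[of N dl] N dl negligible_imp_sets by blast
    have emG: "emeasure lebesgue G < ennreal dl"
    proof -
      have "emeasure lebesgue G \<le> emeasure lebesgue ((G - N) \<union> N)"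
        using G N by (intro emeasure_mono) (auto simp: negligible_imp_sets fmeasurableD)
      also have "\<dots> \<le> emeasure lebesgue (G - N) + emeasure lebesgue N"
        using G N by (intro emeasure_subadditive) (auto simp: negligible_imp_sets fmeasurableD)
      also have "emeasure lebesgue N = 0" using N by (simp add: negligible_iff_null_sets null_setsD1 del: emeasure_completion)
      finally show ?thesis using G(4) by simp
    qed
    have "\<exists>r>0. ball t r \<subseteq> G" if "t \<in> N" for t using G that open_contains_ball by blast
    then obtain r where r: "\<And>t. t \<in> N \<Longrightarrow> r t > 0" "\<And>t. t \<in> N \<Longrightarrow> ball t (r t) \<subseteq> G" by metis
    define \<gamma> where "\<gamma> t = (if t \<in> N then ball t (r t) else if t \<in> {a..b} then ball t (d t) else ball t 1)" for t
    have \<gamma>: "gauge \<gamma>" unfolding gauge_def \<gamma>_def using r d by auto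
    show "\<exists>\<gamma>. gauge \<gamma> \<and> (\<forall>\<D>. \<D> tagged_division_of {a..b} \<and> \<gamma> fine \<D> \<longrightarrow>
        norm (sum (\<lambda>(x,k). Henstock_Kurzweil_Integration.content k *\<^sub>R g' x) \<D> - (f b - f a)) < e)"
    proof (intro exI[of _ \<gamma>] conjI \<gamma> allI impI, elim conjE)
      fix p assume p: "p tagged_division_of {a..b}" and fine: "\<gamma> fine p"
      have fin: "finite p" using p by blast
      have K: "\<exists>u v. k = {u..v} \<and> u \<le> v \<and> u \<in> {a..b} \<and> v \<in> {a..b} \<and> x \<in> {u..v} \<and> {u..v} \<subseteq> \<gamma> x" if xk: "(x, k) \<in> p" for x k
      proof -
        obtain u v where uv: "k = cbox u v" using tagged_division_ofD(4)[OF p xk] by blast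
        have "x \<in> k" "k \<subseteq> {a..b}" using tagged_division_ofD(2,3)[OF p that] by auto
        moreover have "k \<subseteq> \<gamma> x" using fine that unfolding fine_def by blast
        ultimately show ?thesis using uv by (intro exI[of _ u] exI[of _ v]) auto
      qed
      \<comment> \<open>The increments telescope to f b - f a. The Riemann sum is compared with them
        separately for tags inside N, where g' is 0, and for tags outside N, where f is
        differentiable.\<close>
      define F where "F k = f (Sup k) - f (Inf k)" for k :: "real set"
      have tele: "(\<Sum>(x,k)\<in>p. F k) = f b - f a"
        unfolding F_def using additive_tagged_division_1[OF ab p, of f] by simp
      define p1 where "p1 = {q \<in> p. fst q \<in> N}"
      define p2 where "p2 = {q \<in> p. fst q \<notin> N}"
      have pp: "p = p1 \<union> p2" "p1 \<inter> p2 = {}" "finite p1" "finite p2" using fin by (auto simp: p1_def p2_def)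
      have s1: "norm (\<Sum>(x,k)\<in>p1. Henstock_Kurzweil_Integration.content k *\<^sub>R g' x - F k) < e / 2"
      proof -
        obtain h where h: "bij_betw h {..<card p1} p1"
          using ex_bij_betw_nat_finite[OF pp(3)] by (auto simp: atLeast0LessThan)
        define m where "m = card p1"
        define u where "u i = Inf (snd (h i))" for i
        define v where "v i = Sup (snd (h i))" for i
        have hp: "h i \<in> p1" if "i < m" for i using h that by (auto simp: bij_betw_def m_def)
        have uv: "snd (h i) = {u i..v i} \<and> u i \<le> v i \<and> u i \<in> {a..b} \<and> v i \<in> {a..b} \<and> {u i..v i} \<subseteq> G" if im: "i < m" for i
        proof -
          have "(fst (h i), snd (h i)) \<in> p" "fst (h i) \<in> N" using hp[OF im] by (auto simp: p1_def)
          then obtain c d where "snd (h i) = {c..d}" "c \<le> d" "c \<in> {a..b}" "d \<in> {a..b}" "{c..d} \<subseteq> \<gamma> (fst (h i))"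
            using K by metis
          moreover have "\<gamma> (fst (h i)) \<subseteq> G" using \<open>fst (h i) \<in> N\<close> r by (auto simp: \<gamma>_def)
          ultimately show ?thesis by (auto simp: u_def v_def)
        qed
        have dis: "{u i<..<v i} \<inter> {u j<..<v j} = {}" if "i < m" "j < m" "i \<noteq> j" for i j
        proof -
          have "h i \<noteq> h j" using h that by (auto simp: bij_betw_def m_def inj_on_def)
          then have "interior (snd (h i)) \<inter> interior (snd (h j)) = {}"
            using tagged_division_ofD(5)[OF p, of "fst (h i)" "snd (h i)" "fst (h j)" "snd (h j)"] hp that
            by (auto simp: p1_def prod_eq_iff)
          then show ?thesis using uv that by simp
        qed
        have "ennreal (\<Sum>i<m. v i - u i) = (\<Sum>i<m. emeasure lebesgue {u i<..<v i})"
          using uv by (subst sum_ennreal[symmetric]) (auto intro!: sum.cong)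
        also have "\<dots> = emeasure lebesgue (\<Union>i<m. {u i<..<v i})"
          using dis by (intro sum_emeasure) (auto simp: disjoint_family_on_def)
        also have "\<dots> \<le> emeasure lebesgue G"
          using uv G(1) by (intro emeasure_mono) force+
        also have "\<dots> < ennreal dl" by (rule emG)
        finally have "(\<Sum>i<m. v i - u i) < dl" using uv by (subst (asm) ennreal_less_iff) (auto intro!: sum_nonneg)
        then have "(\<Sum>i<m. norm (f (v i) - f (u i))) < e / 2"
          using uv dis by (intro DL) (simp add: disjoint_intervals_def)
        moreover have "(\<Sum>(x,k)\<in>p1. norm (F k)) = (\<Sum>i<m. norm (f (v i) - f (u i)))"
          unfolding m_def by (subst sum.reindex_bij_betw[OF h, symmetric])
            (auto intro!: sum.cong simp: F_def u_def v_def split: prod.split)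
        moreover have "norm (\<Sum>(x,k)\<in>p1. Henstock_Kurzweil_Integration.content k *\<^sub>R g' x - F k) \<le> (\<Sum>(x,k)\<in>p1. norm (F k))"
          by (rule order.trans[OF norm_sum]) (auto intro!: sum_mono simp: p1_def g'_def)
        ultimately show ?thesis by linarith
      qed
      have s2: "norm (\<Sum>(x,k)\<in>p2. Henstock_Kurzweil_Integration.content k *\<^sub>R g' x - F k) \<le> e1 * (b - a)"
      proof -
        \<comment> \<open>Straddle estimate: the tag lies between the end points u and v, so the two
          differentiation errors add up to e1 times the length of the interval.\<close>
        have "norm (Henstock_Kurzweil_Integration.content k *\<^sub>R g' x - F k) \<le> e1 * Henstock_Kurzweil_Integration.content k" if "(x, k) \<in> p2" for x k
        proof -
          have xk: "(x, k) \<in> p" "x \<notin> N" using that by (auto simp: p2_def)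
          obtain u v where uv: "k = {u..v}" "u \<le> v" "u \<in> {a..b}" "v \<in> {a..b}" "x \<in> {u..v}" "{u..v} \<subseteq> \<gamma> x"
            using K[OF xk(1)] by blast
          have xab: "x \<in> {a..b}" using uv by auto
          have "{u..v} \<subseteq> ball x (d x)" using uv(6) xk xab by (auto simp: \<gamma>_def)
          then have "\<bar>u - x\<bar> < d x" "\<bar>v - x\<bar> < d x" using uv(2)
            by (auto simp: subset_iff dist_real_def abs_minus_commute)
          then have "norm (f u - f x - (u - x) *\<^sub>R g x) \<le> e1 * \<bar>u - x\<bar>"
            "norm (f v - f x - (v - x) *\<^sub>R g x) \<le> e1 * \<bar>v - x\<bar>"
            using dD[of x u] dD[of x v] xab xk uv by auto
          moreover have eq: "Henstock_Kurzweil_Integration.content k *\<^sub>R g' x - F k = (f u - f x - (u - x) *\<^sub>R g x) - (f v - f x - (v - x) *\<^sub>R g x)"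
            using uv xk by (simp add: F_def g'_def algebra_simps)
          ultimately have "norm (Henstock_Kurzweil_Integration.content k *\<^sub>R g' x - F k) \<le> e1 * \<bar>u - x\<bar> + e1 * \<bar>v - x\<bar>"
            using norm_triangle_ineq4[of "f u - f x - (u - x) *\<^sub>R g x" "f v - f x - (v - x) *\<^sub>R g x"]
            unfolding eq by linarith
          also have "\<dots> = e1 * Henstock_Kurzweil_Integration.content k" using uv by (simp add: algebra_simps)
          finally show ?thesis .
        qed
        then have "norm (\<Sum>(x,k)\<in>p2. Henstock_Kurzweil_Integration.content k *\<^sub>R g' x - F k) \<le> (\<Sum>(x,k)\<in>p2. e1 * Henstock_Kurzweil_Integration.content k)"
          by (intro order.trans[OF norm_sum] sum_mono) auto
        also have "\<dots> \<le> (\<Sum>(x,k)\<in>p. e1 * Henstock_Kurzweil_Integration.content k)"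
          using e1 fin by (intro sum_mono2) (auto simp: p2_def)
        also have "\<dots> = e1 * (\<Sum>(x,k)\<in>p. Henstock_Kurzweil_Integration.content k)" by (simp add: sum_distrib_left case_prod_beta)
        also have "(\<Sum>(x,k)\<in>p. Henstock_Kurzweil_Integration.content k) = b - a"
          using additive_content_tagged_division[of p a b] p ab by simp
        finally show ?thesis .
      qed
      have "(\<Sum>(x,k)\<in>p. Henstock_Kurzweil_Integration.content k *\<^sub>R g' x) - (f b - f a) = (\<Sum>(x,k)\<in>p. Henstock_Kurzweil_Integration.content k *\<^sub>R g' x - F k)"
        unfolding tele[symmetric] by (simp add: sum_subtractf case_prod_beta)
      also have "\<dots> = (\<Sum>(x,k)\<in>p1. Henstock_Kurzweil_Integration.content k *\<^sub>R g' x - F k) + (\<Sum>(x,k)\<in>p2. Henstock_Kurzweil_Integration.content k *\<^sub>R g' x - F k)"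
        unfolding pp(1) by (rule sum.union_disjoint) (use pp in auto)
      finally have "norm ((\<Sum>(x,k)\<in>p. Henstock_Kurzweil_Integration.content k *\<^sub>R g' x) - (f b - f a)) < e / 2 + e1 * (b - a)"
        using s1 s2 norm_triangle_ineq[of "\<Sum>(x,k)\<in>p1. Henstock_Kurzweil_Integration.content k *\<^sub>R g' x - F k" "\<Sum>(x,k)\<in>p2. Henstock_Kurzweil_Integration.content k *\<^sub>R g' x - F k"]
        by simp
      moreover have "e1 * (b - a) \<le> e / 2"
        using e ab by (simp add: e1_def field_simps)
      ultimately show "norm (sum (\<lambda>(x,k). Henstock_Kurzweil_Integration.content k *\<^sub>R g' x) p - (f b - f a)) < e" by linarith
    qed
  qed
  then show ?thesis
    by (rule has_integral_spike[OF N, rotated]) (auto simp: g'_def)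
qed

section \<open>Indefinite integrals of square-integrable functions\<close>

text \<open>On a bounded interval the bound |f| \<le> |f|^2 + 1 suffices. A constant c is subtracted
  already here because the argument with Lebesgue points needs f - c for all c of a dense
  set.\<close>

lemma square_integrable_set_integrable:
  fixes f :: "real \<Rightarrow> 'h::{complex_hilbert, second_countable_topology}"
  assumes f: "square_integrable f"
  shows "set_integrable lebesgue {a..b} (\<lambda>t. f t - c)"
proof -
  have m [measurable]: "f \<in> borel_measurable lebesgue" using f by (simp add: square_integrable_def)
  show ?thesis
    unfolding set_integrable_def
  proof (rule Bochner_Integration.integrable_bound)
    show "integrable lebesgue (\<lambda>t. (norm (f t))\<^sup>2 + indicator {a..b} t *\<^sub>R (1 + norm c))"
      using f by (intro Bochner_Integration.integrable_add integrable_scaleR_left integrable_real_indicator)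
        (auto simp: square_integrable_def emeasure_lborel_Icc_eq)
    show "(\<lambda>t. indicator {a..b} t *\<^sub>R (f t - c)) \<in> borel_measurable lebesgue"
      by (intro borel_measurable_scaleR borel_measurable_indicator borel_measurable_diff borel_measurable_const m) auto
    have "norm (f t - c) \<le> (norm (f t))\<^sup>2 + (1 + norm c)" for t
    proof -
      have "2 * norm (f t) \<le> (norm (f t))\<^sup>2 + 1" using sum_squares_bound[of "norm (f t)" 1] by simp
      then have "norm (f t) \<le> (norm (f t))\<^sup>2 + 1" using norm_ge_zero[of "f t"] by linarith
      then show ?thesis using norm_triangle_ineq4[of "f t" c] by linarith
    qed
    then show "AE t in lebesgue. norm (indicator {a..b} t *\<^sub>R (f t - c)) \<le> norm ((norm (f t))\<^sup>2 + indicator {a..b} t *\<^sub>R (1 + norm c))"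
      by (intro AE_I2) (auto simp: indicator_def abs_of_nonneg add_nonneg_nonneg)
  qed
qed

definition indef_integral :: "(real \<Rightarrow> 'h::{complex_hilbert, second_countable_topology}) \<Rightarrow> real \<Rightarrow> 'h" where
  "indef_integral f t = (LINT s:{0..t}|lebesgue. f s)"

lemma indef_integral_diff:
  assumes f: "square_integrable f" and "0 \<le> u" "u \<le> v"
  shows "indef_integral f v - indef_integral f u = (LINT s:{u..v}|lebesgue. f s)"
proof -
  have i: "set_integrable lebesgue {a..b} f" for a b
    using square_integrable_set_integrable[OF f, of a b 0] by simp
  have "(LINT s:{0..v}|lebesgue. f s) = (LINT s:{0..u} \<union> {u<..v}|lebesgue. f s)"
    using assms by (simp add: ivl_disj_un_two_touch ivl_disj_un_two)
  also have "\<dots> = (LINT s:{0..u}|lebesgue. f s) + (LINT s:{u<..v}|lebesgue. f s)"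
    by (rule set_integral_Un) (use i[of 0 u] in \<open>auto intro!: set_integrable_subset[OF i[of u v]]\<close>)
  also have "(LINT s:{u<..v}|lebesgue. f s) = (LINT s:{u..v}|lebesgue. f s)"
    unfolding set_lebesgue_integral_def
  proof (rule integral_cong_AE)
    have m: "f \<in> borel_measurable lebesgue" using f by (simp add: square_integrable_def)
    show "(\<lambda>x. indicator {u<..v} x *\<^sub>R f x) \<in> borel_measurable lebesgue"
      "(\<lambda>x. indicator {u..v} x *\<^sub>R f x) \<in> borel_measurable lebesgue"
      by (intro borel_measurable_scaleR borel_measurable_indicator m; simp)+
    have "AE s in lebesgue. s \<noteq> u" by (rule AE_I[of _ _ "{u}"]) auto
    then show "AE x in lebesgue. indicator {u<..v} x *\<^sub>R f x = indicator {u..v} x *\<^sub>R f x"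
      by eventually_elim (auto simp: indicator_def)
  qed
  finally show ?thesis by (simp add: indef_integral_def)
qed

lemma indef_integral_zero [simp]: "indef_integral f 0 = 0"
proof -
  have "AE s in lebesgue. s \<noteq> (0::real)" by (rule AE_I[of _ _ "{0}"]) auto
  then have "AE s in lebesgue. indicator {0..0::real} s *\<^sub>R f s = 0"
    by eventually_elim (simp add: indicator_def)
  then show ?thesis
    unfolding indef_integral_def set_lebesgue_integral_def by (rule integral_eq_zero_AE)
qed

text \<open>Compares the increment of the integral with that of a linear function. The right-hand
  side is a gauge integral of a scalar function, the form in which averages are differentiated
  below.\<close>

lemma indef_integral_bound:
  assumes f: "square_integrable f" and uv: "0 \<le> u" "u \<le> v"
  shows "norm (indef_integral f v - indef_integral f u - (v - u) *\<^sub>R c) \<le> integral {u..v} (\<lambda>s. norm (f s - c))"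
proof -
  have i: "set_integrable lebesgue {u..v} (\<lambda>s. f s - c)" for c
    by (rule square_integrable_set_integrable[OF f])
  have ic: "set_integrable lebesgue {u..v} (\<lambda>s. c)"
    using square_integrable_set_integrable[OF square_integrable_zero, of u v "- c"] by simp
  have "(v - u) *\<^sub>R c = (LINT s:{u..v}|lebesgue. c)" using uv by (subst set_integral_const) auto
  then have "indef_integral f v - indef_integral f u - (v - u) *\<^sub>R c = (LINT s:{u..v}|lebesgue. f s - c)"
    using i[of 0] ic uv by (simp add: indef_integral_diff[OF f] set_integral_diff)
  also have "norm \<dots> \<le> (LINT s:{u..v}|lebesgue. norm (f s - c))" by (rule set_integral_norm_bound[OF i])
  also have "\<dots> = integral {u..v} (\<lambda>s. norm (f s - c))"
    by (rule set_lebesgue_integral_eq_integral) (rule set_integrable_norm[OF i])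
  finally show ?thesis .
qed

lemma norm_diff_integrable_on:
  fixes f :: "real \<Rightarrow> 'h::{complex_hilbert, second_countable_topology}"
  assumes f: "square_integrable f"
  shows "(\<lambda>s. norm (f s - c)) integrable_on {a..b}"
  by (rule set_lebesgue_integral_eq_integral(1)[OF set_integrable_norm[OF square_integrable_set_integrable[OF f]]])

text \<open>From 2 |f| \<le> K + |f|^2 / K, twice the sum of the increments is at most K times the
  total length plus Q / K. The constant K is chosen so that Q / K is at most e, and the total length
  is required to be below e / K.\<close>

lemma abs_continuous_indef_integral:
  assumes f: "square_integrable f" and S: "S \<subseteq> {0..}"
  shows "abs_continuous_on S (indef_integral f)"
proof (rule abs_continuous_onI)
  fix e :: real assume e: "e > 0"
  define Q where "Q = (\<integral>t. (norm (f t))\<^sup>2 \<partial>lebesgue)"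
  have Q: "Q \<ge> 0" by (simp add: Q_def)
  define K where "K = (Q + 1) / e"
  have K: "K > 0" using e Q by (simp add: K_def add_nonneg_pos)
  have sq: "set_integrable lebesgue A (\<lambda>t. (norm (f t))\<^sup>2)" if "A \<in> sets lebesgue" for A
    unfolding set_integrable_def
    by (rule integrable_mult_indicator[OF that]) (use f in \<open>simp add: square_integrable_def\<close>)
  show "\<exists>d>0. \<forall>m u v. disjoint_intervals S d m u v \<longrightarrow>
      (\<Sum>i<m. norm (indef_integral f (v i) - indef_integral f (u i))) < e"
  proof (intro exI[of _ "e / K"] conjI allI impI)
    show "0 < e / K" using e K by simp
    fix m :: nat and u v :: "nat \<Rightarrow> real"
    assume *: "disjoint_intervals S (e / K) m u v"
    have trm: "2 * norm (indef_integral f (v i) - indef_integral f (u i))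
        \<le> K * (v i - u i) + (1 / K) * (LINT s:{u i<..<v i}|lebesgue. (norm (f s))\<^sup>2)" if i: "i < m" for i
    proof -
      have ui: "0 \<le> u i" "u i \<le> v i" using disjoint_intervals_mem[OF * i] S by auto
      have nn: "set_integrable lebesgue {u i..v i} (\<lambda>s. norm (f s))"
        using set_integrable_norm[OF square_integrable_set_integrable[OF f, of "u i" "v i" 0]] by simp
      have ci: "set_integrable lebesgue {u i..v i} (\<lambda>s. K)"
        unfolding set_integrable_def
        by (intro integrable_scaleR_left integrable_real_indicator) (auto simp: emeasure_lborel_Icc_eq)
      have rhs: "set_integrable lebesgue {u i..v i} (\<lambda>s. K + (1 / K) * (norm (f s))\<^sup>2)"
        by (intro set_integral_add(1) ci set_integrable_mult_right sq) auto
      have "2 * norm (indef_integral f (v i) - indef_integral f (u i)) \<le> 2 * (LINT s:{u i..v i}|lebesgue. norm (f s))"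
        unfolding indef_integral_diff[OF f ui]
        using set_integral_norm_bound[OF square_integrable_set_integrable[OF f, of "u i" "v i" 0]] by simp
      also have "\<dots> = (LINT s:{u i..v i}|lebesgue. 2 * norm (f s))" by simp
      also have "\<dots> \<le> (LINT s:{u i..v i}|lebesgue. K + (1 / K) * (norm (f s))\<^sup>2)"
      proof (rule set_integral_mono[OF set_integrable_mult_right rhs])
        fix s
        have "0 \<le> (1 / K) * (K - norm (f s))\<^sup>2" using K by simp
        also have "\<dots> = K + (1 / K) * (norm (f s))\<^sup>2 - 2 * norm (f s)" using K by (simp add: power2_eq_square field_simps)
        finally show "2 * norm (f s) \<le> K + (1 / K) * (norm (f s))\<^sup>2" by simp
      qed (use nn in simp)
      also have "\<dots> = K * (v i - u i) + (1 / K) * (LINT s:{u i..v i}|lebesgue. (norm (f s))\<^sup>2)"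
        using ui by (subst set_integral_add(2)[OF ci]) (auto intro!: set_integrable_mult_right sq simp: set_integral_const)
      \<comment> \<open>Only the open intervals are disjoint, and the integrals are about to be
        added up over their union.\<close>
      also have "(LINT s:{u i..v i}|lebesgue. (norm (f s))\<^sup>2) = (LINT s:{u i<..<v i}|lebesgue. (norm (f s))\<^sup>2)"
        unfolding set_lebesgue_integral_def
      proof (rule integral_cong_AE)
        have m: "(\<lambda>x. (norm (f x))\<^sup>2) \<in> borel_measurable lebesgue"
          using f by (simp add: square_integrable_def borel_measurable_integrable)
        show "(\<lambda>x. indicator {u i..v i} x *\<^sub>R (norm (f x))\<^sup>2) \<in> borel_measurable lebesgue"
          "(\<lambda>x. indicator {u i<..<v i} x *\<^sub>R (norm (f x))\<^sup>2) \<in> borel_measurable lebesgue"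
          by (intro borel_measurable_scaleR borel_measurable_indicator m; simp)+
        have "AE s in lebesgue. s \<notin> {u i, v i}" by (rule AE_I[of _ _ "{u i, v i}"]) (auto simp: emeasure_lborel_countable)
        then show "AE x in lebesgue. indicator {u i..v i} x *\<^sub>R (norm (f x))\<^sup>2 = indicator {u i<..<v i} x *\<^sub>R (norm (f x))\<^sup>2"
          by eventually_elim (auto simp: indicator_def)
      qed
      finally show ?thesis .
    qed
    have "2 * (\<Sum>i<m. norm (indef_integral f (v i) - indef_integral f (u i)))
        \<le> (\<Sum>i<m. K * (v i - u i) + (1 / K) * (LINT s:{u i<..<v i}|lebesgue. (norm (f s))\<^sup>2))"
      unfolding sum_distrib_left by (rule sum_mono) (use trm in auto)
    also have "\<dots> = K * (\<Sum>i<m. v i - u i) + (1 / K) * (\<Sum>i<m. LINT s:{u i<..<v i}|lebesgue. (norm (f s))\<^sup>2)"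
      by (simp only: sum.distrib sum_distrib_left)
    also have "(\<Sum>i<m. LINT s:{u i<..<v i}|lebesgue. (norm (f s))\<^sup>2) = (LINT s:(\<Union>i<m. {u i<..<v i})|lebesgue. (norm (f s))\<^sup>2)"
      by (rule set_integral_finite_Union[symmetric]) (use * in \<open>auto intro!: sq simp: disjoint_family_on_def disjoint_intervals_def\<close>)
    also have "\<dots> \<le> Q"
      unfolding Q_def set_lebesgue_integral_def using f sq[of "\<Union>i<m. {u i<..<v i}"]
      by (intro integral_mono) (auto simp: square_integrable_def set_integrable_def indicator_def)
    finally have "2 * (\<Sum>i<m. norm (indef_integral f (v i) - indef_integral f (u i))) \<le> K * (\<Sum>i<m. v i - u i) + (1 / K) * Q"
      using K by (simp add: divide_right_mono)
    moreover have "K * (\<Sum>i<m. v i - u i) < e" using * K by (simp add: field_simps disjoint_intervals_def)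
    moreover have "(1 / K) * Q \<le> e" using Q e by (simp add: K_def field_simps)
    ultimately show "(\<Sum>i<m. norm (indef_integral f (v i) - indef_integral f (u i))) < e" by linarith
  qed
qed

text \<open>Lebesgue differentiation supplies the averages to the right of a point. Those to the
  left are the right-hand averages of the reflected function, whose exceptional set is the mirror
  image of a null set.\<close>

lemma AE_right_left_averages:
  fixes \<phi> :: "real \<Rightarrow> real"
  assumes \<phi>: "\<And>a b. \<phi> integrable_on {a..b}"
  shows "AE t in lebesgue. \<forall>e>0. \<exists>d>0. \<forall>h. 0 < h \<and> h < d \<longrightarrow>
      integral {t..t + h} \<phi> \<le> h * (\<phi> t + e) \<and> integral {t - h..t} \<phi> \<le> h * (\<phi> t + e)"
proof -
  have one: "\<exists>N. negligible N \<and> (\<forall>x e. x \<notin> N \<longrightarrow> 0 < e \<longrightarrow>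
      (\<exists>d>0. \<forall>h. 0 < h \<and> h < d \<longrightarrow> integral {x..x + h} \<psi> \<le> h * (\<psi> x + e)))"
    if \<psi>: "\<And>a b. \<psi> integrable_on {a..b}" for \<psi> :: "real \<Rightarrow> real"
  proof -
    obtain N where N: "negligible N" and ND: "\<And>x e. x \<notin> N \<Longrightarrow> 0 < e \<Longrightarrow>
        \<exists>d>0. \<forall>h. 0 < h \<and> h < d \<longrightarrow> norm (integral (cbox x (x + h *\<^sub>R One)) \<psi> /\<^sub>R h ^ DIM(real) - \<psi> x) < e"
      using integrable_ccontinuous_explicit[of \<psi>] \<psi> by (metis interval_cbox)
    have "\<exists>d>0. \<forall>h. 0 < h \<and> h < d \<longrightarrow> integral {x..x + h} \<psi> \<le> h * (\<psi> x + e)" if xN: "x \<notin> N" "0 < e" for x e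
    proof -
      obtain d where d: "d > 0" "\<And>h. 0 < h \<Longrightarrow> h < d \<Longrightarrow> \<bar>integral {x..x + h} \<psi> / h - \<psi> x\<bar> < e"
        using ND[OF xN] by (auto simp: divide_inverse mult.commute)
      have "integral {x..x + h} \<psi> \<le> h * (\<psi> x + e)" if "0 < h" "h < d" for h
      proof -
        have "integral {x..x + h} \<psi> / h \<le> \<psi> x + e" using d(2)[OF that] by linarith
        then show ?thesis using that by (simp add: pos_divide_le_eq mult.commute)
      qed
      with d(1) show ?thesis by blast
    qed
    with N show ?thesis by blast
  qed
  obtain N1 where N1: "negligible N1" "\<And>x e. x \<notin> N1 \<Longrightarrow> 0 < e \<Longrightarrow>
      \<exists>d>0. \<forall>h. 0 < h \<and> h < d \<longrightarrow> integral {x..x + h} \<phi> \<le> h * (\<phi> x + e)"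
    using one[OF \<phi>] by blast
  have \<phi>m: "(\<lambda>x. \<phi> (- x)) integrable_on {a..b}" for a b
    using iffD2[OF Henstock_Kurzweil_Integration.integrable_reflect_real \<phi>[of "- b" "- a"]] by simp
  obtain N2 where N2: "negligible N2" "\<And>x e. x \<notin> N2 \<Longrightarrow> 0 < e \<Longrightarrow>
      \<exists>d>0. \<forall>h. 0 < h \<and> h < d \<longrightarrow> integral {x..x + h} (\<lambda>x. \<phi> (- x)) \<le> h * (\<phi> (- x) + e)"
    using one[OF \<phi>m] by blast
  have rf: "integral {- t..- t + h} (\<lambda>x. \<phi> (- x)) = integral {t - h..t} \<phi>" for t h
    using Henstock_Kurzweil_Integration.integral_reflect_real[where f = \<phi> and a = "t - h" and b = t] by simp
  have Nn: "negligible (uminus ` N2)"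
    by (rule negligible_differentiable_image_negligible[OF order_refl N2(1)])
      (intro linear_imp_differentiable_on linear_uminus)
  have "AE t in lebesgue. t \<notin> N1 \<union> uminus ` N2"
    using N1(1) Nn by (metis AE_not_in negligible_Un negligible_iff_null_sets)
  then show ?thesis
  proof eventually_elim
    fix t assume t: "t \<notin> N1 \<union> uminus ` N2"
    then have t2: "- t \<notin> N2" by (metis UnI2 image_eqI minus_minus)
    show "\<forall>e>0. \<exists>d>0. \<forall>h. 0 < h \<and> h < d \<longrightarrow>
      integral {t..t + h} \<phi> \<le> h * (\<phi> t + e) \<and> integral {t - h..t} \<phi> \<le> h * (\<phi> t + e)"
    proof (intro allI impI)
      fix e :: real assume "e > 0"
      obtain d1 where d1: "d1 > 0" "\<And>h. 0 < h \<Longrightarrow> h < d1 \<Longrightarrow> integral {t..t + h} \<phi> \<le> h * (\<phi> t + e)"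
        using N1(2)[of t e] t \<open>e > 0\<close> by blast
      obtain d2 where d2: "d2 > 0" "\<And>h. 0 < h \<Longrightarrow> h < d2 \<Longrightarrow> integral {t - h..t} \<phi> \<le> h * (\<phi> t + e)"
        using N2(2)[OF t2 \<open>e > 0\<close>] unfolding rf by auto
      show "\<exists>d>0. \<forall>h. 0 < h \<and> h < d \<longrightarrow>
          integral {t..t + h} \<phi> \<le> h * (\<phi> t + e) \<and> integral {t - h..t} \<phi> \<le> h * (\<phi> t + e)"
        using d1 d2 by (intro exI[of _ "min d1 d2"]) auto
    qed
  qed
qed

text \<open>Lebesgue points of a vector function: the scalar result is applied to |f - c| for all c
  of a countable dense set at once, which uses separability of H. At a good point t the value f t is
  approximated by such a c, and the constant functions c and f t are exchanged at the cost of two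
  small terms.\<close>

lemma indef_integral_has_vector_derivative_AE:
  fixes f :: "real \<Rightarrow> 'h::{complex_hilbert, second_countable_topology}"
  assumes f: "square_integrable f"
  shows "AE t in lebesgue. 0 < t \<longrightarrow> (indef_integral f has_vector_derivative f t) (at t)"
proof -
  obtain D :: "'h set" where D: "countable D" "\<And>X. open X \<Longrightarrow> X \<noteq> {} \<Longrightarrow> \<exists>d\<in>D. d \<in> X"
    using countable_dense_exists by blast
  have "AE t in lebesgue. \<forall>c\<in>D. \<forall>e>0. \<exists>d>0. \<forall>h. 0 < h \<and> h < d \<longrightarrow>
      integral {t..t + h} (\<lambda>s. norm (f s - c)) \<le> h * (norm (f t - c) + e) \<and>
      integral {t - h..t} (\<lambda>s. norm (f s - c)) \<le> h * (norm (f t - c) + e)"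
    unfolding AE_ball_countable[OF D(1)]
    by (intro ballI AE_right_left_averages norm_diff_integrable_on f)
  then show ?thesis
  proof eventually_elim
    fix t
    assume A: "\<forall>c\<in>D. \<forall>e>0. \<exists>d>0. \<forall>h. 0 < h \<and> h < d \<longrightarrow>
      integral {t..t + h} (\<lambda>s. norm (f s - c)) \<le> h * (norm (f t - c) + e) \<and>
      integral {t - h..t} (\<lambda>s. norm (f s - c)) \<le> h * (norm (f t - c) + e)"
    show "0 < t \<longrightarrow> (indef_integral f has_vector_derivative f t) (at t)"
      unfolding has_vector_derivative_def has_derivative_at_alt
    proof (intro impI conjI allI bounded_linear_scaleR_left)
      fix e :: real assume t: "0 < t" and e: "0 < e"
      obtain c where c: "c \<in> D" "norm (f t - c) < e / 3"
        using D(2)[of "ball (f t) (e / 3)"] e by (auto simp: dist_norm)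
      obtain d where d: "d > 0" "\<And>h. 0 < h \<Longrightarrow> h < d \<Longrightarrow>
          integral {t..t + h} (\<lambda>s. norm (f s - c)) \<le> h * (norm (f t - c) + e / 3) \<and>
          integral {t - h..t} (\<lambda>s. norm (f s - c)) \<le> h * (norm (f t - c) + e / 3)"
        using A[rule_format, OF c(1), of "e / 3"] e by auto
      have main: "norm (indef_integral f v - indef_integral f u - (v - u) *\<^sub>R f t) \<le> e * (v - u)"
        if "0 \<le> u" "u \<le> v" "integral {u..v} (\<lambda>s. norm (f s - c)) \<le> (v - u) * (norm (f t - c) + e / 3)" for u v
      proof -
        have "indef_integral f v - indef_integral f u - (v - u) *\<^sub>R f t
            = (indef_integral f v - indef_integral f u - (v - u) *\<^sub>R c) - (v - u) *\<^sub>R (f t - c)"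
          by (simp add: algebra_simps)
        also have "norm \<dots> \<le> (v - u) * (norm (f t - c) + e / 3) + (v - u) * norm (f t - c)"
          by (rule order.trans[OF norm_triangle_ineq4])
            (use indef_integral_bound[OF f that(1,2), of c] that in \<open>auto intro!: add_mono\<close>)
        also have "\<dots> = (v - u) * (2 * norm (f t - c) + e / 3)" by (simp add: algebra_simps)
        also have "\<dots> \<le> (v - u) * e" using that c by (intro mult_left_mono) auto
        finally show ?thesis by (simp add: mult.commute)
      qed
      show "\<exists>d>0. \<forall>y. norm (y - t) < d \<longrightarrow>
          norm (indef_integral f y - indef_integral f t - (y - t) *\<^sub>R f t) \<le> e * norm (y - t)"
      proof (intro exI[of _ "min d t"] conjI allI impI)
        show "0 < min d t" using d t by simp
        fix y assume y: "norm (y - t) < min d t"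
        consider "y = t" | "y > t" | "y < t" by linarith
        then show "norm (indef_integral f y - indef_integral f t - (y - t) *\<^sub>R f t) \<le> e * norm (y - t)"
        proof cases
          case 2
          then show ?thesis using main[of t y] d(2)[of "y - t"] y t by auto
        next
          case 3
          have eq: "indef_integral f y - indef_integral f t - (y - t) *\<^sub>R f t
              = - (indef_integral f t - indef_integral f y - (t - y) *\<^sub>R f t)" by (simp add: algebra_simps)
          have "norm (indef_integral f t - indef_integral f y - (t - y) *\<^sub>R f t) \<le> e * (t - y)"
            using main[of y t] d(2)[of "t - y"] y t 3 by simp
          then show ?thesis unfolding eq norm_minus_cancel using 3 by simp
        qed simp
      qed
    qed
  qed
qed

section \<open>Linear evolution equations\<close>

text \<open>Reduces local statements at t to a compact interval. If S has a point beyond t, that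
  point serves as \<beta>; otherwise S ends at t and equals {0..t}.\<close>

lemma at_within_half_interval:
  fixes t :: real
  assumes S: "\<forall>t\<in>S. {0..t} \<subseteq> S" "S \<subseteq> {0..}" and t: "t \<in> S"
  obtains \<beta> where "\<beta> \<in> S" "t \<le> \<beta>" "at t within S = at t within {0..\<beta>}"
proof (cases "\<exists>\<beta>\<in>S. t < \<beta>")
  case True
  then obtain \<beta> where b: "\<beta> \<in> S" "t < \<beta>" by blast
  have "at t within S = at t within {0..\<beta>}"
    by (rule at_within_nhd[of t "{..<\<beta>}"]) (use b S in auto)
  with b show ?thesis by (intro that[of \<beta>]) auto
next
  case False
  then have "S \<subseteq> {0..t}" "{0..t} \<subseteq> S" using S t by (auto simp: not_less)
  then have "S = {0..t}" by blast
  with t show ?thesis by (intro that[of t]) auto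
qed

text \<open>Picard iteration on all of S at once. The Lipschitz constant depends on \<beta>, but the
  factorials in the estimates of successive differences give uniform convergence on each
  {0..\<beta>}, so local solutions need not be continued.\<close>

lemma evolution_equation_solution:
  fixes F :: "real \<Rightarrow> 's::banach \<Rightarrow> 's" and \<xi> :: 's
  assumes S: "\<forall>t\<in>S. {0..t} \<subseteq> S" "S \<subseteq> {0..}"
    and cont: "\<And>x. continuous_on S x \<Longrightarrow> continuous_on S (\<lambda>t. F t (x t))"
    and lip: "\<And>\<beta>. \<beta> \<in> S \<Longrightarrow> \<exists>K. \<forall>t\<in>{0..\<beta>}. \<forall>x y. norm (F t x - F t y) \<le> K * norm (x - y)"
  shows "\<exists>x. x 0 = \<xi> \<and> (\<forall>t\<in>S. (x has_vector_derivative F t (x t)) (at t within S))"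
proof -
  have sub: "{0..\<beta>} \<subseteq> S" if "\<beta> \<in> S" for \<beta> using S(1) that by blast
  have cI: "continuous_on S (\<lambda>t. integral {0..t} f)" if f: "continuous_on S f" for f :: "real \<Rightarrow> 's"
    unfolding continuous_on_eq_continuous_within
  proof
    fix t assume t: "t \<in> S"
    obtain \<beta> where b: "\<beta> \<in> S" "t \<le> \<beta>" "at t within S = at t within {0..\<beta>}"
      using at_within_half_interval[OF S t] by metis
    have "continuous_on {0..\<beta>} (\<lambda>t. integral {0..t} f)"
      by (intro indefinite_integral_continuous_1 integrable_continuous_real continuous_on_subset[OF f sub[OF b(1)]])
    then show "continuous (at t within S) (\<lambda>t. integral {0..t} f)"
      unfolding b(3) using b(2) t S(2) by (auto simp: continuous_on_eq_continuous_within)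
  qed
  define X where "X k = ((\<lambda>x t. \<xi> + integral {0..t} (\<lambda>s. F s (x s))) ^^ k) (\<lambda>_. \<xi>)" for k
  have X0: "X 0 = (\<lambda>_. \<xi>)" and XS: "X (Suc k) = (\<lambda>t. \<xi> + integral {0..t} (\<lambda>s. F s (X k s)))" for k
    by (auto simp: X_def)
  have Xc: "continuous_on S (X k)" for k
    by (induction k) (auto simp: X0 XS intro!: continuous_intros cI cont)
  define x where "x t = \<xi> + (\<Sum>i. X (Suc i) t - X i t)" for t
  have unif: "uniform_limit {0..\<beta>} X x sequentially" if b: "\<beta> \<in> S" for \<beta>
  proof -
    have b0: "0 \<le> \<beta>" using b S(2) by auto
    obtain K0 where K0: "\<And>t x y. t \<in> {0..\<beta>} \<Longrightarrow> norm (F t x - F t y) \<le> K0 * norm (x - y)"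
      using lip[OF b] by blast
    define K where "K = \<bar>K0\<bar>"
    have K: "norm (F t x - F t y) \<le> K * norm (x - y)" if "t \<in> {0..\<beta>}" for t x y
      using K0[OF that, of x y] by (smt (verit) K_def mult_right_mono norm_ge_zero)
    have Kn: "K \<ge> 0" by (simp add: K_def)
    have "continuous_on {0..\<beta>} (\<lambda>t. X 1 t - X 0 t)"
      by (intro continuous_intros continuous_on_subset[OF Xc sub[OF b]])
    then obtain M where M: "\<And>t. t \<in> {0..\<beta>} \<Longrightarrow> norm (X 1 t - X 0 t) \<le> M"
      by (rule continuous_on_Icc_bounded) blast
    have est: "norm (X (Suc k) t - X k t) \<le> M * (K ^ k * t ^ k / fact k)" if "t \<in> {0..\<beta>}" for k t
      using that
    proof (induction k arbitrary: t)
      case 0 then show ?case using M by simp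
    next
      case (Suc k)
      have ts: "{0..t} \<subseteq> {0..\<beta>}" using Suc.prems by auto
      have c: "continuous_on {0..t} (\<lambda>s. F s (X j s))" for j
        by (intro continuous_on_subset[OF cont[OF Xc]] order.trans[OF ts sub[OF b]])
      have hp: "((\<lambda>s. M * (K * (K ^ k * s ^ k / fact k))) has_integral (M * (K * (K ^ k * (t ^ Suc k / Suc k) / fact k)))) {0..t}"
      proof -
        have "((\<lambda>s. s ^ k) has_integral (t ^ Suc k / Suc k - 0 ^ Suc k / Suc k)) {0..t}"
          using Suc.prems
          by (intro fundamental_theorem_of_calculus)
            (auto intro!: derivative_eq_intros simp flip: has_real_derivative_iff_has_vector_derivative, cases k, auto simp: field_simps)
        then have "((\<lambda>s. M * (K * (K ^ k / fact k)) * s ^ k) has_integral (M * (K * (K ^ k / fact k)) * (t ^ Suc k / Suc k))) {0..t}"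
          by (intro has_integral_mult_right) simp
        then show ?thesis by (simp add: mult_ac)
      qed
      have "X (Suc (Suc k)) t - X (Suc k) t = integral {0..t} (\<lambda>s. F s (X (Suc k) s) - F s (X k s))"
        using fun_cong[OF XS[of "Suc k"], of t] fun_cong[OF XS[of k], of t]
          Henstock_Kurzweil_Integration.integral_diff[OF integrable_continuous_real[OF c[of "Suc k"]] integrable_continuous_real[OF c[of k]]]
        by simp
      also have "norm \<dots> \<le> integral {0..t} (\<lambda>s. M * (K * (K ^ k * s ^ k / fact k)))"
      proof (rule integral_norm_bound_integral)
        show "(\<lambda>s. F s (X (Suc k) s) - F s (X k s)) integrable_on {0..t}"
          by (intro integrable_continuous_real continuous_intros c)
        show "(\<lambda>s. M * (K * (K ^ k * s ^ k / fact k))) integrable_on {0..t}" using hp by blast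
        fix s assume s: "s \<in> {0..t}"
        have "norm (F s (X (Suc k) s) - F s (X k s)) \<le> K * norm (X (Suc k) s - X k s)" using K s ts by blast
        also have "\<dots> \<le> K * (M * (K ^ k * s ^ k / fact k))" using Suc.IH[of s] s ts Kn by (intro mult_left_mono) auto
        finally show "norm (F s (X (Suc k) s) - F s (X k s)) \<le> M * (K * (K ^ k * s ^ k / fact k))" by (simp add: mult_ac)
      qed
      also have "\<dots> = M * (K ^ Suc k * t ^ Suc k / fact (Suc k))"
        unfolding integral_unique[OF hp] by (simp add: mult_ac)
      finally show ?case .
    qed
    have "M \<ge> 0" using M[of 0] b0 by (smt (verit) atLeastAtMost_iff norm_ge_zero)
    have "uniform_limit {0..\<beta>} (\<lambda>n t. \<Sum>i<n. X (Suc i) t - X i t) (\<lambda>t. \<Sum>i. X (Suc i) t - X i t) sequentially"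
    proof (rule Weierstrass_m_test)
      show "norm (X (Suc n) t - X n t) \<le> M * ((K * \<beta>) ^ n / fact n)" if "t \<in> {0..\<beta>}" for n t
        using est[OF that, of n] that Kn \<open>M \<ge> 0\<close>
        by (elim order.trans) (auto intro!: mult_left_mono divide_right_mono power_mono simp: power_mult_distrib)
      show "summable (\<lambda>n. M * ((K * \<beta>) ^ n / fact n))"
        using summable_exp_generic[of "K * \<beta>"] by (intro summable_mult) (simp add: divide_inverse mult.commute)
    qed
    then have "uniform_limit {0..\<beta>} (\<lambda>n t. \<xi> + (\<Sum>i<n. X (Suc i) t - X i t)) x sequentially"
      unfolding x_def by (intro uniform_limit_intros)
    moreover have "\<xi> + (\<Sum>i<n. X (Suc i) t - X i t) = X n t" for n t
      by (simp add: sum_lessThan_telescope[of "\<lambda>i. X i t"] X0)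
    ultimately show ?thesis by simp
  qed
  have xc: "continuous_on {0..\<beta>} x" if b: "\<beta> \<in> S" for \<beta>
    by (rule uniform_limit_theorem[OF _ unif[OF b]]) (auto intro!: always_eventually continuous_on_subset[OF Xc sub[OF b]])
  have xcS: "continuous_on S x"
    unfolding continuous_on_eq_continuous_within
  proof
    fix t assume t: "t \<in> S"
    obtain \<beta> where b: "\<beta> \<in> S" "t \<le> \<beta>" "at t within S = at t within {0..\<beta>}"
      using at_within_half_interval[OF S t] by metis
    show "continuous (at t within S) x"
      unfolding b(3) using xc[OF b(1)] b(2) t S(2) by (auto simp: continuous_on_eq_continuous_within)
  qed
  have eq: "x t = \<xi> + integral {0..t} (\<lambda>s. F s (x s))" if t: "t \<in> S" for t
  proof -
    have t0: "0 \<le> t" using t S(2) by auto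
    have c: "continuous_on {0..t} (\<lambda>s. F s (z s))" if "continuous_on S z" for z
      by (intro continuous_on_subset[OF cont[OF that]] sub[OF t])
    obtain K0 where K0: "\<And>s x y. s \<in> {0..t} \<Longrightarrow> norm (F s x - F s y) \<le> K0 * norm (x - y)"
      using lip[OF t] by blast
    define K where "K = \<bar>K0\<bar> + 1"
    have K: "norm (F s x - F s y) \<le> K * norm (x - y)" if "s \<in> {0..t}" for s x y
      using K0[OF that, of x y] by (smt (verit) K_def mult_right_mono norm_ge_zero)
    have Kp: "K > 0" by (simp add: K_def)
    \<comment> \<open>The Lipschitz bound holds uniformly on {0..t}, so uniform convergence of the
      iterates carries over to the integrands and the limit may be taken under the integral.\<close>
    have "uniform_limit {0..t} (\<lambda>n s. F s (X n s)) (\<lambda>s. F s (x s)) sequentially"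
      unfolding uniform_limit_iff
    proof (intro allI impI)
      fix e :: real assume e: "e > 0"
      have "\<forall>\<^sub>F n in sequentially. \<forall>s\<in>{0..t}. dist (X n s) (x s) < e / K"
        using unif[OF t] e Kp unfolding uniform_limit_iff by simp
      then show "\<forall>\<^sub>F n in sequentially. \<forall>s\<in>{0..t}. dist (F s (X n s)) (F s (x s)) < e"
      proof eventually_elim
        fix n assume A: "\<forall>s\<in>{0..t}. dist (X n s) (x s) < e / K"
        show "\<forall>s\<in>{0..t}. dist (F s (X n s)) (F s (x s)) < e"
        proof
          fix s assume s: "s \<in> {0..t}"
          have "K * norm (X n s - x s) < e" using A s Kp by (simp add: dist_norm field_simps)
          with K[OF s, of "X n s" "x s"] show "dist (F s (X n s)) (F s (x s)) < e" by (simp add: dist_norm)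
        qed
      qed
    qed
    then obtain I J where IJ: "\<And>n. ((\<lambda>s. F s (X n s)) has_integral I n) {0..t}"
      "((\<lambda>s. F s (x s)) has_integral J) {0..t}" "I \<longlonglongrightarrow> J"
      by (rule uniform_limit_integral[OF _ c[OF Xc] sequentially_bot]) metis
    from IJ(3) have lim: "(\<lambda>n. integral {0..t} (\<lambda>s. F s (X n s))) \<longlonglongrightarrow> integral {0..t} (\<lambda>s. F s (x s))"
      unfolding integral_unique[OF IJ(1)] integral_unique[OF IJ(2)] by blast
    have "(\<lambda>n. X n t) \<longlonglongrightarrow> x t" using tendsto_uniform_limitI[OF unif[OF t]] t0 by auto
    then have "(\<lambda>n. X (Suc n) t) \<longlonglongrightarrow> x t" by (rule LIMSEQ_Suc)
    moreover have "(\<lambda>n. X (Suc n) t) \<longlonglongrightarrow> \<xi> + integral {0..t} (\<lambda>s. F s (x s))"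
      unfolding XS by (intro tendsto_intros lim)
    ultimately show ?thesis by (rule LIMSEQ_unique)
  qed
  show ?thesis
  proof (intro exI[of _ x] conjI ballI)
    show "x 0 = \<xi>"
    proof -
      have "X i 0 = \<xi>" for i by (cases i) (simp_all add: X0 fun_cong[OF XS, of _ 0])
      then show ?thesis by (simp add: x_def)
    qed
    fix t assume t: "t \<in> S"
    obtain \<beta> where b: "\<beta> \<in> S" "t \<le> \<beta>" "at t within S = at t within {0..\<beta>}"
      using at_within_half_interval[OF S t] by metis
    have tb: "t \<in> {0..\<beta>}" using t S(2) b by auto
    have "((\<lambda>t. \<xi> + integral {0..t} (\<lambda>s. F s (x s))) has_vector_derivative (0 + F t (x t))) (at t within {0..\<beta>})"
      by (intro has_vector_derivative_add has_vector_derivative_const integral_has_vector_derivative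
          continuous_on_subset[OF cont[OF xcS] sub[OF b(1)]] tb)
    then have D: "((\<lambda>t. \<xi> + integral {0..t} (\<lambda>s. F s (x s))) has_vector_derivative F t (x t)) (at t within {0..\<beta>})" by simp
    show "(x has_vector_derivative F t (x t)) (at t within S)"
      unfolding b(3) by (rule has_vector_derivative_transform[OF tb _ D]) (use eq sub[OF b(1)] in auto)
  qed
qed

section \<open>Iterated derivatives on the interval\<close>

text \<open>
  \<open>Ck_off N \<Delta> k f\<close>: \<open>f\<close> is of class $C^k$ and its \<open>k\<close>-th derivative is differentiable off the
  exceptional set \<open>N\<close>.  For \<open>N = \<Delta>\<close> this is \<open>Ck_on k \<Delta> f\<close>, so the calculus is developed once.
\<close>

primrec Ck_off :: "real set \<Rightarrow> real set \<Rightarrow> nat \<Rightarrow> (real \<Rightarrow> 'a::real_normed_vector) \<Rightarrow> bool" where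
  "Ck_off N \<Delta> 0 f \<longleftrightarrow> continuous_on \<Delta> f \<and> (\<forall>t\<in>\<Delta> - N. f differentiable (at t within \<Delta>))"
| "Ck_off N \<Delta> (Suc k) f \<longleftrightarrow> f differentiable_on \<Delta> \<and> Ck_off N \<Delta> k (deriv_on \<Delta> f)"

lemma Ck_on_eq_Ck_off: "Ck_on k \<Delta> f \<longleftrightarrow> Ck_off \<Delta> \<Delta> k f"
  by (induction k arbitrary: f) auto

lemma Ck_off_continuous_on: "Ck_off N \<Delta> k f \<Longrightarrow> continuous_on \<Delta> f"
  by (cases k) (auto intro: differentiable_imp_continuous_on)

lemma Ck_on_Suc_imp_Ck_off: "Ck_on (Suc k) \<Delta> f \<Longrightarrow> Ck_off N \<Delta> k f"
  by (induction k arbitrary: f)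
    (auto simp: differentiable_imp_continuous_on differentiable_on_def)

lemma Ck_off_Suc_lower: "Ck_off N \<Delta> (Suc k) f \<Longrightarrow> Ck_off N \<Delta> k f"
  by (induction k arbitrary: f)
    (auto simp: differentiable_imp_continuous_on differentiable_on_def)

lemma Ck_off_lower: "Ck_off N \<Delta> k f \<Longrightarrow> j \<le> k \<Longrightarrow> Ck_off N \<Delta> j f"
proof (induction k)
  case (Suc k)
  then show ?case using Ck_off_Suc_lower[of N \<Delta> k f] by (cases "j = Suc k") auto
qed simp

lemma Ck_on_lower: "Ck_on k \<Delta> f \<Longrightarrow> j \<le> k \<Longrightarrow> Ck_on j \<Delta> f"
  using Ck_off_lower unfolding Ck_on_eq_Ck_off by blast

lemma Ck_on_imp_Ck_off: "Ck_on k \<Delta> f \<Longrightarrow> j < k \<Longrightarrow> Ck_off N \<Delta> j f"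
  using Ck_on_lower[of k \<Delta> f "Suc j"] Ck_on_Suc_imp_Ck_off by (simp add: Suc_leI)

lemma Dpow_Suc: "Dpow \<Delta> (Suc k) f = deriv_on \<Delta> (Dpow \<Delta> k f)"
  by simp

lemma Dpow_Suc': "Dpow \<Delta> (Suc k) f = Dpow \<Delta> k (deriv_on \<Delta> f)"
  by (simp add: funpow_swap1)

lemma Dpow_add: "Dpow \<Delta> (j + k) f = Dpow \<Delta> j (Dpow \<Delta> k f)"
  by (simp add: funpow_add)

lemma Ck_off_Dpow: "Ck_off N \<Delta> (j + k) f \<Longrightarrow> Ck_off N \<Delta> k (Dpow \<Delta> j f)"
  by (induction j arbitrary: f) (auto simp: funpow_swap1)

lemma Ck_off_Dpow': "Ck_off N \<Delta> m f \<Longrightarrow> j + k \<le> m \<Longrightarrow> Ck_off N \<Delta> k (Dpow \<Delta> j f)"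
  by (rule Ck_off_Dpow) (rule Ck_off_lower)

lemma Ck_off_from_Dpow:
  "(\<And>i. i < j \<Longrightarrow> Dpow \<Delta> i f differentiable_on \<Delta>) \<Longrightarrow> Ck_off N \<Delta> k (Dpow \<Delta> j f) \<Longrightarrow> Ck_off N \<Delta> (j + k) f"
proof (induction j arbitrary: f)
  case (Suc j)
  have "Ck_off N \<Delta> (j + k) (deriv_on \<Delta> f)"
  proof (rule Suc.IH)
    show "Dpow \<Delta> i (deriv_on \<Delta> f) differentiable_on \<Delta>" if "i < j" for i
      using Suc.prems(1)[of "Suc i"] that by (simp add: funpow_swap1)
    show "Ck_off N \<Delta> k (Dpow \<Delta> j (deriv_on \<Delta> f))" using Suc.prems(2) by (simp add: funpow_swap1)
  qed
  then show ?case using Suc.prems(1)[of 0] by simp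
qed simp

text \<open>No point is isolated. Derivatives within \<Delta> are then unique, and
  \<open>deriv_on\<close> is the actual derivative wherever one exists.\<close>

locale perfect_interval =
  fixes \<Delta> :: "real set"
  assumes nontrivial: "t \<in> \<Delta> \<Longrightarrow> at t within \<Delta> \<noteq> bot"
begin

lemma deriv_on_eqI: "(f has_vector_derivative d) (at t within \<Delta>) \<Longrightarrow> t \<in> \<Delta> \<Longrightarrow> deriv_on \<Delta> f t = d"
  unfolding deriv_on_def by (rule vector_derivative_within[OF nontrivial])

lemma has_deriv_on:
  "f differentiable (at t within \<Delta>) \<Longrightarrow> (f has_vector_derivative deriv_on \<Delta> f t) (at t within \<Delta>)"
  unfolding deriv_on_def using vector_derivative_works by blast

lemma has_deriv_on':
  "f differentiable_on \<Delta> \<Longrightarrow> t \<in> \<Delta> \<Longrightarrow> (f has_vector_derivative deriv_on \<Delta> f t) (at t within \<Delta>)"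
  by (rule has_deriv_on) (simp add: differentiable_on_def)

lemma deriv_on_cong:
  assumes "\<And>s. s \<in> \<Delta> \<Longrightarrow> f s = g s" "t \<in> \<Delta>"
  shows "deriv_on \<Delta> f t = deriv_on \<Delta> g t"
proof -
  have "(f has_vector_derivative d) (at t within \<Delta>) \<longleftrightarrow> (g has_vector_derivative d) (at t within \<Delta>)" for d
    using has_vector_derivative_transform[of t \<Delta> f g d] has_vector_derivative_transform[of t \<Delta> g f d] assms by auto
  then show ?thesis unfolding deriv_on_def vector_derivative_def by simp
qed

lemma Dpow_cong:
  "(\<And>s. s \<in> \<Delta> \<Longrightarrow> f s = g s) \<Longrightarrow> t \<in> \<Delta> \<Longrightarrow> Dpow \<Delta> k f t = Dpow \<Delta> k g t"
proof (induction k arbitrary: t)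
  case (Suc k)
  then show ?case unfolding Dpow_Suc by (intro deriv_on_cong) auto
qed simp

lemma differentiable_cong:
  assumes "\<And>s. s \<in> \<Delta> \<Longrightarrow> f s = g s" "t \<in> \<Delta>" "f differentiable (at t within \<Delta>)"
  shows "g differentiable (at t within \<Delta>)"
  using has_vector_derivative_transform[of t \<Delta> g f] assms
  by (metis has_deriv_on differentiableI_vector)

lemma Ck_off_cong:
  "(\<And>s. s \<in> \<Delta> \<Longrightarrow> f s = g s) \<Longrightarrow> Ck_off N \<Delta> k f \<Longrightarrow> Ck_off N \<Delta> k g"
proof (induction k arbitrary: f g)
  case 0
  then show ?case using continuous_on_cong[of \<Delta> \<Delta> f g] differentiable_cong[of f g] by auto
next
  case (Suc k)
  have "Ck_off N \<Delta> k (deriv_on \<Delta> g)"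
    using Suc.IH[of "deriv_on \<Delta> f" "deriv_on \<Delta> g"] deriv_on_cong[of f g] Suc.prems by simp
  then show ?case using Suc.prems differentiable_cong[of f g] by (auto simp: differentiable_on_def)
qed

text \<open>The case distinction in j recurs below: derivatives of order less than k can be
  differentiated on all of \<Delta>, the one of order k only off N.\<close>

lemma Dpow_has_vector_derivative:
  assumes "Ck_off N \<Delta> k f" "t \<in> \<Delta>" "j < k \<or> j = k \<and> t \<notin> N"
  shows "(Dpow \<Delta> j f has_vector_derivative Dpow \<Delta> (Suc j) f t) (at t within \<Delta>)"
  unfolding Dpow_Suc
proof (rule has_deriv_on)
  have "Ck_off N \<Delta> (k - j) (Dpow \<Delta> j f)" using assms by (intro Ck_off_Dpow') auto
  then show "Dpow \<Delta> j f differentiable (at t within \<Delta>)"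
    using assms by (cases "k - j") (auto simp: differentiable_on_def)
qed

lemma Ck_off_SucI:
  assumes "\<And>t. t \<in> \<Delta> \<Longrightarrow> (f has_vector_derivative g t) (at t within \<Delta>)" "Ck_off N \<Delta> k g"
  shows "Ck_off N \<Delta> (Suc k) f"
  using assms(1) Ck_off_cong[of g "deriv_on \<Delta> f", OF _ assms(2)] deriv_on_eqI[OF assms(1)]
  by (auto simp: differentiable_on_def intro: differentiableI_vector)

lemma Ck_off_0I:
  assumes "continuous_on \<Delta> f" "\<And>t. t \<in> \<Delta> - N \<Longrightarrow> (f has_vector_derivative g t) (at t within \<Delta>)"
  shows "Ck_off N \<Delta> 0 f"
  using assms by (auto intro: differentiableI_vector)

section \<open>Smoothness and iterated derivatives of sums, linear images, products and
  inverses\<close>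

lemma Ck_off_add: "Ck_off N \<Delta> k f \<Longrightarrow> Ck_off N \<Delta> k g \<Longrightarrow> Ck_off N \<Delta> k (\<lambda>t. f t + g t)"
proof (induction k arbitrary: f g)
  case 0
  then show ?case by (auto intro!: continuous_intros derivative_intros)
next
  case (Suc k)
  show ?case
    by (rule Ck_off_SucI[where g = "\<lambda>t. deriv_on \<Delta> f t + deriv_on \<Delta> g t"])
      (use Suc in \<open>auto intro!: has_vector_derivative_add has_deriv_on'\<close>)
qed

lemma Ck_off_linear:
  assumes L: "bounded_linear L"
  shows "Ck_off N \<Delta> k f \<Longrightarrow> Ck_off N \<Delta> k (\<lambda>t. L (f t))"
proof (induction k arbitrary: f)
  case 0
  show ?case
  proof (rule Ck_off_0I)
    show "continuous_on \<Delta> (\<lambda>t. L (f t))" using 0 by (auto intro: bounded_linear.continuous_on[OF L])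
    show "((\<lambda>t. L (f t)) has_vector_derivative L (deriv_on \<Delta> f t)) (at t within \<Delta>)" if "t \<in> \<Delta> - N" for t
      using 0 that by (intro bounded_linear.has_vector_derivative[OF L] has_deriv_on) auto
  qed
next
  case (Suc k)
  show ?case
    by (rule Ck_off_SucI[where g = "\<lambda>t. L (deriv_on \<Delta> f t)"])
      (use Suc in \<open>auto intro!: bounded_linear.has_vector_derivative[OF L] has_deriv_on'\<close>)
qed

lemma Ck_off_bilinear:
  assumes B: "bounded_bilinear B"
  shows "Ck_off N \<Delta> k f \<Longrightarrow> Ck_off N \<Delta> k g \<Longrightarrow> Ck_off N \<Delta> k (\<lambda>t. B (f t) (g t))"
proof (induction k arbitrary: f g)
  case 0
  show ?case
  proof (rule Ck_off_0I)
    show "continuous_on \<Delta> (\<lambda>t. B (f t) (g t))"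
      using 0 by (auto intro: bounded_bilinear.continuous_on[OF B])
    show "((\<lambda>t. B (f t) (g t)) has_vector_derivative B (f t) (deriv_on \<Delta> g t) + B (deriv_on \<Delta> f t) (g t)) (at t within \<Delta>)"
      if "t \<in> \<Delta> - N" for t
      using 0 that by (intro bounded_bilinear.has_vector_derivative[OF B] has_deriv_on) auto
  qed
next
  case (Suc k)
  have f: "Ck_off N \<Delta> k f" and g: "Ck_off N \<Delta> k g" using Suc.prems Ck_off_Suc_lower by blast+
  show ?case
  proof (rule Ck_off_SucI)
    show "((\<lambda>t. B (f t) (g t)) has_vector_derivative B (f t) (deriv_on \<Delta> g t) + B (deriv_on \<Delta> f t) (g t)) (at t within \<Delta>)"
      if "t \<in> \<Delta>" for t
      using Suc.prems that by (intro bounded_bilinear.has_vector_derivative[OF B] has_deriv_on') auto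
    show "Ck_off N \<Delta> k (\<lambda>t. B (f t) (deriv_on \<Delta> g t) + B (deriv_on \<Delta> f t) (g t))"
      using Suc.IH Suc.prems f g by (intro Ck_off_add) auto
  qed
qed

lemma Ck_off_diff: "Ck_off N \<Delta> k f \<Longrightarrow> Ck_off N \<Delta> k g \<Longrightarrow> Ck_off N \<Delta> k (\<lambda>t. f t - g t)"
  using Ck_off_add[of N k f "\<lambda>t. - g t"] Ck_off_linear[OF bounded_linear_minus[OF bounded_linear_ident], of N k g]
  by simp

lemma Ck_off_minus: "Ck_off N \<Delta> k g \<Longrightarrow> Ck_off N \<Delta> k (\<lambda>t. - g t)"
  using Ck_off_linear[OF bounded_linear_minus[OF bounded_linear_ident], of N k g] by simp

lemma Ck_off_const: "Ck_off N \<Delta> k (\<lambda>t. c)"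
proof (induction k arbitrary: c)
  case (Suc k)
  show ?case by (rule Ck_off_SucI[where g = "\<lambda>_. 0"]) (auto intro: Suc)
qed simp

lemma Dpow_linear:
  assumes L: "bounded_linear L" and f: "Ck_off N \<Delta> k f"
    and t: "t \<in> \<Delta>" "j \<le> k \<or> j = Suc k \<and> t \<notin> N"
  shows "Dpow \<Delta> j (\<lambda>t. L (f t)) t = L (Dpow \<Delta> j f t)"
  using t
proof (induction j arbitrary: t)
  case (Suc j)
  have "deriv_on \<Delta> (Dpow \<Delta> j (\<lambda>t. L (f t))) t = deriv_on \<Delta> (\<lambda>t. L (Dpow \<Delta> j f t)) t"
    by (rule deriv_on_cong[OF Suc.IH]) (use Suc.prems in auto)
  also have "\<dots> = L (Dpow \<Delta> (Suc j) f t)"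
    by (intro deriv_on_eqI bounded_linear.has_vector_derivative[OF L] Dpow_has_vector_derivative[OF f])
      (use Suc.prems in auto)
  finally show ?case by simp
qed simp

lemma Dpow_plus:
  assumes f: "Ck_off N \<Delta> k f" and g: "Ck_off N \<Delta> k g"
    and t: "t \<in> \<Delta>" "j \<le> k \<or> j = Suc k \<and> t \<notin> N"
  shows "Dpow \<Delta> j (\<lambda>t. f t + g t) t = Dpow \<Delta> j f t + Dpow \<Delta> j g t"
  using t
proof (induction j arbitrary: t)
  case (Suc j)
  have "deriv_on \<Delta> (Dpow \<Delta> j (\<lambda>t. f t + g t)) t = deriv_on \<Delta> (\<lambda>t. Dpow \<Delta> j f t + Dpow \<Delta> j g t) t"
    by (rule deriv_on_cong[OF Suc.IH]) (use Suc.prems in auto)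
  also have "\<dots> = Dpow \<Delta> (Suc j) f t + Dpow \<Delta> (Suc j) g t"
    by (intro deriv_on_eqI has_vector_derivative_add Dpow_has_vector_derivative[OF f] Dpow_has_vector_derivative[OF g])
      (use Suc.prems in auto)
  finally show ?case by simp
qed simp

text \<open>Everything rests on R s - R t = - R s (A s - A t) R t. This identity yields in turn that
  R is bounded near t, that R is continuous at t, and the derivative.\<close>

lemma inverse_has_vector_derivative:
  fixes A R :: "real \<Rightarrow> 'h::real_normed_vector \<Rightarrow>\<^sub>L 'h"
  assumes inv: "\<And>t. t \<in> \<Delta> \<Longrightarrow> A t o\<^sub>L R t = id_blinfun" "\<And>t. t \<in> \<Delta> \<Longrightarrow> R t o\<^sub>L A t = id_blinfun"
    and A: "(A has_vector_derivative A') (at t within \<Delta>)" and t: "t \<in> \<Delta>"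
  shows "(R has_vector_derivative - (R t o\<^sub>L A' o\<^sub>L R t)) (at t within \<Delta>)"
proof -
  have res: "R s - R t = - (R s o\<^sub>L (A s - A t) o\<^sub>L R t)" if "s \<in> \<Delta>" for s
  proof (rule blinfun_eqI)
    fix x
    have 1: "R s (A s y) = y" for y using inv(2)[OF that] by (metis blinfun_apply_blinfun_compose blinfun_apply_id_blinfun)
    have 2: "A t (R t y) = y" for y using inv(1)[OF t] by (metis blinfun_apply_blinfun_compose blinfun_apply_id_blinfun)
    show "(R s - R t) x = (- (R s o\<^sub>L (A s - A t) o\<^sub>L R t)) x"
      by (simp add: blinfun.diff_left blinfun.diff_right blinfun.minus_left 1 2)
  qed
  have Ac: "(A \<longlongrightarrow> A t) (at t within \<Delta>)"
    using has_vector_derivative_continuous[OF A] by (simp add: continuous_within)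
  \<comment> \<open>Once |A s - A t| |R t| is below 1/2, the identity gives |R s - R t| \<le> |R s|
    / 2 and hence the factor 2.\<close>
  have bnd: "\<forall>\<^sub>F s in at t within \<Delta>. norm (R s) \<le> 2 * norm (R t)"
  proof -
    have "((\<lambda>s. norm (A s - A t) * norm (R t)) \<longlongrightarrow> norm (A t - A t) * norm (R t)) (at t within \<Delta>)"
      by (intro tendsto_intros Ac)
    then have "\<forall>\<^sub>F s in at t within \<Delta>. norm (A s - A t) * norm (R t) < 1 / 2"
      by (rule order_tendstoD) simp
    moreover have "\<forall>\<^sub>F s in at t within \<Delta>. s \<in> \<Delta>" by (simp add: eventually_at_filter)
    ultimately show ?thesis
    proof eventually_elim
      fix s assume s: "norm (A s - A t) * norm (R t) < 1 / 2" "s \<in> \<Delta>"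
      have "norm (R s o\<^sub>L (A s - A t) o\<^sub>L R t) \<le> norm (R s) * norm (A s - A t) * norm (R t)"
        by (rule order.trans[OF norm_blinfun_compose]) (intro mult_right_mono norm_blinfun_compose norm_ge_zero)
      also have "\<dots> \<le> norm (R s) * (1 / 2)"
        using s by (simp only: mult.assoc) (intro mult_left_mono, auto)
      finally have "norm (R s - R t) \<le> norm (R s) / 2" unfolding res[OF s(2)] by simp
      then show "norm (R s) \<le> 2 * norm (R t)" using norm_triangle_ineq2[of "R s" "R t"] by simp
    qed
  qed
  have ev: "\<forall>\<^sub>F s in at t within \<Delta>. s \<in> \<Delta>" by (simp add: eventually_at_filter)
  have Rc: "((\<lambda>s. norm (R s - R t)) \<longlongrightarrow> 0) (at t within \<Delta>)"
  proof (rule Lim_null_comparison)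
    show "\<forall>\<^sub>F s in at t within \<Delta>. norm (norm (R s - R t)) \<le> 2 * norm (R t) * norm (A s - A t) * norm (R t)"
      using bnd ev
    proof eventually_elim
      fix s assume s: "norm (R s) \<le> 2 * norm (R t)" "s \<in> \<Delta>"
      have "norm (R s o\<^sub>L (A s - A t) o\<^sub>L R t) \<le> norm (R s) * norm (A s - A t) * norm (R t)"
        by (rule order.trans[OF norm_blinfun_compose]) (intro mult_right_mono norm_blinfun_compose norm_ge_zero)
      also have "\<dots> \<le> 2 * norm (R t) * norm (A s - A t) * norm (R t)"
        using s by (intro mult_right_mono) auto
      finally show "norm (norm (R s - R t)) \<le> 2 * norm (R t) * norm (A s - A t) * norm (R t)"
        unfolding res[OF s(2)] by simp
    qed
    have "((\<lambda>s. 2 * norm (R t) * norm (A s - A t) * norm (R t)) \<longlongrightarrow> 2 * norm (R t) * norm (A t - A t) * norm (R t)) (at t within \<Delta>)"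
      by (intro tendsto_intros Ac)
    then show "((\<lambda>s. 2 * norm (R t) * norm (A s - A t) * norm (R t)) \<longlongrightarrow> 0) (at t within \<Delta>)" by simp
  qed
  show ?thesis
    unfolding has_vector_derivative_def has_derivative_iff_norm
  proof (intro conjI bounded_linear_scaleR_left)
    define Q where "Q s = norm (A s - A t - (s - t) *\<^sub>R A') / norm (s - t)" for s
    have Q: "(Q \<longlongrightarrow> 0) (at t within \<Delta>)"
      using A unfolding has_vector_derivative_def has_derivative_iff_norm Q_def by simp
    have lim: "((\<lambda>s. 2 * norm (R t) * Q s * norm (R t) + norm (R s - R t) * norm A' * norm (R t)) \<longlongrightarrow>
        2 * norm (R t) * 0 * norm (R t) + 0 * norm A' * norm (R t)) (at t within \<Delta>)"
      by (intro tendsto_intros Q Rc)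
    show "((\<lambda>s. norm (R s - R t - (s - t) *\<^sub>R (- (R t o\<^sub>L A' o\<^sub>L R t))) / norm (s - t)) \<longlongrightarrow> 0) (at t within \<Delta>)"
    proof (rule Lim_null_comparison)
      show "((\<lambda>s. 2 * norm (R t) * Q s * norm (R t) + norm (R s - R t) * norm A' * norm (R t)) \<longlongrightarrow> 0) (at t within \<Delta>)"
        using lim by simp
      have ne: "\<forall>\<^sub>F s in at t within \<Delta>. s \<noteq> t" by (simp add: eventually_at_filter)
      show "\<forall>\<^sub>F s in at t within \<Delta>. norm (norm (R s - R t - (s - t) *\<^sub>R (- (R t o\<^sub>L A' o\<^sub>L R t))) / norm (s - t))
          \<le> 2 * norm (R t) * Q s * norm (R t) + norm (R s - R t) * norm A' * norm (R t)"
        using bnd ev ne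
      proof eventually_elim
        fix s assume s: "norm (R s) \<le> 2 * norm (R t)" "s \<in> \<Delta>" "s \<noteq> t"
        let ?E = "A s - A t - (s - t) *\<^sub>R A'"
        \<comment> \<open>The error splits into the differentiation error of A between R s and R t,
          and the change of R in front of A'. The first is small by differentiability of A, the
          second by continuity of R.\<close>
        have "R s - R t - (s - t) *\<^sub>R (- (R t o\<^sub>L A' o\<^sub>L R t))
            = - (R s o\<^sub>L ?E o\<^sub>L R t) - (s - t) *\<^sub>R ((R s - R t) o\<^sub>L A' o\<^sub>L R t)"
        proof -
          have "- (R s o\<^sub>L D o\<^sub>L R t) - c *\<^sub>R (- (R t o\<^sub>L A' o\<^sub>L R t))
              = - (R s o\<^sub>L (D - c *\<^sub>R A') o\<^sub>L R t) - c *\<^sub>R ((R s - R t) o\<^sub>L A' o\<^sub>L R t)" for D c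
            by (rule blinfun_eqI) (simp add: blinfun.bilinear_simps scaleR_diff_right)
          then show ?thesis by (subst res[OF s(2)])
        qed
        also have "norm \<dots> \<le> norm (R s o\<^sub>L ?E o\<^sub>L R t) + \<bar>s - t\<bar> * norm ((R s - R t) o\<^sub>L A' o\<^sub>L R t)"
          by (rule order.trans[OF norm_triangle_ineq4]) simp
        also have "\<dots> \<le> 2 * norm (R t) * norm ?E * norm (R t) + \<bar>s - t\<bar> * (norm (R s - R t) * norm A' * norm (R t))"
        proof (intro add_mono mult_left_mono)
          have "norm (R s o\<^sub>L ?E o\<^sub>L R t) \<le> norm (R s) * norm ?E * norm (R t)"
            by (rule order.trans[OF norm_blinfun_compose]) (intro mult_right_mono norm_blinfun_compose norm_ge_zero)
          also have "\<dots> \<le> 2 * norm (R t) * norm ?E * norm (R t)" using s by (intro mult_right_mono) auto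
          finally show "norm (R s o\<^sub>L ?E o\<^sub>L R t) \<le> 2 * norm (R t) * norm ?E * norm (R t)" .
          show "norm ((R s - R t) o\<^sub>L A' o\<^sub>L R t) \<le> norm (R s - R t) * norm A' * norm (R t)"
            by (rule order.trans[OF norm_blinfun_compose]) (intro mult_right_mono norm_blinfun_compose norm_ge_zero)
        qed simp
        finally have "norm (R s - R t - (s - t) *\<^sub>R (- (R t o\<^sub>L A' o\<^sub>L R t))) / \<bar>s - t\<bar>
            \<le> (2 * norm (R t) * norm ?E * norm (R t) + \<bar>s - t\<bar> * (norm (R s - R t) * norm A' * norm (R t))) / \<bar>s - t\<bar>"
          by (rule divide_right_mono) simp
        also have "\<dots> = 2 * norm (R t) * Q s * norm (R t) + norm (R s - R t) * norm A' * norm (R t)"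
          using s(3) by (simp add: Q_def add_divide_distrib)
        finally show "norm (norm (R s - R t - (s - t) *\<^sub>R (- (R t o\<^sub>L A' o\<^sub>L R t))) / norm (s - t))
            \<le> 2 * norm (R t) * Q s * norm (R t) + norm (R s - R t) * norm A' * norm (R t)" by simp
      qed
    qed
  qed
qed

text \<open>The derivative - R A' R contains R itself, so smoothness of R is raised one order at a
  time. The statement starts at order 1 because continuity of R is already a consequence of
  differentiability of A.\<close>

lemma Ck_off_inverse:
  fixes A R :: "real \<Rightarrow> 'h::real_normed_vector \<Rightarrow>\<^sub>L 'h"
  assumes inv: "\<And>t. t \<in> \<Delta> \<Longrightarrow> A t o\<^sub>L R t = id_blinfun" "\<And>t. t \<in> \<Delta> \<Longrightarrow> R t o\<^sub>L A t = id_blinfun"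
  shows "Ck_off N \<Delta> (Suc k) A \<Longrightarrow> Ck_off N \<Delta> (Suc k) R"
proof (induction k)
  case 0
  have d: "(R has_vector_derivative - (R t o\<^sub>L deriv_on \<Delta> A t o\<^sub>L R t)) (at t within \<Delta>)" if "t \<in> \<Delta>" for t
    by (rule inverse_has_vector_derivative[OF inv has_deriv_on' that]) (use 0 that in auto)
  have "Ck_off N \<Delta> 0 R"
    using d by (auto simp: continuous_on_eq_continuous_within
        intro: has_vector_derivative_continuous differentiableI_vector)
  then show ?case
    using 0 by (intro Ck_off_SucI[OF d] Ck_off_minus Ck_off_bilinear[OF bounded_bilinear_blinfun_compose]) auto
next
  case (Suc k)
  have d: "(R has_vector_derivative - (R t o\<^sub>L deriv_on \<Delta> A t o\<^sub>L R t)) (at t within \<Delta>)" if "t \<in> \<Delta>" for t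
    by (rule inverse_has_vector_derivative[OF inv has_deriv_on' that]) (use Suc.prems that in auto)
  have R: "Ck_off N \<Delta> (Suc k) R" by (rule Suc.IH[OF Ck_off_Suc_lower[OF Suc.prems]])
  have A: "Ck_off N \<Delta> (Suc k) (deriv_on \<Delta> A)" using Suc.prems by simp
  show ?case
    by (rule Ck_off_SucI[OF d Ck_off_minus[OF Ck_off_bilinear[OF bounded_bilinear_blinfun_compose
            Ck_off_bilinear[OF bounded_bilinear_blinfun_compose R A] R]]])
qed

end

text \<open>What is used of the interval for a long while: an initial piece of the half line with
  more than one point. Finite and infinite b, with or without the right end point, are covered
  alike.\<close>

locale half_interval =
  fixes \<Delta> :: "real set"
  assumes initial: "\<forall>t\<in>\<Delta>. {0..t} \<subseteq> \<Delta>" and nonneg: "\<Delta> \<subseteq> {0..}" and nondegenerate: "\<exists>t\<in>\<Delta>. 0 < t"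
begin

lemma zero_mem: "0 \<in> \<Delta>"
  using initial nondegenerate by fastforce

sublocale perfect_interval
proof
  fix t assume t: "t \<in> \<Delta>"
  obtain b where b: "b \<in> \<Delta>" "0 < b" using nondegenerate by blast
  define c where "c = max b t"
  have c: "{0..c} \<subseteq> \<Delta>" "t \<in> {0..c}" "0 < c" using b t initial nonneg by (auto simp: c_def max_def)
  then have "at t within {0..c} \<noteq> bot" by (simp add: trivial_limit_within islimpt_Icc)
  then show "at t within \<Delta> \<noteq> bot" using at_le[OF c(1)] by (metis bot.extremum_uniqueI)
qed

lemma continuous_on_localI:
  assumes "\<And>c d. {c..d} \<subseteq> \<Delta> \<Longrightarrow> continuous_on {c..d} f"
  shows "continuous_on \<Delta> f"
  unfolding continuous_on_eq_continuous_within
proof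
  fix t assume t: "t \<in> \<Delta>"
  obtain \<beta> where b: "\<beta> \<in> \<Delta>" "t \<le> \<beta>" "at t within \<Delta> = at t within {0..\<beta>}"
    using at_within_half_interval[OF initial nonneg t] by metis
  have "continuous_on {0..\<beta>} f" using assms initial b by blast
  then show "continuous (at t within \<Delta>) f"
    unfolding b(3) using b(2) t nonneg by (auto simp: continuous_on_eq_continuous_within)
qed

lemma loc_abs_continuous_on_C1:
  assumes "Ck_on 1 \<Delta> f"
  shows "loc_abs_continuous_on \<Delta> f"
  unfolding loc_abs_continuous_on_def
proof (intro conjI allI impI AE_I2)
  have f: "f differentiable_on \<Delta>" "continuous_on \<Delta> (deriv_on \<Delta> f)" using assms by auto
  fix c d assume cd: "{c..d} \<subseteq> \<Delta>"
  show "abs_continuous_on {c..d} f"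
  proof (rule abs_continuous_on_C1[OF _ continuous_on_subset[OF f(2) cd]])
    show "(f has_vector_derivative deriv_on \<Delta> f t) (at t within {c..d})" if "t \<in> {c..d}" for t
      using has_vector_derivative_within_subset[OF has_deriv_on'[OF f(1)] cd] that cd by blast
  qed
next
  fix t assume "t \<in> \<Delta>"
  then show "f differentiable (at t within \<Delta>)" using assms by (auto simp: differentiable_on_def)
qed

end

section \<open>Quasi-derivatives\<close>

text \<open>Bilinearity carries the product rule; multiplicativity and the unit allow p_0 to be
  inverted on values. Vector functions and operator functions are thus treated by the same
  lemmas.\<close>

definition action :: "('h::complex_hilbert \<Rightarrow>\<^sub>L 'h \<Rightarrow> 'v::real_normed_vector \<Rightarrow> 'v) \<Rightarrow> bool" where
  "action act \<longleftrightarrow> bounded_bilinear act \<and> (\<forall>A B x. act (A o\<^sub>L B) x = act A (act B x)) \<and>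
     (\<forall>x. act id_blinfun x = x)"

lemma action_apply: "action blinfun_apply"
  by (simp add: action_def blinfun.bounded_bilinear_axioms)

lemma action_compose: "action (o\<^sub>L)"
  by (auto simp: action_def bounded_bilinear_blinfun_compose intro!: blinfun_eqI)

lemma complex_linear_scalar_op: "complex_linear (scalar_op c)"
  by (simp add: complex_linear_def scaleC_scaleC mult.commute)

locale quasi_coefficients = half_interval \<Delta> for \<Delta> +
  fixes n :: nat and p q :: "nat \<Rightarrow> real \<Rightarrow> 'h::complex_hilbert \<Rightarrow>\<^sub>L 'h"
  assumes n_pos: "0 < n" and coeffs: "coefficients n \<Delta> p q"
begin

lemma p_Ck: "k \<le> n \<Longrightarrow> Ck_on (n - k) \<Delta> (p k)"
  and p_linear: "k \<le> n \<Longrightarrow> t \<in> \<Delta> \<Longrightarrow> complex_linear (p k t)"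
  and p_adjoint: "k \<le> n \<Longrightarrow> t \<in> \<Delta> \<Longrightarrow> adjoint_op (p k t) = p k t"
  and q_Ck: "k < n \<Longrightarrow> Ck_on (n - k) \<Delta> (q k)"
  and q_linear: "k < n \<Longrightarrow> t \<in> \<Delta> \<Longrightarrow> complex_linear (q k t)"
  and p0_invertible: "t \<in> \<Delta> \<Longrightarrow> \<exists>R. complex_linear R \<and> p 0 t o\<^sub>L R = id_blinfun \<and> R o\<^sub>L p 0 t = id_blinfun"
  using coeffs unfolding coefficients_def by auto

lemma q_adjoint_linear: "k < n \<Longrightarrow> t \<in> \<Delta> \<Longrightarrow> complex_linear (adjoint_op (q k t))"
  by (rule complex_linear_adjoint_op[OF q_linear])

text \<open>On complex-linear operators the adjoint is the bounded linear map
  \<open>real_adjoint\<close>, and such maps preserve smoothness classes.\<close>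

lemma q_adjoint_Ck: "k < n \<Longrightarrow> Ck_on (n - k) \<Delta> (\<lambda>t. adjoint_op (q k t))"
  using Ck_off_linear[OF bounded_linear_real_adjoint, of \<Delta> "n - k" "q k"] q_Ck[of k]
    Ck_off_cong[of "\<lambda>t. real_adjoint (q k t)" "\<lambda>t. adjoint_op (q k t)" \<Delta> "n - k"]
  by (simp add: Ck_on_eq_Ck_off adjoint_op_eq_real_adjoint[OF q_linear])

definition p0inv :: "real \<Rightarrow> 'h \<Rightarrow>\<^sub>L 'h" where
  "p0inv t = (SOME R. complex_linear R \<and> p 0 t o\<^sub>L R = id_blinfun \<and> R o\<^sub>L p 0 t = id_blinfun)"

lemma p0inv:
  assumes "t \<in> \<Delta>"
  shows "complex_linear (p0inv t)" "p 0 t o\<^sub>L p0inv t = id_blinfun" "p0inv t o\<^sub>L p 0 t = id_blinfun"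
  using someI_ex[OF p0_invertible[OF assms]] unfolding p0inv_def by auto

lemma p0inv_Ck: "Ck_on n \<Delta> p0inv"
  using Ck_off_inverse[of "p 0" p0inv \<Delta> "n - 1"] p0inv(2,3) p_Ck[of 0] n_pos
  by (simp add: Ck_on_eq_Ck_off)

lemma coefficient_Ck_off:
  assumes "j + k < n \<or> j + k = n \<and> N = \<Delta>"
  shows "Ck_off N \<Delta> j (p k)" "k < n \<Longrightarrow> Ck_off N \<Delta> j (q k)" "k < n \<Longrightarrow> Ck_off N \<Delta> j (\<lambda>t. adjoint_op (q k t))"
proof -
  have *: "Ck_off N \<Delta> j f" if "Ck_on (n - k) \<Delta> f" for f :: "real \<Rightarrow> 'h \<Rightarrow>\<^sub>L 'h"
  proof (cases "j < n - k")
    case True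
    then show ?thesis using Ck_on_imp_Ck_off[OF that] by blast
  next
    case False
    then have "N = \<Delta>" "j = n - k" using assms by auto
    then show ?thesis using that by (simp add: Ck_on_eq_Ck_off)
  qed
  show "Ck_off N \<Delta> j (p k)" "k < n \<Longrightarrow> Ck_off N \<Delta> j (q k)" "k < n \<Longrightarrow> Ck_off N \<Delta> j (\<lambda>t. adjoint_op (q k t))"
    using assms by (auto intro!: * p_Ck q_Ck q_adjoint_Ck)
qed

abbreviation uq :: "('h \<Rightarrow>\<^sub>L 'h \<Rightarrow> 'v::real_normed_vector \<Rightarrow> 'v) \<Rightarrow> nat \<Rightarrow> (real \<Rightarrow> 'v) \<Rightarrow> real \<Rightarrow> 'v" where
  "uq act m y \<equiv> upper_quasi_deriv act n \<Delta> p q y m"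

abbreviation qd :: "('h \<Rightarrow>\<^sub>L 'h \<Rightarrow> 'v::real_normed_vector \<Rightarrow> 'v) \<Rightarrow> nat \<Rightarrow> (real \<Rightarrow> 'v) \<Rightarrow> real \<Rightarrow> 'v" where
  "qd act j y \<equiv> quasi_deriv act n \<Delta> p q y j"

abbreviation de :: "('h \<Rightarrow>\<^sub>L 'h \<Rightarrow> 'v::real_normed_vector \<Rightarrow> 'v) \<Rightarrow> (real \<Rightarrow> 'v) \<Rightarrow> real \<Rightarrow> 'v" where
  "de act y \<equiv> diff_expr act n \<Delta> p q y"

text \<open>The terms of lower order in the recursion $y^{[n+m+1]} = -D y^{[n+m]} + \dots$\<close>

definition lower_terms :: "('h \<Rightarrow>\<^sub>L 'h \<Rightarrow> 'v::real_normed_vector \<Rightarrow> 'v) \<Rightarrow> nat \<Rightarrow> (real \<Rightarrow> 'v) \<Rightarrow> real \<Rightarrow> 'v" where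
  "lower_terms act m y t =
     act (p (Suc m) t) (Dpow \<Delta> (n - Suc m) y t)
     + act (scalar_op (\<i> / 2))
         (act (adjoint_op (q m t)) (Dpow \<Delta> (n - m) y t)
          - (if Suc m < n then act (q (Suc m) t) (Dpow \<Delta> (n - Suc m - 1) y t) else 0))"

lemma uq_Suc: "m < n \<Longrightarrow> uq act (Suc m) y t = - deriv_on \<Delta> (uq act m y) t + lower_terms act m y t"
  by (simp add: lower_terms_def Suc_diff_Suc)

lemma Ck_off_act:
  assumes "action act" "Ck_off N \<Delta> k A" "Ck_off N \<Delta> k y"
  shows "Ck_off N \<Delta> k (\<lambda>t. act (A t) (y t))"
  using Ck_off_bilinear assms unfolding action_def by blast

lemma bounded_linear_act: "action act \<Longrightarrow> bounded_linear (act A)"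
  unfolding action_def by (auto intro: bounded_bilinear.bounded_linear_right)

lemma lower_terms_Ck_off:
  assumes act: "action act" and m: "m < n" and y: "Ck_off N \<Delta> (j + (n - m)) y"
    and j: "j + Suc m < n \<or> j + Suc m = n \<and> N = \<Delta>"
  shows "Ck_off N \<Delta> j (lower_terms act m y)"
proof -
  have qs: "Ck_off N \<Delta> j (\<lambda>t. adjoint_op (q m t))"
    using coefficient_Ck_off(3)[of j m N] m j by auto
  have D: "Ck_off N \<Delta> j (Dpow \<Delta> i y)" if "i \<le> n - m" for i
    using y that by (intro Ck_off_Dpow'[OF y]) auto
  have if_eq: "(\<lambda>t. if Suc m < n then act (q (Suc m) t) (Dpow \<Delta> (n - Suc m - 1) y t) else 0)
      = (if Suc m < n then \<lambda>t. act (q (Suc m) t) (Dpow \<Delta> (n - Suc m - 1) y t) else (\<lambda>t. 0))" by auto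
  have "Ck_off N \<Delta> j (\<lambda>t. if Suc m < n then act (q (Suc m) t) (Dpow \<Delta> (n - Suc m - 1) y t) else 0)"
  proof (cases "Suc m < n")
    case True
    then show ?thesis
      unfolding if_eq using coefficient_Ck_off(2)[of j "Suc m" N] j
      by (simp only: if_True) (intro Ck_off_act[OF act] D, auto)
  qed (simp add: Ck_off_const)
  then show ?thesis
    unfolding lower_terms_def
    by (intro Ck_off_add Ck_off_diff Ck_off_linear[OF bounded_linear_act[OF act]] Ck_off_act[OF act]
        coefficient_Ck_off(1) qs D j) auto
qed

lemma uq_Ck_off:
  assumes act: "action act" and y: "Ck_off N \<Delta> (n + r) y" and r: "r < n \<or> r = n \<and> N = \<Delta>"
  shows "m \<le> r \<Longrightarrow> Ck_off N \<Delta> (r - m) (uq act m y)"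
proof (induction m)
  case 0
  have "Ck_off N \<Delta> r (p 0)" "Ck_off N \<Delta> r (q 0)" using r n_pos by (auto intro!: coefficient_Ck_off)
  moreover have "Ck_off N \<Delta> r (Dpow \<Delta> n y)" "Ck_off N \<Delta> r (Dpow \<Delta> (n - 1) y)"
    using y by (auto intro!: Ck_off_Dpow'[OF y])
  ultimately show ?case
    by (simp, intro Ck_off_diff Ck_off_linear[OF bounded_linear_act[OF act]] Ck_off_act[OF act])
next
  case (Suc m)
  then have IH: "Ck_off N \<Delta> (Suc (r - Suc m)) (uq act m y)" by (simp add: Suc_diff_Suc)
  have m: "m < n" using Suc.prems r by auto
  have "Ck_off N \<Delta> (r - Suc m) (lower_terms act m y)"
    by (rule lower_terms_Ck_off[OF act m Ck_off_lower[OF y]]) (use Suc.prems r in auto)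
  then have "Ck_off N \<Delta> (r - Suc m) (\<lambda>t. - deriv_on \<Delta> (uq act m y) t + lower_terms act m y t)"
    using IH by (intro Ck_off_add Ck_off_minus) auto
  moreover have "uq act (Suc m) y = (\<lambda>t. - deriv_on \<Delta> (uq act m y) t + lower_terms act m y t)"
    using uq_Suc[OF m] by (intro ext) blast
  ultimately show ?case by simp
qed

lemma Dpow_n_eq:
  assumes act: "action act" and t: "t \<in> \<Delta>"
  shows "Dpow \<Delta> n y t = act (p0inv t) (uq act 0 y t + act (scalar_op (\<i> / 2)) (act (q 0 t) (Dpow \<Delta> (n - 1) y t)))"
  using act p0inv(3)[OF t] by (simp add: action_def) (metis)

text \<open>
  Solving the recursion for the derivatives, beginning with $D^n y = p_0^{-1}(y^{[n]} + \frac i2 q_0 D^{n-1} y)$,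
  gives back the smoothness of \<open>y\<close>.
\<close>

lemma quasi_regular_imp_Ck_off:
  assumes act: "action act" and C1: "\<And>k. k \<le> 2 * n - 2 \<Longrightarrow> Ck_on 1 \<Delta> (qd act k y)"
    and top: "Ck_off N \<Delta> 0 (qd act (2 * n - 1) y)"
  shows "Ck_off N \<Delta> (2 * n - 1) y"
proof -
  have low: "Dpow \<Delta> i y differentiable_on \<Delta>" if "i < n" for i
    using C1[of i] that by (auto simp: quasi_deriv_def)
  have up: "uq act k y differentiable_on \<Delta>" if "Suc k < n" for k
    using C1[of "n + k"] that by (auto simp: quasi_deriv_def)
  have Dj: "Ck_off N \<Delta> s (Dpow \<Delta> i y)" if "Ck_off N \<Delta> s (Dpow \<Delta> n y)" "i \<le> n" for s i
  proof -
    have "Ck_off N \<Delta> (n + s) y" by (rule Ck_off_from_Dpow[OF low that(1)])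
    then show ?thesis by (rule Ck_off_Dpow') (use that in auto)
  qed
  have Dn: "Ck_off N \<Delta> s (Dpow \<Delta> n y)"
    if "Ck_off N \<Delta> s (uq act 0 y)" "Ck_off N \<Delta> s (Dpow \<Delta> (n - 1) y)" "s < n" for s
  proof (rule Ck_off_cong[OF Dpow_n_eq[OF act, symmetric]])
    have "Ck_off N \<Delta> s p0inv" using Ck_on_imp_Ck_off[OF p0inv_Ck] that by blast
    then show "Ck_off N \<Delta> s (\<lambda>t. act (p0inv t) (uq act 0 y t + act (scalar_op (\<i> / 2)) (act (q 0 t) (Dpow \<Delta> (n - 1) y t))))"
      using that by (intro Ck_off_act[OF act] Ck_off_add Ck_off_linear[OF bounded_linear_act[OF act]] coefficient_Ck_off) auto
  qed
  \<comment> \<open>All orders are raised together. The recursion read backwards expresses the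
    derivative of the k-th upper quasi-derivative by the next one and lower terms, so each gains an
    order from its successor; D^n y then gains it from the zeroth. The triangle s + k < n records
    how far the gain reaches.\<close>
  have "s < n \<Longrightarrow> Ck_off N \<Delta> s (Dpow \<Delta> n y) \<and> (\<forall>k. s + k < n \<longrightarrow> Ck_off N \<Delta> s (uq act k y))" for s
  proof (induction s)
    case 0
    have u: "Ck_off N \<Delta> 0 (uq act k y)" if "k < n" for k
    proof (cases "Suc k < n")
      case True
      then have "Ck_on 1 \<Delta> (uq act k y)" using C1[of "n + k"] by (simp add: quasi_deriv_def)
      then show ?thesis by (rule Ck_on_imp_Ck_off) simp
    next
      case False
      then have "2 * n - 1 = n + k" using that by simp
      then show ?thesis using top by (simp add: quasi_deriv_def)
    qed
    have d: "Ck_off N \<Delta> 0 (Dpow \<Delta> (n - 1) y)"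
    proof (rule Ck_on_imp_Ck_off)
      have "n - 1 \<le> 2 * n - 2" by arith
      then show "Ck_on 1 \<Delta> (Dpow \<Delta> (n - 1) y)" using C1[of "n - 1"] n_pos by (simp add: quasi_deriv_def)
    qed simp
    show ?case
    proof (intro conjI allI impI)
      show "Ck_off N \<Delta> 0 (Dpow \<Delta> n y)" by (rule Dn[OF u[OF n_pos] d n_pos])
      show "Ck_off N \<Delta> 0 (uq act k y)" if "0 + k < n" for k by (rule u) (use that in simp)
    qed
  next
    case (Suc s)
    then have IH: "Ck_off N \<Delta> s (Dpow \<Delta> n y)" "\<And>k. s + k < n \<Longrightarrow> Ck_off N \<Delta> s (uq act k y)" by auto
    have y: "Ck_off N \<Delta> (n + s) y" by (rule Ck_off_from_Dpow[OF low IH(1)])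
    have u: "Ck_off N \<Delta> (Suc s) (uq act k y)" if k: "Suc s + k < n" for k
    proof -
      have "Ck_off N \<Delta> s (lower_terms act k y)"
        by (rule lower_terms_Ck_off[OF act _ Ck_off_lower[OF y]]) (use k in auto)
      moreover have "Ck_off N \<Delta> s (uq act (Suc k) y)" using IH(2)[of "Suc k"] k by simp
      ultimately have "Ck_off N \<Delta> s (\<lambda>t. lower_terms act k y t - uq act (Suc k) y t)" by (intro Ck_off_diff)
      moreover have "lower_terms act k y t - uq act (Suc k) y t = deriv_on \<Delta> (uq act k y) t" for t
        using uq_Suc[of k act y t] k by simp
      ultimately show ?thesis using up[of k] k by simp
    qed
    have d: "Ck_off N \<Delta> (Suc s) (Dpow \<Delta> (n - 1) y)"
      by (rule Ck_off_Dpow'[OF y]) (use n_pos in simp)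
    show ?case
    proof (intro conjI allI impI)
      show "Ck_off N \<Delta> (Suc s) (Dpow \<Delta> n y)"
        by (rule Dn[OF u d Suc.prems]) (use Suc.prems in simp)
      show "Ck_off N \<Delta> (Suc s) (uq act k y)" if "Suc s + k < n" for k by (rule u[OF that])
    qed
  qed
  from this[of "n - 1"] have top': "Ck_off N \<Delta> (n - 1) (Dpow \<Delta> n y)" using n_pos by auto
  have "Ck_off N \<Delta> (n + (n - 1)) y" by (rule Ck_off_from_Dpow[OF low top'])
  moreover have "n + (n - 1) = 2 * n - 1" using n_pos by simp
  ultimately show ?thesis by simp
qed

text \<open>N covers the points at which the last quasi-derivative, merely absolutely continuous,
  fails to be differentiable. Off N the function y has 2n derivatives.\<close>

lemma quasi_regularD:
  assumes act: "action act" and y: "quasi_regular act n \<Delta> p q y"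
  obtains N where "N \<in> null_sets lebesgue" "Ck_off N \<Delta> (2 * n - 1) y"
proof -
  let ?u = "qd act (2 * n - 1) y"
  have lac: "loc_abs_continuous_on \<Delta> ?u" and C1: "\<And>k. k \<le> 2 * n - 2 \<Longrightarrow> Ck_on 1 \<Delta> (qd act k y)"
    using y by (auto simp: quasi_regular_def)
  have "continuous_on \<Delta> ?u"
    using lac by (intro continuous_on_localI abs_continuous_on_imp_continuous_on) (auto simp: loc_abs_continuous_on_def)
  moreover obtain N where "N \<in> null_sets lebesgue" "{t \<in> space lebesgue. \<not> (t \<in> \<Delta> \<longrightarrow> ?u differentiable (at t within \<Delta>))} \<subseteq> N"
    using lac unfolding loc_abs_continuous_on_def eventually_ae_filter by blast
  ultimately have "N \<in> null_sets lebesgue" "Ck_off N \<Delta> 0 ?u" by auto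
  with quasi_regular_imp_Ck_off[OF act C1] show ?thesis by (intro that)
qed

lemma quasi_regular_if_Ck:
  assumes act: "action act" and y: "Ck_on (2 * n) \<Delta> y"
  shows "quasi_regular act n \<Delta> p q y"
proof -
  have u: "Ck_on (n - m) \<Delta> (uq act m y)" if "m \<le> n" for m
    using uq_Ck_off[OF act, of \<Delta> n y m] y that by (simp add: Ck_on_eq_Ck_off mult_2)
  have *: "Ck_on 1 \<Delta> (qd act k y)" if "k \<le> 2 * n - 1" for k
  proof (cases "k < n")
    case True
    have "Ck_off \<Delta> \<Delta> 1 (Dpow \<Delta> k y)"
      by (rule Ck_off_Dpow'[of \<Delta> \<Delta> "2 * n"]) (use y True in \<open>auto simp: Ck_on_eq_Ck_off\<close>)
    then show ?thesis using True by (simp add: quasi_deriv_def Ck_on_eq_Ck_off)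
  next
    case False
    then have "Ck_on 1 \<Delta> (uq act (k - n) y)"
      using that n_pos by (intro Ck_on_lower[OF u]) auto
    then show ?thesis using False by (simp add: quasi_deriv_def)
  qed
  show ?thesis
    unfolding quasi_regular_def using n_pos by (intro conjI allI impI * loc_abs_continuous_on_C1) auto
qed

text \<open>The recursion is unrolled: after m steps the terms with index j have been differentiated
  m - j times, with alternating sign, and after n steps they are the terms of l. All steps but the
  last are valid on the whole of \<Delta>; the last needs t outside N.\<close>

lemma diff_expr_eq_uq:
  assumes act: "action act" and y: "Ck_off N \<Delta> (2 * n - 1) y" and t: "t \<in> \<Delta> - N"
  shows "de act y t = uq act n y t"
proof -
  let ?h = "act (scalar_op (\<i> / 2))"
  define P where "P j s = act (p j s) (Dpow \<Delta> (n - j) y s)" for j s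
  define Q where "Q j s = act (q j s) (Dpow \<Delta> (n - j - 1) y s)" for j s
  define Qs where "Qs j s = act (adjoint_op (q j s)) (Dpow \<Delta> (n - j) y s)" for j s
  \<comment> \<open>Contribution of p_j and q_j after m steps. The term with the adjoint of q_j
    enters the recursion one step later than the other two, hence one differentiation fewer.\<close>
  define E where "E m j s = (-1) ^ (m - j) *\<^sub>R (Dpow \<Delta> (m - j) (P j) s
      - ?h (Dpow \<Delta> (m - j - 1) (Qs j) s + Dpow \<Delta> (m - j) (Q j) s))" for m j s
  have D: "Ck_off N \<Delta> (n - Suc j) (Dpow \<Delta> i y)" if "i \<le> n" for i j
    by (rule Ck_off_Dpow'[OF y]) (use that in auto)
  have PC: "Ck_off N \<Delta> (n - Suc j) (P j)" and QC: "Ck_off N \<Delta> (n - Suc j) (Q j)"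
    and QsC: "Ck_off N \<Delta> (n - Suc j) (Qs j)" if "j < n" for j
    unfolding P_def Q_def Qs_def using that by (auto intro!: Ck_off_act[OF act] coefficient_Ck_off D)
  have main: "m \<le> n \<Longrightarrow> t \<in> \<Delta> \<Longrightarrow> m < n \<or> t \<notin> N \<Longrightarrow>
      uq act m y t = (\<Sum>j<m. E m j t) + P m t - (if m < n then ?h (Q m t) else 0)" for m t
  proof (induction m arbitrary: t)
    case 0
    then show ?case using n_pos by (simp add: P_def Q_def)
  next
    case (Suc m)
    have m: "m < n" using Suc.prems by simp
    \<comment> \<open>One more differentiation flips the sign in \<open>E\<close>, which agrees with
      the minus sign in front of the derivative in the recursion.\<close>
    have EE: "(E m j has_vector_derivative - E (Suc m) j t) (at t within \<Delta>)" if j: "j < m" for j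
    proof -
      have j': "j < n" using j m by simp
      have v1: "m - j < n - Suc j \<or> m - j = n - Suc j \<and> t \<notin> N" using j Suc.prems by auto
      have v2: "m - j - 1 < n - Suc j \<or> m - j - 1 = n - Suc j \<and> t \<notin> N" using j Suc.prems by auto
      have "(E m j has_vector_derivative (-1) ^ (m - j) *\<^sub>R (Dpow \<Delta> (Suc (m - j)) (P j) t
          - ?h (Dpow \<Delta> (Suc (m - j - 1)) (Qs j) t + Dpow \<Delta> (Suc (m - j)) (Q j) t))) (at t within \<Delta>)"
        unfolding E_def
        by (intro bounded_linear.has_vector_derivative[OF bounded_linear_scaleR_right] has_vector_derivative_diff
            has_vector_derivative_add bounded_linear.has_vector_derivative[OF bounded_linear_act[OF act]]
            Dpow_has_vector_derivative[OF PC[OF j'] Suc.prems(2) v1]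
            Dpow_has_vector_derivative[OF QC[OF j'] Suc.prems(2) v1]
            Dpow_has_vector_derivative[OF QsC[OF j'] Suc.prems(2) v2])
      moreover have "(-1) ^ (m - j) *\<^sub>R (Dpow \<Delta> (Suc (m - j)) (P j) t
          - ?h (Dpow \<Delta> (Suc (m - j - 1)) (Qs j) t + Dpow \<Delta> (Suc (m - j)) (Q j) t)) = - E (Suc m) j t"
        unfolding E_def using j by (simp add: Suc_diff_le Suc_diff_Suc del: funpow.simps)
      ultimately show ?thesis by simp
    qed
    have v0: "0 < n - Suc m \<or> 0 = n - Suc m \<and> t \<notin> N" using Suc.prems by auto
    have "((\<lambda>s. (\<Sum>j<m. E m j s) + P m s - ?h (Q m s)) has_vector_derivative
        (\<Sum>j<m. - E (Suc m) j t) + Dpow \<Delta> (Suc 0) (P m) t - ?h (Dpow \<Delta> (Suc 0) (Q m) t)) (at t within \<Delta>)"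
      using Dpow_has_vector_derivative[OF PC[OF m] Suc.prems(2) v0] Dpow_has_vector_derivative[OF QC[OF m] Suc.prems(2) v0]
      by (intro has_vector_derivative_diff has_vector_derivative_add has_vector_derivative_sum EE
          bounded_linear.has_vector_derivative[OF bounded_linear_act[OF act]]) auto
    then have "deriv_on \<Delta> (\<lambda>s. (\<Sum>j<m. E m j s) + P m s - ?h (Q m s)) t
        = (\<Sum>j<m. - E (Suc m) j t) + Dpow \<Delta> (Suc 0) (P m) t - ?h (Dpow \<Delta> (Suc 0) (Q m) t)"
      by (rule deriv_on_eqI) (use Suc.prems in auto)
    moreover have "deriv_on \<Delta> (uq act m y) t = deriv_on \<Delta> (\<lambda>s. (\<Sum>j<m. E m j s) + P m s - ?h (Q m s)) t"
      by (rule deriv_on_cong) (use Suc.IH Suc.prems m in auto)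
    moreover have "lower_terms act m y t = P (Suc m) t + ?h (Qs m t - (if Suc m < n then Q (Suc m) t else 0))"
      by (simp add: lower_terms_def P_def Q_def Qs_def)
    ultimately have "uq act (Suc m) y t = - ((\<Sum>j<m. - E (Suc m) j t) + Dpow \<Delta> (Suc 0) (P m) t - ?h (Dpow \<Delta> (Suc 0) (Q m) t))
        + (P (Suc m) t + ?h (Qs m t - (if Suc m < n then Q (Suc m) t else 0)))"
      using uq_Suc[OF m, of act y t] by simp
    moreover have "E (Suc m) m t = - (Dpow \<Delta> (Suc 0) (P m) t - ?h (Qs m t + Dpow \<Delta> (Suc 0) (Q m) t))"
      by (simp add: E_def)
    ultimately show ?case
      using bounded_linear_act[OF act, of "scalar_op (\<i> / 2)"]
      by (simp add: sum_negf linear_simps)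
  qed
  have "de act y t = (\<Sum>k=1..n. E n (n - k) t) + P n t"
  proof -
    have "E n (n - k) t = (-1) ^ k *\<^sub>R
        (Dpow \<Delta> k (\<lambda>s. act (p (n - k) s) (Dpow \<Delta> k y s)) t
         - ?h (Dpow \<Delta> (k - 1) (\<lambda>s. act (adjoint_op (q (n - k) s)) (Dpow \<Delta> k y s)) t
              + Dpow \<Delta> k (\<lambda>s. act (q (n - k) s) (Dpow \<Delta> (k - 1) y s)) t))"
      if "k \<in> {1..n}" for k
    proof -
      have "n - (n - k) = k" using that by simp
      then show ?thesis unfolding E_def P_def Q_def Qs_def by (simp only:)
    qed
    then show ?thesis by (simp add: diff_expr_def P_def)
  qed
  also have "(\<Sum>k=1..n. E n (n - k) t) = (\<Sum>j<n. E n j t)"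
    by (rule sum.reindex_bij_witness[of _ "\<lambda>j. n - j" "\<lambda>k. n - k"]) auto
  finally show ?thesis using main[of n t] t by auto
qed

section \<open>Locality, linearity and additivity of quasi-derivatives\<close>

lemma uq_cong:
  assumes "\<And>s. s \<in> \<Delta> \<Longrightarrow> y s = z s"
  shows "t \<in> \<Delta> \<Longrightarrow> uq act m y t = uq act m z t"
proof (induction m arbitrary: t)
  case 0
  then show ?case using Dpow_cong[OF assms] by simp
next
  case (Suc m)
  have "deriv_on \<Delta> (uq act m y) t = deriv_on \<Delta> (uq act m z) t"
    by (rule deriv_on_cong[OF Suc.IH Suc.prems])
  moreover have "Dpow \<Delta> j y t = Dpow \<Delta> j z t" for j by (rule Dpow_cong[OF assms Suc.prems])
  ultimately show ?case by (simp del: funpow.simps)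
qed

lemma qd_cong: "(\<And>s. s \<in> \<Delta> \<Longrightarrow> y s = z s) \<Longrightarrow> t \<in> \<Delta> \<Longrightarrow> qd act j y t = qd act j z t"
  using uq_cong[of y z] Dpow_cong[of y z] by (simp add: quasi_deriv_def)

lemma de_cong:
  assumes "\<And>s. s \<in> \<Delta> \<Longrightarrow> y s = z s" "t \<in> \<Delta>"
  shows "de act y t = de act z t"
proof -
  have "Dpow \<Delta> k (\<lambda>s. act (A s) (Dpow \<Delta> j y s)) t = Dpow \<Delta> k (\<lambda>s. act (A s) (Dpow \<Delta> j z s)) t" for k j A
    using Dpow_cong[OF assms(1)] assms(2) by (intro Dpow_cong) auto
  then show ?thesis using assms by (simp add: diff_expr_def)
qed

lemma loc_abs_continuous_on_cong:
  assumes "\<And>s. s \<in> \<Delta> \<Longrightarrow> f s = g s" "loc_abs_continuous_on \<Delta> f"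
  shows "loc_abs_continuous_on \<Delta> g"
  unfolding loc_abs_continuous_on_def
proof (intro conjI allI impI)
  show "abs_continuous_on {c..d} g" if "{c..d} \<subseteq> \<Delta>" for c d
    using assms that abs_continuous_on_cong[of "{c..d}" f g] by (auto simp: loc_abs_continuous_on_def subset_iff)
  show "AE t in lebesgue. t \<in> \<Delta> \<longrightarrow> g differentiable (at t within \<Delta>)"
  proof -
    have "AE t in lebesgue. t \<in> \<Delta> \<longrightarrow> f differentiable (at t within \<Delta>)"
      using assms(2) by (simp add: loc_abs_continuous_on_def)
    then show ?thesis
    proof (eventually_elim, intro impI)
      fix t assume t: "t \<in> \<Delta> \<longrightarrow> f differentiable (at t within \<Delta>)" "t \<in> \<Delta>"
      show "g differentiable (at t within \<Delta>)" by (rule differentiable_cong[OF assms(1)]) (use t in auto)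
    qed
  qed
qed

text \<open>Phrased by the quasi-derivatives alone, so that it serves both for linear images of y
  and for altering y outside \<Delta>.\<close>

lemma quasi_regular_transfer:
  assumes "quasi_regular act n \<Delta> p q y" "bounded_linear L"
    and "\<And>j t. j < 2 * n \<Longrightarrow> t \<in> \<Delta> \<Longrightarrow> qd act' j z t = L (qd act j y t)"
  shows "quasi_regular act' n \<Delta> p q z"
proof -
  have "Ck_on 1 \<Delta> (qd act' k z)" if "k \<le> 2 * n - 2" for k
  proof -
    have "Ck_off \<Delta> \<Delta> 1 (\<lambda>t. L (qd act k y t))"
      using assms(1) that by (intro Ck_off_linear[OF assms(2)]) (simp add: quasi_regular_def Ck_on_eq_Ck_off)
    then show ?thesis
      using assms(3)[of k] that n_pos Ck_off_cong[of "\<lambda>t. L (qd act k y t)" "qd act' k z" \<Delta> 1]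
      by (simp add: Ck_on_eq_Ck_off)
  qed
  moreover have "loc_abs_continuous_on \<Delta> (qd act' (2 * n - 1) z)"
  proof (rule loc_abs_continuous_on_cong)
    show "L (qd act (2 * n - 1) y t) = qd act' (2 * n - 1) z t" if "t \<in> \<Delta>" for t
      using assms(3)[of "2 * n - 1" t] that n_pos by simp
    show "loc_abs_continuous_on \<Delta> (\<lambda>t. L (qd act (2 * n - 1) y t))"
      unfolding loc_abs_continuous_on_def
    proof (intro conjI allI impI)
      let ?u = "qd act (2 * n - 1) y"
      have u: "loc_abs_continuous_on \<Delta> ?u" using assms(1) by (simp add: quasi_regular_def)
      show "abs_continuous_on {c..d} (\<lambda>t. L (?u t))" if "{c..d} \<subseteq> \<Delta>" for c d
        using u that by (intro abs_continuous_on_linear[OF assms(2)]) (simp add: loc_abs_continuous_on_def)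
      have "AE t in lebesgue. t \<in> \<Delta> \<longrightarrow> ?u differentiable (at t within \<Delta>)"
        using u by (simp add: loc_abs_continuous_on_def)
      then show "AE t in lebesgue. t \<in> \<Delta> \<longrightarrow> (\<lambda>t. L (?u t)) differentiable (at t within \<Delta>)"
      proof (eventually_elim, intro impI)
        fix t assume t: "t \<in> \<Delta> \<longrightarrow> ?u differentiable (at t within \<Delta>)" "t \<in> \<Delta>"
        then have "((\<lambda>t. L (?u t)) has_vector_derivative L (deriv_on \<Delta> ?u t)) (at t within \<Delta>)"
          by (intro bounded_linear.has_vector_derivative[OF assms(2)] has_deriv_on) auto
        then show "(\<lambda>t. L (?u t)) differentiable (at t within \<Delta>)" by (rule differentiableI_vector)
      qed
    qed
  qed
  ultimately show ?thesis unfolding quasi_regular_def by blast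
qed

text \<open>The coefficients and the factor \<i> / 2 are complex-linear operators, so it is enough
  that L intertwines the two actions on these. Later instances of L are multiplication by a complex
  number, composition with a fixed operator from the right, and evaluation of an operator function
  at a vector.\<close>

lemma uq_linear:
  assumes act: "action act" and L: "bounded_linear L"
    and intertwine: "\<And>A x. complex_linear A \<Longrightarrow> L (act A x) = act' A (L x)"
    and y: "Ck_off N \<Delta> (2 * n - 1) y"
  shows "t \<in> \<Delta> \<Longrightarrow> m < n \<or> m = n \<and> t \<notin> N \<Longrightarrow> uq act' m (\<lambda>t. L (y t)) t = L (uq act m y t)"
proof (induction m arbitrary: t)
  case 0
  have "Dpow \<Delta> j (\<lambda>t. L (y t)) t = L (Dpow \<Delta> j y t)" if "j \<le> n" for j
    by (rule Dpow_linear[OF L y 0(1)]) (use that n_pos in auto)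
  then show ?case
    using 0 n_pos p_linear[of 0 t] q_linear[of 0 t]
    by (simp add: linear_simps[OF L] intertwine complex_linear_scalar_op)
next
  case (Suc m)
  have m: "m < n" using Suc.prems by auto
  have D: "Dpow \<Delta> j (\<lambda>t. L (y t)) t = L (Dpow \<Delta> j y t)" if "j \<le> n" for j
    by (rule Dpow_linear[OF L y Suc.prems(1)]) (use that n_pos in auto)
  have lt: "lower_terms act' m (\<lambda>t. L (y t)) t = L (lower_terms act m y t)"
    using m Suc.prems p_linear[of "Suc m" t] q_adjoint_linear[of m t] q_linear[of "Suc m" t]
    by (auto simp: lower_terms_def linear_simps[OF L] intertwine complex_linear_scalar_op D)
  have u: "Ck_off N \<Delta> (n - 1 - m) (uq act m y)"
    using y m n_pos by (intro uq_Ck_off[OF act]) (auto simp: mult_2)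
  have "deriv_on \<Delta> (uq act' m (\<lambda>t. L (y t))) t = deriv_on \<Delta> (\<lambda>t. L (uq act m y t)) t"
    by (rule deriv_on_cong[OF Suc.IH]) (use Suc.prems m in auto)
  also have "\<dots> = L (deriv_on \<Delta> (uq act m y) t)"
    using Dpow_has_vector_derivative[OF u Suc.prems(1), of 0] Suc.prems
    by (intro deriv_on_eqI bounded_linear.has_vector_derivative[OF L]) auto
  finally show ?case using uq_Suc[OF m, of act' "\<lambda>t. L (y t)" t] uq_Suc[OF m, of act y t] lt
    by (simp only: linear_simps[OF L])
qed

lemma qd_linear:
  assumes act: "action act" and L: "bounded_linear L"
    and intertwine: "\<And>A x. complex_linear A \<Longrightarrow> L (act A x) = act' A (L x)"
    and y: "Ck_off N \<Delta> (2 * n - 1) y" and "t \<in> \<Delta>" "j < 2 * n"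
  shows "qd act' j (\<lambda>t. L (y t)) t = L (qd act j y t)"
proof (cases "j < n")
  case True
  have "Dpow \<Delta> j (\<lambda>t. L (y t)) t = L (Dpow \<Delta> j y t)"
    by (rule Dpow_linear[OF L y \<open>t \<in> \<Delta>\<close>]) (use True in simp)
  then show ?thesis using True by (simp add: quasi_deriv_def)
next
  case False
  have "uq act' (j - n) (\<lambda>t. L (y t)) t = L (uq act (j - n) y t)"
    by (rule uq_linear[where act' = act' and L = L, OF act L intertwine y \<open>t \<in> \<Delta>\<close>]) (use False assms(6) in auto)
  then show ?thesis using False by (simp add: quasi_deriv_def)
qed

lemma quasi_regular_linear:
  assumes act: "action act" and act': "action act'" and L: "bounded_linear L"
    and intertwine: "\<And>A x. complex_linear A \<Longrightarrow> L (act A x) = act' A (L x)"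
    and y: "quasi_regular act n \<Delta> p q y"
  shows "quasi_regular act' n \<Delta> p q (\<lambda>t. L (y t))"
    and "\<And>t j. t \<in> \<Delta> \<Longrightarrow> j < 2 * n \<Longrightarrow> qd act' j (\<lambda>t. L (y t)) t = L (qd act j y t)"
    and "AE t in lebesgue. t \<in> \<Delta> \<longrightarrow> de act' (\<lambda>t. L (y t)) t = L (de act y t)"
proof -
  obtain N where N: "N \<in> null_sets lebesgue" "Ck_off N \<Delta> (2 * n - 1) y" using quasi_regularD[OF act y] by metis
  show qd: "\<And>t j. t \<in> \<Delta> \<Longrightarrow> j < 2 * n \<Longrightarrow> qd act' j (\<lambda>t. L (y t)) t = L (qd act j y t)"
    by (rule qd_linear[where act' = act' and L = L, OF act L intertwine N(2)])
  show "quasi_regular act' n \<Delta> p q (\<lambda>t. L (y t))" by (rule quasi_regular_transfer[OF y L qd])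
  show "AE t in lebesgue. t \<in> \<Delta> \<longrightarrow> de act' (\<lambda>t. L (y t)) t = L (de act y t)"
    using AE_not_in[OF N(1)]
  proof (eventually_elim, intro impI)
    fix t assume t: "t \<notin> N" "t \<in> \<Delta>"
    have "de act' (\<lambda>t. L (y t)) t = uq act' n (\<lambda>t. L (y t)) t"
      by (rule diff_expr_eq_uq[OF act' Ck_off_linear[OF L N(2)]]) (use t in simp)
    also have "\<dots> = L (uq act n y t)"
      by (rule uq_linear[where act' = act' and L = L, OF act L intertwine N(2)]) (use t in simp_all)
    also have "uq act n y t = de act y t"
      by (rule diff_expr_eq_uq[OF act N(2), symmetric]) (use t in simp)
    finally show "de act' (\<lambda>t. L (y t)) t = L (de act y t)" .
  qed
qed

lemma uq_plus:
  assumes act: "action act" and y: "Ck_off N \<Delta> (2 * n - 1) y" and z: "Ck_off N \<Delta> (2 * n - 1) z"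
  shows "t \<in> \<Delta> \<Longrightarrow> m < n \<or> m = n \<and> t \<notin> N \<Longrightarrow> uq act m (\<lambda>t. y t + z t) t = uq act m y t + uq act m z t"
proof (induction m arbitrary: t)
  case 0
  have "Dpow \<Delta> j (\<lambda>t. y t + z t) t = Dpow \<Delta> j y t + Dpow \<Delta> j z t" if "j \<le> n" for j
    by (rule Dpow_plus[OF y z 0(1)]) (use that n_pos in auto)
  then show ?case using n_pos by (simp add: linear_simps[OF bounded_linear_act[OF act]])
next
  case (Suc m)
  have m: "m < n" using Suc.prems by auto
  have D: "Dpow \<Delta> j (\<lambda>t. y t + z t) t = Dpow \<Delta> j y t + Dpow \<Delta> j z t" if "j \<le> n" for j
    by (rule Dpow_plus[OF y z Suc.prems(1)]) (use that n_pos in auto)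
  have lt: "lower_terms act m (\<lambda>t. y t + z t) t = lower_terms act m y t + lower_terms act m z t"
    by (auto simp: lower_terms_def linear_simps[OF bounded_linear_act[OF act]] D)
  have u: "Ck_off N \<Delta> (n - 1 - m) (uq act m x)" if "Ck_off N \<Delta> (2 * n - 1) x" for x
    using that m n_pos by (intro uq_Ck_off[OF act]) (auto simp: mult_2)
  have "deriv_on \<Delta> (uq act m (\<lambda>t. y t + z t)) t = deriv_on \<Delta> (\<lambda>t. uq act m y t + uq act m z t) t"
    by (rule deriv_on_cong[OF Suc.IH]) (use Suc.prems m in auto)
  also have "\<dots> = deriv_on \<Delta> (uq act m y) t + deriv_on \<Delta> (uq act m z) t"
    using Dpow_has_vector_derivative[OF u[OF y] Suc.prems(1), of 0] Dpow_has_vector_derivative[OF u[OF z] Suc.prems(1), of 0] Suc.prems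
    by (intro deriv_on_eqI has_vector_derivative_add) auto
  finally show ?case
    using uq_Suc[OF m, of act "\<lambda>t. y t + z t" t] uq_Suc[OF m, of act y t] uq_Suc[OF m, of act z t] lt
    by (simp only:) simp
qed

lemma quasi_regular_plus:
  assumes act: "action act" and y: "quasi_regular act n \<Delta> p q y" and z: "quasi_regular act n \<Delta> p q z"
  shows "quasi_regular act n \<Delta> p q (\<lambda>t. y t + z t)"
    and "\<And>t j. t \<in> \<Delta> \<Longrightarrow> j < 2 * n \<Longrightarrow> qd act j (\<lambda>t. y t + z t) t = qd act j y t + qd act j z t"
    and "AE t in lebesgue. t \<in> \<Delta> \<longrightarrow> de act (\<lambda>t. y t + z t) t = de act y t + de act z t"
proof -
  obtain N1 where N1: "N1 \<in> null_sets lebesgue" "Ck_off N1 \<Delta> (2 * n - 1) y" using quasi_regularD[OF act y] by metis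
  obtain N2 where N2: "N2 \<in> null_sets lebesgue" "Ck_off N2 \<Delta> (2 * n - 1) z" using quasi_regularD[OF act z] by metis
  define N where "N = N1 \<union> N2"
  have mono: "Ck_off N' \<Delta> k f \<Longrightarrow> N' \<subseteq> N \<Longrightarrow> Ck_off N \<Delta> k f" for N' k and f :: "real \<Rightarrow> 'a"
    by (induction k arbitrary: f) auto
  have N: "N \<in> null_sets lebesgue" "Ck_off N \<Delta> (2 * n - 1) y" "Ck_off N \<Delta> (2 * n - 1) z"
    using N1 N2 mono by (auto simp: N_def)
  show qd: "\<And>t j. t \<in> \<Delta> \<Longrightarrow> j < 2 * n \<Longrightarrow> qd act j (\<lambda>t. y t + z t) t = qd act j y t + qd act j z t"
  proof -
    fix t j assume t: "t \<in> \<Delta>" "j < 2 * n"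
    show "qd act j (\<lambda>t. y t + z t) t = qd act j y t + qd act j z t"
    proof (cases "j < n")
      case True
      have "Dpow \<Delta> j (\<lambda>t. y t + z t) t = Dpow \<Delta> j y t + Dpow \<Delta> j z t"
        by (rule Dpow_plus[OF N(2,3) t(1)]) (use True in simp)
      then show ?thesis using True by (simp add: quasi_deriv_def)
    next
      case False
      have "uq act (j - n) (\<lambda>t. y t + z t) t = uq act (j - n) y t + uq act (j - n) z t"
        by (rule uq_plus[OF act N(2,3) t(1)]) (use False t in auto)
      then show ?thesis using False by (simp add: quasi_deriv_def)
    qed
  qed
  show "quasi_regular act n \<Delta> p q (\<lambda>t. y t + z t)"
    unfolding quasi_regular_def
  proof (intro conjI allI impI)
    fix k assume k: "k \<le> 2 * n - 2"
    have "Ck_off \<Delta> \<Delta> 1 (\<lambda>t. qd act k y t + qd act k z t)"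
      using y z k by (intro Ck_off_add) (auto simp: quasi_regular_def Ck_on_eq_Ck_off)
    then show "Ck_on 1 \<Delta> (qd act k (\<lambda>t. y t + z t))"
      using Ck_off_cong[of "\<lambda>t. qd act k y t + qd act k z t" "qd act k (\<lambda>t. y t + z t)" \<Delta> 1] qd[of _ k] k n_pos
      by (simp add: Ck_on_eq_Ck_off)
  next
    have "loc_abs_continuous_on \<Delta> (\<lambda>t. qd act (2 * n - 1) y t + qd act (2 * n - 1) z t)"
      unfolding loc_abs_continuous_on_def
    proof (intro conjI allI impI)
      let ?u = "qd act (2 * n - 1) y" and ?v = "qd act (2 * n - 1) z"
      have uv: "loc_abs_continuous_on \<Delta> ?u" "loc_abs_continuous_on \<Delta> ?v"
        using y z by (simp_all add: quasi_regular_def)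
      show "abs_continuous_on {c..d} (\<lambda>t. ?u t + ?v t)" if "{c..d} \<subseteq> \<Delta>" for c d
        using uv that by (intro abs_continuous_on_add) (simp_all add: loc_abs_continuous_on_def)
      have "AE t in lebesgue. t \<in> \<Delta> \<longrightarrow> ?u differentiable (at t within \<Delta>)"
        "AE t in lebesgue. t \<in> \<Delta> \<longrightarrow> ?v differentiable (at t within \<Delta>)"
        using uv by (simp_all add: loc_abs_continuous_on_def)
      then show "AE t in lebesgue. t \<in> \<Delta> \<longrightarrow> (\<lambda>t. ?u t + ?v t) differentiable (at t within \<Delta>)"
        by eventually_elim (auto intro: differentiable_add)
    qed
    then show "loc_abs_continuous_on \<Delta> (qd act (2 * n - 1) (\<lambda>t. y t + z t))"
      by (rule loc_abs_continuous_on_cong[rotated]) (use qd n_pos in simp)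
  qed
  show "AE t in lebesgue. t \<in> \<Delta> \<longrightarrow> de act (\<lambda>t. y t + z t) t = de act y t + de act z t"
    using AE_not_in[OF N(1)]
  proof (eventually_elim, intro impI)
    fix t assume t: "t \<notin> N" "t \<in> \<Delta>"
    have "de act (\<lambda>t. y t + z t) t = uq act n (\<lambda>t. y t + z t) t"
      by (rule diff_expr_eq_uq[OF act Ck_off_add[OF N(2,3)]]) (use t in simp)
    also have "\<dots> = uq act n y t + uq act n z t"
      by (rule uq_plus[OF act N(2,3)]) (use t in simp_all)
    also have "\<dots> = de act y t + de act z t"
      using diff_expr_eq_uq[OF act N(2), of t] diff_expr_eq_uq[OF act N(3), of t] t by simp
    finally show "de act (\<lambda>t. y t + z t) t = de act y t + de act z t" .
  qed
qed

end

section \<open>Functions with prescribed quasi-derivatives at the left end point\<close>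

text \<open>In each of the four sign cases the Taylor remainder lies between 0 and (y - x)^2, so the
  kink at 0 requires no separate limit.\<close>

lemma max_zero_square_derivative:
  "((\<lambda>x::real. (max 0 x) ^ 2) has_real_derivative 2 * max 0 x) (at x)"
  unfolding has_field_derivative_def has_derivative_at_alt
proof (intro conjI allI impI)
  show "bounded_linear ((*) (2 * max 0 x))" by (rule bounded_linear_mult_right)
  fix e :: real assume e: "e > 0"
  show "\<exists>d>0. \<forall>y. norm (y - x) < d \<longrightarrow>
      norm ((max 0 y) ^ 2 - (max 0 x) ^ 2 - 2 * max 0 x * (y - x)) \<le> e * norm (y - x)"
  proof (intro exI[of _ e] conjI e allI impI)
    fix y assume y: "norm (y - x) < e"
    define r where "r = (max 0 y) ^ 2 - (max 0 x) ^ 2 - 2 * max 0 x * (y - x)"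
    have "0 \<le> r \<and> r \<le> (y - x) ^ 2"
    proof (cases "0 \<le> x"; cases "0 \<le> y")
      assume xy: "0 \<le> x" "0 \<le> y"
      then have "r = (y - x) ^ 2" by (simp add: r_def max_def power2_eq_square algebra_simps)
      then show ?thesis by simp
    next
      assume xy: "0 \<le> x" "\<not> 0 \<le> y"
      then have r: "r = x * x + 2 * (x * - y)" by (simp add: r_def max_def power2_eq_square algebra_simps)
      moreover have "0 \<le> x * - y" using xy by (intro mult_nonneg_nonneg) auto
      moreover have "(y - x) ^ 2 = r + y * y" unfolding r by (simp add: power2_eq_square algebra_simps)
      ultimately show ?thesis using zero_le_square[of x] zero_le_square[of y] by linarith
    next
      assume xy: "\<not> 0 \<le> x" "0 \<le> y"
      then have "r = y ^ 2" by (simp add: r_def max_def)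
      moreover have "y ^ 2 \<le> (y - x) ^ 2" using xy by (intro power_mono) auto
      ultimately show ?thesis by simp
    next
      assume "\<not> 0 \<le> x" "\<not> 0 \<le> y"
      then show ?thesis by (simp add: r_def max_def)
    qed
    then have "norm r \<le> \<bar>y - x\<bar> * \<bar>y - x\<bar>" by (simp add: power2_eq_square)
    also have "\<dots> \<le> e * \<bar>y - x\<bar>" using y by (intro mult_right_mono) auto
    finally show "norm ((max 0 y) ^ 2 - (max 0 x) ^ 2 - 2 * max 0 x * (y - x)) \<le> e * norm (y - x)"
      by (simp add: r_def)
  qed
qed

lemma max_zero_power_derivative:
  "((\<lambda>x::real. (max 0 x) ^ (k + 2)) has_real_derivative real (k + 2) * (max 0 x) ^ (k + 1)) (at x)"
proof (induction k)
  case 0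
  then show ?case using max_zero_square_derivative[of x] by (simp add: numeral_2_eq_2)
next
  case (Suc k)
  have mx: "(max 0 x) ^ Suc (Suc i) = x * (max 0 x) ^ Suc i" for x :: real and i by (simp add: max_def)
  have "((\<lambda>x. x * (max 0 x) ^ (k + 2)) has_real_derivative
      x * (real (k + 2) * (max 0 x) ^ (k + 1)) + 1 * (max 0 x) ^ (k + 2)) (at x)"
    by (rule DERIV_mult'[OF DERIV_ident Suc.IH])
  moreover have "x * (real (k + 2) * (max 0 x) ^ (k + 1)) + 1 * (max 0 x) ^ (k + 2)
      = real (Suc k + 2) * (max 0 x) ^ (Suc k + 1)"
    by (cases "0 \<le> x") (simp_all add: max_def algebra_simps)
  moreover have "(\<lambda>x::real. x * (max 0 x) ^ (k + 2)) = (\<lambda>x. (max 0 x) ^ (Suc k + 2))"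
    by (intro ext) (simp add: max_def)
  ultimately show ?case by simp
qed

context half_interval
begin

text \<open>A cut-off of finite smoothness takes the place of a bump function. It vanishes from c
  on, and for positive c its value at 0 is not zero, which is all that the construction of functions
  with prescribed data asks for.\<close>

lemma cutoff_Ck: "Ck_on k \<Delta> (\<lambda>t. (max 0 (c - t)) ^ (k + 1) :: real)"
proof (induction k)
  case 0
  show ?case by (auto intro!: continuous_intros)
next
  case (Suc k)
  have "((\<lambda>t. (max 0 (c - t)) ^ (k + 2)) has_vector_derivative - real (k + 2) *\<^sub>R (max 0 (c - t)) ^ (k + 1)) (at t within \<Delta>)" for t
  proof -
    have "((\<lambda>t. (max 0 (c - t)) ^ (k + 2)) has_real_derivative (real (k + 2) * (max 0 (c - t)) ^ (k + 1)) * (0 - 1)) (at t within \<Delta>)"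
      by (rule DERIV_chain2[OF max_zero_power_derivative]) (intro derivative_intros)
    then show ?thesis by (simp add: has_real_derivative_iff_has_vector_derivative algebra_simps)
  qed
  note d = this
  have "Ck_off \<Delta> \<Delta> k (\<lambda>t. - real (k + 2) *\<^sub>R (max 0 (c - t)) ^ (k + 1))"
    by (rule Ck_off_linear[OF bounded_linear_scaleR_right Suc[unfolded Ck_on_eq_Ck_off]])
  then have "Ck_off \<Delta> \<Delta> (Suc k) (\<lambda>t. (max 0 (c - t)) ^ (k + 2))" by (rule Ck_off_SucI[OF d])
  moreover have "k + 2 = Suc k + 1" by simp
  ultimately show ?case by (simp only: Ck_on_eq_Ck_off)
qed

lemma id_Ck_off: "Ck_off N \<Delta> k (\<lambda>t. t)"
proof (cases k)
  case (Suc j)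
  show ?thesis unfolding Suc by (rule Ck_off_SucI[OF has_vector_derivative_id Ck_off_const])
qed simp

lemma power_times_Ck_off:
  fixes f :: "real \<Rightarrow> 'v::real_normed_vector"
  shows "Ck_off N \<Delta> k f \<Longrightarrow> Ck_off N \<Delta> k (\<lambda>t. t ^ r *\<^sub>R f t)"
proof (induction r)
  case (Suc r)
  show ?case
    using Ck_off_bilinear[OF bounded_bilinear_scaleR id_Ck_off Suc.IH[OF Suc.prems]] by simp
qed simp

text \<open>The derivative of t^(r+1) f is (r+1) t^r f + t^r g with g = t f', so the induction
  applies to f and to g. As g vanishes at 0, it does not contribute to the leading value.\<close>

lemma Dpow_power_times_zero:
  fixes f :: "real \<Rightarrow> 'v::real_normed_vector"
  shows "Ck_on r \<Delta> f \<Longrightarrow> (\<forall>j<r. Dpow \<Delta> j (\<lambda>t. t ^ r *\<^sub>R f t) 0 = 0) \<and> Dpow \<Delta> r (\<lambda>t. t ^ r *\<^sub>R f t) 0 = fact r *\<^sub>R f 0"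
proof (induction r arbitrary: f)
  case (Suc r)
  have f: "Ck_off \<Delta> \<Delta> (Suc r) f" "Ck_off \<Delta> \<Delta> r f" "Ck_off \<Delta> \<Delta> r (deriv_on \<Delta> f)"
    using Suc.prems Ck_off_Suc_lower by (auto simp: Ck_on_eq_Ck_off)
  define g where "g t = t *\<^sub>R deriv_on \<Delta> f t" for t
  have g: "Ck_off \<Delta> \<Delta> r g" unfolding g_def by (rule Ck_off_bilinear[OF bounded_bilinear_scaleR id_Ck_off f(3)])
  have d: "deriv_on \<Delta> (\<lambda>t. t ^ Suc r *\<^sub>R f t) t = real (Suc r) *\<^sub>R (t ^ r *\<^sub>R f t) + t ^ r *\<^sub>R g t" if t: "t \<in> \<Delta>" for t
  proof (rule deriv_on_eqI[OF _ t])
    have "((\<lambda>t. t ^ Suc r) has_vector_derivative real (Suc r) * t ^ r) (at t within \<Delta>)"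
      unfolding has_real_derivative_iff_has_vector_derivative[symmetric]
      by (rule DERIV_cong[OF DERIV_pow]) simp
    then have "((\<lambda>t. t ^ Suc r *\<^sub>R f t) has_vector_derivative
        t ^ Suc r *\<^sub>R deriv_on \<Delta> f t + (real (Suc r) * t ^ r) *\<^sub>R f t) (at t within \<Delta>)"
      by (rule has_vector_derivative_scaleR[unfolded has_real_derivative_iff_has_vector_derivative])
        (rule has_deriv_on'[OF _ t], use Suc.prems in simp)
    then show "((\<lambda>t. t ^ Suc r *\<^sub>R f t) has_vector_derivative real (Suc r) *\<^sub>R (t ^ r *\<^sub>R f t) + t ^ r *\<^sub>R g t) (at t within \<Delta>)"
      by (simp add: g_def add.commute mult.commute del: of_nat_Suc)
  qed
  have step: "Dpow \<Delta> (Suc j) (\<lambda>t. t ^ Suc r *\<^sub>R f t) 0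
      = real (Suc r) *\<^sub>R Dpow \<Delta> j (\<lambda>t. t ^ r *\<^sub>R f t) 0 + Dpow \<Delta> j (\<lambda>t. t ^ r *\<^sub>R g t) 0" if "j \<le> r" for j
  proof -
    have "Dpow \<Delta> (Suc j) (\<lambda>t. t ^ Suc r *\<^sub>R f t) 0 = Dpow \<Delta> j (\<lambda>t. real (Suc r) *\<^sub>R (t ^ r *\<^sub>R f t) + t ^ r *\<^sub>R g t) 0"
      unfolding Dpow_Suc' by (rule Dpow_cong[OF d zero_mem])
    also have "\<dots> = Dpow \<Delta> j (\<lambda>t. real (Suc r) *\<^sub>R (t ^ r *\<^sub>R f t)) 0 + Dpow \<Delta> j (\<lambda>t. t ^ r *\<^sub>R g t) 0"
      by (rule Dpow_plus[OF Ck_off_linear[OF bounded_linear_scaleR_right power_times_Ck_off[OF f(2)]] power_times_Ck_off[OF g] zero_mem])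
        (use that in simp)
    also have "Dpow \<Delta> j (\<lambda>t. real (Suc r) *\<^sub>R (t ^ r *\<^sub>R f t)) 0 = real (Suc r) *\<^sub>R Dpow \<Delta> j (\<lambda>t. t ^ r *\<^sub>R f t) 0"
      by (rule Dpow_linear[OF bounded_linear_scaleR_right power_times_Ck_off[OF f(2)] zero_mem]) (use that in simp)
    finally show ?thesis .
  qed
  have IHf: "\<And>j. j < r \<Longrightarrow> Dpow \<Delta> j (\<lambda>t. t ^ r *\<^sub>R f t) 0 = 0" "Dpow \<Delta> r (\<lambda>t. t ^ r *\<^sub>R f t) 0 = fact r *\<^sub>R f 0"
    and IHg: "\<And>j. j < r \<Longrightarrow> Dpow \<Delta> j (\<lambda>t. t ^ r *\<^sub>R g t) 0 = 0" "Dpow \<Delta> r (\<lambda>t. t ^ r *\<^sub>R g t) 0 = fact r *\<^sub>R g 0"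
    using Suc.IH[of f] Suc.IH[of g] f g by (auto simp: Ck_on_eq_Ck_off)
  show ?case
  proof (intro conjI allI impI)
    fix j assume j: "j < Suc r"
    show "Dpow \<Delta> j (\<lambda>t. t ^ Suc r *\<^sub>R f t) 0 = 0"
    proof (cases j)
      case (Suc i)
      then show ?thesis using step[of i] IHf(1)[of i] IHg(1)[of i] j by simp
    qed simp
  next
    show "Dpow \<Delta> (Suc r) (\<lambda>t. t ^ Suc r *\<^sub>R f t) 0 = fact (Suc r) *\<^sub>R f 0"
      using step[of r] IHf(2) IHg(2) by (simp add: g_def del: funpow.simps)
  qed
qed simp

text \<open>In Leibniz' formula every term in which A is differentiated contains a derivative of f
  of order below j, and these vanish at 0.\<close>

lemma Dpow_bilinear_zero:
  assumes B: "bounded_bilinear B"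
  shows "Ck_on k \<Delta> A \<Longrightarrow> Ck_on k \<Delta> f \<Longrightarrow> (\<And>i. i < k \<Longrightarrow> Dpow \<Delta> i f 0 = 0) \<Longrightarrow>
    j \<le> k \<Longrightarrow> Dpow \<Delta> j (\<lambda>t. B (A t) (f t)) 0 = B (A 0) (Dpow \<Delta> j f 0)"
proof (induction k arbitrary: A f j)
  case (Suc k)
  have A': "Ck_off \<Delta> \<Delta> (Suc k) A" and f': "Ck_off \<Delta> \<Delta> (Suc k) f"
    using Suc.prems(1,2) by (simp_all only: Ck_on_eq_Ck_off)
  have A: "Ck_off \<Delta> \<Delta> k A" "Ck_off \<Delta> \<Delta> k (deriv_on \<Delta> A)" "A differentiable_on \<Delta>"
    using Ck_off_Suc_lower[OF A'] A' by simp_all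
  have f: "Ck_off \<Delta> \<Delta> k f" "Ck_off \<Delta> \<Delta> k (deriv_on \<Delta> f)" "f differentiable_on \<Delta>"
    using Ck_off_Suc_lower[OF f'] f' by simp_all
  interpret B: bounded_bilinear B by fact
  show ?case
  proof (cases j)
    case (Suc i)
    have i: "i \<le> k" using Suc Suc.prems by simp
    have "Dpow \<Delta> j (\<lambda>t. B (A t) (f t)) 0 = Dpow \<Delta> i (\<lambda>t. B (A t) (deriv_on \<Delta> f t) + B (deriv_on \<Delta> A t) (f t)) 0"
      unfolding Suc Dpow_Suc'
      by (rule Dpow_cong[OF _ zero_mem], rule deriv_on_eqI)
        (intro B.has_vector_derivative has_deriv_on' A f)
    also have "\<dots> = Dpow \<Delta> i (\<lambda>t. B (A t) (deriv_on \<Delta> f t)) 0 + Dpow \<Delta> i (\<lambda>t. B (deriv_on \<Delta> A t) (f t)) 0"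
      by (rule Dpow_plus[OF Ck_off_bilinear[OF B A(1) f(2)] Ck_off_bilinear[OF B A(2) f(1)] zero_mem]) (use i in simp)
    also have "Dpow \<Delta> i (\<lambda>t. B (A t) (deriv_on \<Delta> f t)) 0 = B (A 0) (Dpow \<Delta> i (deriv_on \<Delta> f) 0)"
    proof (rule Suc.IH[OF _ _ _ i])
      show "Dpow \<Delta> l (deriv_on \<Delta> f) 0 = 0" if "l < k" for l
        using Suc.prems(3)[of "Suc l"] that unfolding Dpow_Suc' by simp
    qed (use A f in \<open>simp_all add: Ck_on_eq_Ck_off\<close>)
    also have "Dpow \<Delta> i (\<lambda>t. B (deriv_on \<Delta> A t) (f t)) 0 = B (deriv_on \<Delta> A 0) (Dpow \<Delta> i f 0)"
      by (rule Suc.IH[OF _ _ Suc.prems(3) i]) (use A f in \<open>simp_all add: Ck_on_eq_Ck_off\<close>)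
    also have "Dpow \<Delta> i f 0 = 0" using Suc.prems(3) i by simp
    finally show ?thesis unfolding Suc Dpow_Suc' by (simp add: B.zero_right)
  qed simp
qed simp

end

context quasi_coefficients
begin

text \<open>At 0 the lower terms contain only derivatives of y of order below r. Every step of the
  recursion therefore acts as - D, which leaves the factor p_0 and the sign (-1)^m in front of the
  first derivative that does not vanish. The statement about the intermediate derivatives carries
  the induction.\<close>

lemma uq_at_zero:
  fixes y :: "real \<Rightarrow> 'v::real_normed_vector"
  assumes act: "action act" and y: "Ck_on (2 * n) \<Delta> y" and van: "\<And>i. i < r \<Longrightarrow> Dpow \<Delta> i y 0 = 0"
    and r: "n \<le> r" "r < 2 * n"
  shows "n + m \<le> r \<Longrightarrow> (\<forall>i < r - n - m. Dpow \<Delta> i (uq act m y) 0 = 0) \<and>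
     Dpow \<Delta> (r - n - m) (uq act m y) 0 = (-1) ^ m *\<^sub>R act (p 0 0) (Dpow \<Delta> r y 0)"
proof (induction m)
  have B: "bounded_bilinear act" using act by (simp add: action_def)
  interpret B: bounded_bilinear act by fact
  have yC: "Ck_off \<Delta> \<Delta> (2 * n) y" using y by (simp add: Ck_on_eq_Ck_off)
  have DC: "Ck_off \<Delta> \<Delta> k (Dpow \<Delta> j y)" if "j + k \<le> 2 * n" for j k by (rule Ck_off_Dpow'[OF yC that])
  have Dv: "Dpow \<Delta> i (Dpow \<Delta> j y) 0 = 0" if "i + j < r" for i j
    using van[OF that] by (simp add: Dpow_add)
  have cv: "Dpow \<Delta> i (\<lambda>t. act (A t) (Dpow \<Delta> j y t)) 0 = act (A 0) (Dpow \<Delta> (i + j) y 0)"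
    if "Ck_off \<Delta> \<Delta> i A" "i + j \<le> r" for A i j
    unfolding Dpow_add
    by (rule Dpow_bilinear_zero[OF B _ _ _ order_refl])
      (use that r DC[of j i] Dv[of _ j] in \<open>auto simp: Ck_on_eq_Ck_off\<close>)
  have h: "bounded_linear (act A)" for A by (rule bounded_linear_act[OF act])
  {
    case 0
    have val: "Dpow \<Delta> i (uq act 0 y) 0 = act (p 0 0) (Dpow \<Delta> (i + n) y 0)" if i: "i \<le> r - n" for i
    proof -
      have pC: "Ck_off \<Delta> \<Delta> i (p 0)" "Ck_off \<Delta> \<Delta> i (q 0)" using i r n_pos
        by (auto intro!: Ck_off_lower[OF coefficient_Ck_off(1)[of n 0 \<Delta>]] Ck_off_lower[OF coefficient_Ck_off(2)[of n 0 \<Delta>]])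
      have C: "Ck_off \<Delta> \<Delta> i (\<lambda>t. act (p 0 t) (Dpow \<Delta> n y t))" "Ck_off \<Delta> \<Delta> i (\<lambda>t. act (q 0 t) (Dpow \<Delta> (n - 1) y t))"
        using i r by (auto intro!: Ck_off_act[OF act] pC DC)
      have "Dpow \<Delta> i (uq act 0 y) 0 = Dpow \<Delta> i (\<lambda>t. act (p 0 t) (Dpow \<Delta> n y t) + - act (scalar_op (\<i> / 2)) (act (q 0 t) (Dpow \<Delta> (n - 1) y t))) 0"
        by simp
      also have "\<dots> = Dpow \<Delta> i (\<lambda>t. act (p 0 t) (Dpow \<Delta> n y t)) 0 + Dpow \<Delta> i (\<lambda>t. - act (scalar_op (\<i> / 2)) (act (q 0 t) (Dpow \<Delta> (n - 1) y t))) 0"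
        by (rule Dpow_plus[OF C(1) Ck_off_minus[OF Ck_off_linear[OF h C(2)]] zero_mem]) simp
      also have "Dpow \<Delta> i (\<lambda>t. - act (scalar_op (\<i> / 2)) (act (q 0 t) (Dpow \<Delta> (n - 1) y t))) 0
          = - act (scalar_op (\<i> / 2)) (Dpow \<Delta> i (\<lambda>t. act (q 0 t) (Dpow \<Delta> (n - 1) y t)) 0)"
        by (rule Dpow_linear[OF bounded_linear_minus[OF h] C(2) zero_mem]) simp
      also have "Dpow \<Delta> i (\<lambda>t. act (q 0 t) (Dpow \<Delta> (n - 1) y t)) 0 = act (q 0 0) (Dpow \<Delta> (i + (n - 1)) y 0)"
        by (rule cv[OF pC(2)]) (use i r in arith)
      also have "Dpow \<Delta> (i + (n - 1)) y 0 = 0" by (rule van) (use i r n_pos in linarith)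
      also have "Dpow \<Delta> i (\<lambda>t. act (p 0 t) (Dpow \<Delta> n y t)) 0 = act (p 0 0) (Dpow \<Delta> (i + n) y 0)"
        by (rule cv[OF pC(1)]) (use i r in arith)
      finally show ?thesis by (simp add: B.zero_right)
    qed
    show ?case using val van 0 by (auto simp: B.zero_right simp del: upper_quasi_deriv.simps)
  next
    case (Suc m)
    have m: "m < n" using Suc.prems r by simp
    have IH: "\<And>i. i < r - n - m \<Longrightarrow> Dpow \<Delta> i (uq act m y) 0 = 0"
      "Dpow \<Delta> (r - n - m) (uq act m y) 0 = (-1) ^ m *\<^sub>R act (p 0 0) (Dpow \<Delta> r y 0)"
      using Suc.IH Suc.prems by auto
    have uC: "Ck_off \<Delta> \<Delta> (n - m) (uq act m y)"
      using uq_Ck_off[OF act, of \<Delta> n y m] yC m by (simp add: mult_2)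
    \<comment> \<open>Only D^j y with j \<le> n occurs in the lower terms; after at most r - n - m -
      1 further differentiations the order is still below r.\<close>
    have lowz: "Dpow \<Delta> i (lower_terms act m y) 0 = 0" if i: "i \<le> r - n - Suc m" for i
    proof -
      have ir: "i + Suc m \<le> n" "i + Suc m \<le> r - n" using i Suc.prems r by auto
      have C1: "Ck_off \<Delta> \<Delta> i (p (Suc m))" using ir by (auto intro!: Ck_off_lower[OF coefficient_Ck_off(1)[of "n - Suc m" "Suc m" \<Delta>]])
      have C2: "Ck_off \<Delta> \<Delta> i (\<lambda>t. adjoint_op (q m t))" using ir m by (auto intro!: Ck_off_lower[OF coefficient_Ck_off(3)[of "n - m" m \<Delta>]])
      have C3: "Ck_off \<Delta> \<Delta> i (q (Suc m))" if "Suc m < n" using ir that by (auto intro!: Ck_off_lower[OF coefficient_Ck_off(2)[of "n - Suc m" "Suc m" \<Delta>]])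
      have z: "Dpow \<Delta> i (\<lambda>t. act (A t) (Dpow \<Delta> j y t)) 0 = 0" if "Ck_off \<Delta> \<Delta> i A" "j \<le> n" for A j
        using cv[OF that(1), of j] van[of "i + j"] ir that r by (simp add: B.zero_right)
      have T: "Ck_off \<Delta> \<Delta> i (\<lambda>t. act (A t) (Dpow \<Delta> j y t))" if "Ck_off \<Delta> \<Delta> i A" "j \<le> n" for A j
        using ir that by (intro Ck_off_act[OF act] DC) auto
      define u where "u t = (if Suc m < n then act (q (Suc m) t) (Dpow \<Delta> (n - Suc m - 1) y t) else 0)" for t
      have ue: "u = (if Suc m < n then \<lambda>t. act (q (Suc m) t) (Dpow \<Delta> (n - Suc m - 1) y t) else (\<lambda>t. 0))"
        by (auto simp: u_def)
      have zero: "Dpow \<Delta> i (\<lambda>t. 0 :: 'v) 0 = 0"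
        using Dpow_linear[OF bounded_linear_zero[where 'a = real and 'b = 'v] id_Ck_off[of \<Delta> i] zero_mem, of i] by simp
      have u: "Ck_off \<Delta> \<Delta> i u" "Dpow \<Delta> i u 0 = 0"
        unfolding ue using T[OF C3, of "n - Suc m - 1"] z[OF C3, of "n - Suc m - 1"] zero
        by (auto simp: Ck_off_const simp del: funpow.simps)
      define v where "v t = act (adjoint_op (q m t)) (Dpow \<Delta> (n - m) y t) + - u t" for t
      have v: "Ck_off \<Delta> \<Delta> i v" "Dpow \<Delta> i v 0 = 0"
      proof -
        show "Ck_off \<Delta> \<Delta> i v" unfolding v_def using T[OF C2, of "n - m"] u by (intro Ck_off_add Ck_off_minus) auto
        have "Dpow \<Delta> i v 0 = Dpow \<Delta> i (\<lambda>t. act (adjoint_op (q m t)) (Dpow \<Delta> (n - m) y t)) 0 + Dpow \<Delta> i (\<lambda>t. - u t) 0"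
          unfolding v_def by (rule Dpow_plus[OF T[OF C2] Ck_off_minus[OF u(1)] zero_mem]) auto
        also have "Dpow \<Delta> i (\<lambda>t. - u t) 0 = - Dpow \<Delta> i u 0"
          by (rule Dpow_linear[OF bounded_linear_minus[OF bounded_linear_ident] u(1) zero_mem]) simp
        finally show "Dpow \<Delta> i v 0 = 0" using z[OF C2, of "n - m"] u by simp
      qed
      have "lower_terms act m y = (\<lambda>t. act (p (Suc m) t) (Dpow \<Delta> (n - Suc m) y t) + act (scalar_op (\<i> / 2)) (v t))"
        by (auto simp: lower_terms_def v_def u_def fun_eq_iff)
      then have "Dpow \<Delta> i (lower_terms act m y) 0
          = Dpow \<Delta> i (\<lambda>t. act (p (Suc m) t) (Dpow \<Delta> (n - Suc m) y t)) 0 + Dpow \<Delta> i (\<lambda>t. act (scalar_op (\<i> / 2)) (v t)) 0"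
        using Dpow_plus[OF T[OF C1, of "n - Suc m"] Ck_off_linear[OF h v(1)] zero_mem, of i] by simp
      also have "Dpow \<Delta> i (\<lambda>t. act (scalar_op (\<i> / 2)) (v t)) 0 = act (scalar_op (\<i> / 2)) (Dpow \<Delta> i v 0)"
        by (rule Dpow_linear[OF h v(1) zero_mem]) simp
      finally show ?thesis using z[OF C1, of "n - Suc m"] v by (simp add: B.zero_right)
    qed
    have lC: "Ck_off \<Delta> \<Delta> (n - Suc m) (lower_terms act m y)"
      by (rule lower_terms_Ck_off[OF act m Ck_off_lower[OF yC]]) (use m in auto)
    have val: "Dpow \<Delta> i (uq act (Suc m) y) 0 = - Dpow \<Delta> (Suc i) (uq act m y) 0" if i: "i \<le> r - n - Suc m" for i
    proof -
      have in': "i \<le> n - Suc m" using i r by simp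
      have dC: "Ck_off \<Delta> \<Delta> (n - Suc m) (deriv_on \<Delta> (uq act m y))"
        using uC m by (cases "n - m") (auto simp flip: Suc_diff_Suc)
      have "Dpow \<Delta> i (uq act (Suc m) y) 0 = Dpow \<Delta> i (\<lambda>t. - deriv_on \<Delta> (uq act m y) t + lower_terms act m y t) 0"
        by (rule Dpow_cong[OF uq_Suc[OF m] zero_mem])
      also have "\<dots> = Dpow \<Delta> i (\<lambda>t. - deriv_on \<Delta> (uq act m y) t) 0 + Dpow \<Delta> i (lower_terms act m y) 0"
        by (rule Dpow_plus[OF Ck_off_minus[OF dC] lC zero_mem]) (use in' in simp)
      also have "Dpow \<Delta> i (\<lambda>t. - deriv_on \<Delta> (uq act m y) t) 0 = - Dpow \<Delta> i (deriv_on \<Delta> (uq act m y)) 0"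
        by (rule Dpow_linear[OF bounded_linear_minus[OF bounded_linear_ident] dC zero_mem]) (use in' in simp)
      finally show ?thesis using lowz[OF i] unfolding Dpow_Suc' by simp
    qed
    show ?case
    proof (intro conjI allI impI)
      show "Dpow \<Delta> i (uq act (Suc m) y) 0 = 0" if "i < r - n - Suc m" for i
        using val[of i] IH(1)[of "Suc i"] that by (simp del: upper_quasi_deriv.simps funpow.simps)
      have "Suc (r - n - Suc m) = r - n - m" using Suc.prems by simp
      then show "Dpow \<Delta> (r - n - Suc m) (uq act (Suc m) y) 0 = (- 1) ^ Suc m *\<^sub>R act (p 0 0) (Dpow \<Delta> r y 0)"
        using val[of "r - n - Suc m"] IH(2) by (simp del: upper_quasi_deriv.simps funpow.simps)
    qed
  }
qed

lemma qd_at_zero: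
  assumes act: "action act" and y: "Ck_on (2 * n) \<Delta> y" and van: "\<And>i. i < r \<Longrightarrow> Dpow \<Delta> i y 0 = 0"
    and r: "r < 2 * n"
  shows "\<And>j. j < r \<Longrightarrow> qd act j y 0 = 0"
    and "qd act r y 0 = (if r < n then Dpow \<Delta> r y 0 else (-1) ^ (r - n) *\<^sub>R act (p 0 0) (Dpow \<Delta> r y 0))"
proof -
  show "qd act j y 0 = 0" if "j < r" for j
  proof (cases "j < n")
    case False
    then have "0 < r - n - (j - n)" "n \<le> r" "n + (j - n) \<le> r" using that by auto
    then have "Dpow \<Delta> 0 (uq act (j - n) y) 0 = 0"
      using uq_at_zero[OF act y van _ r, where m = "j - n"] by blast
    then show ?thesis using False by (simp add: quasi_deriv_def)
  qed (use van that in \<open>simp add: quasi_deriv_def\<close>)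
  show "qd act r y 0 = (if r < n then Dpow \<Delta> r y 0 else (-1) ^ (r - n) *\<^sub>R act (p 0 0) (Dpow \<Delta> r y 0))"
  proof (cases "r < n")
    case False
    then have "n \<le> r" "n + (r - n) \<le> r" by auto
    then show ?thesis using uq_at_zero[OF act y van _ r, where m = "r - n"] False by (simp add: quasi_deriv_def)
  qed (simp add: quasi_deriv_def)
qed

text \<open>
  The functions $t^r (c - t)_+^{2n+1}$ have triangular quasi-derivative data at \<open>0\<close>; eliminating
  from the last order downwards yields operator functions with unit data.
\<close>

lemma steering_function:
  assumes c: "c > 0" and m: "m < 2 * n"
  shows "\<exists>W :: real \<Rightarrow> 'h \<Rightarrow>\<^sub>L 'h. Ck_on (2 * n) \<Delta> W \<and> (\<forall>t. c \<le> t \<longrightarrow> W t = 0) \<and>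
     (\<forall>j<2 * n. qd (o\<^sub>L) j W 0 = (if j = m then id_blinfun else 0))"
proof -
  have act: "action ((o\<^sub>L) :: 'h \<Rightarrow>\<^sub>L 'h \<Rightarrow> 'h \<Rightarrow>\<^sub>L 'h \<Rightarrow> 'h \<Rightarrow>\<^sub>L 'h)" by (rule action_compose)
  let ?P = "\<lambda>m W. Ck_on (2 * n) \<Delta> W \<and> (\<forall>t. c \<le> t \<longrightarrow> W t = 0) \<and>
     (\<forall>j<2 * n. qd (o\<^sub>L) j W 0 = (if j = m then id_blinfun else 0 :: 'h \<Rightarrow>\<^sub>L 'h))"
  have lin: "qd (o\<^sub>L) j (\<lambda>t. W t o\<^sub>L B) 0 = qd (o\<^sub>L) j W 0 o\<^sub>L B"
    if W: "Ck_on (2 * n) \<Delta> W" and j: "j < 2 * n" for W :: "real \<Rightarrow> 'h \<Rightarrow>\<^sub>L 'h" and B :: "'h \<Rightarrow>\<^sub>L 'h" and j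
  proof (rule quasi_regular_linear(2)[where L = "\<lambda>A. A o\<^sub>L B", OF act act _ _ quasi_regular_if_Ck[OF act W] zero_mem j])
    show "bounded_linear (\<lambda>A. A o\<^sub>L B)"
      by (rule bounded_bilinear.bounded_linear_left[OF bounded_bilinear_blinfun_compose])
  qed (auto intro: blinfun_eqI)
  have plus: "qd (o\<^sub>L) j (\<lambda>t. W t + V t) 0 = qd (o\<^sub>L) j W 0 + qd (o\<^sub>L) j V 0"
    if "Ck_on (2 * n) \<Delta> W" "Ck_on (2 * n) \<Delta> V" "j < 2 * n" for W V :: "real \<Rightarrow> 'h \<Rightarrow>\<^sub>L 'h" and j
    by (rule quasi_regular_plus(2)[OF act quasi_regular_if_Ck[OF act that(1)] quasi_regular_if_Ck[OF act that(2)] zero_mem that(3)])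
  have compC: "Ck_on (2 * n) \<Delta> (\<lambda>t. W t o\<^sub>L B)" if "Ck_on (2 * n) \<Delta> W" for W :: "real \<Rightarrow> 'h \<Rightarrow>\<^sub>L 'h" and B :: "'h \<Rightarrow>\<^sub>L 'h"
    using Ck_off_linear[OF bounded_bilinear.bounded_linear_left[OF bounded_bilinear_blinfun_compose]] that
    by (simp add: Ck_on_eq_Ck_off)
  have "\<forall>m. 2 * n - k \<le> m \<and> m < 2 * n \<longrightarrow> (\<exists>W. ?P m W)" if "k \<le> 2 * n" for k
    using that
  proof (induction k)
    case (Suc k)
    define r where "r = 2 * n - Suc k"
    have r: "r < 2 * n" using Suc.prems by (simp add: r_def)
    have IH: "\<exists>W. ?P m W" if "r < m" "m < 2 * n" for m using Suc that by (auto simp: r_def)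
    then obtain V where V: "\<And>m. r < m \<Longrightarrow> m < 2 * n \<Longrightarrow> ?P m (V m)" by metis
    define f where "f t = (max 0 (c - t)) ^ (2 * n + 1) *\<^sub>R (id_blinfun :: 'h \<Rightarrow>\<^sub>L 'h)" for t
    have f: "Ck_on (2 * n) \<Delta> f"
      using Ck_off_linear[OF bounded_linear_scaleR_left] cutoff_Ck[of "2 * n" c] unfolding f_def Ck_on_eq_Ck_off by blast
    define E where "E t = t ^ r *\<^sub>R f t" for t
    have E: "Ck_on (2 * n) \<Delta> E"
      using power_times_Ck_off f unfolding E_def Ck_on_eq_Ck_off by blast
    have fr: "Ck_on r \<Delta> f" using Ck_on_lower[OF f] r by simp
    have van: "\<And>i. i < r \<Longrightarrow> Dpow \<Delta> i E 0 = 0" and top: "Dpow \<Delta> r E 0 = (fact r * c ^ (2 * n + 1)) *\<^sub>R id_blinfun"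
      using Dpow_power_times_zero[OF fr] c unfolding E_def by (auto simp: f_def)
    define d where "d j = qd (o\<^sub>L) j E 0" for j
    have d0: "d j = 0" if "j < r" for j unfolding d_def by (rule qd_at_zero(1)[OF act E van r that])
    \<comment> \<open>The diagonal entry is a nonzero multiple of the identity below order n and, up
      to sign, of p_0 at 0 from order n on. Both have a right inverse.\<close>
    obtain R where R: "d r o\<^sub>L R = id_blinfun"
    proof -
      define s where "s = fact r * c ^ (2 * n + 1)"
      have s: "s \<noteq> 0" using c by (simp add: s_def)
      have dr: "d r = (if r < n then s *\<^sub>R id_blinfun else (-1) ^ (r - n) *\<^sub>R (p 0 0 o\<^sub>L s *\<^sub>R id_blinfun))"
        unfolding d_def using qd_at_zero(2)[OF act E van r] by (simp add: top s_def)
      show ?thesis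
      proof (cases "r < n")
        case True
        then have "d r o\<^sub>L inverse s *\<^sub>R id_blinfun = id_blinfun"
          using s by (intro blinfun_eqI) (simp add: dr blinfun.scaleR_left)
        then show ?thesis by (rule that)
      next
        case False
        have "p 0 0 (p0inv 0 x) = x" for x
          using p0inv(2)[OF zero_mem] by (metis blinfun_apply_blinfun_compose blinfun_apply_id_blinfun)
        moreover have "(-1) ^ (r - n) * ((-1) ^ (r - n) :: real) = 1" by (simp flip: power_mult_distrib)
        moreover from this have "(- 1) ^ (r - n) * inverse s * (- 1) ^ (r - n) * s = 1"
          using s by (simp add: mult.commute mult.left_commute)
        ultimately have "d r o\<^sub>L ((-1) ^ (r - n) * inverse s) *\<^sub>R p0inv 0 = id_blinfun"
          using s False by (intro blinfun_eqI) (simp add: dr blinfun.scaleR_left blinfun.scaleR_right mult.assoc[symmetric])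
        then show ?thesis by (rule that)
      qed
    qed
    \<comment> \<open>The entries above the diagonal are removed one at a time with the functions
      \<open>V\<close> of higher order, i counting those already removed. Each \<open>V l\<close>
      has data in position l only and leaves the others unchanged.\<close>
    have "\<exists>W. Ck_on (2 * n) \<Delta> W \<and> (\<forall>t. c \<le> t \<longrightarrow> W t = 0) \<and>
        (\<forall>j<2 * n. qd (o\<^sub>L) j W 0 = (if j \<le> r \<or> r + i < j then d j else 0))" if "r + i < 2 * n" for i
      using that
    proof (induction i)
      case 0
      show ?case
      proof (intro exI[of _ E] conjI E)
        show "\<forall>t. c \<le> t \<longrightarrow> E t = 0" by (auto simp: E_def f_def)
      qed (auto simp: d_def)
    next
      case (Suc i)
      then obtain W where W: "Ck_on (2 * n) \<Delta> W" "\<forall>t. c \<le> t \<longrightarrow> W t = 0"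
        "\<And>j. j < 2 * n \<Longrightarrow> qd (o\<^sub>L) j W 0 = (if j \<le> r \<or> r + i < j then d j else 0)" by auto
      define l where "l = Suc (r + i)"
      have l: "?P l (V l)" using V[of l] Suc.prems by (simp add: l_def)
      let ?U = "\<lambda>t. W t + (V l t o\<^sub>L (- d l))"
      have UC: "Ck_on (2 * n) \<Delta> ?U"
        using Ck_off_add[of \<Delta> "2 * n" W "\<lambda>t. V l t o\<^sub>L (- d l)"] W(1) compC[of "V l" "- d l"] l
        by (simp add: Ck_on_eq_Ck_off)
      have "qd (o\<^sub>L) j ?U 0 = (if j \<le> r \<or> r + Suc i < j then d j else 0)" if j: "j < 2 * n" for j
      proof -
        have "qd (o\<^sub>L) j ?U 0 = qd (o\<^sub>L) j W 0 + (qd (o\<^sub>L) j (V l) 0 o\<^sub>L (- d l))"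
          using plus[OF W(1) compC j, of "V l" "- d l"] lin[of "V l" j "- d l"] l j by simp
        also have "\<dots> = (if j \<le> r \<or> r + i < j then d j else 0) + (if j = l then - d l else 0)"
          using W(3)[OF j] l j by (auto intro!: blinfun_eqI)
        also have "\<dots> = (if j \<le> r \<or> r + Suc i < j then d j else 0)"
          by (auto simp: l_def)
        finally show ?thesis .
      qed
      moreover have "\<forall>t. c \<le> t \<longrightarrow> ?U t = 0" using W(2) l by (auto intro!: blinfun_eqI)
      ultimately show ?case using UC by blast
    qed
    from this[of "2 * n - 1 - r"] r obtain W where W: "Ck_on (2 * n) \<Delta> W" "\<forall>t. c \<le> t \<longrightarrow> W t = 0"
      "\<And>j. j < 2 * n \<Longrightarrow> qd (o\<^sub>L) j W 0 = (if j \<le> r \<or> r + (2 * n - 1 - r) < j then d j else 0)" by auto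
    have "?P r (\<lambda>t. W t o\<^sub>L R)"
    proof (intro conjI allI impI compC W(1))
      show "W t o\<^sub>L R = 0" if "c \<le> t" for t using W(2) that by (auto intro!: blinfun_eqI)
      fix j assume j: "j < 2 * n"
      have "qd (o\<^sub>L) j W 0 = (if j = r then d r else 0)"
        using W(3)[OF j] d0[of j] j by auto
      then show "qd (o\<^sub>L) j (\<lambda>t. W t o\<^sub>L R) 0 = (if j = r then id_blinfun else 0)"
        unfolding lin[OF W(1) j] using R by (auto intro!: blinfun_eqI)
    qed
    then have "\<exists>W. ?P r W" by blast
    moreover have "m = r \<or> r < m" if "2 * n - Suc k \<le> m" for m using that by (auto simp: r_def)
    ultimately show ?case using IH by blast
  qed auto
  from this[of "2 * n"] m show ?thesis by auto
qed

end

section \<open>The equation as a first-order system\<close>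

lemma pos_strict_mono: "i < k \<Longrightarrow> pos i < pos (k :: 'n::{finite, linorder})"
  unfolding pos_def by (rule psubset_card_mono) (auto simp: psubset_eq)

lemma inj_pos: "inj (pos :: 'n::{finite, linorder} \<Rightarrow> nat)"
  by (rule linorder_injI) (metis pos_strict_mono less_irrefl)

lemma pos_less: "pos (i :: 'n::{finite, linorder}) < CARD('n)"
  unfolding pos_def by (rule psubset_card_mono) auto

lemma range_pos: "range (pos :: 'n::{finite, linorder} \<Rightarrow> nat) = {..<CARD('n)}"
  by (rule card_subset_eq) (auto simp: pos_less card_image[OF inj_pos])

lemma sum_pos: "(\<Sum>i\<in>(UNIV :: 'n::{finite, linorder} set). f (pos i)) = (\<Sum>j<CARD('n). f j)"
  unfolding range_pos[where 'n = 'n, symmetric] by (rule sum.reindex[OF inj_pos, symmetric, unfolded comp_def])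

lemma pos_inv: "j < CARD('n) \<Longrightarrow> pos (inv pos j :: 'n::{finite, linorder}) = j"
  using f_inv_into_f[of j "pos :: 'n \<Rightarrow> nat" UNIV] by (simp add: range_pos)

lemma inv_pos [simp]: "inv pos (pos i) = (i :: 'n::{finite, linorder})"
  by (rule inv_f_f[OF inj_pos])

text \<open>Reads a pair of columns as one list ordered by the order of the quasi-derivative. The
  second column is stored in descending order, hence the reflected index.\<close>

definition state_comp :: "('h, 'n::{finite, linorder}) vec \<times> ('h, 'n) vec \<Rightarrow> nat \<Rightarrow> 'h" where
  "state_comp x j = (if j < CARD('n) then fst x $ inv pos j else snd x $ inv pos (2 * CARD('n) - 1 - j))"

definition of_comps :: "(nat \<Rightarrow> 'h) \<Rightarrow> ('h, 'n::{finite, linorder}) vec \<times> ('h, 'n) vec" where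
  "of_comps f = (\<chi> i. f (pos i), \<chi> i. f (2 * CARD('n) - 1 - pos i))"

lemma comp_of_comps [simp]:
  assumes "j < 2 * CARD('n)"
  shows "state_comp (of_comps f :: ('h, 'n::{finite, linorder}) vec \<times> _) j = f j"
  using assms by (auto simp: state_comp_def of_comps_def pos_inv)

lemma of_comps_comp [simp]: "of_comps (state_comp x) = (x :: ('h, 'n::{finite, linorder}) vec \<times> _)"
proof -
  have "\<not> 2 * CARD('n) - 1 - pos i < CARD('n)" "2 * CARD('n) - 1 - (2 * CARD('n) - 1 - pos i) = pos i" for i :: 'n
    using pos_less[of i] by auto
  then show ?thesis by (simp add: of_comps_def state_comp_def pos_less prod_eq_iff vec_eq_iff)
qed

lemma bounded_linear_state_comp: "bounded_linear (\<lambda>x :: ('h::real_normed_vector, 'n::{finite, linorder}) vec \<times> _. state_comp x j)"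
  by (cases "j < CARD('n)")
    (auto simp: state_comp_def intro: bounded_linear_compose[OF bounded_linear_vec_nth bounded_linear_fst]
      bounded_linear_compose[OF bounded_linear_vec_nth bounded_linear_snd])

definition unit_comp :: "nat \<Rightarrow> 'h \<Rightarrow> ('h::real_normed_vector, 'n::{finite, linorder}) vec \<times> ('h, 'n) vec" where
  "unit_comp k h = of_comps (\<lambda>j. if j = k then h else 0)"

text \<open>The two demands on the right-hand side in the Picard iteration, bundled so that they can
  be verified along the way in which the right-hand side is built up.\<close>

definition lipschitz_family :: "real set \<Rightarrow> (real \<Rightarrow> 'a::real_normed_vector \<Rightarrow> 'b::real_normed_vector) \<Rightarrow> bool" where
  "lipschitz_family S F \<longleftrightarrow>
     (\<forall>x. continuous_on S x \<longrightarrow> continuous_on S (\<lambda>t. F t (x t))) \<and>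
     (\<forall>\<beta>\<in>S. \<exists>K. \<forall>t\<in>{0..\<beta>}. \<forall>x y. norm (F t x - F t y) \<le> K * norm (x - y))"

section \<open>Closure properties of admissible right-hand sides\<close>

lemma lipschitz_family_linear: "bounded_linear L \<Longrightarrow> lipschitz_family S (\<lambda>t x. L x)"
  unfolding lipschitz_family_def
proof (intro conjI allI impI ballI)
  assume L: "bounded_linear L"
  show "continuous_on S (\<lambda>t. L (x t))" if "continuous_on S x" for x
    by (rule bounded_linear.continuous_on[OF L that])
  obtain K where "\<And>x. norm (L x) \<le> norm x * K" using bounded_linear.bounded[OF L] by blast
  then show "\<exists>K. \<forall>t\<in>{0..\<beta>}. \<forall>x y. norm (L x - L y) \<le> K * norm (x - y)" for \<beta>
    by (intro exI[of _ K]) (simp add: linear_simps[OF L, symmetric] mult.commute)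
qed

lemma lipschitz_family_cont: "lipschitz_family S F \<Longrightarrow> continuous_on S x \<Longrightarrow> continuous_on S (\<lambda>t. F t (x t))"
  by (simp add: lipschitz_family_def)

lemma lipschitz_familyD:
  assumes "lipschitz_family S F" "\<beta> \<in> S"
  obtains K where "K \<ge> 0" "\<And>t x y. t \<in> {0..\<beta>} \<Longrightarrow> norm (F t x - F t y) \<le> K * norm (x - y)"
proof -
  obtain K where K: "\<forall>t\<in>{0..\<beta>}. \<forall>x y. norm (F t x - F t y) \<le> K * norm (x - y)"
    using assms unfolding lipschitz_family_def by blast
  have "norm (F t x - F t y) \<le> \<bar>K\<bar> * norm (x - y)" if "t \<in> {0..\<beta>}" for t x y
  proof -
    have "K * norm (x - y) \<le> \<bar>K\<bar> * norm (x - y)" by (intro mult_right_mono) auto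
    then show ?thesis using K that by (metis order_trans)
  qed
  then show ?thesis by (intro that[of "\<bar>K\<bar>"]) auto
qed

lemma lipschitz_family_add:
  assumes F: "lipschitz_family S F" and G: "lipschitz_family S G"
  shows "lipschitz_family S (\<lambda>t x. F t x + G t x)"
  unfolding lipschitz_family_def
proof (intro conjI allI impI ballI)
  show "continuous_on S (\<lambda>t. F t (x t) + G t (x t))" if "continuous_on S x" for x
    using lipschitz_family_cont[OF F that] lipschitz_family_cont[OF G that] by (rule continuous_on_add)
  fix \<beta> assume b: "\<beta> \<in> S"
  obtain K1 where K1: "\<And>t x y. t \<in> {0..\<beta>} \<Longrightarrow> norm (F t x - F t y) \<le> K1 * norm (x - y)"
    using lipschitz_familyD[OF F b] by metis
  obtain K2 where K2: "\<And>t x y. t \<in> {0..\<beta>} \<Longrightarrow> norm (G t x - G t y) \<le> K2 * norm (x - y)"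
    using lipschitz_familyD[OF G b] by metis
  show "\<exists>K. \<forall>t\<in>{0..\<beta>}. \<forall>x y. norm (F t x + G t x - (F t y + G t y)) \<le> K * norm (x - y)"
  proof (intro exI[of _ "K1 + K2"] ballI allI)
    fix t x y assume t: "t \<in> {0..\<beta>}"
    have "norm (F t x + G t x - (F t y + G t y)) \<le> norm (F t x - F t y) + norm (G t x - G t y)"
      by (simp add: add_diff_add norm_triangle_ineq)
    then show "norm (F t x + G t x - (F t y + G t y)) \<le> (K1 + K2) * norm (x - y)"
      using K1[OF t, of x y] K2[OF t, of x y] by (simp add: distrib_right)
  qed
qed

lemma lipschitz_family_apply:
  fixes A :: "real \<Rightarrow> 'b::real_normed_vector \<Rightarrow>\<^sub>L 'c::real_normed_vector"
  assumes S: "\<forall>t\<in>S. {0..t} \<subseteq> S" and A: "continuous_on S A" and F: "lipschitz_family S F"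
  shows "lipschitz_family S (\<lambda>t x. A t (F t x))"
  unfolding lipschitz_family_def
proof (intro conjI allI impI ballI)
  show "continuous_on S (\<lambda>t. A t (F t (x t)))" if "continuous_on S x" for x
    by (rule bounded_bilinear.continuous_on[OF bounded_bilinear_blinfun_apply A lipschitz_family_cont[OF F that]])
  fix \<beta> assume b: "\<beta> \<in> S"
  obtain K where K: "K \<ge> 0" "\<And>t x y. t \<in> {0..\<beta>} \<Longrightarrow> norm (F t x - F t y) \<le> K * norm (x - y)"
    using lipschitz_familyD[OF F b] by metis
  obtain M where M: "M \<ge> 0" "\<And>t. t \<in> {0..\<beta>} \<Longrightarrow> norm (A t) \<le> M"
    using continuous_on_Icc_bounded[OF continuous_on_subset[OF A]] S b by metis
  show "\<exists>K. \<forall>t\<in>{0..\<beta>}. \<forall>x y. norm (A t (F t x) - A t (F t y)) \<le> K * norm (x - y)"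
  proof (intro exI[of _ "M * K"] ballI allI)
    fix t x y assume t: "t \<in> {0..\<beta>}"
    have "norm (A t (F t x) - A t (F t y)) \<le> norm (A t) * norm (F t x - F t y)"
      by (metis blinfun.diff_right norm_blinfun)
    also have "\<dots> \<le> M * (K * norm (x - y))" using K M t by (intro mult_mono) auto
    finally show "norm (A t (F t x) - A t (F t y)) \<le> M * K * norm (x - y)" by (simp add: mult.assoc)
  qed
qed

lemma lipschitz_family_compose_linear:
  assumes L: "bounded_linear L" and F: "lipschitz_family S F"
  shows "lipschitz_family S (\<lambda>t x. L (F t x))"
  unfolding lipschitz_family_def
proof (intro conjI allI impI ballI)
  show "continuous_on S (\<lambda>t. L (F t (x t)))" if "continuous_on S x" for x
    by (rule bounded_linear.continuous_on[OF L lipschitz_family_cont[OF F that]])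
  fix \<beta> assume b: "\<beta> \<in> S"
  obtain K where K: "K \<ge> 0" "\<And>t x y. t \<in> {0..\<beta>} \<Longrightarrow> norm (F t x - F t y) \<le> K * norm (x - y)"
    using lipschitz_familyD[OF F b] by metis
  obtain M where M: "M \<ge> 0" "\<And>x. norm (L x) \<le> norm x * M" using bounded_linear.nonneg_bounded[OF L] by blast
  show "\<exists>K. \<forall>t\<in>{0..\<beta>}. \<forall>x y. norm (L (F t x) - L (F t y)) \<le> K * norm (x - y)"
  proof (intro exI[of _ "K * M"] ballI allI)
    fix t x y assume t: "t \<in> {0..\<beta>}"
    have "norm (L (F t x) - L (F t y)) \<le> norm (F t x - F t y) * M"
      using M(2)[of "F t x - F t y"] by (simp add: linear_simps[OF L])
    also have "\<dots> \<le> (K * norm (x - y)) * M" using K M t by (intro mult_right_mono) auto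
    finally show "norm (L (F t x) - L (F t y)) \<le> K * M * norm (x - y)" by (simp add: mult_ac)
  qed
qed

lemma lipschitz_family_minus: "lipschitz_family S F \<Longrightarrow> lipschitz_family S (\<lambda>t x. - F t x)"
  by (rule lipschitz_family_compose_linear[OF bounded_linear_minus[OF bounded_linear_ident]])

lemma lipschitz_family_diff:
  "lipschitz_family S F \<Longrightarrow> lipschitz_family S G \<Longrightarrow> lipschitz_family S (\<lambda>t x. F t x - G t x)"
  using lipschitz_family_add[OF _ lipschitz_family_minus, of S F G] by simp

lemma lipschitz_family_zero: "lipschitz_family S (\<lambda>t x. 0)"
  by (rule lipschitz_family_linear[OF bounded_linear_zero])

lemma lipschitz_family_shift:
  assumes F: "lipschitz_family S F" and c: "continuous_on S c"
  shows "lipschitz_family S (\<lambda>t x. F t (x - c t))"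
  unfolding lipschitz_family_def
proof (intro conjI allI impI ballI)
  show "continuous_on S (\<lambda>t. F t (x t - c t))" if "continuous_on S x" for x
    by (rule lipschitz_family_cont[OF F continuous_on_diff[OF that c]])
  fix \<beta> assume b: "\<beta> \<in> S"
  obtain K where "\<And>t x y. t \<in> {0..\<beta>} \<Longrightarrow> norm (F t x - F t y) \<le> K * norm (x - y)"
    using lipschitz_familyD[OF F b] by metis
  note K = this
  show "\<exists>K. \<forall>t\<in>{0..\<beta>}. \<forall>x y. norm (F t (x - c t) - F t (y - c t)) \<le> K * norm (x - y)"
  proof (intro exI[of _ K] ballI allI)
    fix t x y assume "t \<in> {0..\<beta>}"
    from K[OF this, of "x - c t" "y - c t"] show "norm (F t (x - c t) - F t (y - c t)) \<le> K * norm (x - y)" by simp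
  qed
qed

lemma lipschitz_family_plus_function:
  assumes F: "lipschitz_family S F" and c: "continuous_on S c"
  shows "lipschitz_family S (\<lambda>t x. F t x - c t)"
  unfolding lipschitz_family_def
proof (intro conjI allI impI ballI)
  show "continuous_on S (\<lambda>t. F t (x t) - c t)" if "continuous_on S x" for x
    by (rule continuous_on_diff[OF lipschitz_family_cont[OF F that] c])
  fix \<beta> assume b: "\<beta> \<in> S"
  show "\<exists>K. \<forall>t\<in>{0..\<beta>}. \<forall>x y. norm (F t x - c t - (F t y - c t)) \<le> K * norm (x - y)"
    using F b by (simp add: lipschitz_family_def)
qed

lemma lipschitz_family_of_comps:
  fixes f :: "nat \<Rightarrow> real \<Rightarrow> 'a::real_normed_vector \<Rightarrow> 'h::real_normed_vector"
  assumes f: "\<And>j. lipschitz_family S (f j)"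
  shows "lipschitz_family S (\<lambda>t x. of_comps (\<lambda>j. f j t x) :: ('h, 'n::{finite, linorder}) vec \<times> _)"
  unfolding lipschitz_family_def
proof (intro conjI allI impI ballI)
  show "continuous_on S (\<lambda>t. of_comps (\<lambda>j. f j t (x t)) :: ('h, 'n) vec \<times> _)" if "continuous_on S x" for x
    unfolding of_comps_def by (intro continuous_on_Pair continuous_on_vec_lambda lipschitz_family_cont[OF f that])
  fix \<beta> assume b: "\<beta> \<in> S"
  have "\<forall>j. \<exists>K. \<forall>t\<in>{0..\<beta>}. \<forall>x y. norm (f j t x - f j t y) \<le> K * norm (x - y)"
    using f b unfolding lipschitz_family_def by blast
  then obtain K where K: "\<And>j t x y. t \<in> {0..\<beta>} \<Longrightarrow> norm (f j t x - f j t y) \<le> K j * norm (x - y)" by metis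
  have v: "norm (\<chi> i. g i - h i) \<le> (\<Sum>i\<in>UNIV. norm (g i - h i))" for g h :: "'n \<Rightarrow> 'h"
    unfolding norm_vec_def using L2_set_le_sum[of UNIV "\<lambda>i. norm (g i - h i)"] by simp
  show "\<exists>K. \<forall>t\<in>{0..\<beta>}. \<forall>x y. norm (of_comps (\<lambda>j. f j t x) - of_comps (\<lambda>j. f j t y) :: ('h, 'n) vec \<times> _) \<le> K * norm (x - y)"
  proof (intro exI[of _ "(\<Sum>i\<in>(UNIV :: 'n set). K (pos i)) + (\<Sum>i\<in>(UNIV :: 'n set). K (2 * CARD('n) - 1 - pos i))"] ballI allI)
    fix t x y assume t: "t \<in> {0..\<beta>}"
    have "norm (of_comps (\<lambda>j. f j t x) - of_comps (\<lambda>j. f j t y) :: ('h, 'n) vec \<times> _)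
        \<le> norm (\<chi> i. f (pos i) t x - f (pos i) t y :: ('h, 'n) vec)
          + norm (\<chi> i. f (2 * CARD('n) - 1 - pos i) t x - f (2 * CARD('n) - 1 - pos i) t y :: ('h, 'n) vec)"
      by (rule order.trans[OF eq_refl norm_Pair_le]) (simp add: of_comps_def minus_vec_def)
    also have "\<dots> \<le> (\<Sum>i\<in>(UNIV :: 'n set). K (pos i) * norm (x - y)) + (\<Sum>i\<in>(UNIV :: 'n set). K (2 * CARD('n) - 1 - pos i) * norm (x - y))"
      by (intro add_mono order.trans[OF v] sum_mono K t)
    finally show "norm (of_comps (\<lambda>j. f j t x) - of_comps (\<lambda>j. f j t y) :: ('h, 'n) vec \<times> _)
        \<le> ((\<Sum>i\<in>(UNIV :: 'n set). K (pos i)) + (\<Sum>i\<in>(UNIV :: 'n set). K (2 * CARD('n) - 1 - pos i))) * norm (x - y)"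
      by (simp add: sum_distrib_right distrib_right)
  qed
qed

text \<open>For gluing a solution on {0..\<beta>} to the zero function beyond \<beta>.\<close>

lemma has_vector_derivative_union:
  assumes "(f has_vector_derivative d) (at t within A)" "(f has_vector_derivative d) (at t within B)"
  shows "(f has_vector_derivative d) (at t within (A \<union> B))"
  using assms unfolding has_vector_derivative_def has_derivative_iff_norm
  by (auto simp: at_within_union intro: filterlim_sup)

locale quasi_system = quasi_coefficients \<Delta> n p q
  for \<Delta> n and p q :: "nat \<Rightarrow> real \<Rightarrow> 'h::{complex_hilbert, second_countable_topology} \<Rightarrow>\<^sub>L 'h" +
  fixes dim :: "'n::{finite, linorder} itself"
  assumes n_eq: "n = CARD('n)"
begin

text \<open>The value of D^n y for the state x: the definition of the n-th quasi-derivative solved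
  by means of the inverse of p_0.\<close>

definition top_deriv :: "real \<Rightarrow> ('h, 'n) vec \<times> ('h, 'n) vec \<Rightarrow> 'h" where
  "top_deriv t x = p0inv t (state_comp x n + scalar_op (\<i> / 2) (q 0 t (state_comp x (n - 1))))"

definition lower_deriv :: "nat \<Rightarrow> real \<Rightarrow> ('h, 'n) vec \<times> ('h, 'n) vec \<Rightarrow> 'h" where
  "lower_deriv j t x = (if j < n then state_comp x j else top_deriv t x)"

definition lower_sys :: "nat \<Rightarrow> real \<Rightarrow> ('h, 'n) vec \<times> ('h, 'n) vec \<Rightarrow> 'h" where
  "lower_sys k t x = p (Suc k) t (lower_deriv (n - Suc k) t x)
     + scalar_op (\<i> / 2) (adjoint_op (q k t) (lower_deriv (n - k) t x)
         - (if Suc k < n then q (Suc k) t (lower_deriv (n - Suc k - 1) t x) else 0))"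

text \<open>The recursion of the quasi-derivatives solved for their derivatives, with l[y] = \<mu> y
  put into the last component. Inhomogeneous terms are left out: a square-integrable one is absorbed
  by a shift of the unknown, a continuous one is added to the last component.\<close>

definition sys :: "complex \<Rightarrow> nat \<Rightarrow> real \<Rightarrow> ('h, 'n) vec \<times> ('h, 'n) vec \<Rightarrow> 'h" where
  "sys \<mu> j t x =
     (if Suc j < n then state_comp x (Suc j)
      else if Suc j = n then top_deriv t x
      else - (if Suc j < 2 * n then state_comp x (Suc j) else scalar_op \<mu> (state_comp x 0)) + lower_sys (j - n) t x)"

lemma continuous_coefficients:
  assumes "S \<subseteq> \<Delta>"
  shows "k \<le> n \<Longrightarrow> continuous_on S (p k)" "k < n \<Longrightarrow> continuous_on S (q k)"
    "k < n \<Longrightarrow> continuous_on S (\<lambda>t. adjoint_op (q k t))" "continuous_on S p0inv"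
  using p_Ck q_Ck q_adjoint_Ck p0inv_Ck assms
  by (auto intro!: continuous_on_subset[OF _ assms] Ck_off_continuous_on[of \<Delta> \<Delta>] simp: Ck_on_eq_Ck_off)

lemma lipschitz_sys:
  assumes S: "S \<subseteq> \<Delta>" "\<forall>t\<in>S. {0..t} \<subseteq> S" and j: "j < 2 * n"
  shows "lipschitz_family S (sys \<mu> j)"
proof -
  note cc = continuous_coefficients[OF S(1)]
  have cmp: "lipschitz_family S (\<lambda>t x :: ('h, 'n) vec \<times> ('h, 'n) vec. state_comp x i)" for i
    by (rule lipschitz_family_linear[OF bounded_linear_state_comp])
  have sc: "lipschitz_family S (\<lambda>t x. scalar_op c (F t x))" if "lipschitz_family S F"
    for c and F :: "real \<Rightarrow> ('h, 'n) vec \<times> ('h, 'n) vec \<Rightarrow> 'h"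
    by (rule lipschitz_family_compose_linear[OF blinfun.bounded_linear_right that])
  have top: "lipschitz_family S top_deriv"
    unfolding top_deriv_def[abs_def] using n_pos
    by (intro lipschitz_family_apply[OF S(2)] cc lipschitz_family_add sc cmp) auto
  have low: "lipschitz_family S (lower_deriv i)" for i
    using cmp[of i] top unfolding lower_deriv_def[abs_def] by (cases "i < n") simp_all
  have lows: "lipschitz_family S (lower_sys k)" if k: "k < n" for k
  proof -
    have last: "lipschitz_family S (\<lambda>t x. if Suc k < n then q (Suc k) t (lower_deriv (n - Suc k - 1) t x) else 0)"
    proof (cases "Suc k < n")
      case True
      then show ?thesis by (simp only: if_True) (intro lipschitz_family_apply[OF S(2)] cc low, simp)
    qed (simp add: lipschitz_family_zero)
    show ?thesis
      unfolding lower_sys_def[abs_def]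
      by (intro lipschitz_family_add sc lipschitz_family_diff last lipschitz_family_apply[OF S(2)] cc low)
        (use k in auto)
  qed
  consider "Suc j < n" | "Suc j = n" | "n \<le> j" "Suc j < 2 * n" | "n \<le> j" "Suc j = 2 * n"
    using j by linarith
  then show ?thesis
  proof cases
    case 3
    then have "sys \<mu> j = (\<lambda>t x. - state_comp x (Suc j) + lower_sys (j - n) t x)" by (auto simp: sys_def fun_eq_iff)
    then show ?thesis
      by (simp only:) (intro lipschitz_family_add lipschitz_family_minus cmp lows, use 3 j in linarith)
  next
    case 4
    then have "sys \<mu> j = (\<lambda>t x. - scalar_op \<mu> (state_comp x 0) + lower_sys (j - n) t x)" using n_pos
      by (auto simp: sys_def fun_eq_iff)
    then show ?thesis
      by (simp only:) (intro lipschitz_family_add lipschitz_family_minus sc cmp lows, use 4 j in linarith)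
  qed (use cmp[of "Suc j"] top in \<open>auto simp: sys_def[abs_def]\<close>)
qed

lemma lipschitz_system:
  assumes S: "S \<subseteq> \<Delta>" "\<forall>t\<in>S. {0..t} \<subseteq> S"
  shows "lipschitz_family S (\<lambda>t x. of_comps (\<lambda>j. sys \<mu> j t x) :: ('h, 'n) vec \<times> ('h, 'n) vec)"
proof -
  have eq: "(of_comps (\<lambda>j. sys \<mu> j t x) :: ('h, 'n) vec \<times> ('h, 'n) vec) = of_comps (\<lambda>j. if j < 2 * n then sys \<mu> j t x else 0)" for t x
  proof -
    have "pos i < 2 * n" "2 * CARD('n) - 1 - pos i < 2 * n" for i :: 'n
      using pos_less[of i] n_eq by auto
    then show ?thesis by (simp add: of_comps_def)
  qed
  have "lipschitz_family S (\<lambda>t x. if j < 2 * n then sys \<mu> j t x else 0)" for j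
    using lipschitz_sys[OF S, of j \<mu>] lipschitz_family_zero by (cases "j < 2 * n") auto
  then show ?thesis unfolding eq by (rule lipschitz_family_of_comps)
qed

text \<open>The components are identified in increasing order: the equations below index n - 1 give
  the derivatives D^j y, the one with index n - 1 gives D^n y, and the later ones give the upper
  quasi-derivatives. The last component need not be continuously differentiable, so its absolute
  continuity is a hypothesis of its own and its equation is demanded almost everywhere.\<close>

lemma system_solution:
  fixes x :: "real \<Rightarrow> ('h, 'n) vec \<times> ('h, 'n) vec"
  assumes d: "\<And>j t. Suc j < 2 * n \<Longrightarrow> t \<in> \<Delta> \<Longrightarrow> ((\<lambda>t. state_comp (x t) j) has_vector_derivative sys \<mu> j t (x t)) (at t within \<Delta>)"
    and xc: "continuous_on \<Delta> x"
    and top: "\<And>c d. {c..d} \<subseteq> \<Delta> \<Longrightarrow> abs_continuous_on {c..d} (\<lambda>t. state_comp (x t) (2 * n - 1))"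
    and top_d: "AE t in lebesgue. t \<in> \<Delta> \<longrightarrow> ((\<lambda>t. state_comp (x t) (2 * n - 1)) has_vector_derivative sys \<mu> (2 * n - 1) t (x t) - g t) (at t within \<Delta>)"
  defines "y \<equiv> \<lambda>t. state_comp (x t) 0"
  shows "quasi_regular blinfun_apply n \<Delta> p q y"
    and "\<And>j t. j < 2 * n \<Longrightarrow> t \<in> \<Delta> \<Longrightarrow> qd blinfun_apply j y t = state_comp (x t) j"
    and "AE t in lebesgue. t \<in> \<Delta> \<longrightarrow> de blinfun_apply y t = \<mu> *\<^sub>C y t + g t"
proof -
  have D: "Dpow \<Delta> j y t = state_comp (x t) j" if "j < n" "t \<in> \<Delta>" for j t
    using that
  proof (induction j arbitrary: t)
    case (Suc j)
    have "deriv_on \<Delta> (Dpow \<Delta> j y) t = deriv_on \<Delta> (\<lambda>t. state_comp (x t) j) t"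
      by (rule deriv_on_cong[OF Suc.IH]) (use Suc.prems in auto)
    also have "\<dots> = sys \<mu> j t (x t)" by (rule deriv_on_eqI[OF d]) (use Suc.prems in auto)
    finally show ?case using Suc.prems by (simp add: sys_def)
  qed (simp add: y_def)
  have Dn: "Dpow \<Delta> n y t = top_deriv t (x t)" if t: "t \<in> \<Delta>" for t
  proof -
    obtain m where m: "n = Suc m" using n_pos by (cases n) auto
    have "Dpow \<Delta> n y t = deriv_on \<Delta> (Dpow \<Delta> m y) t" by (simp add: m)
    also have "\<dots> = deriv_on \<Delta> (\<lambda>t. state_comp (x t) m) t"
      by (rule deriv_on_cong[OF D t]) (use m in auto)
    also have "\<dots> = sys \<mu> m t (x t)" by (rule deriv_on_eqI[OF d t]) (use m t in auto)
    also have "\<dots> = top_deriv t (x t)" by (simp add: sys_def m[symmetric])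
    finally show ?thesis .
  qed
  have DL: "Dpow \<Delta> j y t = lower_deriv j t (x t)" if "j \<le> n" "t \<in> \<Delta>" for j t
    using D[of j t] Dn[of t] that by (cases "j = n") (auto simp: lower_deriv_def)
  have low: "lower_terms blinfun_apply k y t = lower_sys k t (x t)" if "k < n" "t \<in> \<Delta>" for k t
    using that by (simp add: lower_terms_def lower_sys_def DL)
  have U: "uq blinfun_apply k y t = state_comp (x t) (n + k)" if "k < n" "t \<in> \<Delta>" for k t
    using that
  proof (induction k arbitrary: t)
    case 0
    have "p 0 t (p0inv t h) = h" for h
      using p0inv(2)[OF 0(2)] by (metis blinfun_apply_blinfun_compose blinfun_apply_id_blinfun)
    then show ?case using Dn[OF 0(2)] D[of "n - 1" t] n_pos 0 by (simp add: top_deriv_def)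
  next
    case (Suc k)
    have "deriv_on \<Delta> (uq blinfun_apply k y) t = deriv_on \<Delta> (\<lambda>t. state_comp (x t) (n + k)) t"
      by (rule deriv_on_cong[OF Suc.IH]) (use Suc.prems in auto)
    also have "\<dots> = sys \<mu> (n + k) t (x t)" by (rule deriv_on_eqI[OF d]) (use Suc.prems in auto)
    also have "\<dots> = - state_comp (x t) (n + Suc k) + lower_sys k t (x t)" using Suc.prems by (simp add: sys_def)
    finally show ?case using uq_Suc[of k blinfun_apply y t] low[of k t] Suc.prems by (simp del: upper_quasi_deriv.simps)
  qed
  show qd: "\<And>j t. j < 2 * n \<Longrightarrow> t \<in> \<Delta> \<Longrightarrow> qd blinfun_apply j y t = state_comp (x t) j"
  proof -
    fix j t assume jt: "j < 2 * n" "t \<in> \<Delta>"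
    show "qd blinfun_apply j y t = state_comp (x t) j"
      using D[of j t] U[of "j - n" t] jt by (cases "j < n") (auto simp: quasi_deriv_def)
  qed
  have lacx: "loc_abs_continuous_on \<Delta> (\<lambda>t. state_comp (x t) (2 * n - 1))"
    unfolding loc_abs_continuous_on_def
  proof (intro conjI allI impI)
    show "AE t in lebesgue. t \<in> \<Delta> \<longrightarrow> (\<lambda>t. state_comp (x t) (2 * n - 1)) differentiable at t within \<Delta>"
      using top_d by eventually_elim (auto intro: differentiableI_vector)
  qed (rule top)
  show reg: "quasi_regular blinfun_apply n \<Delta> p q y"
    unfolding quasi_regular_def
  proof (intro conjI allI impI)
    fix k assume k: "k \<le> 2 * n - 2"
    then have k': "Suc k < 2 * n" using n_pos by auto
    have sc: "continuous_on \<Delta> (\<lambda>t. sys \<mu> k t (x t))"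
      by (rule lipschitz_family_cont[OF lipschitz_sys[OF order_refl initial] xc]) (use k' in simp)
    have "Ck_off \<Delta> \<Delta> 1 (\<lambda>t. state_comp (x t) k)"
      unfolding One_nat_def by (rule Ck_off_SucI[OF d[OF k']]) (use sc in auto)
    then have "Ck_off \<Delta> \<Delta> 1 (qd blinfun_apply k y)" by (rule Ck_off_cong[rotated]) (use qd k' in auto)
    then show "Ck_on 1 \<Delta> (qd blinfun_apply k y)" by (simp only: Ck_on_eq_Ck_off)
  next
    show "loc_abs_continuous_on \<Delta> (qd blinfun_apply (2 * n - 1) y)"
      by (rule loc_abs_continuous_on_cong[OF _ lacx]) (use qd n_pos in auto)
  qed
  obtain N where N: "N \<in> null_sets lebesgue" "Ck_off N \<Delta> (2 * n - 1) y"
    using quasi_regularD[OF action_apply reg] by metis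
  obtain m where m: "n = Suc m" using n_pos by (cases n) auto
  show "AE t in lebesgue. t \<in> \<Delta> \<longrightarrow> de blinfun_apply y t = \<mu> *\<^sub>C y t + g t"
    using AE_not_in[OF N(1)] top_d
  proof (eventually_elim, intro impI)
    fix t assume tN: "t \<notin> N" and t: "t \<in> \<Delta>"
      and "t \<in> \<Delta> \<longrightarrow> ((\<lambda>t. state_comp (x t) (2 * n - 1)) has_vector_derivative sys \<mu> (2 * n - 1) t (x t) - g t) (at t within \<Delta>)"
    then have td: "((\<lambda>t. state_comp (x t) (2 * n - 1)) has_vector_derivative sys \<mu> (2 * n - 1) t (x t) - g t) (at t within \<Delta>)" by simp
    have "de blinfun_apply y t = uq blinfun_apply (Suc m) y t"
      using diff_expr_eq_uq[OF action_apply N(2), of t] tN t m by simp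
    also have "\<dots> = - deriv_on \<Delta> (uq blinfun_apply m y) t + lower_sys m t (x t)"
      using uq_Suc[of m blinfun_apply y t] low[of m t] t m by simp
    also have "deriv_on \<Delta> (uq blinfun_apply m y) t = deriv_on \<Delta> (\<lambda>t. state_comp (x t) (2 * n - 1)) t"
      by (rule deriv_on_cong[OF _ t]) (use U[of m] m in \<open>auto simp: mult_2 simp del: upper_quasi_deriv.simps\<close>)
    also have "\<dots> = sys \<mu> (2 * n - 1) t (x t) - g t" by (rule deriv_on_eqI[OF td t])
    also have "sys \<mu> (2 * n - 1) t (x t) = - (\<mu> *\<^sub>C y t) + lower_sys m t (x t)"
    proof -
      have "\<not> Suc (2 * n - 1) < n" "Suc (2 * n - 1) \<noteq> n" "\<not> Suc (2 * n - 1) < 2 * n" "2 * n - 1 - n = m"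
        using m by auto
      then show ?thesis by (simp add: sys_def y_def)
    qed
    finally show "de blinfun_apply y t = \<mu> *\<^sub>C y t + g t" by simp
  qed
qed

lemma comp_unit_comp: "j < 2 * n \<Longrightarrow> state_comp (unit_comp k h :: ('h, 'n) vec \<times> ('h, 'n) vec) j = (if j = k then h else 0)"
  by (simp add: unit_comp_def n_eq)

lemma bounded_linear_unit_comp: "bounded_linear (unit_comp k :: 'h \<Rightarrow> ('h, 'n) vec \<times> ('h, 'n) vec)"
proof -
  have "lipschitz_family UNIV (\<lambda>t h. of_comps (\<lambda>j. if j = k then h else 0) :: ('h, 'n) vec \<times> ('h, 'n) vec)"
  proof (rule lipschitz_family_of_comps)
    show "lipschitz_family UNIV (\<lambda>t h. if j = k then h else 0 :: 'h)" for j
      using lipschitz_family_linear[OF bounded_linear_ident] lipschitz_family_zero by (cases "j = k") auto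
  qed
  then obtain K where "\<And>h h' :: 'h. norm ((unit_comp k h :: ('h, 'n) vec \<times> ('h, 'n) vec) - unit_comp k h') \<le> K * norm (h - h')"
    using lipschitz_familyD[of UNIV _ 0] unfolding unit_comp_def by (metis UNIV_I atLeastAtMost_iff order_refl)
  from this[of _ 0] have "norm (unit_comp k h :: ('h, 'n) vec \<times> ('h, 'n) vec) \<le> norm h * K" for h :: 'h
    by (simp add: unit_comp_def of_comps_def zero_vec_def[symmetric] zero_prod_def[symmetric] mult.commute)
  then show ?thesis
    by (intro bounded_linear_intro[where K = K]) (auto simp: unit_comp_def of_comps_def vec_eq_iff)
qed

text \<open>A right-hand side that is merely square integrable is made continuous by a shift: with G
  the indefinite integral of g, the state plus G in its last component solves a system to which
  Picard iteration applies. The data at 0 are not disturbed because G vanishes there.\<close>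

lemma forward_solution:
  assumes g: "square_integrable g"
  shows "\<exists>y. quasi_regular blinfun_apply n \<Delta> p q y \<and> (\<forall>j<2 * n. qd blinfun_apply j y 0 = state_comp (\<xi> :: ('h, 'n) vec \<times> ('h, 'n) vec) j)
     \<and> (AE t in lebesgue. t \<in> \<Delta> \<longrightarrow> de blinfun_apply y t = \<mu> *\<^sub>C y t + g t)"
proof -
  let ?G = "indef_integral g"
  let ?e = "unit_comp (2 * n - 1) :: 'h \<Rightarrow> ('h, 'n) vec \<times> ('h, 'n) vec"
  let ?F = "\<lambda>t w. of_comps (\<lambda>j. sys \<mu> j t (w - ?e (?G t))) :: ('h, 'n) vec \<times> ('h, 'n) vec"
  have Gac: "abs_continuous_on {c..d} ?G" if "{c..d} \<subseteq> \<Delta>" for c d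
    by (rule abs_continuous_indef_integral[OF g]) (use that nonneg in blast)
  have Gc: "continuous_on \<Delta> ?G"
    by (rule continuous_on_localI[OF abs_continuous_on_imp_continuous_on[OF Gac]])
  have ec: "continuous_on \<Delta> (\<lambda>t. ?e (?G t))"
    by (rule bounded_linear.continuous_on[OF bounded_linear_unit_comp Gc])
  have F: "lipschitz_family \<Delta> ?F"
    by (rule lipschitz_family_shift[OF lipschitz_system[OF order_refl initial] ec])
  obtain w where w: "w 0 = \<xi>" "\<And>t. t \<in> \<Delta> \<Longrightarrow> (w has_vector_derivative ?F t (w t)) (at t within \<Delta>)"
    using evolution_equation_solution[OF initial nonneg, of ?F \<xi>] F unfolding lipschitz_family_def by blast
  define x where "x t = w t - ?e (?G t)" for t
  have wc: "continuous_on \<Delta> w"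
    using w(2) by (auto simp: continuous_on_eq_continuous_within intro: has_vector_derivative_continuous)
  have xc: "continuous_on \<Delta> x" unfolding x_def by (intro continuous_on_diff wc ec)
  have cx: "state_comp (x t) j = state_comp (w t) j - (if j = 2 * n - 1 then ?G t else 0)" if "j < 2 * n" for t j
    using comp_unit_comp[OF that] by (simp add: x_def linear_simps[OF bounded_linear_state_comp])
  have wd: "((\<lambda>t. state_comp (w t) j) has_vector_derivative sys \<mu> j t (x t)) (at t within \<Delta>)" if "t \<in> \<Delta>" "j < 2 * n" for t j
    using bounded_linear.has_vector_derivative[OF bounded_linear_state_comp w(2)[OF that(1)], of j] that
    by (simp add: x_def n_eq)
  have top: "abs_continuous_on {c..d} (\<lambda>t. state_comp (x t) (2 * n - 1))" if cd: "{c..d} \<subseteq> \<Delta>" for c d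
  proof -
    have "abs_continuous_on {c..d} (\<lambda>t. state_comp (w t) (2 * n - 1))"
    proof (rule abs_continuous_on_C1)
      show "((\<lambda>t. state_comp (w t) (2 * n - 1)) has_vector_derivative sys \<mu> (2 * n - 1) t (x t)) (at t within {c..d})" if "t \<in> {c..d}" for t
        by (rule has_vector_derivative_within_subset[OF wd cd]) (use that cd n_pos in auto)
      show "continuous_on {c..d} (\<lambda>t. sys \<mu> (2 * n - 1) t (x t))"
        by (rule continuous_on_subset[OF lipschitz_family_cont[OF lipschitz_sys[OF order_refl initial] xc] cd]) (use n_pos in simp)
    qed
    moreover have "abs_continuous_on {c..d} (\<lambda>t. - ?G t)"
      by (rule abs_continuous_on_linear[OF bounded_linear_minus[OF bounded_linear_ident] Gac[OF cd]])
    ultimately have "abs_continuous_on {c..d} (\<lambda>t. state_comp (w t) (2 * n - 1) + - ?G t)" by (rule abs_continuous_on_add)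
    then show ?thesis using cx[of "2 * n - 1"] n_pos by simp
  qed
  have ae0: "AE t in lebesgue. t \<noteq> (0 :: real)" by (rule AE_I[of _ _ "{0}"]) auto
  have top_d: "AE t in lebesgue. t \<in> \<Delta> \<longrightarrow> ((\<lambda>t. state_comp (x t) (2 * n - 1)) has_vector_derivative sys \<mu> (2 * n - 1) t (x t) - g t) (at t within \<Delta>)"
    using indef_integral_has_vector_derivative_AE[OF g] ae0
  proof (eventually_elim, intro impI)
    fix t assume t: "0 < t \<longrightarrow> (?G has_vector_derivative g t) (at t)" "t \<noteq> 0" "t \<in> \<Delta>"
    then have "(?G has_vector_derivative g t) (at t within \<Delta>)"
      using nonneg by (auto intro: has_vector_derivative_at_within)
    then have "((\<lambda>t. state_comp (w t) (2 * n - 1) - ?G t) has_vector_derivative sys \<mu> (2 * n - 1) t (x t) - g t) (at t within \<Delta>)"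
      using t n_pos by (intro has_vector_derivative_diff wd) auto
    then show "((\<lambda>t. state_comp (x t) (2 * n - 1)) has_vector_derivative sys \<mu> (2 * n - 1) t (x t) - g t) (at t within \<Delta>)"
      using cx[of "2 * n - 1"] n_pos by simp
  qed
  have d: "((\<lambda>t. state_comp (x t) j) has_vector_derivative sys \<mu> j t (x t)) (at t within \<Delta>)" if "Suc j < 2 * n" "t \<in> \<Delta>" for j t
  proof -
    have "j \<noteq> 2 * n - 1" using that by auto
    then show ?thesis using wd[of t j] cx[of j] that by simp
  qed
  have "state_comp (x 0) j = state_comp \<xi> j" if "j < 2 * n" for j
    using cx[OF that, of 0] by (simp add: w(1))
  then show ?thesis
    using system_solution[OF d xc top top_d] zero_mem by (intro exI[of _ "\<lambda>t. state_comp (x t) 0"]) auto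
qed

text \<open>Reversing time on {0..\<beta>} turns the zero condition at \<beta> into an initial
  condition. Beyond \<beta> the zero function continues the solution, because f vanishes
  there.\<close>

lemma backward_solution:
  assumes f: "continuous_on \<Delta> f" and \<beta>: "\<beta> \<in> \<Delta>" "\<And>t. t \<in> \<Delta> \<Longrightarrow> \<beta> \<le> t \<Longrightarrow> f t = 0"
  shows "\<exists>y. quasi_regular blinfun_apply n \<Delta> p q y \<and> (\<forall>t\<in>\<Delta>. \<beta> \<le> t \<longrightarrow> (\<forall>j<2 * n. qd blinfun_apply j y t = 0))
     \<and> (AE t in lebesgue. t \<in> \<Delta> \<longrightarrow> de blinfun_apply y t = \<mu> *\<^sub>C y t + f t)"
proof -
  let ?e = "unit_comp (2 * n - 1) :: 'h \<Rightarrow> ('h, 'n) vec \<times> ('h, 'n) vec"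
  define F where "F t w = of_comps (\<lambda>j. sys \<mu> j t w) - ?e (f t)" for t w
  have \<beta>0: "0 \<le> \<beta>" using \<beta>(1) nonneg by auto
  have I: "{0..\<beta>} \<subseteq> \<Delta>" "\<forall>t\<in>{0..\<beta>}. {0..t} \<subseteq> {0..\<beta>}" using \<beta>(1) initial by auto
  have lip: "lipschitz_family S F" if "S \<subseteq> \<Delta>" "\<forall>t\<in>S. {0..t} \<subseteq> S" for S
    unfolding F_def[abs_def]
    by (rule lipschitz_family_plus_function[OF lipschitz_system[OF that]
          bounded_linear.continuous_on[OF bounded_linear_unit_comp continuous_on_subset[OF f that(1)]]])
  let ?B = "\<lambda>t w. - F (\<beta> - t) w"
  have Bc: "continuous_on {0..\<beta>} (\<lambda>t. ?B t (x t))" if x: "continuous_on {0..\<beta>} x" for x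
  proof -
    have r: "continuous_on {0..\<beta>} (\<lambda>t. \<beta> - t)" "(\<lambda>t. \<beta> - t) ` {0..\<beta>} \<subseteq> {0..\<beta>}"
      by (auto intro: continuous_intros)
    have "continuous_on {0..\<beta>} (\<lambda>t. x (\<beta> - t))" by (rule continuous_on_compose2[OF x r])
    then have "continuous_on {0..\<beta>} (\<lambda>t. F t (x (\<beta> - t)))" by (rule lipschitz_family_cont[OF lip[OF I]])
    then have "continuous_on {0..\<beta>} (\<lambda>t. F (\<beta> - t) (x (\<beta> - (\<beta> - t))))"
      using continuous_on_compose2[OF _ r] by blast
    then show ?thesis by (auto intro: continuous_on_minus)
  qed
  obtain K where K: "\<And>t x y. t \<in> {0..\<beta>} \<Longrightarrow> norm (F t x - F t y) \<le> K * norm (x - y)"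
    using lipschitz_familyD[OF lip[OF I], of \<beta>] \<beta>0 by (metis atLeastAtMost_iff order_refl)
  have Bl: "\<exists>K. \<forall>t\<in>{0..b}. \<forall>x y. norm (?B t x - ?B t y) \<le> K * norm (x - y)" if "b \<in> {0..\<beta>}" for b
  proof (intro exI[of _ K] ballI allI)
    fix t x y assume t: "t \<in> {0..b}"
    have "norm (F (\<beta> - t) y - F (\<beta> - t) x) \<le> K * norm (y - x)" using K[of "\<beta> - t" y x] t that by auto
    then show "norm (?B t x - ?B t y) \<le> K * norm (x - y)" by (simp add: norm_minus_commute)
  qed
  obtain w where w: "w 0 = 0" "\<And>t. t \<in> {0..\<beta>} \<Longrightarrow> (w has_vector_derivative ?B t (w t)) (at t within {0..\<beta>})"
    using evolution_equation_solution[of "{0..\<beta>}" ?B 0, OF I(2) _ Bc Bl] by auto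
  define x where "x t = (if t \<le> \<beta> then w (\<beta> - t) else 0)" for t
  have x0: "x t = 0" if "\<beta> \<le> t" for t using that w(1) by (auto simp: x_def)
  have comp0: "state_comp (0 :: ('h, 'n) vec \<times> ('h, 'n) vec) j = 0" for j
    by (rule linear_simps(3)[OF bounded_linear_state_comp])
  have top0: "top_deriv t 0 = 0" for t by (simp add: top_deriv_def comp0 blinfun.zero_right)
  have low0: "lower_deriv j t 0 = 0" for j t by (simp add: lower_deriv_def comp0 top0)
  have sys0: "sys \<mu> j t 0 = 0" for j t
    by (simp add: sys_def lower_sys_def low0 top0 comp0 blinfun.zero_right)
  have F0: "F t 0 = 0" if "t \<in> \<Delta>" "\<beta> \<le> t" for t
    using \<beta>(2)[OF that] by (simp add: F_def sys0 of_comps_def unit_comp_def zero_vec_def[symmetric] zero_prod_def[symmetric])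
  \<comment> \<open>The derivative is computed separately within the two pieces of \<Delta>. At
    \<beta> both give the same value; at any other point one of the pieces does not have t in its
    closure, and the condition within it is void.\<close>
  have xd: "(x has_vector_derivative F t (x t)) (at t within \<Delta>)" if t: "t \<in> \<Delta>" for t
  proof -
    have bot: "(x has_vector_derivative d) (at t within A)" if "at t within A = bot" for A d
      unfolding has_vector_derivative_def has_derivative_iff_norm
      by (simp add: that bounded_linear_scaleR_left)
    have "(x has_vector_derivative F t (x t)) (at t within {0..\<beta>})"
    proof (cases "t \<le> \<beta>")
      case True
      have tb: "t \<in> {0..\<beta>}" "\<beta> - t \<in> {0..\<beta>}" using True t nonneg by auto
      have im: "(\<lambda>t. \<beta> - t) ` {0..\<beta>} = {0..\<beta>}"
      proof -
        have "s \<in> (\<lambda>t. \<beta> - t) ` {0..\<beta>}" if "s \<in> {0..\<beta>}" for s using that by (intro image_eqI[of _ _ "\<beta> - s"]) auto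
        then show ?thesis by auto
      qed
      have "((\<lambda>t. \<beta> - t) has_vector_derivative 0 - 1) (at t within {0..\<beta>})"
        by (intro has_vector_derivative_diff has_vector_derivative_const has_vector_derivative_id)
      moreover have "(w has_vector_derivative ?B (\<beta> - t) (w (\<beta> - t))) (at (\<beta> - t) within (\<lambda>t. \<beta> - t) ` {0..\<beta>})"
        unfolding im by (rule w(2)[OF tb(2)])
      ultimately have "((w \<circ> (\<lambda>t. \<beta> - t)) has_vector_derivative (0 - 1) *\<^sub>R ?B (\<beta> - t) (w (\<beta> - t))) (at t within {0..\<beta>})"
        by (rule vector_diff_chain_within)
      moreover have "(0 - 1) *\<^sub>R ?B (\<beta> - t) (w (\<beta> - t)) = F t (x t)" using True by (simp add: x_def)
      ultimately have D: "((w \<circ> (\<lambda>t. \<beta> - t)) has_vector_derivative F t (x t)) (at t within {0..\<beta>})" by (simp only:)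
      show ?thesis by (rule has_vector_derivative_transform[OF tb(1) _ D]) (simp add: x_def)
    next
      case False
      then have "t \<notin> closure {0..\<beta>}" by simp
      then show ?thesis by (rule bot[OF not_in_closure_trivial_limitI])
    qed
    moreover have "(x has_vector_derivative F t (x t)) (at t within (\<Delta> \<inter> {\<beta>..}))"
    proof (cases "\<beta> \<le> t")
      case True
      have D: "((\<lambda>_. 0) has_vector_derivative F t (x t)) (at t within (\<Delta> \<inter> {\<beta>..}))"
        unfolding x0[OF True] F0[OF t True] by (rule has_vector_derivative_const)
      show ?thesis by (rule has_vector_derivative_transform[OF _ _ D]) (use True t x0 in auto)
    next
      case False
      then have "t \<notin> closure (\<Delta> \<inter> {\<beta>..})" using closure_minimal[of "\<Delta> \<inter> {\<beta>..}" "{\<beta>..}"] by auto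
      then show ?thesis by (rule bot[OF not_in_closure_trivial_limitI])
    qed
    ultimately have "(x has_vector_derivative F t (x t)) (at t within ({0..\<beta>} \<union> (\<Delta> \<inter> {\<beta>..})))"
      by (rule has_vector_derivative_union)
    moreover have "{0..\<beta>} \<union> (\<Delta> \<inter> {\<beta>..}) = \<Delta>" using I nonneg by (auto dest: subsetD)
    ultimately show ?thesis by simp
  qed
  have xc: "continuous_on \<Delta> x"
    using xd by (auto simp: continuous_on_eq_continuous_within intro: has_vector_derivative_continuous)
  have cd: "((\<lambda>t. state_comp (x t) j) has_vector_derivative sys \<mu> j t (x t) - (if j = 2 * n - 1 then f t else 0)) (at t within \<Delta>)"
    if "t \<in> \<Delta>" "j < 2 * n" for t j
    using bounded_linear.has_vector_derivative[OF bounded_linear_state_comp xd[OF that(1)], of j] that comp_unit_comp[OF that(2)]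
    by (simp add: F_def n_eq linear_simps[OF bounded_linear_state_comp])
  have d: "((\<lambda>t. state_comp (x t) j) has_vector_derivative sys \<mu> j t (x t)) (at t within \<Delta>)" if "Suc j < 2 * n" "t \<in> \<Delta>" for j t
  proof -
    have "j \<noteq> 2 * n - 1" using that by auto
    then show ?thesis using cd[of t j] that by simp
  qed
  have td: "((\<lambda>t. state_comp (x t) (2 * n - 1)) has_vector_derivative sys \<mu> (2 * n - 1) t (x t) - f t) (at t within \<Delta>)" if "t \<in> \<Delta>" for t
    using cd[of t "2 * n - 1"] that n_pos by simp
  have top: "abs_continuous_on {c..d} (\<lambda>t. state_comp (x t) (2 * n - 1))" if cd': "{c..d} \<subseteq> \<Delta>" for c d
  proof (rule abs_continuous_on_C1)
    show "((\<lambda>t. state_comp (x t) (2 * n - 1)) has_vector_derivative sys \<mu> (2 * n - 1) t (x t) - f t) (at t within {c..d})" if "t \<in> {c..d}" for t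
      by (rule has_vector_derivative_within_subset[OF td cd']) (use that cd' in auto)
    have "continuous_on \<Delta> (\<lambda>t. sys \<mu> (2 * n - 1) t (x t) - f t)"
      by (intro continuous_on_diff f lipschitz_family_cont[OF lipschitz_sys[OF order_refl initial] xc]) (use n_pos in simp)
    then show "continuous_on {c..d} (\<lambda>t. sys \<mu> (2 * n - 1) t (x t) - f t)" by (rule continuous_on_subset[OF _ cd'])
  qed
  have "AE t in lebesgue. t \<in> \<Delta> \<longrightarrow> ((\<lambda>t. state_comp (x t) (2 * n - 1)) has_vector_derivative sys \<mu> (2 * n - 1) t (x t) - f t) (at t within \<Delta>)"
    using td by simp
  note sol = system_solution[OF d xc top this]
  show ?thesis
  proof (intro exI[of _ "\<lambda>t. state_comp (x t) 0"] conjI sol ballI allI impI)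
    fix t j assume "t \<in> \<Delta>" "\<beta> \<le> t" "j < 2 * n"
    then show "qd blinfun_apply j (\<lambda>t. state_comp (x t) 0) t = 0"
      using sol(2)[of j t] x0[of t] by (simp add: linear_simps[OF bounded_linear_state_comp])
  qed
qed

end

section \<open>The Lagrange identity\<close>

text \<open>
  Pointwise form: \<open>Yd i\<close>, \<open>Yu k\<close> stand for $D^i y$, $y^{[n+k]}$, and \<open>YL k - Yu (k + 1)\<close> for the derivative
  of $y^{[n+k]}$.  Every term is a difference of consecutive values of one sequence.
\<close>

lemma lagrange_algebra:
  fixes Yd Zd Yu Zu YL ZL :: "nat \<Rightarrow> 'h::complex_hilbert" and P Q Qs :: "nat \<Rightarrow> 'h \<Rightarrow>\<^sub>L 'h"
  assumes P: "\<And>k x y. k \<le> n \<Longrightarrow> cinner (P k x) y = cinner x (P k y)"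
    and Q: "\<And>k x y. k < n \<Longrightarrow> cinner (Q k x) y = cinner x (Qs k y)"
    and Y0: "Yu 0 = P 0 (Yd n) - scalar_op (\<i> / 2) (Q 0 (Yd (n - 1)))"
    and Z0: "Zu 0 = P 0 (Zd n) - scalar_op (\<i> / 2) (Q 0 (Zd (n - 1)))"
    and YL: "\<And>k. k < n \<Longrightarrow> YL k = P (Suc k) (Yd (n - Suc k)) + scalar_op (\<i> / 2)
        (Qs k (Yd (n - k)) - (if Suc k < n then Q (Suc k) (Yd (n - Suc k - 1)) else 0))"
    and ZL: "\<And>k. k < n \<Longrightarrow> ZL k = P (Suc k) (Zd (n - Suc k)) + scalar_op (\<i> / 2)
        (Qs k (Zd (n - k)) - (if Suc k < n then Q (Suc k) (Zd (n - Suc k - 1)) else 0))"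
    and n: "0 < n"
  shows "(\<Sum>i<n. (cinner (Yd i) (ZL (n - 1 - i) - Zu (n - i)) + cinner (Yd (Suc i)) (Zu (n - 1 - i)))
      - (cinner (Yu (n - 1 - i)) (Zd (Suc i)) + cinner (YL (n - 1 - i) - Yu (n - i)) (Zd i)))
    = cinner (Yu n) (Zd 0) - cinner (Yd 0) (Zu n)"
proof -
  \<comment> \<open>The boundary form alone does not telescope, because a coefficient q enters two
    consecutive steps with shifted indices. These contributions are collected in b and c, and the
    corrected f telescopes. By the formula for the zeroth upper quasi-derivative f vanishes at n,
    and at 0 there is nothing to correct, which leaves the right-hand side.\<close>
  define b where "b i = (if i = 0 then 0 else \<i> / 2 * cinner (Q (n - i) (Yd (i - 1))) (Zd i))" for i
  define c where "c i = (if i = 0 then 0 else \<i> / 2 * cinner (Yd i) (Q (n - i) (Zd (i - 1))))" for i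
  define f where "f i = cinner (Yd i) (Zu (n - i)) - cinner (Yu (n - i)) (Zd i) - b i - c i" for i
  have Q': "cinner (Qs k x) y = cinner x (Q k y)" if "k < n" for k x y
    by (metis Q[OF that] cinner_commute)
  have s: "cinner x (scalar_op (\<i> / 2) y) = - (\<i> / 2 * cinner x y)" "cinner (scalar_op (\<i> / 2) x) y = \<i> / 2 * cinner x y" for x y :: 'h
    by (simp_all add: cinner_scaleC_left cinner_scaleC_right)
  have trm: "(cinner (Yd i) (ZL (n - 1 - i) - Zu (n - i)) + cinner (Yd (Suc i)) (Zu (n - 1 - i)))
      - (cinner (Yu (n - 1 - i)) (Zd (Suc i)) + cinner (YL (n - 1 - i) - Yu (n - i)) (Zd i)) = f (Suc i) - f i" if i: "i < n" for i
  proof -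
    define k where "k = n - 1 - i"
    have k: "k < n" "n - Suc k = i" "n - k = Suc i" "Suc k = n - i" "n - Suc i = k" "Suc k < n \<longleftrightarrow> i \<noteq> 0" "n - Suc k - 1 = i - 1"
      using i by (auto simp: k_def)
    have 1: "cinner (Yd i) (ZL k) = cinner (Yd i) (P (Suc k) (Zd i)) - b (Suc i) + c i"
      unfolding ZL[OF k(1)] using k(1) i
      by (auto simp: k(2,3,5,6,7) cinner_add_right s cinner_diff_right Q[OF k(1), symmetric] b_def c_def k(4) algebra_simps simp del: scalar_op_apply)
    have 2: "cinner (YL k) (Zd i) = cinner (P (Suc k) (Yd i)) (Zd i) + c (Suc i) - b i"
      unfolding YL[OF k(1)] using k(1) i
      by (auto simp: k(2,3,5,6,7) cinner_add_left s cinner_diff_left Q'[OF k(1)] b_def c_def k(4) algebra_simps simp del: scalar_op_apply)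
    have 3: "cinner (P (Suc k) (Yd i)) (Zd i) = cinner (Yd i) (P (Suc k) (Zd i))" using k by (intro P) auto
    show ?thesis
      unfolding k_def[symmetric] f_def using 1 2 3 k(5) by (simp add: cinner_diff_left cinner_diff_right)
  qed
  have "(\<Sum>i<n. (cinner (Yd i) (ZL (n - 1 - i) - Zu (n - i)) + cinner (Yd (Suc i)) (Zu (n - 1 - i)))
      - (cinner (Yu (n - 1 - i)) (Zd (Suc i)) + cinner (YL (n - 1 - i) - Yu (n - i)) (Zd i))) = (\<Sum>i<n. f (Suc i) - f i)"
    by (rule sum.cong) (use trm in auto)
  also have "\<dots> = f n - f 0" by (rule sum_lessThan_telescope)
  also have "f n = 0"
  proof -
    have "cinner (Yd n) (Zu 0) = cinner (Yd n) (P 0 (Zd n)) + c n"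
      using n by (simp only: Z0 cinner_diff_right s) (simp add: c_def)
    moreover have "cinner (Yu 0) (Zd n) = cinner (P 0 (Yd n)) (Zd n) - b n"
      using n by (simp only: Y0 cinner_diff_left s) (simp add: b_def)
    ultimately show ?thesis using P[of 0 "Yd n" "Zd n"] by (simp add: f_def)
  qed
  finally show ?thesis by (simp add: f_def b_def c_def)
qed

lemma abs_continuous_on_sum:
  assumes "\<And>i. i \<in> I \<Longrightarrow> abs_continuous_on S (f i)"
  shows "abs_continuous_on S (\<lambda>t. \<Sum>i\<in>I. f i t)"
  using assms
proof (induction I rule: infinite_finite_induct)
  case (insert i I)
  then show ?case by (auto intro: abs_continuous_on_add)
qed (auto intro: abs_continuous_on_lipschitz[where K = 0])

context quasi_system
begin

abbreviation bf :: "(real \<Rightarrow> 'h) \<Rightarrow> (real \<Rightarrow> 'h) \<Rightarrow> real \<Rightarrow> complex" where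
  "bf y z \<equiv> boundary_form dim \<Delta> p q y z"

abbreviation qv :: "nat \<Rightarrow> (real \<Rightarrow> 'h) \<Rightarrow> real \<Rightarrow> 'h" where
  "qv \<equiv> qd blinfun_apply"

abbreviation dv :: "(real \<Rightarrow> 'h) \<Rightarrow> real \<Rightarrow> 'h" where
  "dv \<equiv> de blinfun_apply"

abbreviation regular :: "(real \<Rightarrow> 'h) \<Rightarrow> bool" where
  "regular y \<equiv> quasi_regular blinfun_apply n \<Delta> p q y"

lemma bf_eq_sum:
  "bf y z t = (\<Sum>i<n. cinner (qv i y t) (qv (2 * n - 1 - i) z t) - cinner (qv (2 * n - 1 - i) y t) (qv i z t))"
proof -
  have "(\<Sum>i\<in>(UNIV :: 'n set). cinner (qv (pos i) y t) (qv (2 * n - 1 - pos i) z t)) = (\<Sum>i<n. cinner (qv i y t) (qv (2 * n - 1 - i) z t))"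
    "(\<Sum>i\<in>(UNIV :: 'n set). cinner (qv (2 * n - 1 - pos i) y t) (qv (pos i) z t)) = (\<Sum>i<n. cinner (qv (2 * n - 1 - i) y t) (qv i z t))"
    unfolding n_eq by (rule sum_pos)+
  then show ?thesis
    by (simp add: boundary_form_def cinner_vec_def column1_def column2_def n_eq[symmetric] sum_subtractf)
qed

lemma qd_abs_continuous:
  assumes y: "regular y" and j: "j < 2 * n" and cd: "{c..d} \<subseteq> \<Delta>"
  shows "abs_continuous_on {c..d} (qv j y)"
proof (cases "j = 2 * n - 1")
  case True
  then show ?thesis using y cd unfolding quasi_regular_def loc_abs_continuous_on_def by blast
next
  case False
  then have "j \<le> 2 * n - 2" using j by auto
  then have "Ck_on 1 \<Delta> (qv j y)" using y unfolding quasi_regular_def by blast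
  then have "loc_abs_continuous_on \<Delta> (qv j y)" by (rule loc_abs_continuous_on_C1)
  then show ?thesis using cd unfolding loc_abs_continuous_on_def by blast
qed

lemma qd_continuous_on:
  assumes y: "regular y" and j: "j < 2 * n"
  shows "continuous_on \<Delta> (qv j y)"
  by (intro continuous_on_localI abs_continuous_on_imp_continuous_on qd_abs_continuous[OF y j])

lemma regular_continuous_on: "regular y \<Longrightarrow> continuous_on \<Delta> y"
  using qd_continuous_on[of y 0] n_pos by (simp add: quasi_deriv_def)

lemma qd_has_vector_derivative:
  assumes y: "Ck_off N \<Delta> (2 * n - 1) y" and t: "t \<in> \<Delta> - N"
  shows "j < n \<Longrightarrow> (qv j y has_vector_derivative Dpow \<Delta> (Suc j) y t) (at t within \<Delta>)"
    and "k < n \<Longrightarrow> (qv (n + k) y has_vector_derivative lower_terms blinfun_apply k y t - uq blinfun_apply (Suc k) y t) (at t within \<Delta>)"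
proof -
  show "(qv j y has_vector_derivative Dpow \<Delta> (Suc j) y t) (at t within \<Delta>)" if "j < n"
  proof -
    have "j < 2 * n - 1" using that by arith
    moreover have "qv j y = Dpow \<Delta> j y" using that by (simp add: quasi_deriv_def)
    ultimately show ?thesis using Dpow_has_vector_derivative[OF y, of t j] t by (simp only:) blast
  qed
  show "(qv (n + k) y has_vector_derivative lower_terms blinfun_apply k y t - uq blinfun_apply (Suc k) y t) (at t within \<Delta>)"
    if k: "k < n"
  proof -
    have y': "Ck_off N \<Delta> (n + (n - 1)) y" using y n_pos by (simp add: mult_2)
    have u: "Ck_off N \<Delta> (n - 1 - k) (uq blinfun_apply k y)"
      by (rule uq_Ck_off[OF action_apply y']) (use k in auto)
    have "(uq blinfun_apply k y has_vector_derivative deriv_on \<Delta> (uq blinfun_apply k y) t) (at t within \<Delta>)"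
    proof -
      have "0 < n - 1 - k \<or> 0 = n - 1 - k \<and> t \<notin> N" using t by auto
      then show ?thesis using Dpow_has_vector_derivative[OF u, of t 0] t by simp
    qed
    moreover have "deriv_on \<Delta> (uq blinfun_apply k y) t = lower_terms blinfun_apply k y t - uq blinfun_apply (Suc k) y t"
      using uq_Suc[OF k, of blinfun_apply y t] by (simp del: upper_quasi_deriv.simps)
    moreover have "qv (n + k) y = uq blinfun_apply k y" by (simp add: quasi_deriv_def)
    ultimately show ?thesis by (simp only:)
  qed
qed

lemma bf_has_vector_derivative:
  assumes y: "Ck_off N \<Delta> (2 * n - 1) y" and z: "Ck_off N \<Delta> (2 * n - 1) z" and t: "t \<in> \<Delta> - N"
  shows "(bf y z has_vector_derivative cinner (dv y t) (z t) - cinner (y t) (dv z t)) (at t within \<Delta>)"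
proof -
  let ?L = "lower_terms blinfun_apply" and ?u = "uq blinfun_apply"
  have tD: "t \<in> \<Delta>" using t by simp
  have ix: "2 * n - 1 - i = n + (n - 1 - i)" "Suc (n - 1 - i) = n - i" if "i < n" for i using that by auto
  have "((\<lambda>t. \<Sum>i<n. cinner (qv i y t) (qv (2 * n - 1 - i) z t) - cinner (qv (2 * n - 1 - i) y t) (qv i z t)) has_vector_derivative
    (\<Sum>i<n. (cinner (Dpow \<Delta> i y t) (?L (n - 1 - i) z t - ?u (n - i) z t) + cinner (Dpow \<Delta> (Suc i) y t) (?u (n - 1 - i) z t))
      - (cinner (?u (n - 1 - i) y t) (Dpow \<Delta> (Suc i) z t) + cinner (?L (n - 1 - i) y t - ?u (n - i) y t) (Dpow \<Delta> i z t)))) (at t within \<Delta>)"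
  proof (rule has_vector_derivative_sum)
    fix i assume "i \<in> {..<n}"
    then have i: "i < n" "n - 1 - i < n" by auto
    have qn: "qv (n + (n - 1 - i)) x t = ?u (n - 1 - i) x t" for x by (simp add: quasi_deriv_def)
    have qi: "qv i x t = Dpow \<Delta> i x t" for x using i by (simp add: quasi_deriv_def)
    note v = qi qn
    show "((\<lambda>t. cinner (qv i y t) (qv (2 * n - 1 - i) z t) - cinner (qv (2 * n - 1 - i) y t) (qv i z t)) has_vector_derivative
      (cinner (Dpow \<Delta> i y t) (?L (n - 1 - i) z t - ?u (n - i) z t) + cinner (Dpow \<Delta> (Suc i) y t) (?u (n - 1 - i) z t))
      - (cinner (?u (n - 1 - i) y t) (Dpow \<Delta> (Suc i) z t) + cinner (?L (n - 1 - i) y t - ?u (n - i) y t) (Dpow \<Delta> i z t))) (at t within \<Delta>)"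
      unfolding ix(1)[OF i(1)] ix(2)[OF i(1), symmetric] v[symmetric]
      by (intro has_vector_derivative_diff bounded_bilinear.has_vector_derivative[OF bounded_bilinear_cinner]
          qd_has_vector_derivative[OF y t] qd_has_vector_derivative[OF z t] i)
  qed
  also have "(\<Sum>i<n. (cinner (Dpow \<Delta> i y t) (?L (n - 1 - i) z t - ?u (n - i) z t) + cinner (Dpow \<Delta> (Suc i) y t) (?u (n - 1 - i) z t))
      - (cinner (?u (n - 1 - i) y t) (Dpow \<Delta> (Suc i) z t) + cinner (?L (n - 1 - i) y t - ?u (n - i) y t) (Dpow \<Delta> i z t)))
    = cinner (?u n y t) (Dpow \<Delta> 0 z t) - cinner (Dpow \<Delta> 0 y t) (?u n z t)"
  proof (rule lagrange_algebra[where P = "\<lambda>k. p k t" and Q = "\<lambda>k. q k t" and Qs = "\<lambda>k. adjoint_op (q k t)"])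
    show "cinner (p k t x) v = cinner x (p k t v)" if "k \<le> n" for k x v
      using cinner_adjoint_op[OF p_linear[OF that tD], of x v] p_adjoint[OF that tD] by simp
    show "cinner (q k t x) v = cinner x (adjoint_op (q k t) v)" if "k < n" for k x v
      by (rule cinner_adjoint_op[OF q_linear[OF that tD]])
  qed (auto simp: lower_terms_def n_pos)
  also have "\<dots> = cinner (dv y t) (z t) - cinner (y t) (dv z t)"
    using diff_expr_eq_uq[OF action_apply y t] diff_expr_eq_uq[OF action_apply z t] by simp
  finally show ?thesis unfolding bf_eq_sum[abs_def, symmetric] by (simp add: bf_eq_sum[abs_def])
qed

lemma bf_abs_continuous:
  assumes "regular y" "regular z" "{c..d} \<subseteq> \<Delta>"
  shows "abs_continuous_on {c..d} (bf y z)"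
proof -
  have "abs_continuous_on {c..d} (\<lambda>t. cinner (qv i u t) (qv j v t))"
    if "i < 2 * n" "j < 2 * n" "regular u" "regular v" for i j u v
    using that assms(3) by (intro abs_continuous_on_bilinear[OF bounded_bilinear_cinner] qd_abs_continuous)
  then have "abs_continuous_on {c..d} (\<lambda>t. cinner (qv i y t) (qv (2 * n - 1 - i) z t) + - cinner (qv (2 * n - 1 - i) y t) (qv i z t))" if "i < n" for i
    using that assms by (intro abs_continuous_on_add abs_continuous_on_linear[OF bounded_linear_minus[OF bounded_linear_ident]]) auto
  then show ?thesis unfolding bf_eq_sum[abs_def] by (intro abs_continuous_on_sum) auto
qed

lemma lagrange_identity:
  assumes y: "regular y" and z: "regular z" and \<beta>: "\<beta> \<in> \<Delta>"
  shows "((\<lambda>t. cinner (dv y t) (z t) - cinner (y t) (dv z t)) has_integral (bf y z \<beta> - bf y z 0)) {0..\<beta>}"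
proof -
  obtain N1 where N1: "N1 \<in> null_sets lebesgue" "Ck_off N1 \<Delta> (2 * n - 1) y" using quasi_regularD[OF action_apply y] by metis
  obtain N2 where N2: "N2 \<in> null_sets lebesgue" "Ck_off N2 \<Delta> (2 * n - 1) z" using quasi_regularD[OF action_apply z] by metis
  define N where "N = N1 \<union> N2"
  have mono: "Ck_off N' \<Delta> k f \<Longrightarrow> N' \<subseteq> N \<Longrightarrow> Ck_off N \<Delta> k f" for N' k and f :: "real \<Rightarrow> 'h"
    by (induction k arbitrary: f) auto
  have N: "N \<in> null_sets lebesgue" "Ck_off N \<Delta> (2 * n - 1) y" "Ck_off N \<Delta> (2 * n - 1) z"
    using N1 N2 mono by (auto simp: N_def)
  have sub: "{0..\<beta>} \<subseteq> \<Delta>" "0 \<le> \<beta>" using \<beta> initial nonneg by auto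
  show ?thesis
  proof (rule abs_continuous_has_integral[OF sub(2) bf_abs_continuous[OF y z sub(1)]])
    show "negligible N" using N(1) by (simp add: negligible_iff_null_sets)
    show "(bf y z has_vector_derivative cinner (dv y t) (z t) - cinner (y t) (dv z t)) (at t within {0..\<beta>})"
      if "t \<in> {0..\<beta>} - N" for t
      by (rule has_vector_derivative_within_subset[OF bf_has_vector_derivative[OF N(2,3)] sub(1)])
        (use that sub(1) in auto)
  qed
qed

end

section \<open>The maximal operator and Green's formula\<close>

text \<open>Lebesgue measure is complete: subsets of the set where f and g differ are measurable, so
  preimages under g differ from those under f by measurable sets.\<close>

lemma borel_measurable_lebesgue_cong_AE:
  fixes f g :: "real \<Rightarrow> 'a::topological_space"
  assumes f: "f \<in> borel_measurable lebesgue" and fg: "AE t in lebesgue. f t = g t"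
  shows "g \<in> borel_measurable lebesgue"
proof (rule measurableI)
  fix A :: "'a set" assume A: "A \<in> sets borel"
  have null: "{t. f t \<noteq> g t \<and> P t} \<in> sets lebesgue" for P
  proof -
    have "AE t in lborel. \<not> (f t \<noteq> g t \<and> P t)"
      using fg by (simp add: AE_completion_iff) (auto elim: eventually_mono)
    from sets_completion_AE[OF this] show ?thesis by (simp add: pred_def)
  qed
  have "f -` A \<in> sets lebesgue" using measurable_sets[OF f A] by simp
  moreover have "g -` A \<inter> space lebesgue =
      (f -` A - {t. f t \<noteq> g t \<and> True}) \<union> {t. f t \<noteq> g t \<and> g t \<in> A}" by auto
  ultimately show "g -` A \<inter> space lebesgue \<in> sets lebesgue"
    using null[of "\<lambda>_. True"] null[of "\<lambda>t. g t \<in> A"] by (simp only:) (intro sets.Un sets.Diff; assumption)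
qed simp

lemma square_integrable_cong_AE:
  assumes f: "square_integrable f" and fg: "AE t in lebesgue. f t = g t"
  shows "square_integrable g"
proof -
  have m: "g \<in> borel_measurable lebesgue"
    using borel_measurable_lebesgue_cong_AE[OF _ fg] f by (simp add: square_integrable_def)
  moreover have "integrable lebesgue (\<lambda>t. (norm (f t))\<^sup>2) \<longleftrightarrow> integrable lebesgue (\<lambda>t. (norm (g t))\<^sup>2)"
    by (rule integrable_cong_AE) (use f fg m in \<open>auto simp: square_integrable_def elim: eventually_mono\<close>)
  ultimately show ?thesis using f by (simp add: square_integrable_def)
qed

lemma square_integrable_indicator:
  assumes "square_integrable f" "S \<in> sets lebesgue"
  shows "square_integrable (\<lambda>t. indicator S t *\<^sub>R f t)"
proof -
  have m: "(\<lambda>t. indicator S t *\<^sub>R f t) \<in> borel_measurable lebesgue"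
    using assms by (intro borel_measurable_scaleR borel_measurable_indicator) (auto simp: square_integrable_def)
  have "integrable lebesgue (\<lambda>t. (norm (indicator S t *\<^sub>R f t))\<^sup>2)"
  proof (rule Bochner_Integration.integrable_bound)
    show "integrable lebesgue (\<lambda>t. (norm (f t))\<^sup>2)" using assms by (simp add: square_integrable_def)
    show "(\<lambda>t. (norm (indicator S t *\<^sub>R f t))\<^sup>2) \<in> borel_measurable lebesgue"
      by (rule measurable_compose[OF m borel_measurable_continuous_onI]) (intro continuous_intros)
  qed (auto simp: indicator_def)
  with m show ?thesis by (simp add: square_integrable_def)
qed

lemma square_integrable_continuous_Icc:
  fixes f :: "real \<Rightarrow> 'a::{complex_hilbert, second_countable_topology}"
  assumes "continuous_on {a..c} f"
  shows "square_integrable (\<lambda>t. indicator {a..c} t *\<^sub>R f t)"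
proof -
  have "(\<lambda>t. indicator {a..c} t *\<^sub>R f t) \<in> borel_measurable borel"
    using assms by (intro borel_measurable_continuous_on_indicator) auto
  then have m: "(\<lambda>t. indicator {a..c} t *\<^sub>R f t) \<in> borel_measurable lebesgue"
    by (simp add: measurable_completion)
  have "set_integrable lborel {a..c} (\<lambda>t. (norm (f t))\<^sup>2)"
    by (intro borel_integrable_atLeastAtMost' continuous_intros assms)
  then have "integrable lborel (\<lambda>t. (norm (indicator {a..c} t *\<^sub>R f t))\<^sup>2)"
    unfolding set_integrable_def by (rule Bochner_Integration.integrable_cong[THEN iffD1, rotated 2]) (auto simp: indicator_def)
  then have "integrable lebesgue (\<lambda>t. (norm (indicator {a..c} t *\<^sub>R f t))\<^sup>2)"
    by (rule integrable_completion[THEN iffD2, rotated])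
      (simp only: measurable_lborel1 measurable_lborel2, rule measurable_compose[OF \<open>(\<lambda>t. indicator {a..c} t *\<^sub>R f t) \<in> borel_measurable borel\<close> borel_measurable_continuous_onI],
        intro continuous_intros)
  with m show ?thesis by (simp add: square_integrable_def)
qed

section \<open>The interval and limits at its right end\<close>

lemma half_interval_is_interval_to:
  assumes "is_interval_to \<Delta> b"
  shows "half_interval \<Delta>"
proof
  obtain r :: real where r: "0 < r" "ereal r < b"
    using assms ereal_dense2[of 0 b] by (auto simp: is_interval_to_def zero_ereal_def)
  have "r \<in> \<Delta>" using assms r by (auto simp: is_interval_to_def)
  then show "\<exists>t\<in>\<Delta>. 0 < t" using r(1) by blast
  have *: "s \<in> \<Delta>" if "t \<in> \<Delta>" "0 \<le> s" "s \<le> t" for s t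
  proof -
    have "ereal s \<le> ereal t" using that by simp
    then show ?thesis
      using assms that unfolding is_interval_to_def by (metis (mono_tags, lifting) mem_Collect_eq order.strict_trans1 order_trans)
  qed
  then show "\<forall>t\<in>\<Delta>. {0..t} \<subseteq> \<Delta>" by auto
  show "\<Delta> \<subseteq> {0..}" using assms by (auto simp: is_interval_to_def)
qed

text \<open>Treats finite and infinite b in the same way and in the sequential form required by
  dominated convergence. The first premise on X says that each point before b is eventually
  passed.\<close>

lemma end_filter_tendstoI:
  fixes f :: "real \<Rightarrow> 'a::first_countable_topology"
  assumes b: "0 < b"
    and seq: "\<And>X. (\<And>t. 0 \<le> t \<Longrightarrow> ereal t < b \<Longrightarrow> eventually (\<lambda>k. t \<le> X k) sequentially) \<Longrightarrow>
      eventually (\<lambda>k. 0 < X k \<and> ereal (X k) < b) sequentially \<Longrightarrow> (\<lambda>k. f (X k)) \<longlonglongrightarrow> l"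
  shows "(f \<longlongrightarrow> l) (end_filter b)"
proof (cases "b = \<infinity>")
  case True
  have "(f \<longlongrightarrow> l) at_top"
  proof (rule tendsto_at_topI_sequentially, rule seq)
    fix X :: "nat \<Rightarrow> real" assume X: "filterlim X at_top sequentially"
    show "eventually (\<lambda>k. t \<le> X k) sequentially" for t using X by (simp add: filterlim_at_top)
    show "eventually (\<lambda>k. 0 < X k \<and> ereal (X k) < b) sequentially"
      using X True by (simp add: filterlim_at_top_dense)
  qed
  then show ?thesis using True by (simp add: end_filter_def)
next
  case False
  then obtain r where r: "b = ereal r" "0 < r" using b by (cases b) auto
  have "(f \<longlongrightarrow> l) (at_left r)"
  proof (rule tendsto_at_left_sequentially[OF r(2)], rule seq)
    fix S :: "nat \<Rightarrow> real" assume S: "\<And>k. S k < r" "\<And>k. 0 < S k" "S \<longlonglongrightarrow> r"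
    show "eventually (\<lambda>k. t \<le> S k) sequentially" if "ereal t < b" for t
      using order_tendstoD(1)[OF S(3), of t] that r by (auto elim: eventually_mono)
    show "eventually (\<lambda>k. 0 < S k \<and> ereal (S k) < b) sequentially" using S r by simp
  qed
  then show ?thesis using False r by (simp add: end_filter_def)
qed

lemma end_filter_nontrivial: "end_filter b \<noteq> bot"
  by (simp add: end_filter_def)

lemma eventually_end_filter:
  assumes "0 < b" "ereal c < b"
  shows "eventually (\<lambda>t. c < t \<and> 0 < t \<and> ereal t < b) (end_filter b)"
proof (cases "b = \<infinity>")
  case True
  then show ?thesis using eventually_gt_at_top[of "max 0 c"] by (auto simp: end_filter_def elim: eventually_mono)
next
  case False
  then obtain r where r: "b = ereal r" "0 < r" "c < r" using assms by (cases b) auto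
  show ?thesis using eventually_at_left_real[of "max 0 c" r] r by (auto simp: end_filter_def elim: eventually_mono)
qed

locale quasi_interval = quasi_system \<Delta> n p q dim
  for \<Delta> n and p q :: "nat \<Rightarrow> real \<Rightarrow> 'h::{complex_hilbert, second_countable_topology} \<Rightarrow>\<^sub>L 'h"
    and dim :: "'n::{finite, linorder} itself" +
  fixes b :: ereal
  assumes interval: "is_interval_to \<Delta> b"
begin

abbreviation mdom :: "(real \<Rightarrow> 'h) set" where
  "mdom \<equiv> max_domain n \<Delta> p q"

abbreviation Lop :: "(real \<Rightarrow> 'h) \<Rightarrow> 'h L2" where
  "Lop y \<equiv> abs_L2 (zero_ext \<Delta> (dv y))"

abbreviation bb :: "(real \<Rightarrow> 'h) \<Rightarrow> (real \<Rightarrow> 'h) \<Rightarrow> complex" where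
  "bb y z \<equiv> boundary_form_at_b dim \<Delta> b p q y z"

lemma b_pos: "0 < b" using interval by (simp add: is_interval_to_def)

lemma memI: "0 \<le> t \<Longrightarrow> ereal t < b \<Longrightarrow> t \<in> \<Delta>"
  using interval by (auto simp: is_interval_to_def)

lemma memD: "t \<in> \<Delta> \<Longrightarrow> 0 \<le> t" "t \<in> \<Delta> \<Longrightarrow> ereal t \<le> b"
  using interval by (auto simp: is_interval_to_def)

lemma AE_not_endpoint: "AE t in lebesgue. t \<noteq> c"
  by (rule AE_I[of _ _ "{c}"]) auto

lemma AE_interior: "AE t in lebesgue. t \<in> \<Delta> \<longrightarrow> 0 < t \<and> ereal t < b"
  using AE_not_endpoint[of 0] AE_not_endpoint[of "real_of_ereal b"]
proof eventually_elim
  case (elim t)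
  have "ereal t \<noteq> b" using elim(2) by (metis real_of_ereal.simps(1))
  then show ?case using elim memD[of t] by (auto simp: less_le)
qed

lemma sets_interval: "\<Delta> \<in> sets lebesgue"
proof -
  have 1: "open {t. ereal t < b}" "closed {t. ereal t \<le> b}"
    by (intro open_Collect_less closed_Collect_le continuous_intros continuous_on_ereal)+
  have "\<Delta> = {0..} \<inter> {t. ereal t < b} \<or> \<Delta> = {0..} \<inter> {t. ereal t \<le> b}"
    using interval by (auto simp: is_interval_to_def)
  then have "\<Delta> \<in> sets borel" using borel_open[OF 1(1)] borel_closed[OF 1(2)] by (metis atLeast_borel sets.Int)
  then show ?thesis by simp
qed

text \<open>If continuous functions differ at t, they differ on a nondegenerate interval inside
  \<Delta>, lying to the right of t when t is 0 and to the left otherwise; such an interval is not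
  null. This makes \<open>abs_L2\<close> injective on the maximal domain, where the boundary values
  are defined on functions and not on classes.\<close>

lemma eq_on_interval_if_AE:
  fixes y z :: "real \<Rightarrow> 'h"
  assumes y: "continuous_on \<Delta> y" and z: "continuous_on \<Delta> z" and ae: "AE t in lebesgue. t \<in> \<Delta> \<longrightarrow> y t = z t"
    and t: "t \<in> \<Delta>"
  shows "y t = z t"
proof (rule ccontr)
  assume "y t \<noteq> z t"
  then have pos: "0 < norm (y t - z t)" by simp
  have "continuous_on \<Delta> (\<lambda>s. y s - z s)" by (intro continuous_intros y z)
  then obtain d where d: "0 < d" "\<And>s. s \<in> \<Delta> \<Longrightarrow> dist s t < d \<Longrightarrow> dist (y s - z s) (y t - z t) < norm (y t - z t)"
    using t pos unfolding continuous_on_iff by metis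
  have ne: "y s \<noteq> z s" if "s \<in> \<Delta>" "dist s t < d" for s
    using d(2)[OF that] by (auto simp: dist_norm norm_minus_commute)
  obtain c where c: "c \<in> \<Delta>" "0 < c" using nondegenerate by blast
  obtain l r where lr: "l < r" "{l<..<r} \<subseteq> \<Delta>" "\<And>s. s \<in> {l<..<r} \<Longrightarrow> dist s t < d"
  proof (cases "t = 0")
    case True
    have "{0<..<min d c} \<subseteq> \<Delta>" using c initial by fastforce
    moreover have "0 < min d c" using d c by simp
    ultimately show ?thesis using that[of 0 "min d c"] True by (auto simp: dist_real_def)
  next
    case False
    then have t0: "0 < t" using memD(1)[OF t] by simp
    have "{max 0 (t - d)<..<t} \<subseteq> \<Delta>" using t initial by fastforce
    moreover have "max 0 (t - d) < t" using d t0 by simp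
    ultimately show ?thesis using that[of "max 0 (t - d)" t] by (auto simp: dist_real_def)
  qed
  have "AE s in lebesgue. s \<notin> {l<..<r}" using ae by eventually_elim (use lr ne in blast)
  then have "emeasure lebesgue {l<..<r} = 0" by (subst (asm) AE_iff_measurable[of "{l<..<r}"]) auto
  then show False using lr(1) by simp
qed

section \<open>Linear structure of the maximal domain\<close>

lemma mdomD:
  assumes "y \<in> mdom"
  shows "regular y" "t \<notin> \<Delta> \<Longrightarrow> y t = 0" "square_integrable y" "square_integrable (zero_ext \<Delta> (dv y))"
  using assms by (auto simp: max_domain_def)

lemma mdom_eqI:
  assumes "y \<in> mdom" "z \<in> mdom" "abs_L2 y = abs_L2 z"
  shows "y = z"
proof
  fix t
  have "AE s in lebesgue. y s = z s" using abs_L2_eq_iff[OF mdomD(3)[OF assms(1)] mdomD(3)[OF assms(2)]] assms(3) by simp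
  then have "AE s in lebesgue. s \<in> \<Delta> \<longrightarrow> y s = z s" by eventually_elim auto
  then show "y t = z t"
    using eq_on_interval_if_AE[OF regular_continuous_on[OF mdomD(1)[OF assms(1)]] regular_continuous_on[OF mdomD(1)[OF assms(2)]]]
      mdomD(2)[OF assms(1)] mdomD(2)[OF assms(2)] by metis
qed

text \<open>The usual way into the maximal domain: l[y] is known almost everywhere as a function g
  whose square integrability is already established.\<close>

lemma mdomI:
  assumes y: "regular y" "\<And>t. t \<notin> \<Delta> \<Longrightarrow> y t = 0" "square_integrable y"
    and g: "square_integrable g" "\<And>t. t \<notin> \<Delta> \<Longrightarrow> g t = 0" "AE t in lebesgue. t \<in> \<Delta> \<longrightarrow> dv y t = g t"
  shows "y \<in> mdom \<and> Lop y = abs_L2 g"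
proof -
  have ae: "AE t in lebesgue. g t = zero_ext \<Delta> (dv y) t"
    using g(3) by eventually_elim (auto simp: zero_ext_def g(2))
  have sq: "square_integrable (zero_ext \<Delta> (dv y))" by (rule square_integrable_cong_AE[OF g(1) ae])
  then show ?thesis using y ae abs_L2_eq_iff[OF sq g(1)] by (auto simp: max_domain_def elim: eventually_mono)
qed

lemma zero_ext_regular:
  assumes "regular y"
  shows "regular (zero_ext \<Delta> y)" "t \<in> \<Delta> \<Longrightarrow> qv j (zero_ext \<Delta> y) t = qv j y t" "t \<in> \<Delta> \<Longrightarrow> dv (zero_ext \<Delta> y) t = dv y t"
proof -
  show 1: "t \<in> \<Delta> \<Longrightarrow> qv j (zero_ext \<Delta> y) t = qv j y t" for t j by (rule qd_cong) (simp_all add: zero_ext_def)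
  show "t \<in> \<Delta> \<Longrightarrow> dv (zero_ext \<Delta> y) t = dv y t" by (rule de_cong) (simp_all add: zero_ext_def)
  show "regular (zero_ext \<Delta> y)"
    by (rule quasi_regular_transfer[OF assms bounded_linear_ident]) (rule 1)
qed

lemma mdom_add:
  assumes y: "y \<in> mdom" and z: "z \<in> mdom"
  shows "(\<lambda>t. y t + z t) \<in> mdom \<and> Lop (\<lambda>t. y t + z t) = Lop y + Lop z"
proof -
  note p = quasi_regular_plus[OF action_apply mdomD(1)[OF y] mdomD(1)[OF z]]
  have "(\<lambda>t. y t + z t) \<in> mdom \<and> Lop (\<lambda>t. y t + z t) = abs_L2 (\<lambda>t. zero_ext \<Delta> (dv y) t + zero_ext \<Delta> (dv z) t)"
  proof (rule mdomI[OF p(1)])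
    show "AE t in lebesgue. t \<in> \<Delta> \<longrightarrow> dv (\<lambda>t. y t + z t) t = zero_ext \<Delta> (dv y) t + zero_ext \<Delta> (dv z) t"
      using p(3) by eventually_elim (simp add: zero_ext_def)
  qed (use mdomD[OF y] mdomD[OF z] in \<open>auto simp: zero_ext_def intro: square_integrable_add\<close>)
  then show ?thesis using abs_L2_arith(1)[OF mdomD(4)[OF y] mdomD(4)[OF z]] by simp
qed

lemma scaleC_regular:
  assumes "regular y"
  shows "regular (\<lambda>t. a *\<^sub>C y t)" "t \<in> \<Delta> \<Longrightarrow> j < 2 * n \<Longrightarrow> qv j (\<lambda>t. a *\<^sub>C y t) t = a *\<^sub>C qv j y t"
    "AE t in lebesgue. t \<in> \<Delta> \<longrightarrow> dv (\<lambda>t. a *\<^sub>C y t) t = a *\<^sub>C dv y t"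
proof -
  have i: "a *\<^sub>C (blinfun_apply A x) = blinfun_apply A (a *\<^sub>C x)" if "complex_linear A" for A :: "'h \<Rightarrow>\<^sub>L 'h" and x
    using complex_linearD[OF that] by simp
  note l = quasi_regular_linear[where L = "\<lambda>x :: 'h. a *\<^sub>C x", OF action_apply action_apply bounded_linear_scaleC i assms]
  show "regular (\<lambda>t. a *\<^sub>C y t)" by (rule l(1))
  show "t \<in> \<Delta> \<Longrightarrow> j < 2 * n \<Longrightarrow> qv j (\<lambda>t. a *\<^sub>C y t) t = a *\<^sub>C qv j y t" by (rule l(2))
  show "AE t in lebesgue. t \<in> \<Delta> \<longrightarrow> dv (\<lambda>t. a *\<^sub>C y t) t = a *\<^sub>C dv y t" by (rule l(3))
qed

lemma mdom_scaleC:
  assumes y: "y \<in> mdom"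
  shows "(\<lambda>t. a *\<^sub>C y t) \<in> mdom \<and> Lop (\<lambda>t. a *\<^sub>C y t) = a *\<^sub>C Lop y"
proof -
  note p = scaleC_regular[OF mdomD(1)[OF y], where a = a]
  have "(\<lambda>t. a *\<^sub>C y t) \<in> mdom \<and> Lop (\<lambda>t. a *\<^sub>C y t) = abs_L2 (\<lambda>t. a *\<^sub>C zero_ext \<Delta> (dv y) t)"
  proof (rule mdomI[OF p(1)])
    show "AE t in lebesgue. t \<in> \<Delta> \<longrightarrow> dv (\<lambda>t. a *\<^sub>C y t) t = a *\<^sub>C zero_ext \<Delta> (dv y) t"
      using p(3) by eventually_elim (simp add: zero_ext_def)
  qed (use mdomD[OF y] in \<open>auto simp: zero_ext_def intro: square_integrable_scaleC\<close>)
  then show ?thesis using abs_L2_arith(3)[OF mdomD(4)[OF y] mdomD(4)[OF y]] by simp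
qed

lemma mdom_zero: "(\<lambda>_. 0) \<in> mdom \<and> Lop (\<lambda>_. 0) = 0"
proof -
  have "Ck_on k \<Delta> (\<lambda>_. 0 :: 'h)" for k
    unfolding Ck_on_eq_Ck_off by (rule Ck_off_const)
  then have r: "regular (\<lambda>_. 0)" by (rule quasi_regular_if_Ck[OF action_apply])
  note s = scaleC_regular(3)[OF r, where a = 0]
  have "(\<lambda>_. 0) \<in> mdom \<and> Lop (\<lambda>_. 0) = abs_L2 (\<lambda>_. 0)"
    by (rule mdomI[OF r]) (use s in \<open>auto simp: square_integrable_zero\<close>)
  then show ?thesis by (simp add: abs_L2_zero)
qed

lemma mdom_diff:
  assumes y: "y \<in> mdom" and z: "z \<in> mdom"
  shows "(\<lambda>t. y t - z t) \<in> mdom \<and> Lop (\<lambda>t. y t - z t) = Lop y - Lop z"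
  using mdom_add[OF y conjunct1[OF mdom_scaleC[OF z, of "-1"]]] mdom_scaleC[OF z, of "-1"] by simp

text \<open>The Lagrange identity on {0..t} as t approaches b, by dominated convergence. In
  particular the limit in [y,z](b) exists for y and z in the maximal domain, so that
  \<open>Lim\<close> has its intended value.\<close>

lemma bf_tendsto:
  assumes y: "y \<in> mdom" and z: "z \<in> mdom"
  shows "(bf y z \<longlongrightarrow> bf y z 0 + (cinner (Lop y) (abs_L2 z) - cinner (abs_L2 y) (Lop z))) (end_filter b)"
proof -
  let ?F = "\<lambda>t. cinner (zero_ext \<Delta> (dv y) t) (z t) - cinner (y t) (zero_ext \<Delta> (dv z) t)"
  note Y = mdomD[OF y] and Z = mdomD[OF z]
  have i: "integrable lebesgue ?F" by (intro Bochner_Integration.integrable_diff integrable_cinner Y Z)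
  have I: "integral\<^sup>L lebesgue ?F = cinner (Lop y) (abs_L2 z) - cinner (abs_L2 y) (Lop z)"
    using abs_L2_arith(6)[OF Y(4) Z(3)] abs_L2_arith(6)[OF Y(3) Z(4)] integrable_cinner[OF Y(4) Z(3)] integrable_cinner[OF Y(3) Z(4)] by simp
  have si: "set_integrable lebesgue {0..\<beta>} ?F" for \<beta>
    unfolding set_integrable_def using integrable_mult_indicator[OF _ i, of "{0..\<beta>}"] by simp
  have eq: "bf y z \<beta> = bf y z 0 + (LINT t:{0..\<beta>}|lebesgue. ?F t)" if \<beta>: "\<beta> \<in> \<Delta>" for \<beta>
  proof -
    have sub: "{0..\<beta>} \<subseteq> \<Delta>" using initial \<beta> by blast
    have "(?F has_integral (bf y z \<beta> - bf y z 0)) {0..\<beta>}"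
      by (rule has_integral_eq[OF _ lagrange_identity[OF Y(1) Z(1) \<beta>]]) (use sub in \<open>auto simp: zero_ext_def\<close>)
    from has_integral_unique[OF this has_integral_set_lebesgue[OF si]]
    have "bf y z \<beta> = (LINT t:{0..\<beta>}|lebesgue. ?F t) + bf y z 0" by (simp only: diff_eq_eq)
    then show ?thesis by (rule trans[OF _ add.commute])
  qed
  show ?thesis
  proof (rule end_filter_tendstoI[OF b_pos])
    fix X :: "nat \<Rightarrow> real"
    assume X: "\<And>t. 0 \<le> t \<Longrightarrow> ereal t < b \<Longrightarrow> eventually (\<lambda>k. t \<le> X k) sequentially"
      "eventually (\<lambda>k. 0 < X k \<and> ereal (X k) < b) sequentially"
    have "(\<lambda>k. LINT t:{0..X k}|lebesgue. ?F t) \<longlonglongrightarrow> integral\<^sup>L lebesgue ?F"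
      unfolding set_lebesgue_integral_def
    proof (rule integral_dominated_convergence[where w = "\<lambda>t. norm (?F t)"])
      show "integrable lebesgue (\<lambda>t. norm (?F t))" using i by (rule integrable_norm)
      show "AE t in lebesgue. (\<lambda>k. indicat_real {0..X k} t *\<^sub>R ?F t) \<longlonglongrightarrow> ?F t"
        using AE_interior
      proof eventually_elim
        case (elim t)
        show ?case
        proof (cases "t \<in> \<Delta>")
          case True
          then have "eventually (\<lambda>k. t \<le> X k) sequentially" using X(1) elim by auto
          then have "eventually (\<lambda>k. indicat_real {0..X k} t *\<^sub>R ?F t = ?F t) sequentially"
            by eventually_elim (use True elim in \<open>simp add: indicator_def\<close>)
          then show ?thesis by (rule tendsto_eventually)
        next
          case False
          then have "?F t = 0" using Y(2) Z(2) by (simp add: zero_ext_def)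
          then show ?thesis by simp
        qed
      qed
      show "AE t in lebesgue. norm (indicat_real {0..X k} t *\<^sub>R ?F t) \<le> norm (?F t)" for k
        by (rule AE_I2) (auto simp: indicator_def)
      show "?F \<in> borel_measurable lebesgue" using i by (rule borel_measurable_integrable)
      then show "(\<lambda>t. indicat_real {0..X k} t *\<^sub>R ?F t) \<in> borel_measurable lebesgue" for k
        by (intro borel_measurable_scaleR borel_measurable_indicator) simp_all
    qed
    then have "(\<lambda>k. bf y z 0 + (LINT t:{0..X k}|lebesgue. ?F t)) \<longlonglongrightarrow> bf y z 0 + integral\<^sup>L lebesgue ?F"
      by (intro tendsto_intros)
    moreover have "eventually (\<lambda>k. bf y z 0 + (LINT t:{0..X k}|lebesgue. ?F t) = bf y z (X k)) sequentially"
      using X(2) by eventually_elim (rule eq[symmetric], auto intro: memI)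
    ultimately show "(\<lambda>k. bf y z (X k)) \<longlonglongrightarrow> bf y z 0 + (cinner (Lop y) (abs_L2 z) - cinner (abs_L2 y) (Lop z))"
      unfolding I by (rule Lim_transform_eventually)
  qed
qed

lemma green:
  assumes "y \<in> mdom" "z \<in> mdom"
  shows "cinner (Lop y) (abs_L2 z) - cinner (abs_L2 y) (Lop z) = bb y z - bf y z 0"
  using tendsto_Lim[OF end_filter_nontrivial bf_tendsto[OF assms]] by (simp add: boundary_form_at_b_def)

section \<open>Functions that vanish near the right end\<close>

lemma deriv_on_local:
  assumes "\<And>s. s \<in> \<Delta> \<Longrightarrow> c < s \<Longrightarrow> f s = 0" "t \<in> \<Delta>" "c < t"
  shows "deriv_on \<Delta> f t = 0"
proof (rule deriv_on_eqI[OF _ assms(2)])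
  show "(f has_vector_derivative 0) (at t within \<Delta>)"
    by (rule has_vector_derivative_transform_within[OF has_vector_derivative_const[of 0], of "t - c"])
      (use assms in \<open>auto simp: dist_real_def\<close>)
qed

lemma qv_local:
  assumes y: "\<And>s. s \<in> \<Delta> \<Longrightarrow> c < s \<Longrightarrow> y s = 0" and t: "t \<in> \<Delta>" "c < t"
  shows "qv j y t = 0"
proof -
  have D: "Dpow \<Delta> k y s = 0" if "s \<in> \<Delta>" "c < s" for k s
    using that
  proof (induction k arbitrary: s)
    case (Suc k)
    then show ?case using deriv_on_local[of c "Dpow \<Delta> k y" s] by (simp add: Dpow_Suc del: funpow.simps)
  qed (simp add: y)
  have "uq blinfun_apply m y s = 0" if "s \<in> \<Delta>" "c < s" for m s
    using that
  proof (induction m arbitrary: s)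
    case (Suc m)
    then show ?case using deriv_on_local[of c "uq blinfun_apply m y" s] by (simp add: D del: funpow.simps)
  qed (simp add: D del: funpow.simps)
  then show ?thesis using D t by (simp add: quasi_deriv_def)
qed

lemma bb_local:
  assumes c: "ereal c < b" and y: "\<And>s. s \<in> \<Delta> \<Longrightarrow> c < s \<Longrightarrow> y s = 0"
  shows "bb y z = 0" "bb z y = 0"
proof -
  have v: "bf y z t = 0 \<and> bf z y t = 0" if "t \<in> \<Delta>" "c < t" for t
    using qv_local[OF y that] by (simp add: bf_eq_sum)
  have "eventually (\<lambda>t. bf y z t = 0 \<and> bf z y t = 0) (end_filter b)"
    using eventually_end_filter[OF b_pos c] by (rule eventually_mono) (use v memI in \<open>metis less_imp_le\<close>)
  then have "(bf y z \<longlongrightarrow> 0) (end_filter b)" "(bf z y \<longlongrightarrow> 0) (end_filter b)"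
    by (auto intro!: tendsto_eventually elim: eventually_mono)
  then show "bb y z = 0" "bb z y = 0"
    using tendsto_Lim[OF end_filter_nontrivial] by (auto simp: boundary_form_at_b_def)
qed

end

section \<open>Weak solutions\<close>

lemma norm_abs_L2_le:
  assumes f: "square_integrable f" and z: "\<And>t. t \<notin> {0..c} \<Longrightarrow> f t = 0" and K: "\<And>t. norm (f t) \<le> K" and c: "0 \<le> c"
  shows "norm (abs_L2 f) \<le> sqrt c * K"
proof -
  have K0: "0 \<le> K" using K[of 0] norm_ge_zero order_trans by blast
  have "(norm (abs_L2 f))\<^sup>2 = (\<integral>t. (norm (f t))\<^sup>2 \<partial>lebesgue)" by (rule norm_abs_L2(1)[OF f])
  also have "\<dots> \<le> (\<integral>t. indicator {0..c} t *\<^sub>R K\<^sup>2 \<partial>lebesgue)"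
  proof (rule integral_mono)
    show "integrable lebesgue (\<lambda>t. (norm (f t))\<^sup>2)" using f by (simp add: square_integrable_def)
    show "integrable lebesgue (\<lambda>t. indicat_real {0..c} t *\<^sub>R K\<^sup>2)" by (intro integrable_scaleR_left integrable_real_indicator) (use c in simp_all)
    show "(norm (f t))\<^sup>2 \<le> indicat_real {0..c} t *\<^sub>R K\<^sup>2" for t
      using z[of t] power_mono[OF K[of t], of 2] by (cases "t \<in> {0..c}") auto
  qed
  also have "\<dots> = c * K\<^sup>2" using c by simp
  also have "\<dots> = (sqrt c * K)\<^sup>2" using c by (simp add: power_mult_distrib)
  finally show ?thesis by (rule power2_le_imp_le) (use K0 c in simp)
qed

text \<open>Continuous ramps that are 1 well before s and 0 from s on converge to the indicator of
  the points before s. Orthogonality passes to the limit and says that the indefinite integral of d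
  vanishes on {0..\<beta>}; its derivative is d almost everywhere. For s \<le> \<beta> the ramps
  vanish from \<beta> on, as the hypothesis requires.\<close>

lemma zero_AE_if_orthogonal_to_continuous:
  fixes d :: "real \<Rightarrow> 'h::{complex_hilbert, second_countable_topology}"
  assumes d: "square_integrable d" and z: "\<And>t. t \<notin> {0..\<beta>} \<Longrightarrow> d t = 0"
    and orth: "\<And>f :: real \<Rightarrow> 'h. continuous_on UNIV f \<Longrightarrow> (\<And>t. \<beta> \<le> t \<Longrightarrow> f t = 0) \<Longrightarrow> (\<integral>t. inner (d t) (f t) \<partial>lebesgue) = 0"
  shows "AE t in lebesgue. d t = 0"
proof -
  have m: "d \<in> borel_measurable lebesgue" using d by (simp add: square_integrable_def)
  have i: "integrable lebesgue d"
  proof -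
    have "integrable lebesgue (\<lambda>t. indicator {0..\<beta>} t *\<^sub>R d t)"
      using square_integrable_set_integrable[OF d, of 0 \<beta> 0] by (simp add: set_integrable_def)
    moreover have "(\<lambda>t. indicator {0..\<beta>} t *\<^sub>R d t) = d" using z by (auto simp: fun_eq_iff indicator_def)
    ultimately show ?thesis by simp
  qed
  have ind: "indef_integral d s = 0" if s: "0 \<le> s" "s \<le> \<beta>" for s
  proof -
    have "inner (indef_integral d s) e = 0" for e
    proof -
      define r where "r k t = max 0 (min 1 (real k * (s - t)))" for k t
      have lim: "(\<lambda>k. \<integral>t. inner (d t) (r k t *\<^sub>R e) \<partial>lebesgue) \<longlonglongrightarrow> (\<integral>t. inner (d t) (indicator {0..<s} t *\<^sub>R e) \<partial>lebesgue)"
      proof (rule integral_dominated_convergence[where w = "\<lambda>t. norm (d t) * norm e"])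
        show "integrable lebesgue (\<lambda>t. norm (d t) * norm e)" using i by (intro integrable_mult_left integrable_norm)
        show "(\<lambda>t. inner (d t) (indicat_real {0..<s} t *\<^sub>R e)) \<in> borel_measurable lebesgue"
          by (intro borel_measurable_inner m borel_measurable_scaleR borel_measurable_indicator) auto
        show "(\<lambda>t. inner (d t) (r k t *\<^sub>R e)) \<in> borel_measurable lebesgue" for k
        proof -
          have "r k \<in> borel_measurable borel" unfolding r_def by (intro borel_measurable_continuous_onI continuous_intros)
          then have "r k \<in> borel_measurable lebesgue" by (simp add: measurable_completion)
          then show ?thesis by (intro borel_measurable_inner m borel_measurable_scaleR) auto
        qed
        show "AE t in lebesgue. norm (inner (d t) (r k t *\<^sub>R e)) \<le> norm (d t) * norm e" for k
        proof (rule AE_I2)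
          fix t
          have "norm (inner (d t) (r k t *\<^sub>R e)) \<le> norm (d t) * norm (r k t *\<^sub>R e)"
            using Cauchy_Schwarz_ineq2 by (simp only: real_norm_def)
          also have "norm (r k t *\<^sub>R e) \<le> 1 * norm e" unfolding norm_scaleR by (intro mult_right_mono) (auto simp: r_def)
          finally show "norm (inner (d t) (r k t *\<^sub>R e)) \<le> norm (d t) * norm e" by (simp add: mult_left_mono)
        qed
        show "AE t in lebesgue. (\<lambda>k. inner (d t) (r k t *\<^sub>R e)) \<longlonglongrightarrow> inner (d t) (indicat_real {0..<s} t *\<^sub>R e)"
        proof (rule AE_I2)
          fix t
          consider "t < 0" | "0 \<le> t" "t < s" | "s \<le> t" by linarith
          then show "(\<lambda>k. inner (d t) (r k t *\<^sub>R e)) \<longlonglongrightarrow> inner (d t) (indicat_real {0..<s} t *\<^sub>R e)"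
          proof cases
            case 1
            then show ?thesis using z[of t] by simp
          next
            case 2
            obtain k0 where k0: "1 / (s - t) < real k0" using reals_Archimedean2 by blast
            have "eventually (\<lambda>k. r k t = 1) sequentially"
              using eventually_ge_at_top[of k0]
            proof eventually_elim
              case (elim k)
              have "1 < real k0 * (s - t)" using k0 2 by (simp add: field_simps)
              also have "\<dots> \<le> real k * (s - t)" using elim 2 by (intro mult_right_mono) auto
              finally show ?case by (simp add: r_def)
            qed
            then have "eventually (\<lambda>k. inner (d t) (r k t *\<^sub>R e) = inner (d t) (indicat_real {0..<s} t *\<^sub>R e)) sequentially"
              by eventually_elim (use 2 in simp)
            then show ?thesis by (rule tendsto_eventually)
          next
            case 3
            then have "r k t = 0" for k using mult_nonneg_nonpos[of "real k" "s - t"] by (simp add: r_def)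
            then show ?thesis using 3 by simp
          qed
        qed
      qed
      have "(\<integral>t. inner (d t) (r k t *\<^sub>R e) \<partial>lebesgue) = 0" for k
      proof (rule orth)
        show "continuous_on UNIV (\<lambda>t. r k t *\<^sub>R e)" unfolding r_def by (intro continuous_intros)
        show "r k t *\<^sub>R e = 0" if "\<beta> \<le> t" for t
          using mult_nonneg_nonpos[of "real k" "s - t"] that s by (simp add: r_def)
      qed
      with lim have 0: "(\<integral>t. inner (d t) (indicator {0..<s} t *\<^sub>R e) \<partial>lebesgue) = 0"
        by (simp add: LIMSEQ_const_iff)
      have ii: "integrable lebesgue (\<lambda>t. indicator {0..s} t *\<^sub>R d t)" using integrable_mult_indicator[OF _ i, of "{0..s}"] by simp
      have "inner (indef_integral d s) e = (\<integral>t. inner (indicator {0..s} t *\<^sub>R d t) e \<partial>lebesgue)"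
        unfolding indef_integral_def set_lebesgue_integral_def by (rule integral_inner_left[OF ii, symmetric])
      also have "\<dots> = (\<integral>t. inner (d t) (indicator {0..<s} t *\<^sub>R e) \<partial>lebesgue)"
      proof (rule integral_cong_AE)
        show "(\<lambda>t. inner (indicat_real {0..s} t *\<^sub>R d t) e) \<in> borel_measurable lebesgue"
          "(\<lambda>t. inner (d t) (indicat_real {0..<s} t *\<^sub>R e)) \<in> borel_measurable lebesgue"
          by (intro borel_measurable_inner m borel_measurable_scaleR borel_measurable_indicator borel_measurable_const; simp)+
        have "AE t in lebesgue. t \<noteq> s" by (rule AE_I[of _ _ "{s}"]) auto
        then show "AE t in lebesgue. inner (indicat_real {0..s} t *\<^sub>R d t) e = inner (d t) (indicat_real {0..<s} t *\<^sub>R e)"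
          by eventually_elim (auto simp: indicator_def)
      qed
      finally show ?thesis using 0 by simp
    qed
    from this[of "indef_integral d s"] show ?thesis by simp
  qed
  have n: "AE t in lebesgue. t \<noteq> u" for u :: real by (rule AE_I[of _ _ "{u}"]) auto
  show ?thesis
    using indef_integral_has_vector_derivative_AE[OF d] n[of 0] n[of \<beta>]
  proof eventually_elim
    case (elim t)
    show ?case
    proof (cases "0 < t \<and> t < \<beta>")
      case True
      have "((\<lambda>_. 0) has_vector_derivative d t) (at t)"
      proof (rule has_vector_derivative_transform_within[where S = UNIV])
        show "(indef_integral d has_vector_derivative d t) (at t)" using elim True by blast
        show "0 < min t (\<beta> - t)" using True by simp
        show "indef_integral d s = 0" if "dist s t < min t (\<beta> - t)" for s
          using that by (intro ind) (auto simp: dist_real_def)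
      qed simp
      then show ?thesis using vector_derivative_unique_at[OF _ has_vector_derivative_const] by blast
    next
      case False
      then show ?thesis using z[of t] elim by auto
    qed
  qed
qed

context quasi_interval
begin

lemma operator_function_apply:
  fixes W :: "real \<Rightarrow> 'k::complex_hilbert \<Rightarrow>\<^sub>L 'h"
  assumes "quasi_regular (o\<^sub>L) n \<Delta> p q W"
  shows "regular (\<lambda>t. W t h)" "t \<in> \<Delta> \<Longrightarrow> j < 2 * n \<Longrightarrow> qv j (\<lambda>t. W t h) t = qd (o\<^sub>L) j W t h"
    "AE t in lebesgue. t \<in> \<Delta> \<longrightarrow> dv (\<lambda>t. W t h) t = de (o\<^sub>L) W t h"
proof -
  have L: "bounded_linear (\<lambda>A :: 'k \<Rightarrow>\<^sub>L 'h. A h)" by (rule blinfun.bounded_linear_left)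
  have i: "blinfun_apply (A o\<^sub>L x) h = blinfun_apply A (blinfun_apply x h)" for A :: "'h \<Rightarrow>\<^sub>L 'h" and x :: "'k \<Rightarrow>\<^sub>L 'h" by simp
  note l = quasi_regular_linear[where L = "\<lambda>A :: 'k \<Rightarrow>\<^sub>L 'h. A h" and act' = blinfun_apply, OF action_compose action_apply L i assms]
  show "regular (\<lambda>t. W t h)" by (rule l(1))
  show "t \<in> \<Delta> \<Longrightarrow> j < 2 * n \<Longrightarrow> qv j (\<lambda>t. W t h) t = qd (o\<^sub>L) j W t h" by (rule l(2))
  show "AE t in lebesgue. t \<in> \<Delta> \<longrightarrow> dv (\<lambda>t. W t h) t = de (o\<^sub>L) W t h" by (rule l(3))
qed

text \<open>For functions vanishing near b, the vanishing of the quasi-derivative of order 2n there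
  is immediate by locality; this carries it over to l[y].\<close>

lemma dv_eq_qv_AE:
  assumes "regular y"
  shows "AE t in lebesgue. t \<in> \<Delta> \<longrightarrow> dv y t = qv (2 * n) y t"
proof -
  obtain N where N: "N \<in> null_sets lebesgue" "Ck_off N \<Delta> (2 * n - 1) y"
    using quasi_regularD[OF action_apply assms] by metis
  show ?thesis
    using AE_not_in[OF N(1)]
  proof eventually_elim
    case (elim t)
    show ?case
    proof
      assume "t \<in> \<Delta>"
      then have "dv y t = uq blinfun_apply n y t" using elim by (intro diff_expr_eq_uq[OF action_apply N(2)]) auto
      then show "dv y t = qv (2 * n) y t" by (simp add: quasi_deriv_def mult_2)
    qed
  qed
qed

text \<open>Besides the data at 0, linearity in h and a bound by the norm of h are recorded, since
  functionals of h formed with these elements will be represented by Riesz vectors. The data at 0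
  are those of the operator function with unit data, applied to h.\<close>

lemma steering_element:
  assumes c: "c \<in> \<Delta>" "0 < c" and m: "m < 2 * n"
  shows "\<exists>\<Phi>. (\<forall>h. \<Phi> h \<in> mdom) \<and> (\<forall>h. \<forall>j<2 * n. qv j (\<Phi> h) 0 = (if j = m then h else 0)) \<and>
    (\<forall>h t. c \<le> t \<longrightarrow> \<Phi> h t = 0) \<and> (\<forall>h k. \<Phi> (h + k) = (\<lambda>t. \<Phi> h t + \<Phi> k t)) \<and>
    (\<forall>r h. \<Phi> (r *\<^sub>R h) = (\<lambda>t. complex_of_real r *\<^sub>C \<Phi> h t)) \<and>
    (\<exists>C. \<forall>h. norm (abs_L2 (\<Phi> h)) \<le> C * norm h \<and> norm (Lop (\<Phi> h)) \<le> C * norm h)"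
proof -
  obtain W :: "real \<Rightarrow> 'h \<Rightarrow>\<^sub>L 'h" where W: "Ck_on (2 * n) \<Delta> W" "\<And>t. c \<le> t \<Longrightarrow> W t = 0"
      "\<And>j. j < 2 * n \<Longrightarrow> qd (o\<^sub>L) j W 0 = (if j = m then id_blinfun else 0)"
    using steering_function[OF c(2) m] by metis
  have reg: "quasi_regular (o\<^sub>L) n \<Delta> p q W" by (rule quasi_regular_if_Ck[OF action_compose W(1)])
  define V where "V = uq (o\<^sub>L) n W"
  have W2: "Ck_on (n + n) \<Delta> W" using W(1) by (simp add: mult_2)
  have "Ck_off \<Delta> \<Delta> (n - n) V"
    unfolding V_def by (rule uq_Ck_off[OF action_compose]) (use W2 in \<open>auto simp: Ck_on_eq_Ck_off\<close>)
  then have Vc: "continuous_on \<Delta> V" by (rule Ck_off_continuous_on)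
  have Wc: "continuous_on \<Delta> W" using W(1) unfolding Ck_on_eq_Ck_off by (rule Ck_off_continuous_on)
  have sub: "{0..c} \<subseteq> \<Delta>" using c initial by blast
  have deV: "de (o\<^sub>L) W t = V t" if "t \<in> \<Delta>" for t
  proof -
    have "Ck_off {} \<Delta> (2 * n - 1) W" using W(1) n_pos by (intro Ck_on_imp_Ck_off[OF W(1)]) auto
    from diff_expr_eq_uq[OF action_compose this] show ?thesis using that by (simp add: V_def)
  qed
  define \<Phi> where "\<Phi> h = zero_ext \<Delta> (\<lambda>t. W t h)" for h
  define G where "G h t = indicator {0..c} t *\<^sub>R V t h" for h t
  have \<Phi>c: "\<Phi> h t = 0" if "c \<le> t" for h t using W(2)[OF that] by (simp add: \<Phi>_def zero_ext_def)
  have \<Phi>i: "\<Phi> h = (\<lambda>t. indicator {0..c} t *\<^sub>R W t h)" for h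
  proof
    fix t show "\<Phi> h t = indicator {0..c} t *\<^sub>R W t h"
      using \<Phi>c[of t h] sub memD(1)[of t] by (auto simp: \<Phi>_def zero_ext_def indicator_def split: if_splits)
  qed
  note a = operator_function_apply[OF reg] and r = zero_ext_regular[OF operator_function_apply(1)[OF reg]]
  have sq: "square_integrable (\<Phi> h)" "square_integrable (G h)" for h
    unfolding \<Phi>i G_def
    by (intro square_integrable_continuous_Icc continuous_on_subset[OF _ sub] continuous_intros Wc Vc)+
  have dom: "\<Phi> h \<in> mdom \<and> Lop (\<Phi> h) = abs_L2 (G h)" for h
  proof (rule mdomI)
    show reg\<Phi>: "regular (\<Phi> h)" unfolding \<Phi>_def by (rule r(1))
    show "AE t in lebesgue. t \<in> \<Delta> \<longrightarrow> dv (\<Phi> h) t = G h t"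
      using a(3)[of h] dv_eq_qv_AE[OF reg\<Phi>]
    proof eventually_elim
      case (elim t)
      show ?case
      proof
        assume t: "t \<in> \<Delta>"
        show "dv (\<Phi> h) t = G h t"
        proof (cases "t \<le> c")
          case True
          then show ?thesis using elim(1) t r(3)[OF t] deV[OF t] memD(1)[OF t] by (simp add: \<Phi>_def G_def)
        next
          case False
          have "qv (2 * n) (\<Phi> h) t = 0" by (rule qv_local[of c]) (use False t \<Phi>c in auto)
          then show ?thesis using elim(2) t False by (simp add: G_def)
        qed
      qed
    qed
  qed (use sq sub in \<open>auto simp: \<Phi>_def zero_ext_def G_def indicator_def\<close>)
  obtain K1 where K1: "K1 \<ge> 0" "\<And>t. t \<in> {0..c} \<Longrightarrow> norm (W t) \<le> K1"
    using continuous_on_Icc_bounded[OF continuous_on_subset[OF Wc sub]] by metis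
  obtain K2 where K2: "K2 \<ge> 0" "\<And>t. t \<in> {0..c} \<Longrightarrow> norm (V t) \<le> K2"
    using continuous_on_Icc_bounded[OF continuous_on_subset[OF Vc sub]] by metis
  define K where "K = max K1 K2"
  have bound: "norm (indicator {0..c} t *\<^sub>R (A t :: 'h \<Rightarrow>\<^sub>L 'h) h) \<le> K * norm h"
    if "\<And>t. t \<in> {0..c} \<Longrightarrow> norm (A t) \<le> K" for A t h
  proof (cases "t \<in> {0..c}")
    case True
    then have "norm (A t h) \<le> K * norm h" using norm_blinfun[of "A t" h] that[OF True] by (meson mult_right_mono norm_ge_zero order_trans)
    then show ?thesis using True by simp
  qed (use K1 in \<open>simp add: K_def\<close>)
  have K: "norm (W t) \<le> K" "norm (V t) \<le> K" if "t \<in> {0..c}" for t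
    using K1(2)[OF that] K2(2)[OF that] by (auto simp: K_def)
  have "norm (abs_L2 (\<Phi> h)) \<le> (sqrt c * K) * norm h \<and> norm (Lop (\<Phi> h)) \<le> (sqrt c * K) * norm h" for h
  proof -
    have "norm (abs_L2 (\<Phi> h)) \<le> sqrt c * (K * norm h)"
      by (rule norm_abs_L2_le[OF sq(1)]) (use bound[of W, OF K(1)] c in \<open>auto simp: \<Phi>i\<close>)
    moreover have "norm (abs_L2 (G h)) \<le> sqrt c * (K * norm h)"
      by (rule norm_abs_L2_le[OF sq(2)]) (use bound[of V, OF K(2)] c in \<open>auto simp: G_def\<close>)
    ultimately show ?thesis using dom[of h] by (simp add: mult.assoc)
  qed
  moreover have "qv j (\<Phi> h) 0 = (if j = m then h else 0)" if "j < 2 * n" for j h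
    unfolding \<Phi>_def using r(2)[OF zero_mem] a(2)[OF zero_mem that] W(3)[OF that] by simp
  moreover have "\<Phi> (h + k) = (\<lambda>t. \<Phi> h t + \<Phi> k t)" for h k
    by (simp add: \<Phi>_def zero_ext_def fun_eq_iff blinfun.add_right)
  moreover have "\<Phi> (s *\<^sub>R h) = (\<lambda>t. complex_of_real s *\<^sub>C \<Phi> h t)" for s h
    by (simp add: \<Phi>_def zero_ext_def fun_eq_iff blinfun.scaleR_right scaleC_of_real)
  ultimately show ?thesis using dom \<Phi>c by (intro exI[of _ \<Phi>] conjI allI impI exI[of _ "sqrt c * K"]) auto
qed

lemma mdom_sum:
  fixes k :: nat
  assumes "\<And>m. m < k \<Longrightarrow> f m \<in> mdom"
  shows "(\<lambda>t. \<Sum>m<k. f m t) \<in> mdom \<and> Lop (\<lambda>t. \<Sum>m<k. f m t) = (\<Sum>m<k. Lop (f m)) \<and>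
    abs_L2 (\<lambda>t. \<Sum>m<k. f m t) = (\<Sum>m<k. abs_L2 (f m)) \<and>
    (\<forall>j<2 * n. qv j (\<lambda>t. \<Sum>m<k. f m t) 0 = (\<Sum>m<k. qv j (f m) 0))"
  using assms
proof (induction k)
  case 0
  have "qv j (\<lambda>t. 0) 0 = 0" if "j < 2 * n" for j
    using scaleC_regular(2)[OF mdomD(1)[OF conjunct1[OF mdom_zero]] zero_mem that, of 0] by simp
  then show ?case using mdom_zero abs_L2_zero by simp
next
  case (Suc k)
  define s where "s = (\<lambda>t. \<Sum>m<k. f m t)"
  have IH: "s \<in> mdom" "Lop s = (\<Sum>m<k. Lop (f m))" "abs_L2 s = (\<Sum>m<k. abs_L2 (f m))"
    "\<And>j. j < 2 * n \<Longrightarrow> qv j s 0 = (\<Sum>m<k. qv j (f m) 0)"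
    using Suc unfolding s_def by auto
  have fk: "f k \<in> mdom" using Suc.prems by simp
  have e: "(\<lambda>t. \<Sum>m<Suc k. f m t) = (\<lambda>t. s t + f k t)" by (simp add: s_def)
  have "qv j (\<lambda>t. s t + f k t) 0 = (\<Sum>m<Suc k. qv j (f m) 0)" if "j < 2 * n" for j
    using quasi_regular_plus(2)[OF action_apply mdomD(1)[OF IH(1)] mdomD(1)[OF fk] zero_mem that] IH(4)[OF that] by simp
  then show ?case
    unfolding e using mdom_add[OF IH(1) fk] IH(2,3) abs_L2_arith(1)[OF mdomD(3)[OF IH(1)] mdomD(3)[OF fk]] by simp
qed

lemma qv_diff:
  assumes y: "y \<in> mdom" and z: "z \<in> mdom" and j: "j < 2 * n" and t: "t \<in> \<Delta>"
  shows "qv j (\<lambda>t. y t - z t) t = qv j y t - qv j z t"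
  using quasi_regular_plus(2)[OF action_apply mdomD(1)[OF y] scaleC_regular(1)[OF mdomD(1)[OF z], where a = "-1"] t j]
    scaleC_regular(2)[OF mdomD(1)[OF z] t j, of "-1"] by simp

end

lemma sum_reflect:
  fixes a :: "nat \<Rightarrow> 'a::comm_monoid_add"
  shows "(\<Sum>m<2 * n. a m) = (\<Sum>i<n. a i + a (2 * n - 1 - i))"
proof -
  have "(\<Sum>m<n + k. a m) = (\<Sum>m<n. a m) + (\<Sum>m<k. a (n + m))" for k
    by (induction k) (simp_all add: add.assoc)
  from this[of n] have "(\<Sum>m<2 * n. a m) = (\<Sum>m<n. a m) + (\<Sum>m<n. a (n + m))" by (simp only: mult_2)
  also have "(\<Sum>m<n. a (n + m)) = (\<Sum>i<n. a (n + (n - Suc i)))" by (rule sum.nat_diff_reindex[symmetric])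
  also have "\<dots> = (\<Sum>i<n. a (2 * n - 1 - i))" by (intro sum.cong arg_cong[where f = a]) auto
  finally show ?thesis by (simp add: sum.distrib)
qed

context quasi_interval
begin

definition mdom0 :: "(real \<Rightarrow> 'h) set" where
  "mdom0 = {y \<in> mdom. (\<forall>j<2 * n. qv j y 0 = 0) \<and> (\<forall>z\<in>mdom. bb y z = 0)}"

text \<open>All quasi-derivatives of x vanish at \<beta>, so the Lagrange identity leaves only the
  form at 0. The data of u are \<eta> reflected, with the signs of the form, and the real part of
  the boundary form at 0 is then minus the pairing of \<eta> with the data of x.\<close>

lemma inner_bf_has_integral:
  assumes x: "regular x" and u: "regular u" and \<beta>: "\<beta> \<in> \<Delta>" "\<And>j. j < 2 * n \<Longrightarrow> qv j x \<beta> = 0"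
    and f: "AE t in lebesgue. t \<in> \<Delta> \<longrightarrow> dv x t = f t" and g: "AE t in lebesgue. t \<in> \<Delta> \<longrightarrow> dv u t = g t"
    and data: "\<And>i. i < n \<Longrightarrow> qv i u 0 = \<eta> (2 * n - 1 - i) \<and> qv (2 * n - 1 - i) u 0 = - \<eta> i"
  shows "((\<lambda>t. inner (f t) (u t) - inner (x t) (g t)) has_integral (\<Sum>m<2 * n. inner (\<eta> m) (qv m x 0))) {0..\<beta>}"
proof -
  have sub: "{0..\<beta>} \<subseteq> \<Delta>" using \<beta> initial by blast
  have "bf x u \<beta> = 0" using \<beta>(2) by (simp add: bf_eq_sum)
  with lagrange_identity[OF x u \<beta>(1)]
  have "((\<lambda>t. cinner (dv x t) (u t) - cinner (x t) (dv u t)) has_integral (- bf x u 0)) {0..\<beta>}" by simp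
  from has_integral_linear[OF this bounded_linear_Re]
  have 1: "((\<lambda>t. inner (dv x t) (u t) - inner (x t) (dv u t)) has_integral (- Re (bf x u 0))) {0..\<beta>}"
    by (simp add: o_def Re_cinner)
  obtain N1 where N1: "N1 \<in> null_sets lebesgue" "{t \<in> space lebesgue. \<not> (t \<in> \<Delta> \<longrightarrow> dv x t = f t)} \<subseteq> N1"
    using f unfolding eventually_ae_filter by blast
  obtain N2 where N2: "N2 \<in> null_sets lebesgue" "{t \<in> space lebesgue. \<not> (t \<in> \<Delta> \<longrightarrow> dv u t = g t)} \<subseteq> N2"
    using g unfolding eventually_ae_filter by blast
  have neg: "negligible (N1 \<union> N2)" using N1(1) N2(1) by (simp add: negligible_iff_null_sets[symmetric])
  have 2: "((\<lambda>t. inner (f t) (u t) - inner (x t) (g t)) has_integral (- Re (bf x u 0))) {0..\<beta>}"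
  proof (rule has_integral_spike[OF neg _ 1])
    fix t assume t: "t \<in> {0..\<beta>} - (N1 \<union> N2)"
    then have "t \<in> \<Delta>" using sub by blast
    then have "dv x t = f t" "dv u t = g t" using N1(2) N2(2) t by (auto simp: subset_iff)
    then show "inner (f t) (u t) - inner (x t) (g t) = inner (dv x t) (u t) - inner (x t) (dv u t)" by simp
  qed
  have "Re (bf x u 0) = (\<Sum>i<n. inner (qv i x 0) (- \<eta> i) - inner (qv (2 * n - 1 - i) x 0) (\<eta> (2 * n - 1 - i)))"
    unfolding bf_eq_sum Re_sum by (rule sum.cong) (use data in \<open>auto simp: Re_cinner\<close>)
  also have "\<dots> = - (\<Sum>i<n. inner (\<eta> i) (qv i x 0) + inner (\<eta> (2 * n - 1 - i)) (qv (2 * n - 1 - i) x 0))"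
    unfolding sum_negf[symmetric] by (rule sum.cong) (auto simp: inner_commute)
  also have "(\<Sum>i<n. inner (\<eta> i) (qv i x 0) + inner (\<eta> (2 * n - 1 - i)) (qv (2 * n - 1 - i) x 0)) = (\<Sum>m<2 * n. inner (\<eta> m) (qv m x 0))"
    by (rule sum_reflect[symmetric])
  finally show ?thesis using 2 by simp
qed

text \<open>
  The functional of the initial data that the correction terms produce is represented by a vector
  \<open>\<eta>\<close> (Riesz); choosing it as the initial data of a solution \<open>u\<close> of $l[u] = g$ cancels the boundary term
  at \<open>0\<close>, and \<open>w = u\<close> almost everywhere remains.
\<close>

lemma weak_solution:
  assumes w: "square_integrable w" "\<And>t. t \<notin> \<Delta> \<Longrightarrow> w t = 0"
    and g: "square_integrable g" "\<And>t. t \<notin> \<Delta> \<Longrightarrow> g t = 0"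
    and orth: "\<And>\<phi>. \<phi> \<in> mdom0 \<Longrightarrow> inner (abs_L2 w) (Lop \<phi>) = inner (abs_L2 g) (abs_L2 \<phi>)"
  shows "\<exists>y\<in>mdom. abs_L2 y = abs_L2 w \<and> Lop y = abs_L2 g"
proof -
  obtain c where c: "0 < c" "ereal c < b" using ereal_dense2[OF b_pos] by (auto simp: zero_ereal_def)
  then have cD: "c \<in> \<Delta>" by (intro memI) auto
  define P where "P m \<Phi> \<longleftrightarrow> (\<forall>h. \<Phi> h \<in> mdom) \<and> (\<forall>h. \<forall>j<2 * n. qv j (\<Phi> h) 0 = (if j = m then h else 0)) \<and>
    (\<forall>h t. c \<le> t \<longrightarrow> \<Phi> h t = 0) \<and> (\<forall>h k. \<Phi> (h + k) = (\<lambda>t. \<Phi> h t + \<Phi> k t)) \<and>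
    (\<forall>r h. \<Phi> (r *\<^sub>R h) = (\<lambda>t. complex_of_real r *\<^sub>C \<Phi> h t)) \<and>
    (\<exists>C. \<forall>h. norm (abs_L2 (\<Phi> h)) \<le> C * norm h \<and> norm (Lop (\<Phi> h)) \<le> C * norm h)" for m and \<Phi> :: "'h \<Rightarrow> real \<Rightarrow> 'h"
  have "\<exists>\<Phi>. P m \<Phi>" if "m < 2 * n" for m unfolding P_def by (rule steering_element[OF cD c(1) that])
  then have "\<forall>m\<in>{..<2 * n}. \<exists>\<Phi>. P m \<Phi>" by simp
  from bchoice[OF this] obtain \<Phi> where \<Phi>: "\<And>m. m < 2 * n \<Longrightarrow> P m (\<Phi> m)" by auto
  have \<Phi>dom: "\<Phi> m h \<in> mdom" and \<Phi>data: "j < 2 * n \<Longrightarrow> qv j (\<Phi> m h) 0 = (if j = m then h else 0)"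
    and \<Phi>c: "c \<le> t \<Longrightarrow> \<Phi> m h t = 0" if "m < 2 * n" for m h j t
    using \<Phi>[OF that] unfolding P_def by blast+
  have "\<exists>e. \<forall>h. inner (abs_L2 w) (Lop (\<Phi> m h)) - inner (abs_L2 g) (abs_L2 (\<Phi> m h)) = inner e h" if m: "m < 2 * n" for m
  proof -
    have add: "\<Phi> m (h + k) = (\<lambda>t. \<Phi> m h t + \<Phi> m k t)" and sc: "\<Phi> m (r *\<^sub>R h) = (\<lambda>t. complex_of_real r *\<^sub>C \<Phi> m h t)" for r h k
      using \<Phi>[OF m] unfolding P_def by blast+
    obtain C where C: "\<And>h. norm (abs_L2 (\<Phi> m h)) \<le> C * norm h" "\<And>h. norm (Lop (\<Phi> m h)) \<le> C * norm h"
      using \<Phi>[OF m] unfolding P_def by blast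
    \<comment> \<open>The defect of the weak equation on the steering functions, to which the
      hypothesis does not apply because their data at 0 need not vanish.\<close>
    define l where "l h = inner (abs_L2 w) (Lop (\<Phi> m h)) - inner (abs_L2 g) (abs_L2 (\<Phi> m h))" for h
    have "\<exists>e\<in>UNIV. \<forall>h\<in>UNIV. l h = inner e h"
    proof (rule riesz_on_subspace[where C = "norm (abs_L2 w) * C + norm (abs_L2 g) * C"])
      show "l (h + k) = l h + l k" for h k
        using mdom_add[OF \<Phi>dom[OF m, of h] \<Phi>dom[OF m, of k]] abs_L2_arith(1)[OF mdomD(3)[OF \<Phi>dom[OF m, of h]] mdomD(3)[OF \<Phi>dom[OF m, of k]], symmetric]
        unfolding l_def add by (simp add: inner_add_right)
      show "l (r *\<^sub>R h) = r * l h" for r h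
        using mdom_scaleC[OF \<Phi>dom[OF m, of h], of "complex_of_real r"]
          abs_L2_arith(3)[OF mdomD(3)[OF \<Phi>dom[OF m, of h]] mdomD(3)[OF \<Phi>dom[OF m, of h]], of "complex_of_real r", symmetric]
        unfolding l_def sc by (simp add: scaleC_of_real right_diff_distrib)
      show "\<bar>l h\<bar> \<le> (norm (abs_L2 w) * C + norm (abs_L2 g) * C) * norm h" for h
      proof -
        have "\<bar>l h\<bar> \<le> norm (abs_L2 w) * norm (Lop (\<Phi> m h)) + norm (abs_L2 g) * norm (abs_L2 (\<Phi> m h))"
          unfolding l_def using Cauchy_Schwarz_ineq2[of "abs_L2 w" "Lop (\<Phi> m h)"] Cauchy_Schwarz_ineq2[of "abs_L2 g" "abs_L2 (\<Phi> m h)"]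
          by linarith
        also have "\<dots> \<le> norm (abs_L2 w) * (C * norm h) + norm (abs_L2 g) * (C * norm h)"
          by (intro add_mono mult_left_mono C) auto
        finally show ?thesis by (simp add: algebra_simps)
      qed
    qed (auto simp: complete_UNIV)
    then show ?thesis unfolding l_def by blast
  qed
  then have "\<forall>m. \<exists>e. m < 2 * n \<longrightarrow> (\<forall>h. inner (abs_L2 w) (Lop (\<Phi> m h)) - inner (abs_L2 g) (abs_L2 (\<Phi> m h)) = inner e h)" by blast
  from choice[OF this] obtain \<eta> where \<eta>: "\<And>m h. m < 2 * n \<Longrightarrow> inner (abs_L2 w) (Lop (\<Phi> m h)) - inner (abs_L2 g) (abs_L2 (\<Phi> m h)) = inner (\<eta> m) h"
    by blast
  \<comment> \<open>The form at 0 pairs order j with order 2n - 1 - j, with opposite signs in the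
    two columns, so u receives \<eta> reflected and with a sign.\<close>
  define \<xi> :: "('h, 'n) vec \<times> ('h, 'n) vec" where "\<xi> = of_comps (\<lambda>j. if j < n then \<eta> (2 * n - 1 - j) else - \<eta> (2 * n - 1 - j))"
  obtain u where u: "regular u" "\<And>j. j < 2 * n \<Longrightarrow> qv j u 0 = state_comp \<xi> j" "AE t in lebesgue. t \<in> \<Delta> \<longrightarrow> dv u t = 0 *\<^sub>C u t + g t"
    using forward_solution[OF g(1), of \<xi> 0] by blast
  have u_data: "qv i u 0 = \<eta> (2 * n - 1 - i) \<and> qv (2 * n - 1 - i) u 0 = - \<eta> i" if i: "i < n" for i
  proof -
    have a: "i < 2 * n" "2 * n - 1 - i < 2 * n" "\<not> 2 * n - 1 - i < n" "2 * n - 1 - (2 * n - 1 - i) = i" using i by auto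
    show ?thesis using u(2)[OF a(1)] u(2)[OF a(2)] a i by (simp add: \<xi>_def n_eq[symmetric])
  qed
  have ug: "AE t in lebesgue. t \<in> \<Delta> \<longrightarrow> dv u t = g t" using u(3) by eventually_elim simp
  have uc: "continuous_on \<Delta> u" by (rule regular_continuous_on[OF u(1)])
  \<comment> \<open>The difference of w and u on {0..\<beta>} is shown to be orthogonal to every
    continuous f vanishing from \<beta> on. Taking \<beta> \<ge> c ensures that the steering
    functions, too, vanish from \<beta> on; \<beta> < b makes the corrected test function vanish
    near the right end.\<close>
  have loc: "AE t in lebesgue. t \<in> {0..\<beta>} \<longrightarrow> w t = u t" if \<beta>: "c \<le> \<beta>" "ereal \<beta> < b" for \<beta>
  proof -
    have \<beta>D: "\<beta> \<in> \<Delta>" using \<beta> c by (intro memI) auto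
    have sub: "{0..\<beta>} \<subseteq> \<Delta>" using \<beta>D initial by blast
    define U where "U t = indicator {0..\<beta>} t *\<^sub>R u t" for t
    have Usq: "square_integrable U" unfolding U_def by (rule square_integrable_continuous_Icc[OF continuous_on_subset[OF uc sub]])
    define d where "d t = indicator {0..\<beta>} t *\<^sub>R w t - U t" for t
    have dsq: "square_integrable d" unfolding d_def by (intro square_integrable_diff square_integrable_indicator w Usq) auto
    have "AE t in lebesgue. d t = 0"
    proof (rule zero_AE_if_orthogonal_to_continuous[OF dsq])
      show "d t = 0" if "t \<notin> {0..\<beta>}" for t using that by (simp add: d_def U_def)
      fix f :: "real \<Rightarrow> 'h" assume f: "continuous_on UNIV f" "\<And>t. \<beta> \<le> t \<Longrightarrow> f t = 0"
      obtain \<phi> where \<phi>: "regular \<phi>" "\<And>t j. t \<in> \<Delta> \<Longrightarrow> \<beta> \<le> t \<Longrightarrow> j < 2 * n \<Longrightarrow> qv j \<phi> t = 0"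
          "AE t in lebesgue. t \<in> \<Delta> \<longrightarrow> dv \<phi> t = 0 *\<^sub>C \<phi> t + f t"
        using backward_solution[OF continuous_on_subset[OF f(1) subset_UNIV] \<beta>D f(2), of 0] by blast
      define x where "x = zero_ext \<Delta> \<phi>"
      define F where "F t = indicator {0..\<beta>} t *\<^sub>R f t" for t
      have \<phi>0: "\<phi> t = 0" if "t \<in> \<Delta>" "\<beta> \<le> t" for t using \<phi>(2)[OF that, of 0] n_pos by (simp add: quasi_deriv_def)
      have xi: "x = (\<lambda>t. indicator {0..\<beta>} t *\<^sub>R \<phi> t)"
      proof
        fix t show "x t = indicator {0..\<beta>} t *\<^sub>R \<phi> t"
          using \<phi>0[of t] sub memD(1)[of t] by (auto simp: x_def zero_ext_def indicator_def split: if_splits)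
      qed
      have xsq: "square_integrable x" unfolding xi
        by (rule square_integrable_continuous_Icc[OF continuous_on_subset[OF regular_continuous_on[OF \<phi>(1)] sub]])
      have Fsq: "square_integrable F" unfolding F_def by (rule square_integrable_continuous_Icc[OF continuous_on_subset[OF f(1)]]) simp
      have xr: "regular x" unfolding x_def by (rule zero_ext_regular(1)[OF \<phi>(1)])
      have xqv: "qv j x t = qv j \<phi> t" if "t \<in> \<Delta>" for j t unfolding x_def by (rule zero_ext_regular(2)[OF \<phi>(1) that])
      have xdv: "AE t in lebesgue. t \<in> \<Delta> \<longrightarrow> dv x t = F t"
        using \<phi>(3)
      proof eventually_elim
        case (elim t)
        show ?case using elim zero_ext_regular(3)[OF \<phi>(1), of t] f(2)[of t] memD(1)[of t]
          by (auto simp: x_def F_def indicator_def)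
      qed
      have x: "x \<in> mdom \<and> Lop x = abs_L2 F"
      proof (rule mdomI[OF xr _ xsq Fsq _ xdv])
        show "x t = 0" "F t = 0" if "t \<notin> \<Delta>" for t using that sub by (auto simp: x_def zero_ext_def F_def indicator_def)
      qed
      define \<kappa> where "\<kappa> m = qv m x 0" for m
      define \<Psi> where "\<Psi> t = (\<Sum>m<2 * n. \<Phi> m (\<kappa> m) t)" for t
      have \<Psi>: "\<Psi> \<in> mdom" "Lop \<Psi> = (\<Sum>m<2 * n. Lop (\<Phi> m (\<kappa> m)))" "abs_L2 \<Psi> = (\<Sum>m<2 * n. abs_L2 (\<Phi> m (\<kappa> m)))"
          "\<And>j. j < 2 * n \<Longrightarrow> qv j \<Psi> 0 = (\<Sum>m<2 * n. qv j (\<Phi> m (\<kappa> m)) 0)"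
        using mdom_sum[of "2 * n" "\<lambda>m. \<Phi> m (\<kappa> m)"] \<Phi>dom unfolding \<Psi>_def[abs_def] by auto
      define xd where "xd t = x t - \<Psi> t" for t
      have xd: "xd \<in> mdom" "Lop xd = Lop x - Lop \<Psi>" using mdom_diff[OF conjunct1[OF x] \<Psi>(1)] by (auto simp: xd_def[abs_def])
      have "qv j xd 0 = 0" if j: "j < 2 * n" for j
      proof -
        have "qv j \<Psi> 0 = (\<Sum>m<2 * n. if j = m then \<kappa> m else 0)"
          unfolding \<Psi>(4)[OF j] by (rule sum.cong) (use \<Phi>data[OF _ j] in auto)
        also have "\<dots> = \<kappa> j" using j by simp
        finally show ?thesis using qv_diff[OF conjunct1[OF x] \<Psi>(1) j zero_mem] by (simp add: xd_def[abs_def] \<kappa>_def)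
      qed
      moreover have "bb xd z = 0" for z
      proof (rule bb_local(1)[OF \<beta>(2)])
        fix s assume s: "s \<in> \<Delta>" "\<beta> < s"
        have "\<Psi> s = 0" unfolding \<Psi>_def by (rule sum.neutral) (use \<Phi>c \<beta> s in auto)
        then show "xd s = 0" using \<phi>0[of s] s by (simp add: xd_def x_def zero_ext_def)
      qed
      ultimately have "xd \<in> mdom0" using xd by (auto simp: mdom0_def)
      from orth[OF this] have "inner (abs_L2 w) (Lop x - Lop \<Psi>) = inner (abs_L2 g) (abs_L2 x - abs_L2 \<Psi>)"
        unfolding xd(2) abs_L2_arith(2)[OF xsq mdomD(3)[OF \<Psi>(1)]] by (simp add: xd_def[abs_def])
      then have "inner (abs_L2 w) (Lop x) - inner (abs_L2 g) (abs_L2 x) = inner (abs_L2 w) (Lop \<Psi>) - inner (abs_L2 g) (abs_L2 \<Psi>)"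
        by (simp add: inner_diff_right)
      also have "\<dots> = (\<Sum>m<2 * n. inner (abs_L2 w) (Lop (\<Phi> m (\<kappa> m))) - inner (abs_L2 g) (abs_L2 (\<Phi> m (\<kappa> m))))"
        unfolding \<Psi>(2,3) by (simp add: inner_sum_right sum_subtractf)
      also have "\<dots> = (\<Sum>m<2 * n. inner (\<eta> m) (\<kappa> m))" by (rule sum.cong) (use \<eta> in auto)
      \<comment> \<open>This equation comes from the weak equation and the choice of \<eta>;
        equation \<open>B\<close> below comes from the Lagrange identity for x and u. Their
        right-hand sides agree, so w and U have the same inner product with F.\<close>
      finally have A: "inner (abs_L2 w) (abs_L2 F) - inner (abs_L2 g) (abs_L2 x) = (\<Sum>m<2 * n. inner (\<eta> m) (\<kappa> m))" using x by simp
      have int: "integrable lebesgue (\<lambda>t. inner (F t) (U t) - inner (x t) (g t))"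
        by (intro Bochner_Integration.integrable_diff integrable_inner Fsq Usq xsq g)
      have "((\<lambda>t. inner (F t) (u t) - inner (x t) (g t)) has_integral (\<Sum>m<2 * n. inner (\<eta> m) (\<kappa> m))) {0..\<beta>}"
        unfolding \<kappa>_def by (rule inner_bf_has_integral[OF xr u(1) \<beta>D _ xdv ug u_data]) (simp_all add: xqv[OF \<beta>D] \<phi>(2)[OF \<beta>D])
      then have "((\<lambda>t. inner (F t) (U t) - inner (x t) (g t)) has_integral (\<Sum>m<2 * n. inner (\<eta> m) (\<kappa> m))) UNIV"
        unfolding has_integral_restrict_UNIV[of "{0..\<beta>}", symmetric]
        by (rule has_integral_eq[rotated]) (auto simp: U_def F_def xi)
      from has_integral_unique[OF this has_integral_integral_lebesgue[OF int]]
      have "(\<integral>t. inner (F t) (U t) - inner (x t) (g t) \<partial>lebesgue) = (\<Sum>m<2 * n. inner (\<eta> m) (\<kappa> m))" by simp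
      then have B: "inner (abs_L2 F) (abs_L2 U) - inner (abs_L2 x) (abs_L2 g) = (\<Sum>m<2 * n. inner (\<eta> m) (\<kappa> m))"
        using abs_L2_arith(5)[OF Fsq Usq] abs_L2_arith(5)[OF xsq g(1)] integrable_inner[OF Fsq Usq] integrable_inner[OF xsq g(1)] by simp
      have "(\<integral>t. inner (d t) (f t) \<partial>lebesgue) = (\<integral>t. inner (w t) (F t) - inner (U t) (F t) \<partial>lebesgue)"
        by (intro Bochner_Integration.integral_cong refl) (auto simp: d_def F_def U_def indicator_def inner_diff_left)
      also have "\<dots> = inner (abs_L2 w) (abs_L2 F) - inner (abs_L2 U) (abs_L2 F)"
        using abs_L2_arith(5)[OF w(1) Fsq] abs_L2_arith(5)[OF Usq Fsq] integrable_inner[OF w(1) Fsq] integrable_inner[OF Usq Fsq] by simp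
      also have "\<dots> = 0" using A B by (simp add: inner_commute)
      finally show "(\<integral>t. inner (d t) (f t) \<partial>lebesgue) = 0" .
    qed
    then show ?thesis by eventually_elim (auto simp: d_def U_def)
  qed
  \<comment> \<open>Rational end points exhaust the points before b while the exceptional sets
    remain countably many.\<close>
  have "AE t in lebesgue. \<forall>r\<in>\<rat>. ereal (max c r) < b \<longrightarrow> t \<in> {0..max c r} \<longrightarrow> w t = u t"
  proof (rule AE_ball_countable'[OF _ countable_rat])
    fix r :: real
    show "AE t in lebesgue. ereal (max c r) < b \<longrightarrow> t \<in> {0..max c r} \<longrightarrow> w t = u t"
      using loc[of "max c r"] by (cases "ereal (max c r) < b") auto
  qed
  then have wu: "AE t in lebesgue. w t = zero_ext \<Delta> u t"
    using AE_interior
  proof eventually_elim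
    case (elim t)
    show ?case
    proof (cases "t \<in> \<Delta>")
      case True
      then obtain s where s: "ereal t < ereal s" "ereal s < b" using elim(2) ereal_dense2[of t b] by blast
      then obtain r where r: "r \<in> \<rat>" "t < r" "r < s" using Rats_dense_in_real[of t s] by auto
      have "ereal r < b" using r(3) s(2) by (meson ereal_less_eq(3) less_imp_le order.strict_trans1)
      then have "ereal (max c r) < b" using c by (simp add: max_def)
      moreover have "t \<in> {0..max c r}" using r memD(1)[OF True] by auto
      ultimately show ?thesis using elim(1) r(1) True by (simp add: zero_ext_def)
    qed (simp add: w zero_ext_def)
  qed
  define y where "y = zero_ext \<Delta> u"
  have ysq: "square_integrable y" unfolding y_def by (rule square_integrable_cong_AE[OF w(1) wu])
  have "y \<in> mdom \<and> Lop y = abs_L2 g"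
  proof (rule mdomI[OF _ _ ysq g])
    show "regular y" unfolding y_def by (rule zero_ext_regular(1)[OF u(1)])
    show "AE t in lebesgue. t \<in> \<Delta> \<longrightarrow> dv y t = g t"
      using ug by eventually_elim (simp add: y_def zero_ext_regular(3)[OF u(1)])
  qed (simp add: y_def zero_ext_def)
  moreover have "abs_L2 y = abs_L2 w" using abs_L2_eq_iff[OF w(1) ysq] wu by (simp add: y_def)
  ultimately show ?thesis by blast
qed

end

section \<open>Two operators on one space\<close>

definition real_operator_on :: "'a::real_normed_vector set \<Rightarrow> ('a \<Rightarrow> 'b::real_normed_vector) \<Rightarrow> bool" where
  "real_operator_on S f \<longleftrightarrow> (\<forall>x\<in>S. \<forall>y\<in>S. f (x + y) = f x + f y) \<and> (\<forall>r. \<forall>x\<in>S. f (r *\<^sub>R x) = r *\<^sub>R f x) \<and>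
     (\<exists>C. \<forall>x\<in>S. norm (f x) \<le> C * norm x)"

lemma real_operator_onD:
  assumes "real_operator_on S f" "subspace S" "x \<in> S" "y \<in> S"
  shows "f (x + y) = f x + f y" "f (r *\<^sub>R x) = r *\<^sub>R f x" "f (x - y) = f x - f y"
proof -
  have a: "f (u + v) = f u + f v" "f (r *\<^sub>R u) = r *\<^sub>R f u" if "u \<in> S" "v \<in> S" for u v r
    using assms(1) that by (auto simp: real_operator_on_def)
  show "f (x + y) = f x + f y" "f (r *\<^sub>R x) = r *\<^sub>R f x" using a assms by auto
  have "(-1) *\<^sub>R y \<in> S" using assms by (intro subspace_scale)
  then have "f (x + (-1) *\<^sub>R y) = f x + (-1) *\<^sub>R f y" using a[OF assms(3)] a(2)[OF assms(4) assms(4)] by metis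
  then show "f (x - y) = f x - f y" by simp
qed

lemma open_mapping_on:
  assumes f: "real_operator_on S f" and S: "subspace S" "complete S" and V: "subspace V" "complete V" and onto: "f ` S = V"
  obtains M where "M > 0" "\<And>v. v \<in> V \<Longrightarrow> \<exists>x\<in>S. f x = v \<and> norm x \<le> M * norm v"
proof -
  obtain C where C: "\<And>x. x \<in> S \<Longrightarrow> norm (f x) \<le> C * norm x" using f unfolding real_operator_on_def by blast
  have "\<exists>M>0. \<forall>v\<in>V. \<exists>x\<in>S. f x = v \<and> norm x \<le> M * norm v"
    by (rule linear_complete_image_bound[OF S V _ _ C onto]) (use f in \<open>auto simp: real_operator_on_def\<close>)
  then show ?thesis using that by blast
qed

text \<open>If B e = B x with F x = 0, then e - x lies in the kernel of B and has the same image as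
  e under F. For the closure B x is only close to B e: the open mapping theorem for B supplies a
  small y with B y = B (e - x), and e - x - y is the required element, its image differing from F e
  by the small vector F y.\<close>

lemma coupled_ranges_forward:
  assumes E: "subspace E" "complete E" and B: "real_operator_on E B" and F: "real_operator_on E F"
    and W: "subspace W" "complete W" "B ` E = W" and e: "e \<in> E"
  shows "B e \<in> B ` {x \<in> E. F x = 0} \<Longrightarrow> F e \<in> F ` {x \<in> E. B x = 0}"
    and "B e \<in> closure (B ` {x \<in> E. F x = 0}) \<Longrightarrow> F e \<in> closure (F ` {x \<in> E. B x = 0})"
proof -
  note b = real_operator_onD[OF B E(1)] and f = real_operator_onD[OF F E(1)]
  show "F e \<in> F ` {x \<in> E. B x = 0}" if Be: "B e \<in> B ` {x \<in> E. F x = 0}"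
  proof -
    obtain x where x: "x \<in> E" "F x = 0" "B e = B x" using Be by auto
    have "e - x \<in> E" using E e x by (simp add: subspace_diff)
    moreover have "B (e - x) = 0" "F (e - x) = F e" using b(3)[OF e x(1)] f(3)[OF e x(1)] x by auto
    ultimately show ?thesis by (metis (mono_tags, lifting) image_eqI mem_Collect_eq)
  qed
  assume cl: "B e \<in> closure (B ` {x \<in> E. F x = 0})"
  obtain M where M: "M > 0" "\<And>v. v \<in> W \<Longrightarrow> \<exists>x\<in>E. B x = v \<and> norm x \<le> M * norm v"
    using open_mapping_on[OF B E W] by metis
  obtain C0 where C0: "\<And>x. x \<in> E \<Longrightarrow> norm (F x) \<le> C0 * norm x" using F unfolding real_operator_on_def by blast
  define C where "C = \<bar>C0\<bar>"
  have C: "norm (F x) \<le> C * norm x" if "x \<in> E" for x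
  proof -
    have "C0 * norm x \<le> C * norm x" unfolding C_def by (intro mult_right_mono) auto
    then show ?thesis using C0[OF that] by linarith
  qed
  have C_pos: "0 \<le> C" by (simp add: C_def)
  show "F e \<in> closure (F ` {x \<in> E. B x = 0})"
    unfolding closure_approachable
  proof (intro allI impI)
    fix \<epsilon> :: real assume \<epsilon>: "0 < \<epsilon>"
    \<comment> \<open>The norm of F y will be at most C M \<delta>. The added 1 keeps the divisor
      positive and makes the final estimate strict.\<close>
    define \<delta> where "\<delta> = \<epsilon> / (C * M + 1)"
    have CM: "0 < C * M + 1" using C_pos M(1) by (simp add: add_nonneg_pos)
    have \<delta>: "0 < \<delta>" using \<epsilon> CM by (simp add: \<delta>_def)
    obtain x where x: "x \<in> E" "F x = 0" "dist (B x) (B e) < \<delta>"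
      using cl \<delta> unfolding closure_approachable by auto
    have ex: "e - x \<in> E" using E e x by (simp add: subspace_diff)
    have "B (e - x) \<in> W" using W(3) ex by blast
    then obtain y where y: "y \<in> E" "B y = B (e - x)" "norm y \<le> M * norm (B (e - x))" using M(2) by blast
    have exy: "e - x - y \<in> E" using E ex y by (simp add: subspace_diff)
    have "B (e - x - y) = 0" using b(3)[OF ex y(1)] y(2) by simp
    moreover have "F (e - x - y) = F e - F y" using f(3)[OF ex y(1)] f(3)[OF e x(1)] x(2) by simp
    moreover have "norm (F y) < \<epsilon>"
    proof -
      have "norm (B (e - x)) < \<delta>" using x(3) b(3)[OF e x(1)] by (simp add: dist_norm norm_minus_commute)
      then have "norm y \<le> M * \<delta>" using y(3) M(1) by (meson less_imp_le mult_left_mono order_trans)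
      then have "norm (F y) \<le> C * (M * \<delta>)" using C[OF y(1)] C_pos by (meson mult_left_mono order_trans)
      also have "\<dots> < (C * M + 1) * \<delta>" using \<delta> by (simp add: algebra_simps)
      also have "\<dots> = \<epsilon>" using CM by (simp add: \<delta>_def)
      finally show ?thesis .
    qed
    moreover have "F (e - x - y) \<in> F ` {x \<in> E. B x = 0}" using exy \<open>B (e - x - y) = 0\<close> by blast
    ultimately show "\<exists>y\<in>F ` {x \<in> E. B x = 0}. dist y (F e) < \<epsilon>"
      by (intro bexI[of _ "F (e - x - y)"]) (simp_all add: dist_norm)
  qed
qed

text \<open>The hypotheses are symmetric in B and F, so the preceding lemma applies in both
  directions: B e lies in R exactly when F e lies in S, and likewise for the closures. As B and F
  are onto, letting e run through E transports each of the three properties.\<close>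

lemma coupled_ranges:
  assumes E: "subspace E" "complete E" and B: "real_operator_on E B" and F: "real_operator_on E F"
    and W: "subspace W" "complete W" "B ` E = W" and V: "subspace V" "complete V" "F ` E = V"
  defines "R \<equiv> B ` {x \<in> E. F x = 0}" and "S \<equiv> F ` {x \<in> E. B x = 0}"
  shows "R = W \<longleftrightarrow> S = V" "closure R = W \<longleftrightarrow> closure S = V" "closure R = R \<longleftrightarrow> closure S = S"
proof -
  note f = coupled_ranges_forward[OF E B F W, folded R_def S_def] and g = coupled_ranges_forward[OF E F B V, folded R_def S_def]
  have sub: "R \<subseteq> W" "S \<subseteq> V" using W(3) V(3) by (auto simp: R_def S_def)
  have csub: "closure R \<subseteq> W" "closure S \<subseteq> V"
    by (rule closure_minimal[OF sub(1) complete_imp_closed[OF W(2)]])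
      (rule closure_minimal[OF sub(2) complete_imp_closed[OF V(2)]])
  have eq: "B e \<in> R \<longleftrightarrow> F e \<in> S" "B e \<in> closure R \<longleftrightarrow> F e \<in> closure S" if "e \<in> E" for e
    using f[OF that] g[OF that] by blast+
  have "W \<subseteq> R \<longleftrightarrow> V \<subseteq> S" "W \<subseteq> closure R \<longleftrightarrow> V \<subseteq> closure S"
    unfolding W(3)[symmetric] V(3)[symmetric] using eq by blast+
  then show "R = W \<longleftrightarrow> S = V" "closure R = W \<longleftrightarrow> closure S = V" using sub csub by blast+
  have "closure R \<subseteq> R \<longleftrightarrow> (\<forall>e\<in>E. B e \<in> closure R \<longrightarrow> B e \<in> R)" using csub(1) W(3) by blast
  also have "\<dots> \<longleftrightarrow> (\<forall>e\<in>E. F e \<in> closure S \<longrightarrow> F e \<in> S)" using eq by blast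
  also have "\<dots> \<longleftrightarrow> closure S \<subseteq> S" using csub(2) V(3) by blast
  finally show "closure R = R \<longleftrightarrow> closure S = S" using closure_subset[of R] closure_subset[of S] by blast
qed

section \<open>The minimal operator\<close>

lemma L2_onE:
  assumes "x \<in> L2_on \<Delta>"
  obtains f where "square_integrable f" "\<And>t. t \<notin> \<Delta> \<Longrightarrow> f t = 0" "x = abs_L2 f"
  using assms unfolding L2_on_def zero_ext_def by (auto split: if_splits)

lemma L2_onI:
  assumes "square_integrable f" "\<And>t. t \<notin> \<Delta> \<Longrightarrow> f t = 0"
  shows "abs_L2 f \<in> L2_on \<Delta>"
proof -
  have "f = zero_ext \<Delta> f" using assms(2) by (auto simp: zero_ext_def)
  then show ?thesis using assms(1) unfolding L2_on_def by (metis (mono_tags, lifting) mem_Collect_eq)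
qed

text \<open>An orthogonal complement is closed at sight. For the converse inclusion the part of a
  representative outside \<Delta> is used as test function.\<close>

lemma L2_on_eq_orthogonal:
  assumes \<Delta>: "\<Delta> \<in> sets lebesgue"
  shows "L2_on \<Delta> = {x :: 'a::{complex_hilbert, second_countable_topology} L2. \<forall>z. square_integrable z \<and> (\<forall>t\<in>\<Delta>. z t = 0) \<longrightarrow> inner x (abs_L2 z) = 0}" (is "_ = ?R")
proof
  show "L2_on \<Delta> \<subseteq> ?R"
  proof safe
    fix x :: "'a L2" and z :: "real \<Rightarrow> 'a" assume x: "x \<in> L2_on \<Delta>" and z: "square_integrable z" "\<forall>t\<in>\<Delta>. z t = 0"
    obtain f where f: "square_integrable f" "\<And>t. t \<notin> \<Delta> \<Longrightarrow> f t = 0" "x = abs_L2 f" using L2_onE[OF x] by metis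
    have "inner (f t) (z t) = 0" for t using f(2)[of t] z(2) by (cases "t \<in> \<Delta>") auto
    then show "inner x (abs_L2 z) = 0" using abs_L2_arith(5)[OF f(1) z(1)] f(3) by simp
  qed
  show "?R \<subseteq> L2_on \<Delta>"
  proof
    fix x :: "'a L2" assume x: "x \<in> ?R"
    obtain f where f: "square_integrable f" "x = abs_L2 f" using L2_cases by metis
    define z where "z t = indicator (- \<Delta>) t *\<^sub>R f t" for t
    define y where "y t = indicator \<Delta> t *\<^sub>R f t" for t
    have "- \<Delta> \<in> sets lebesgue" using \<Delta> by (simp add: Compl_in_sets_lebesgue)
    then have z: "square_integrable z" "\<forall>t\<in>\<Delta>. z t = 0" and y: "square_integrable y"
      unfolding z_def y_def using square_integrable_indicator[OF f(1)] \<Delta> by auto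
    have "inner x (abs_L2 z) = 0" using x z by blast
    moreover have "inner (f t) (z t) = inner (z t) (z t)" for t by (auto simp: z_def indicator_def)
    ultimately have "inner (abs_L2 z) (abs_L2 z) = 0"
      using abs_L2_arith(5)[OF f(1) z(1)] abs_L2_arith(5)[OF z(1) z(1)] f(2) by simp
    then have "abs_L2 z = abs_L2 (\<lambda>_. 0)" by (simp add: abs_L2_zero)
    then have "AE t in lebesgue. z t = 0" using abs_L2_eq_iff[OF z(1) square_integrable_zero] by simp
    then have "AE t in lebesgue. f t = y t" by eventually_elim (auto simp: z_def y_def indicator_def split: if_splits)
    then have "x = abs_L2 y" using abs_L2_eq_iff[OF f(1) y] f(2) by simp
    then show "x \<in> L2_on \<Delta>" using L2_onI[OF y, of \<Delta>] by (simp add: y_def)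
  qed
qed

lemma closed_L2_on: "\<Delta> \<in> sets lebesgue \<Longrightarrow> closed (L2_on \<Delta> :: 'a::{complex_hilbert, second_countable_topology} L2 set)"
  unfolding L2_on_eq_orthogonal by (intro closed_Collect_all closed_Collect_imp open_Collect_const closed_Collect_eq continuous_intros)

lemma csubspace_L2_on: "csubspace (L2_on \<Delta> :: 'a::{complex_hilbert, second_countable_topology} L2 set)"
  unfolding csubspace_def
proof (intro conjI ballI allI)
  show "(0 :: 'a L2) \<in> L2_on \<Delta>" unfolding abs_L2_zero[symmetric] by (rule L2_onI[OF square_integrable_zero]) simp
  fix x :: "'a L2" assume "x \<in> L2_on \<Delta>"
  then obtain f where f: "square_integrable f" "\<And>t. t \<notin> \<Delta> \<Longrightarrow> f t = 0" "x = abs_L2 f" using L2_onE by metis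
  show "x + y \<in> L2_on \<Delta>" if y: "y \<in> L2_on \<Delta>" for y
  proof -
    obtain g where g: "square_integrable g" "\<And>t. t \<notin> \<Delta> \<Longrightarrow> g t = 0" "y = abs_L2 g" using L2_onE[OF y] by metis
    show ?thesis unfolding f(3) g(3) abs_L2_arith(1)[OF f(1) g(1)]
      by (rule L2_onI) (use f g in \<open>auto intro: square_integrable_add\<close>)
  qed
  show "c *\<^sub>C x \<in> L2_on \<Delta>" for c
    unfolding f(3) abs_L2_arith(3)[OF f(1) f(1)] by (rule L2_onI) (use f in \<open>auto intro: square_integrable_scaleC\<close>)
qed

context quasi_interval
begin

lemma mdom_L2_on: "y \<in> mdom \<Longrightarrow> abs_L2 y \<in> L2_on \<Delta>" "y \<in> mdom \<Longrightarrow> Lop y \<in> L2_on \<Delta>"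
  by (rule L2_onI; simp add: mdomD)+ (rule L2_onI[OF mdomD(4)], simp_all add: zero_ext_def)

text \<open>Separates the two ends: the data at 0 are arbitrary while the form at b does not notice
  z. The function is a sum of steering elements that vanish from one point c < b on.\<close>

lemma steering:
  obtains z where "z \<in> mdom" "\<And>j. j < 2 * n \<Longrightarrow> qv j z 0 = v j" "\<And>y. bb y z = 0" "\<And>y. bb z y = 0"
proof -
  obtain c where c: "0 < c" "ereal c < b" using ereal_dense2[OF b_pos] by (auto simp: zero_ereal_def)
  then have cD: "c \<in> \<Delta>" by (intro memI) auto
  have "\<exists>f. f \<in> mdom \<and> (\<forall>j<2 * n. qv j f 0 = (if j = m then v m else 0)) \<and> (\<forall>t. c \<le> t \<longrightarrow> f t = 0)" if m: "m < 2 * n" for m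
    using steering_element[OF cD c(1) m] by blast
  then have "\<forall>m\<in>{..<2 * n}. \<exists>f. f \<in> mdom \<and> (\<forall>j<2 * n. qv j f 0 = (if j = m then v m else 0)) \<and> (\<forall>t. c \<le> t \<longrightarrow> f t = 0)" by simp
  from bchoice[OF this] obtain f where f: "\<And>m. m < 2 * n \<Longrightarrow> f m \<in> mdom"
    "\<And>m j. m < 2 * n \<Longrightarrow> j < 2 * n \<Longrightarrow> qv j (f m) 0 = (if j = m then v m else 0)" "\<And>m t. m < 2 * n \<Longrightarrow> c \<le> t \<Longrightarrow> f m t = 0" by auto
  define z where "z t = (\<Sum>m<2 * n. f m t)" for t
  have z: "z \<in> mdom" "\<And>j. j < 2 * n \<Longrightarrow> qv j z 0 = (\<Sum>m<2 * n. qv j (f m) 0)"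
    using mdom_sum[of "2 * n" f] f(1) unfolding z_def[abs_def] by auto
  show ?thesis
  proof (rule that[OF z(1)])
    show "qv j z 0 = v j" if j: "j < 2 * n" for j
    proof -
      have "qv j z 0 = (\<Sum>m<2 * n. if j = m then v m else 0)" unfolding z(2)[OF j] by (rule sum.cong) (use f(2)[OF _ j] in auto)
      also have "\<dots> = v j" using j by simp
      finally show ?thesis .
    qed
    have "z s = 0" if "c < s" for s unfolding z_def by (rule sum.neutral) (use f(3) that in auto)
    then show "bb y z = 0" "bb z y = 0" for y using bb_local[OF c(2)] by blast+
  qed
qed

lemma green_mdom0:
  assumes "\<phi> \<in> mdom0" "y \<in> mdom"
  shows "cinner (Lop \<phi>) (abs_L2 y) = cinner (abs_L2 \<phi>) (Lop y)" "inner (Lop \<phi>) (abs_L2 y) = inner (abs_L2 \<phi>) (Lop y)"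
proof -
  have "bf \<phi> y 0 = 0" unfolding bf_eq_sum by (rule sum.neutral) (use assms in \<open>auto simp: mdom0_def\<close>)
  then show "cinner (Lop \<phi>) (abs_L2 y) = cinner (abs_L2 \<phi>) (Lop y)" using green[of \<phi> y] assms by (simp add: mdom0_def)
  then show "inner (Lop \<phi>) (abs_L2 y) = inner (abs_L2 \<phi>) (Lop y)" by (metis Re_cinner)
qed

text \<open>Symmetry against the whole maximal domain says that [y,z](b) = [y,z](0) for every z. A
  steering z whose form with y at b is zero and whose data are those of y, reflected and with a
  sign, makes [y,z](0) the sum of the squared norms of the data of y; hence they vanish, and with
  them the form at b.\<close>

lemma mdom0I:
  assumes y: "y \<in> mdom" and sym: "\<And>z. z \<in> mdom \<Longrightarrow> inner (Lop y) (abs_L2 z) = inner (abs_L2 y) (Lop z)"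
  shows "y \<in> mdom0"
proof -
  have "cinner (Lop y) (abs_L2 z) = cinner (abs_L2 y) (Lop z)" if z: "z \<in> mdom" for z
    using sym[OF z] sym[OF conjunct1[OF mdom_scaleC[OF z, of \<i>]]] mdom_scaleC[OF z, of \<i>]
      abs_L2_arith(3)[OF mdomD(3)[OF z] mdomD(3)[OF z], of \<i>, symmetric]
    by (simp add: cinner_eq_Complex)
  then have eq: "bb y z = bf y z 0" if "z \<in> mdom" for z using green[OF y that] that by simp
  obtain z where z: "z \<in> mdom" "\<And>j. j < 2 * n \<Longrightarrow> qv j z 0 = (if j < n then - qv (2 * n - 1 - j) y 0 else qv (2 * n - 1 - j) y 0)" "bb y z = 0"
    using steering[of "\<lambda>j. if j < n then - qv (2 * n - 1 - j) y 0 else qv (2 * n - 1 - j) y 0"] by metis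
  have "0 = Re (bf y z 0)" using eq[OF z(1)] z(3) by simp
  also have "\<dots> = (\<Sum>i<n. inner (qv i y 0) (qv i y 0) + inner (qv (2 * n - 1 - i) y 0) (qv (2 * n - 1 - i) y 0))"
    unfolding bf_eq_sum Re_sum
  proof (rule sum.cong[OF refl])
    fix i assume "i \<in> {..<n}"
    then have i: "i < 2 * n" "2 * n - 1 - i < 2 * n" "i < n" "\<not> 2 * n - 1 - i < n" "2 * n - 1 - (2 * n - 1 - i) = i" by auto
    show "Re (cinner (qv i y 0) (qv (2 * n - 1 - i) z 0) - cinner (qv (2 * n - 1 - i) y 0) (qv i z 0)) =
      inner (qv i y 0) (qv i y 0) + inner (qv (2 * n - 1 - i) y 0) (qv (2 * n - 1 - i) y 0)"
      unfolding z(2)[OF i(1)] z(2)[OF i(2)] using i(3-5) by (simp add: Re_cinner)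
  qed
  also have "\<dots> = (\<Sum>j<2 * n. inner (qv j y 0) (qv j y 0))" by (rule sum_reflect[symmetric])
  finally have d: "qv j y 0 = 0" if "j < 2 * n" for j
    using that sum_nonneg_eq_0_iff[of "{..<2 * n}" "\<lambda>j. inner (qv j y 0) (qv j y 0)"] by simp
  have "bf y z 0 = 0" for z unfolding bf_eq_sum by (rule sum.neutral) (use d in auto)
  then show ?thesis using y d eq by (simp add: mdom0_def)
qed

lemma weak_solution_L2:
  assumes "w \<in> L2_on \<Delta>" "g \<in> L2_on \<Delta>" and orth: "\<And>\<phi>. \<phi> \<in> mdom0 \<Longrightarrow> inner w (Lop \<phi>) = inner g (abs_L2 \<phi>)"
  obtains y where "y \<in> mdom" "abs_L2 y = w" "Lop y = g"
proof -
  obtain f where f: "square_integrable f" "\<And>t. t \<notin> \<Delta> \<Longrightarrow> f t = 0" "w = abs_L2 f" using L2_onE[OF assms(1)] by metis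
  obtain k where k: "square_integrable k" "\<And>t. t \<notin> \<Delta> \<Longrightarrow> k t = 0" "g = abs_L2 k" using L2_onE[OF assms(2)] by metis
  have "\<exists>y\<in>mdom. abs_L2 y = abs_L2 f \<and> Lop y = abs_L2 k"
    by (rule weak_solution[OF f(1,2) k(1,2)]) (use orth f(3) k(3) in auto)
  then show ?thesis using that f k by blast
qed

text \<open>The graph of the minimal operator; it is identified with \<open>min_op\<close> once
  vanishing columns have been translated into vanishing quasi-derivatives.\<close>

definition graph0 :: "('h L2 \<times> 'h L2) set" where
  "graph0 = {(abs_L2 y, Lop y) | y. y \<in> mdom0}"

text \<open>The minimal operator is the adjoint of L, in real form. A pair on the right is a weak
  solution, since elements of \<open>mdom0\<close> are among the test functions; so it comes from
  the maximal domain, and symmetry puts it into \<open>mdom0\<close>. The right-hand side is visibly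
  a closed subspace.\<close>

lemma graph0_eq:
  "graph0 = (L2_on \<Delta> \<times> L2_on \<Delta>) \<inter> {x. \<forall>z\<in>mdom. inner (snd x) (abs_L2 z) = inner (fst x) (Lop z)}" (is "_ = ?R")
proof
  show "graph0 \<subseteq> ?R" unfolding graph0_def using green_mdom0(2) mdom_L2_on by (auto simp: mdom0_def)
  show "?R \<subseteq> graph0"
  proof
    fix x assume x: "x \<in> ?R"
    then have m: "fst x \<in> L2_on \<Delta>" "snd x \<in> L2_on \<Delta>" and s: "\<And>z. z \<in> mdom \<Longrightarrow> inner (snd x) (abs_L2 z) = inner (fst x) (Lop z)" by auto
    have "inner (fst x) (Lop \<phi>) = inner (snd x) (abs_L2 \<phi>)" if "\<phi> \<in> mdom0" for \<phi> using s[of \<phi>] that by (simp add: mdom0_def)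
    then obtain y where y: "y \<in> mdom" "abs_L2 y = fst x" "Lop y = snd x" using weak_solution_L2[OF m] by metis
    have "y \<in> mdom0" by (rule mdom0I[OF y(1)]) (simp add: y s)
    then show "x \<in> graph0" using y unfolding graph0_def by (auto intro!: exI[of _ y])
  qed
qed

lemma graph0_complete: "complete graph0" and graph0_subspace: "subspace graph0"
proof -
  have "closed (L2_on \<Delta> :: 'h L2 set)" by (rule closed_L2_on[OF sets_interval])
  moreover have "closed {x :: 'h L2 \<times> 'h L2. \<forall>z\<in>mdom. inner (snd x) (abs_L2 z) = inner (fst x) (Lop z)}"
    unfolding Ball_def by (intro closed_Collect_all closed_Collect_imp open_Collect_const closed_Collect_eq continuous_intros)
  ultimately have "closed graph0" unfolding graph0_eq by (intro closed_Int closed_Times)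
  then show "complete graph0" by (simp add: complete_eq_closed)
  have "subspace (L2_on \<Delta> :: 'h L2 set)" by (rule csubspace_imp_subspace[OF csubspace_L2_on])
  then show "subspace graph0" unfolding graph0_eq subspace_def by (auto simp: mem_Times_iff inner_add_left)
qed

text \<open>The norm of \<open>snd x - c *\<^sub>C fst x\<close> on the symmetric graph depends on c
  only through its real part and modulus, because \<open>cinner (snd x) (fst x)\<close> is real; so
  the lower bound passes from lam to its conjugate. On the range for the conjugate, the functional
  sending the image of x to the inner product of f with \<open>fst x\<close> is well defined and
  bounded. Its Riesz vector w satisfies (L - lam) w = f weakly, hence genuinely.\<close>

lemma resolvent_onto:
  assumes ker: "\<And>x. x \<in> graph0 \<Longrightarrow> snd x - lam *\<^sub>C fst x = 0 \<Longrightarrow> x = 0"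
    and cl: "closed ((\<lambda>x. snd x - lam *\<^sub>C fst x) ` graph0)" and f: "f \<in> L2_on \<Delta>"
  shows "\<exists>y\<in>mdom. Lop y - lam *\<^sub>C abs_L2 y = f"
proof -
  have bl: "bounded_linear (\<lambda>x :: 'h L2 \<times> 'h L2. snd x - c *\<^sub>C fst x)" for c
    by (intro bounded_linear_sub bounded_linear_snd bounded_linear_compose[OF bounded_linear_scaleC bounded_linear_fst])
  note lin = linear_simps[OF bl[of lam]]
  let ?V = "(\<lambda>x. snd x - lam *\<^sub>C fst x) ` graph0"
  have "real_operator_on graph0 (\<lambda>x. snd x - lam *\<^sub>C fst x)"
    unfolding real_operator_on_def using lin bounded_linear.bounded[OF bl[of lam]] by (metis mult.commute)
  moreover have V: "subspace ?V" using graph0_subspace bl[of lam] by (intro linear_subspace_image bounded_linear.linear)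
  ultimately obtain M where M: "M > 0" "\<And>v. v \<in> ?V \<Longrightarrow> \<exists>x\<in>graph0. snd x - lam *\<^sub>C fst x = v \<and> norm x \<le> M * norm v"
    using open_mapping_on[OF _ graph0_subspace graph0_complete V _ refl] cl unfolding complete_eq_closed by blast
  \<comment> \<open>The open mapping theorem controls the norm of some preimage, and injectivity
    identifies it with x.\<close>
  have lower: "norm x \<le> M * norm (snd x - lam *\<^sub>C fst x)" if x: "x \<in> graph0" for x
  proof -
    obtain x' where x': "x' \<in> graph0" "snd x' - lam *\<^sub>C fst x' = snd x - lam *\<^sub>C fst x" "norm x' \<le> M * norm (snd x - lam *\<^sub>C fst x)"
      using M(2) x by blast
    have "x' - x \<in> graph0" using graph0_subspace x x' by (simp add: subspace_diff)
    moreover have "snd (x' - x) - lam *\<^sub>C fst (x' - x) = 0" unfolding lin(2) using x'(2) by simp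
    ultimately have "x' - x = 0" by (rule ker)
    then show ?thesis using x'(3) by simp
  qed
  have conj: "norm (snd x - cnj lam *\<^sub>C fst x) = norm (snd x - lam *\<^sub>C fst x)" if x: "x \<in> graph0" for x
  proof -
    obtain \<phi> where \<phi>: "\<phi> \<in> mdom0" "x = (abs_L2 \<phi>, Lop \<phi>)" using x unfolding graph0_def by blast
    then have "cinner (snd x) (fst x) = cinner (fst x) (snd x)" using green_mdom0(1)[OF \<phi>(1), of \<phi>] by (simp add: mdom0_def)
    then have "Im (cinner (snd x) (fst x)) = 0" by (metis cinner_commute cnj.simps(2) equation_minus_iff neg_equal_zero)
    then have i: "inner (snd x) (c *\<^sub>C fst x) = Re c * Re (cinner (snd x) (fst x))" for c
      by (simp add: Re_cinner[symmetric] cinner_scaleC_right)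
    have "(norm (snd x - c *\<^sub>C fst x))\<^sup>2 = (norm (snd x))\<^sup>2 - 2 * (Re c * Re (cinner (snd x) (fst x))) + (cmod c * norm (fst x))\<^sup>2" for c
    proof -
      have "(norm (snd x - c *\<^sub>C fst x))\<^sup>2 = (norm (snd x))\<^sup>2 - 2 * inner (snd x) (c *\<^sub>C fst x) + (norm (c *\<^sub>C fst x))\<^sup>2"
        by (simp add: power2_norm_eq_inner inner_diff_left inner_diff_right inner_commute)
      then show ?thesis by (simp only: i norm_scaleC)
    qed
    from this[of lam] this[of "cnj lam"] show ?thesis by (metis complex_cnj complex_mod_cnj cnj.simps(1) norm_ge_zero power2_eq_iff_nonneg)
  qed
  define f' where "f' x = snd x - cnj lam *\<^sub>C fst x" for x :: "'h L2 \<times> 'h L2"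
  have lower': "norm x \<le> M * norm (f' x)" if "x \<in> graph0" for x using lower[OF that] conj[OF that] by (simp add: f'_def)
  have bl': "bounded_linear f'" unfolding f'_def by (rule bl)
  note lin' = linear_simps[OF bl']
  have inj: "inj_on f' graph0"
  proof (rule inj_onI)
    fix x y assume xy: "x \<in> graph0" "y \<in> graph0" "f' x = f' y"
    have "x - y \<in> graph0" using graph0_subspace xy by (simp add: subspace_diff)
    from lower'[OF this] xy(3) show "x = y" by (simp add: lin'(2))
  qed
  define R where "R = f' ` graph0"
  have R: "subspace R" unfolding R_def using graph0_subspace bl' by (intro linear_subspace_image bounded_linear.linear)
  have Rc: "complete R"
    unfolding R_def
  proof (rule complete_isometric_image[OF _ graph0_subspace bl' _ graph0_complete, of "1 / M"])
    show "\<forall>x\<in>graph0. 1 / M * norm x \<le> norm (f' x)" using lower' M(1) by (simp add: field_simps mult.commute)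
  qed (use M in simp)
  \<comment> \<open>Injectivity of f' on the graph makes the value independent of the chosen
    preimage.\<close>
  define l where "l r = inner f (fst (inv_into graph0 f' r))" for r
  have lf: "l (f' x) = inner f (fst x)" if "x \<in> graph0" for x using inv_into_f_f[OF inj that] by (simp add: l_def)
  have "\<exists>w\<in>R. \<forall>r\<in>R. l r = inner w r"
  proof (rule riesz_on_subspace[OF R Rc, of _ "norm f * M"])
    fix r s assume "r \<in> R" "s \<in> R"
    then obtain x y where xy: "x \<in> graph0" "y \<in> graph0" "r = f' x" "s = f' y" by (auto simp: R_def)
    have "l (f' (x + y)) = l (f' x) + l (f' y)"
      using lf[OF xy(1)] lf[OF xy(2)] lf[OF subspace_add[OF graph0_subspace xy(1,2)]] by (simp add: inner_add_right)
    then show "l (r + s) = l r + l s" by (simp add: xy lin')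
  next
    fix a r assume "r \<in> R"
    then obtain x where x: "x \<in> graph0" "r = f' x" by (auto simp: R_def)
    have "l (f' (a *\<^sub>R x)) = a * l (f' x)"
      using lf[OF x(1)] lf[OF subspace_scale[OF graph0_subspace x(1)], of a] by simp
    then show "l (a *\<^sub>R r) = a * l r" by (simp add: x lin')
  next
    fix r assume "r \<in> R"
    then obtain x where x: "x \<in> graph0" "r = f' x" by (auto simp: R_def)
    have "\<bar>l r\<bar> \<le> norm f * norm (fst x)" unfolding x(2) lf[OF x(1)] by (rule Cauchy_Schwarz_ineq2)
    also have "\<dots> \<le> norm f * norm x" using norm_fst_le[of "fst x" "snd x"] by (intro mult_left_mono) auto
    also have "\<dots> \<le> norm f * (M * norm r)" unfolding x(2) by (intro mult_left_mono lower'[OF x(1)]) auto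
    finally show "\<bar>l r\<bar> \<le> norm f * M * norm r" by (simp add: mult.assoc)
  qed
  then obtain w where w: "w \<in> R" "\<And>r. r \<in> R \<Longrightarrow> l r = inner w r" by blast
  have cs: "csubspace (L2_on \<Delta> :: 'h L2 set)" by (rule csubspace_L2_on)
  \<comment> \<open>The Riesz vector belongs to the range itself, and therefore vanishes outside
    \<Delta>, as a weak solution must.\<close>
  obtain x where x: "x \<in> graph0" "w = f' x" using w(1) by (auto simp: R_def)
  have "fst x \<in> L2_on \<Delta>" "snd x \<in> L2_on \<Delta>" using x(1) unfolding graph0_eq by auto
  moreover have "c *\<^sub>C u \<in> L2_on \<Delta>" if "u \<in> L2_on \<Delta>" for c and u :: "'h L2" using cs that unfolding csubspace_def by blast
  ultimately have wL: "w \<in> L2_on \<Delta>" "f + lam *\<^sub>C w \<in> L2_on \<Delta>"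
    unfolding x(2) f'_def using csubspace_imp_subspace[OF cs] f by (simp_all add: subspace_diff subspace_add)
  have "inner w (Lop \<phi>) = inner (f + lam *\<^sub>C w) (abs_L2 \<phi>)" if \<phi>: "\<phi> \<in> mdom0" for \<phi>
  proof -
    have g: "(abs_L2 \<phi>, Lop \<phi>) \<in> graph0" using \<phi> unfolding graph0_def by blast
    have "inner f (abs_L2 \<phi>) = inner w (f' (abs_L2 \<phi>, Lop \<phi>))" using lf[OF g] w(2) g by (simp add: R_def)
    also have "\<dots> = inner w (Lop \<phi>) - inner w (cnj lam *\<^sub>C abs_L2 \<phi>)" by (simp add: f'_def inner_diff_right)
    also have "inner w (cnj lam *\<^sub>C abs_L2 \<phi>) = inner (lam *\<^sub>C w) (abs_L2 \<phi>)"
      by (simp add: Re_cinner[symmetric] cinner_scaleC_right cinner_scaleC_left)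
    finally show ?thesis by (simp add: inner_add_left)
  qed
  then obtain y where "y \<in> mdom" "abs_L2 y = w" "Lop y = f + lam *\<^sub>C w" using weak_solution_L2[OF wL] by metis
  then show ?thesis by (intro bexI[of _ y]) auto
qed

end

section \<open>Boundary triplets\<close>

text \<open>The Riesz vector z of the functional x -> (a, x) on S is the projection of a onto S, so
  a - z is the component in the complement. The definite description in
  \<open>orth_projector\<close> refers to the double complement, which is why uniqueness has to be
  shown along with it.\<close>

lemma orth_projector_orth_complement:
  fixes S :: "'a::complex_hilbert set"
  assumes S: "csubspace S" "closed S"
  shows "orth_projector (orth_complement S) a \<in> orth_complement S" "a - orth_projector (orth_complement S) a \<in> S"
proof -
  have sub: "subspace S" "complete S" using S by (auto simp: csubspace_imp_subspace complete_eq_closed)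
  have "\<exists>z\<in>S. \<forall>x\<in>S. inner a x = inner z x"
    by (rule riesz_on_subspace[OF sub, of "inner a" "norm a"]) (auto simp: inner_add_right Cauchy_Schwarz_ineq2)
  then obtain z where z: "z \<in> S" "\<And>x. x \<in> S \<Longrightarrow> inner (a - z) x = 0" by (auto simp: inner_diff_left)
  have az: "a - z \<in> orth_complement S"
    unfolding orth_complement_def using cinner_eq_zero_if_inner[OF S(1) z(2)] by blast
  have SS: "x \<in> orth_complement (orth_complement S)" if "x \<in> S" for x
    unfolding orth_complement_def using that by (auto simp: orth_complement_def) (metis cinner_commute complex_cnj_zero)
  have "orth_projector (orth_complement S) a = a - z"
    unfolding orth_projector_def
  proof (rule the_equality)
    show "a - z \<in> orth_complement S \<and> a - (a - z) \<in> orth_complement (orth_complement S)" using az SS[OF z(1)] by simp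
    fix y assume y: "y \<in> orth_complement S \<and> a - y \<in> orth_complement (orth_complement S)"
    have 1: "y - (a - z) \<in> orth_complement S" using y az by (auto simp: orth_complement_def cinner_diff_left)
    have "z - (a - y) \<in> orth_complement (orth_complement S)" using y SS[OF z(1)] by (auto simp: orth_complement_def cinner_diff_left)
    then have "y - (a - z) \<in> orth_complement (orth_complement S)" by (simp add: algebra_simps)
    with 1 have "cinner (y - (a - z)) (y - (a - z)) = 0" unfolding orth_complement_def by blast
    then have "inner (y - (a - z)) (y - (a - z)) = 0" by (simp only: cinner_self of_real_eq_0_iff)
    then show "y = a - z" by simp
  qed
  then show "orth_projector (orth_complement S) a \<in> orth_complement S" "a - orth_projector (orth_complement S) a \<in> S"
    using az z(1) by simp_all
qed

lemma bounded_operator_on_real: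
  assumes "bounded_operator_on S A"
  shows "x \<in> S \<Longrightarrow> y \<in> S \<Longrightarrow> A (x + y) = A x + A y" "x \<in> S \<Longrightarrow> A (r *\<^sub>R x) = r *\<^sub>R A x"
    "\<exists>M\<ge>0. \<forall>x\<in>S. norm (A x) \<le> M * norm x"
proof -
  show "x \<in> S \<Longrightarrow> y \<in> S \<Longrightarrow> A (x + y) = A x + A y" using assms by (simp add: bounded_operator_on_def)
  show "x \<in> S \<Longrightarrow> A (r *\<^sub>R x) = r *\<^sub>R A x" using assms by (simp add: bounded_operator_on_def scaleC_of_real[symmetric])
  obtain M where M: "\<And>x. x \<in> S \<Longrightarrow> norm (A x) \<le> M * norm x" using assms unfolding bounded_operator_on_def by blast
  have "norm (A x) \<le> \<bar>M\<bar> * norm x" if "x \<in> S" for x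
  proof -
    have "M * norm x \<le> \<bar>M\<bar> * norm x" by (intro mult_right_mono) auto
    then show ?thesis using M[OF that] by linarith
  qed
  then show "\<exists>M\<ge>0. \<forall>x\<in>S. norm (A x) \<le> M * norm x" by (intro exI[of _ "\<bar>M\<bar>"]) auto
qed

lemma norm_fst_snd_le: "norm (fst x) \<le> norm x" "norm (snd x) \<le> norm x"
  using norm_fst_le[of "fst x" "snd x"] norm_snd_le[of "snd x" "fst x"] by simp_all

locale boundary_triplet = quasi_interval \<Delta> n p q dim b
  for \<Delta> n and p q :: "nat \<Rightarrow> real \<Rightarrow> 'h::{complex_hilbert, second_countable_topology} \<Rightarrow>\<^sub>L 'h"
    and dim :: "'n::{finite, linorder} itself" and b +
  fixes H1' :: "'a::complex_hilbert set" and \<Gamma>0' \<Gamma>1' :: "(real \<Rightarrow> 'h) \<Rightarrow> 'a"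
  assumes H1: "csubspace H1'" "closed H1'"
    and \<Gamma>0_linear: "linear_on_functions mdom \<Gamma>0'" and \<Gamma>1_linear: "linear_on_functions mdom \<Gamma>1'"
    and \<Gamma>_onto: "(\<lambda>y. (\<Gamma>0' y, \<Gamma>1' y)) ` mdom = UNIV \<times> H1'"
    and \<Gamma>_form: "\<And>y z. y \<in> mdom \<Longrightarrow> z \<in> mdom \<Longrightarrow> bb y z = cinner (\<Gamma>1' y) (\<Gamma>0' z) - cinner (\<Gamma>0' y) (\<Gamma>1' z)
      + \<i> * cinner (orth_projector (orth_complement H1') (\<Gamma>0' y)) (orth_projector (orth_complement H1') (\<Gamma>0' z))"
begin

section \<open>Nondegeneracy of the boundary form\<close>

abbreviation P2 :: "'a \<Rightarrow> 'a" where "P2 \<equiv> orth_projector (orth_complement H1')"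

abbreviation c1 :: "(real \<Rightarrow> 'h) \<Rightarrow> ('h, 'n) vec" where "c1 y \<equiv> column1 blinfun_apply \<Delta> p q y 0"

abbreviation c2 :: "(real \<Rightarrow> 'h) \<Rightarrow> ('h, 'n) vec" where "c2 y \<equiv> column2 blinfun_apply \<Delta> p q y 0"

lemma H1_subspace: "subspace H1'" by (rule csubspace_imp_subspace[OF H1(1)])

lemma P2: "P2 a \<in> orth_complement H1'" "a - P2 a \<in> H1'"
  by (rule orth_projector_orth_complement[OF H1])+

lemma orth_inter: "a \<in> H1' \<Longrightarrow> a \<in> orth_complement H1' \<Longrightarrow> a = 0"
proof -
  assume "a \<in> H1'" "a \<in> orth_complement H1'"
  then have "cinner a a = 0" by (auto simp: orth_complement_def)
  then show "a = 0" by (simp add: cinner_self)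
qed

lemma P2_zero: "a \<in> H1' \<Longrightarrow> P2 a = 0"
proof -
  assume "a \<in> H1'"
  from subspace_diff[OF H1_subspace this P2(2)[of a]] have "P2 a \<in> H1'" by simp
  then show "P2 a = 0" by (rule orth_inter) (rule P2(1))
qed

lemma P2_ident: "a \<in> orth_complement H1' \<Longrightarrow> P2 a = a"
proof -
  assume "a \<in> orth_complement H1'"
  then have "a - P2 a \<in> orth_complement H1'" using P2(1)[of a] by (auto simp: orth_complement_def cinner_diff_left)
  from orth_inter[OF P2(2) this] show "P2 a = a" by simp
qed

lemma cinner_P2: "cinner (P2 a) (P2 c) = cinner a (P2 c)"
proof -
  have "cinner (P2 c) (a - P2 a) = 0" using P2(1)[of c] P2(2)[of a] by (auto simp: orth_complement_def)
  then have "cinner (a - P2 a) (P2 c) = 0" by (metis cinner_commute complex_cnj_zero)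
  then show ?thesis by (simp add: cinner_diff_left)
qed

lemma \<Gamma>_surj:
  assumes "a' \<in> H1'"
  obtains z where "z \<in> mdom" "\<Gamma>0' z = a" "\<Gamma>1' z = a'"
proof -
  have "(a, a') \<in> (\<lambda>y. (\<Gamma>0' y, \<Gamma>1' y)) ` mdom" unfolding \<Gamma>_onto using assms by simp
  then show ?thesis using that by auto
qed

lemma \<Gamma>1_mem: "y \<in> mdom \<Longrightarrow> \<Gamma>1' y \<in> H1'"
  using \<Gamma>_onto by blast

text \<open>Since the boundary maps are jointly onto, the values c of \<open>\<Gamma>0'\<close> and
  c' of \<open>\<Gamma>1'\<close> can be chosen independently. The choice c = 0 shows that a is
  orthogonal to \<open>H1'\<close>; then c = a' gives a' = 0 because \<open>P2\<close> vanishes on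
  \<open>H1'\<close>; finally c = \<i> a gives a = 0 because \<open>P2\<close> is the identity on
  the complement.\<close>

lemma form_nondegenerate:
  assumes a': "a' \<in> H1'"
    and form: "\<And>z. z \<in> mdom \<Longrightarrow> inner a' (\<Gamma>0' z) - inner a (\<Gamma>1' z) + inner (\<i> *\<^sub>C a) (P2 (\<Gamma>0' z)) = 0"
  shows "a = 0" "a' = 0"
proof -
  have form': "inner a' c - inner a c' + inner (\<i> *\<^sub>C a) (P2 c) = 0" if c': "c' \<in> H1'" for c c'
  proof -
    obtain z where "z \<in> mdom" "\<Gamma>0' z = c" "\<Gamma>1' z = c'" using \<Gamma>_surj[OF c'] by metis
    then show ?thesis using form[of z] by simp
  qed
  have 0: "0 \<in> H1'" using H1_subspace by (rule subspace_0)
  have "inner a c' = 0" if "c' \<in> H1'" for c' using form'[OF that, of 0] P2_zero[OF 0] by simp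
  then have "a \<in> orth_complement H1'" unfolding orth_complement_def using cinner_eq_zero_if_inner[OF H1(1)] by blast
  then have ia: "\<i> *\<^sub>C a \<in> orth_complement H1'" by (simp add: orth_complement_def cinner_scaleC_left)
  have "inner a' a' = 0" using form'[OF 0, of a'] P2_zero[OF a'] by simp
  then show a'0: "a' = 0" by simp
  have "inner (\<i> *\<^sub>C a) (\<i> *\<^sub>C a) = 0" using form'[OF 0, of "\<i> *\<^sub>C a"] P2_ident[OF ia] a'0 by simp
  then have "norm (\<i> *\<^sub>C a) = 0" by simp
  then show "a = 0" by (simp add: norm_scaleC)
qed

text \<open>The factor \<i> is moved to the first argument and \<open>P2\<close> is kept in the
  second only. For fixed z the right-hand side is then linear and continuous in the boundary values
  of y, the shape needed for a closed condition.\<close>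

lemma green_real:
  assumes y: "y \<in> mdom" and z: "z \<in> mdom"
  shows "inner (Lop y) (abs_L2 z) - inner (abs_L2 y) (Lop z) =
    inner (\<Gamma>1' y) (\<Gamma>0' z) - inner (\<Gamma>0' y) (\<Gamma>1' z) + inner (\<i> *\<^sub>C \<Gamma>0' y) (P2 (\<Gamma>0' z))
    - (inner (c1 y) (c2 z) - inner (c2 y) (c1 z))"
proof -
  have "cinner (Lop y) (abs_L2 z) - cinner (abs_L2 y) (Lop z) =
    cinner (\<Gamma>1' y) (\<Gamma>0' z) - cinner (\<Gamma>0' y) (\<Gamma>1' z) + cinner (\<i> *\<^sub>C \<Gamma>0' y) (P2 (\<Gamma>0' z))
    - (cinner (c1 y) (c2 z) - cinner (c2 y) (c1 z))"
    unfolding green[OF y z] \<Gamma>_form[OF y z] cinner_P2 boundary_form_def cinner_scaleC_left ..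
  then have "Re (cinner (Lop y) (abs_L2 z) - cinner (abs_L2 y) (Lop z)) =
    Re (cinner (\<Gamma>1' y) (\<Gamma>0' z) - cinner (\<Gamma>0' y) (\<Gamma>1' z) + cinner (\<i> *\<^sub>C \<Gamma>0' y) (P2 (\<Gamma>0' z))
    - (cinner (c1 y) (c2 z) - cinner (c2 y) (c1 z)))" by (rule arg_cong)
  then show ?thesis by (simp only: minus_complex.simps plus_complex.simps Re_cinner)
qed

section \<open>Boundary values as linear maps\<close>

lemma columns: "(c1 y, c2 y) = of_comps (\<lambda>j. qv j y 0)"
  by (simp add: of_comps_def column1_def column2_def n_eq[symmetric])

lemma of_comps_cong: "(\<And>j. j < 2 * n \<Longrightarrow> f j = g j) \<Longrightarrow> (of_comps f :: ('h, 'n) vec \<times> ('h, 'n) vec) = of_comps g"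
proof -
  assume fg: "\<And>j. j < 2 * n \<Longrightarrow> f j = g j"
  have "f (pos i) = g (pos i) \<and> f (2 * CARD('n) - 1 - pos i) = g (2 * CARD('n) - 1 - pos i)" for i :: 'n
    using fg[of "pos i"] fg[of "2 * CARD('n) - 1 - pos i"] pos_less[of i] n_eq by simp
  then show ?thesis by (simp add: of_comps_def)
qed

lemma columns_add:
  assumes "y \<in> mdom" "z \<in> mdom"
  shows "(c1 (\<lambda>t. y t + z t), c2 (\<lambda>t. y t + z t)) = (c1 y, c2 y) + (c1 z, c2 z)"
proof -
  have "(c1 (\<lambda>t. y t + z t), c2 (\<lambda>t. y t + z t)) = of_comps (\<lambda>j. qv j y 0 + qv j z 0)"
    unfolding columns by (rule of_comps_cong) (rule quasi_regular_plus(2)[OF action_apply mdomD(1)[OF assms(1)] mdomD(1)[OF assms(2)] zero_mem])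
  then show ?thesis unfolding columns by (simp add: of_comps_def vec_eq_iff)
qed

lemma columns_scaleC:
  assumes "y \<in> mdom"
  shows "(c1 (\<lambda>t. a *\<^sub>C y t), c2 (\<lambda>t. a *\<^sub>C y t)) = a *\<^sub>C (c1 y, c2 y)"
proof -
  have "(c1 (\<lambda>t. a *\<^sub>C y t), c2 (\<lambda>t. a *\<^sub>C y t)) = of_comps (\<lambda>j. a *\<^sub>C qv j y 0)"
    unfolding columns by (rule of_comps_cong) (rule scaleC_regular(2)[OF mdomD(1)[OF assms] zero_mem])
  then show ?thesis unfolding columns by (simp add: of_comps_def vec_eq_iff scaleC_prod_def scaleC_vec_def)
qed

lemma boundary_values_zero:
  assumes z: "z \<in> mdom" and bz: "\<And>y. y \<in> mdom \<Longrightarrow> bb z y = 0"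
  shows "\<Gamma>0' z = 0" "\<Gamma>1' z = 0"
proof -
  have "inner (\<Gamma>1' z) (\<Gamma>0' y) - inner (\<Gamma>0' z) (\<Gamma>1' y) + inner (\<i> *\<^sub>C \<Gamma>0' z) (P2 (\<Gamma>0' y)) = 0" if "y \<in> mdom" for y
  proof -
    have "cinner (\<Gamma>1' z) (\<Gamma>0' y) - cinner (\<Gamma>0' z) (\<Gamma>1' y) + cinner (\<i> *\<^sub>C \<Gamma>0' z) (P2 (\<Gamma>0' y)) = 0"
      using bz[OF that] unfolding \<Gamma>_form[OF z that] cinner_P2 cinner_scaleC_left .
    then have "Re (cinner (\<Gamma>1' z) (\<Gamma>0' y) - cinner (\<Gamma>0' z) (\<Gamma>1' y) + cinner (\<i> *\<^sub>C \<Gamma>0' z) (P2 (\<Gamma>0' y))) = 0" by simp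
    then show ?thesis by (simp only: minus_complex.simps plus_complex.simps Re_cinner)
  qed
  then show "\<Gamma>0' z = 0" "\<Gamma>1' z = 0" using form_nondegenerate[OF \<Gamma>1_mem[OF z]] by blast+
qed

lemma \<Gamma>_add:
  assumes "y \<in> mdom" "z \<in> mdom"
  shows "\<Gamma>0' (\<lambda>t. y t + z t) = \<Gamma>0' y + \<Gamma>0' z" "\<Gamma>1' (\<lambda>t. y t + z t) = \<Gamma>1' y + \<Gamma>1' z"
  using \<Gamma>0_linear \<Gamma>1_linear assms by (auto simp: linear_on_functions_def)

lemma \<Gamma>_scaleC:
  assumes "y \<in> mdom"
  shows "\<Gamma>0' (\<lambda>t. a *\<^sub>C y t) = a *\<^sub>C \<Gamma>0' y" "\<Gamma>1' (\<lambda>t. a *\<^sub>C y t) = a *\<^sub>C \<Gamma>1' y"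
  using \<Gamma>0_linear \<Gamma>1_linear assms by (auto simp: linear_on_functions_def)

text \<open>An element with the prescribed values at b is corrected at 0 by a steering function. The
  form of the latter at b is zero, so by nondegeneracy its values at b are zero and the correction
  does not disturb them.\<close>

lemma boundary_values_onto:
  assumes "a' \<in> H1'"
  obtains y where "y \<in> mdom" "c1 y = x1" "c2 y = x2" "\<Gamma>0' y = a" "\<Gamma>1' y = a'"
proof -
  obtain y where y: "y \<in> mdom" "\<Gamma>0' y = a" "\<Gamma>1' y = a'" using \<Gamma>_surj[OF assms] by metis
  define v where "v = (x1, x2) - (c1 y, c2 y)"
  obtain z where z: "z \<in> mdom" "\<And>j. j < 2 * n \<Longrightarrow> qv j z 0 = state_comp v j" "\<And>u. bb u z = 0" "\<And>u. bb z u = 0"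
    using steering[of "state_comp v"] by metis
  have cz: "(c1 z, c2 z) = v" unfolding columns using of_comps_cong[of "\<lambda>j. qv j z 0" "state_comp v", OF z(2)] by simp
  have "\<Gamma>0' z = 0" "\<Gamma>1' z = 0" using boundary_values_zero[OF z(1)] z(4) by blast+
  then show ?thesis
    using that[of "\<lambda>t. y t + z t"] mdom_add[OF y(1) z(1)] \<Gamma>_add[OF y(1) z(1)] y columns_add[OF y(1) z(1)] unfolding cz v_def by simp
qed

text \<open>The image of the maximal domain under \<open>ev\<close> is the space E. With the
  boundary values as coordinates the boundary operator is a bounded function of the point, whatever
  is known about the maps that produce them.\<close>

definition ev :: "(real \<Rightarrow> 'h) \<Rightarrow> 'h L2 \<times> 'h L2 \<times> (('h, 'n) vec \<times> ('h, 'n) vec) \<times> 'a \<times> 'a" where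
  "ev y = (abs_L2 y, Lop y, (c1 y, c2 y), \<Gamma>0' y, \<Gamma>1' y)"

lemma ev_add: "y \<in> mdom \<Longrightarrow> z \<in> mdom \<Longrightarrow> ev y + ev z = ev (\<lambda>t. y t + z t)"
  using mdom_add[of y z] \<Gamma>_add[of y z] columns_add[of y z] abs_L2_arith(1)[OF mdomD(3) mdomD(3), of y z]
  unfolding ev_def by simp

lemma ev_scaleC: "y \<in> mdom \<Longrightarrow> a *\<^sub>C ev y = ev (\<lambda>t. a *\<^sub>C y t)"
  using mdom_scaleC[of y a] \<Gamma>_scaleC[of y a] columns_scaleC[of y a] abs_L2_arith(3)[OF mdomD(3) mdomD(3), of y y a]
  unfolding ev_def by (simp add: scaleC_prod_def)

lemma ev_subspace: "subspace (ev ` mdom)"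
  unfolding subspace_def
proof (intro conjI ballI allI)
  fix x assume "x \<in> ev ` mdom"
  then obtain y where y: "y \<in> mdom" "x = ev y" by blast
  show "x + x' \<in> ev ` mdom" if x': "x' \<in> ev ` mdom" for x'
  proof -
    obtain z where z: "z \<in> mdom" "x' = ev z" using x' by blast
    show ?thesis unfolding y(2) z(2) ev_add[OF y(1) z(1)] using mdom_add[OF y(1) z(1)] by blast
  qed
  show "r *\<^sub>R x \<in> ev ` mdom" for r
    unfolding y(2) scaleC_of_real[symmetric] ev_scaleC[OF y(1)] using mdom_scaleC[OF y(1)] by blast
next
  have "0 *\<^sub>C ev (\<lambda>_. 0) \<in> ev ` mdom"
    unfolding ev_scaleC[OF conjunct1[OF mdom_zero]] using mdom_scaleC[OF conjunct1[OF mdom_zero]] by blast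
  then show "0 \<in> ev ` mdom" by simp
qed

text \<open>Green's formula against fixed z is a family of closed conditions, and it characterizes
  E: testing with \<open>mdom0\<close> removes all boundary terms and makes the first two
  coordinates a weak solution, hence an element y of the maximal domain. It remains to see that the
  other coordinates are the boundary values of y.\<close>

lemma ev_image_eq:
  "ev ` mdom = {e. fst e \<in> L2_on \<Delta> \<and> fst (snd e) \<in> L2_on \<Delta> \<and> snd (snd (snd (snd e))) \<in> H1' \<and>
     (\<forall>z. z \<in> mdom \<longrightarrow> inner (fst (snd e)) (abs_L2 z) - inner (fst e) (Lop z) =
       inner (snd (snd (snd (snd e)))) (\<Gamma>0' z) - inner (fst (snd (snd (snd e)))) (\<Gamma>1' z)
       + inner (\<i> *\<^sub>C fst (snd (snd (snd e)))) (P2 (\<Gamma>0' z))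
       - (inner (fst (fst (snd (snd e)))) (c2 z) - inner (snd (fst (snd (snd e)))) (c1 z)))}" (is "_ = ?R")
proof
  show "ev ` mdom \<subseteq> ?R" unfolding ev_def using mdom_L2_on \<Gamma>1_mem green_real by auto
  show "?R \<subseteq> ev ` mdom"
  proof
    fix e assume e: "e \<in> ?R"
    obtain w g x1 x2 a a' where ee: "e = (w, g, (x1, x2), a, a')" by (metis surj_pair)
    have L: "w \<in> L2_on \<Delta>" "g \<in> L2_on \<Delta>" "a' \<in> H1'" using e ee by auto
    have form: "inner g (abs_L2 z) - inner w (Lop z) = inner a' (\<Gamma>0' z) - inner a (\<Gamma>1' z) + inner (\<i> *\<^sub>C a) (P2 (\<Gamma>0' z))
       - (inner x1 (c2 z) - inner x2 (c1 z))" if "z \<in> mdom" for z using e ee that by simp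
    have "inner w (Lop \<phi>) = inner g (abs_L2 \<phi>)" if \<phi>: "\<phi> \<in> mdom0" for \<phi>
    proof -
      have d: "\<phi> \<in> mdom" "\<And>z. z \<in> mdom \<Longrightarrow> bb \<phi> z = 0" "\<And>j. j < 2 * n \<Longrightarrow> qv j \<phi> 0 = 0" using \<phi> by (auto simp: mdom0_def)
      have "(c1 \<phi>, c2 \<phi>) = of_comps (\<lambda>_. 0)" unfolding columns by (rule of_comps_cong[OF d(3)])
      then have c: "c1 \<phi> = 0" "c2 \<phi> = 0" by (simp_all add: of_comps_def vec_eq_iff)
      show ?thesis using form[OF d(1)] boundary_values_zero[OF d(1,2)] c P2_zero[OF subspace_0[OF H1_subspace]] by simp
    qed
    then obtain y where y: "y \<in> mdom" "abs_L2 y = w" "Lop y = g" using weak_solution_L2[OF L(1,2)] by metis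
    \<comment> \<open>Green's formula for y has the same left-hand side, so only the differences of
      the boundary coordinates remain.\<close>
    have diff: "inner (a' - \<Gamma>1' y) (\<Gamma>0' z) - inner (a - \<Gamma>0' y) (\<Gamma>1' z) + inner (\<i> *\<^sub>C (a - \<Gamma>0' y)) (P2 (\<Gamma>0' z))
       - (inner (x1 - c1 y) (c2 z) - inner (x2 - c2 y) (c1 z)) = 0" if z: "z \<in> mdom" for z
      using form[OF z] green_real[OF y(1) z] unfolding y(2,3) scaleC_diff_right inner_diff_left by linarith
    have x: "x1 = c1 y" "x2 = c2 y"
    proof -
      have 0: "0 \<in> H1'" using H1_subspace by (rule subspace_0)
      \<comment> \<open>A test function with vanishing values at b and one column equal to the
        difference in question isolates this difference at 0. After both columns are settled,
        nondegeneracy settles the values at b.\<close>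
      obtain z where z: "z \<in> mdom" "c1 z = 0" "c2 z = x1 - c1 y" "\<Gamma>0' z = 0" "\<Gamma>1' z = 0" using boundary_values_onto[OF 0] by metis
      have "inner (x1 - c1 y) (x1 - c1 y) = 0" using diff[OF z(1)] z P2_zero[OF 0] by simp
      then show "x1 = c1 y" by simp
      obtain z where z: "z \<in> mdom" "c1 z = x2 - c2 y" "c2 z = 0" "\<Gamma>0' z = 0" "\<Gamma>1' z = 0" using boundary_values_onto[OF 0] by metis
      have "inner (x2 - c2 y) (x2 - c2 y) = 0" using diff[OF z(1)] z P2_zero[OF 0] by simp
      then show "x2 = c2 y" by simp
    qed
    have "a' - \<Gamma>1' y \<in> H1'" using H1_subspace L(3) \<Gamma>1_mem[OF y(1)] by (intro subspace_diff)
    moreover have "inner (a' - \<Gamma>1' y) (\<Gamma>0' z) - inner (a - \<Gamma>0' y) (\<Gamma>1' z) + inner (\<i> *\<^sub>C (a - \<Gamma>0' y)) (P2 (\<Gamma>0' z)) = 0" if "z \<in> mdom" for z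
      using diff[OF that] unfolding x by simp
    ultimately have "a - \<Gamma>0' y = 0" "a' - \<Gamma>1' y = 0" using form_nondegenerate by blast+
    then have "e = ev y" unfolding ee ev_def using x y by simp
    then show "e \<in> ev ` mdom" using y(1) by blast
  qed
qed

lemma ev_complete: "complete (ev ` mdom)"
proof -
  have cL: "closed (L2_on \<Delta> :: 'h L2 set)" by (rule closed_L2_on[OF sets_interval])
  have cont: "continuous_on UNIV (\<lambda>e :: 'h L2 \<times> 'h L2 \<times> (('h, 'n) vec \<times> ('h, 'n) vec) \<times> 'a \<times> 'a. \<i> *\<^sub>C fst (snd (snd (snd e))))"
    by (intro bounded_linear.continuous_on[OF bounded_linear_scaleC] continuous_intros)
  have vim: "closed {e. f e \<in> S}" if "closed S" "continuous_on UNIV f" for f :: "'h L2 \<times> 'h L2 \<times> (('h, 'n) vec \<times> ('h, 'n) vec) \<times> 'a \<times> 'a \<Rightarrow> 'z::topological_space" and S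
    using closed_vimage[OF that] by (simp add: vimage_def)
  have "closed (ev ` mdom)"
    unfolding ev_image_eq
    by (intro closed_Collect_conj closed_Collect_all closed_Collect_imp open_Collect_const closed_Collect_eq vim cL H1(2) cont continuous_intros)
  then show ?thesis by (simp add: complete_eq_closed)
qed

end

section \<open>Spectra of proper extensions\<close>

context boundary_triplet
begin

lemma boundary_operator:
  fixes Ch1 Ch2 :: "('h, 'n) vec \<Rightarrow> 'k::complex_hilbert" and C0' C1' :: "'a \<Rightarrow> 'k"
  assumes Ch1: "bounded_operator_on UNIV Ch1" and Ch2: "bounded_operator_on UNIV Ch2"
    and C0': "bounded_operator_on UNIV C0'" and C1': "bounded_operator_on H1' C1'"
  shows "real_operator_on (ev ` mdom) (\<lambda>e. Ch1 (fst (fst (snd (snd e)))) + Ch2 (snd (fst (snd (snd e))))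
    + (C0' (fst (snd (snd (snd e)))) + C1' (snd (snd (snd (snd e))))))"
  unfolding real_operator_on_def
proof (intro conjI ballI allI)
  note a = bounded_operator_on_real[OF Ch1] and b = bounded_operator_on_real[OF Ch2]
    and c = bounded_operator_on_real[OF C0'] and d = bounded_operator_on_real[OF C1']
  have mem: "snd (snd (snd (snd e))) \<in> H1'" if "e \<in> ev ` mdom" for e using that \<Gamma>1_mem by (auto simp: ev_def)
  fix e assume e: "e \<in> ev ` mdom"
  show "Ch1 (fst (fst (snd (snd (e + e'))))) + Ch2 (snd (fst (snd (snd (e + e'))))) + (C0' (fst (snd (snd (snd (e + e'))))) + C1' (snd (snd (snd (snd (e + e'))))))
    = Ch1 (fst (fst (snd (snd e)))) + Ch2 (snd (fst (snd (snd e)))) + (C0' (fst (snd (snd (snd e)))) + C1' (snd (snd (snd (snd e)))))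
    + (Ch1 (fst (fst (snd (snd e')))) + Ch2 (snd (fst (snd (snd e')))) + (C0' (fst (snd (snd (snd e')))) + C1' (snd (snd (snd (snd e'))))))"
    if "e' \<in> ev ` mdom" for e'
    using mem[OF e] mem[OF that] by (simp add: a(1) b(1) c(1) d(1))
  show "Ch1 (fst (fst (snd (snd (r *\<^sub>R e))))) + Ch2 (snd (fst (snd (snd (r *\<^sub>R e))))) + (C0' (fst (snd (snd (snd (r *\<^sub>R e))))) + C1' (snd (snd (snd (snd (r *\<^sub>R e))))))
    = r *\<^sub>R (Ch1 (fst (fst (snd (snd e)))) + Ch2 (snd (fst (snd (snd e)))) + (C0' (fst (snd (snd (snd e)))) + C1' (snd (snd (snd (snd e))))))" for r
    using mem[OF e] by (simp add: a(2) b(2) c(2) d(2) scaleR_add_right)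
next
  have mem: "snd (snd (snd (snd e))) \<in> H1'" if "e \<in> ev ` mdom" for e using that \<Gamma>1_mem by (auto simp: ev_def)
  obtain Ma where Ma: "Ma \<ge> 0" "\<And>x. norm (Ch1 x) \<le> Ma * norm x" using bounded_operator_on_real(3)[OF Ch1] by blast
  obtain Mb where Mb: "Mb \<ge> 0" "\<And>x. norm (Ch2 x) \<le> Mb * norm x" using bounded_operator_on_real(3)[OF Ch2] by blast
  obtain Mc where Mc: "Mc \<ge> 0" "\<And>x. norm (C0' x) \<le> Mc * norm x" using bounded_operator_on_real(3)[OF C0'] by blast
  obtain Md where Md: "Md \<ge> 0" "\<And>x. x \<in> H1' \<Longrightarrow> norm (C1' x) \<le> Md * norm x" using bounded_operator_on_real(3)[OF C1'] by blast
  show "\<exists>C. \<forall>e\<in>ev ` mdom. norm (Ch1 (fst (fst (snd (snd e)))) + Ch2 (snd (fst (snd (snd e))))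
      + (C0' (fst (snd (snd (snd e)))) + C1' (snd (snd (snd (snd e)))))) \<le> C * norm e"
  proof (intro exI[of _ "Ma + Mb + (Mc + Md)"] ballI)
    fix e assume e: "e \<in> ev ` mdom"
    have s: "norm (snd (snd e)) \<le> norm e" "norm (snd (snd (snd e))) \<le> norm e"
      using norm_fst_snd_le(2)[of e] norm_fst_snd_le(2)[of "snd e"] norm_fst_snd_le(2)[of "snd (snd e)"] by linarith+
    have n: "norm (fst (fst (snd (snd e)))) \<le> norm e" "norm (snd (fst (snd (snd e)))) \<le> norm e"
      "norm (fst (snd (snd (snd e)))) \<le> norm e" "norm (snd (snd (snd (snd e)))) \<le> norm e"
      using s norm_fst_snd_le[of "fst (snd (snd e))"] norm_fst_snd_le[of "snd (snd (snd e))"] norm_fst_snd_le(1)[of "snd (snd e)"]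
      by linarith+
    have "norm (Ch1 (fst (fst (snd (snd e)))) + Ch2 (snd (fst (snd (snd e)))) + (C0' (fst (snd (snd (snd e)))) + C1' (snd (snd (snd (snd e))))))
      \<le> norm (Ch1 (fst (fst (snd (snd e))))) + norm (Ch2 (snd (fst (snd (snd e))))) + (norm (C0' (fst (snd (snd (snd e))))) + norm (C1' (snd (snd (snd (snd e))))))"
      by (intro norm_triangle_le add_mono norm_triangle_ineq order_refl)
    also have "\<dots> \<le> Ma * norm e + Mb * norm e + (Mc * norm e + Md * norm e)"
      using n by (intro add_mono order_trans[OF Ma(2)] order_trans[OF Mb(2)] order_trans[OF Mc(2)] order_trans[OF Md(2)[OF mem[OF e]]]
          mult_left_mono Ma(1) Mb(1) Mc(1) Md(1))
    finally show "norm (Ch1 (fst (fst (snd (snd e)))) + Ch2 (snd (fst (snd (snd e)))) + (C0' (fst (snd (snd (snd e)))) + C1' (snd (snd (snd (snd e))))))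
      \<le> (Ma + Mb + (Mc + Md)) * norm e" by (simp add: algebra_simps)
  qed
qed

text \<open>All the spectral notions are built from four statements: trivial kernel, full range,
  dense range, closed range. The fundamental solution parametrizes the kernel of \<open>F\<close>
  bijectively, and \<open>T\<close> is \<open>B\<close> expressed in this parameter.\<close>

lemma spectral_equivalence:
  fixes Ch1 Ch2 :: "('h, 'n) vec \<Rightarrow> 'k::complex_hilbert" and C0' C1' :: "'a \<Rightarrow> 'k"
    and C0 C1 :: "('h, 'n) vec \<times> 'a \<Rightarrow> 'k" and Z :: "real \<Rightarrow> 'k1::complex_hilbert \<Rightarrow>\<^sub>L 'h" and T :: "'k1 \<Rightarrow> 'k"
  assumes pair: "operator_pair UNIV (UNIV \<times> H1') C0 C1"
    and Ch1: "bounded_operator_on UNIV Ch1" and Ch2: "bounded_operator_on UNIV Ch2"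
    and C0': "bounded_operator_on UNIV C0'" and C1': "bounded_operator_on H1' C1'"
    and C0: "\<And>x u. C0 (x, u) = Ch2 x + C0' u" and C1: "\<And>x u. u \<in> H1' \<Longrightarrow> C1 (x, u) = - Ch1 x + C1' u"
    and A: "A = restricted_op n \<Delta> p q {y \<in> mdom. Ch1 (c1 y) + Ch2 (c2 y) + C0' (\<Gamma>0' y) + C1' (\<Gamma>1' y) = 0}"
    and Z: "fundamental_solution n \<Delta> p q lam Z"
    and T: "\<And>h. T h = Ch1 (column_apply (column1 (o\<^sub>L) \<Delta> p q Z 0) h) + Ch2 (column_apply (column2 (o\<^sub>L) \<Delta> p q Z 0) h)
                  + (C0' (\<Gamma>0' (zero_ext \<Delta> (\<lambda>t. Z t h))) + C1' (\<Gamma>1' (zero_ext \<Delta> (\<lambda>t. Z t h))))"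
    and lam: "lam \<in> rho_hat (min_op dim \<Delta> b p q)"
  shows "op_ker (op_minus A lam) = {0} \<longleftrightarrow> op_ker (op_graph T) = {0}"
    "Range (op_minus A lam) = L2_on \<Delta> \<longleftrightarrow> Range (op_graph T) = UNIV"
    "closure (Range (op_minus A lam)) = L2_on \<Delta> \<longleftrightarrow> closure (Range (op_graph T)) = UNIV"
    "closure (Range (op_minus A lam)) = Range (op_minus A lam) \<longleftrightarrow> closure (Range (op_graph T)) = Range (op_graph T)"
proof -
  define B where "B e = Ch1 (fst (fst (snd (snd e)))) + Ch2 (snd (fst (snd (snd e))))
    + (C0' (fst (snd (snd (snd e)))) + C1' (snd (snd (snd (snd e)))))" for e :: "'h L2 \<times> 'h L2 \<times> (('h, 'n) vec \<times> ('h, 'n) vec) \<times> 'a \<times> 'a"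
  define F where "F e = fst (snd e) - lam *\<^sub>C fst e" for e :: "'h L2 \<times> 'h L2 \<times> (('h, 'n) vec \<times> ('h, 'n) vec) \<times> 'a \<times> 'a"
  have Bev: "B (ev y) = Ch1 (c1 y) + Ch2 (c2 y) + (C0' (\<Gamma>0' y) + C1' (\<Gamma>1' y))" for y by (simp add: B_def ev_def)
  have Fev: "F (ev y) = Lop y - lam *\<^sub>C abs_L2 y" for y by (simp add: F_def ev_def)
  have B: "real_operator_on (ev ` mdom) B" unfolding B_def by (rule boundary_operator[OF Ch1 Ch2 C0' C1'])
  have blF: "bounded_linear F" unfolding F_def
    by (intro bounded_linear_sub bounded_linear_compose[OF bounded_linear_fst bounded_linear_snd] bounded_linear_compose[OF bounded_linear_scaleC bounded_linear_fst])
  have F: "real_operator_on (ev ` mdom) F"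
    unfolding real_operator_on_def using linear_simps[OF blF] bounded_linear.bounded[OF blF] by (metis mult.commute)
  have cs: "csubspace (L2_on \<Delta> :: 'h L2 set)" by (rule csubspace_L2_on)
  have B_onto: "B ` ev ` mdom = UNIV"
  proof (intro equalityI subset_UNIV subsetI)
    fix k :: 'k
    have "k \<in> {C0 x0 + C1 x1 | x0 x1. x0 \<in> UNIV \<and> x1 \<in> UNIV \<times> H1'}" using pair unfolding operator_pair_def by simp
    then obtain x u x' u' where k: "k = C0 (x, u) + C1 (x', u')" "u' \<in> H1'" by auto
    \<comment> \<open>The block of \<open>C1\<close> acting on the first column is minus
      \<open>Ch1\<close>, so the column prescribed for y is - x'.\<close>
    obtain y where y: "y \<in> mdom" "c1 y = - x'" "c2 y = x" "\<Gamma>0' y = u" "\<Gamma>1' y = u'"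
      using boundary_values_onto[OF k(2), of "- x'" x u] by metis
    have "Ch1 (- x') = - Ch1 x'" using bounded_operator_on_real(2)[OF Ch1, of x' "-1"] by simp
    then have "B (ev y) = k" unfolding Bev y k(1) C0 C1[OF k(2)] by simp
    then show "k \<in> B ` ev ` mdom" using y(1) by blast
  qed
  have min: "min_op dim \<Delta> b p q = graph0"
  proof -
    have "(c1 y = 0 \<and> c2 y = 0) \<longleftrightarrow> (\<forall>j<2 * n. qv j y 0 = 0)" for y
    proof -
      have "(c1 y = 0 \<and> c2 y = 0) \<longleftrightarrow> (of_comps (\<lambda>j. qv j y 0) :: ('h, 'n) vec \<times> ('h, 'n) vec) = of_comps (\<lambda>_. 0)"
        unfolding columns[symmetric] by (simp add: of_comps_def vec_eq_iff)
      also have "\<dots> \<longleftrightarrow> (\<forall>j<2 * n. qv j y 0 = 0)"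
      proof
        assume eq: "(of_comps (\<lambda>j. qv j y 0) :: ('h, 'n) vec \<times> ('h, 'n) vec) = of_comps (\<lambda>_. 0)"
        show "\<forall>j<2 * n. qv j y 0 = 0"
        proof (intro allI impI)
          fix j assume "j < 2 * n"
          then have j: "j < 2 * CARD('n)" using n_eq by simp
          show "qv j y 0 = 0"
            using arg_cong[OF eq, of "\<lambda>x. state_comp x j"] by (simp only: comp_of_comps[OF j])
        qed
      qed (rule of_comps_cong, simp)
      finally show ?thesis .
    qed
    then have "{y \<in> mdom. c1 y = 0 \<and> c2 y = 0 \<and> (\<forall>z\<in>mdom. bb y z = 0)} = mdom0" unfolding mdom0_def by blast
    then show ?thesis unfolding min_op_def n_eq[symmetric] graph0_def restricted_op_def by simp
  qed
  have F_onto: "F ` ev ` mdom = L2_on \<Delta>"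
  proof
    show "F ` ev ` mdom \<subseteq> L2_on \<Delta>"
    proof
      fix f assume "f \<in> F ` ev ` mdom"
      then obtain y where y: "y \<in> mdom" "f = Lop y - lam *\<^sub>C abs_L2 y" by (auto simp: Fev)
      have "lam *\<^sub>C abs_L2 y \<in> L2_on \<Delta>" using mdom_L2_on(1)[OF y(1)] cs unfolding csubspace_def by blast
      then show "f \<in> L2_on \<Delta>" unfolding y(2) using mdom_L2_on(2)[OF y(1)] csubspace_imp_subspace[OF cs] by (intro subspace_diff)
    qed
    have rng: "Range (op_minus graph0 lam) = (\<lambda>x. snd x - lam *\<^sub>C fst x) ` graph0" by (force simp: op_minus_def)
    have lam': "op_ker (op_minus graph0 lam) = {0}" "closed (Range (op_minus graph0 lam))"
      using lam unfolding min rho_hat_def zero_in_rho_hat_def by auto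
    have ker: "x = 0" if x: "x \<in> graph0" "snd x - lam *\<^sub>C fst x = 0" for x
    proof -
      have "(fst x, 0) \<in> op_minus graph0 lam" unfolding op_minus_def using x by (metis (mono_tags, lifting) mem_Collect_eq prod.collapse)
      then have "fst x = 0" using lam'(1) by (auto simp: op_ker_def)
      then show "x = 0" using x(2) by (simp add: prod_eq_iff)
    qed
    have "\<exists>y\<in>mdom. Lop y - lam *\<^sub>C abs_L2 y = f" if "f \<in> L2_on \<Delta>" for f
      by (rule resolvent_onto[OF ker lam'(2)[unfolded rng] that])
    then show "L2_on \<Delta> \<subseteq> F ` ev ` mdom" by (force simp: Fev image_image)
  qed
  have closedL: "complete (L2_on \<Delta> :: 'h L2 set)" using closed_L2_on[OF sets_interval] by (simp add: complete_eq_closed)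
  note C = coupled_ranges[OF ev_subspace ev_complete B F subspace_UNIV complete_UNIV B_onto csubspace_imp_subspace[OF cs] closedL F_onto]

  have A': "A = {(abs_L2 y, Lop y) | y. y \<in> mdom \<and> B (ev y) = 0}"
    unfolding A restricted_op_def Bev by (simp add: add.assoc)
  have rangeA: "Range (op_minus A lam) = F ` {e \<in> ev ` mdom. B e = 0}"
    unfolding A' op_minus_def by (force simp: Fev)
  have kerA: "op_ker (op_minus A lam) = {abs_L2 y | y. y \<in> mdom \<and> B (ev y) = 0 \<and> F (ev y) = 0}"
    unfolding A' op_minus_def op_ker_def by (force simp: Fev)

  define sol where "sol h = zero_ext \<Delta> (\<lambda>t. Z t h)" for h
  have Zreg: "quasi_regular (o\<^sub>L) n \<Delta> p q Z"
    and Zde: "AE t in lebesgue. t \<in> \<Delta> \<longrightarrow> de (o\<^sub>L) Z t = scalar_op lam o\<^sub>L Z t"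
    and Zsq: "square_integrable (sol h)"
    and Zun: "y \<in> mdom \<Longrightarrow> abs_L2 y \<in> op_ker (op_minus (max_op n \<Delta> p q) lam) \<Longrightarrow> \<exists>!h. \<forall>t\<in>\<Delta>. y t = Z t h" for h y
    using Z unfolding fundamental_solution_def sol_def by blast+
  note r = zero_ext_regular[OF operator_function_apply(1)[OF Zreg]] and a = operator_function_apply[OF Zreg]
  have sol: "sol h \<in> mdom" "F (ev (sol h)) = 0" for h
  proof -
    have "sol h \<in> mdom \<and> Lop (sol h) = abs_L2 (\<lambda>t. lam *\<^sub>C sol h t)"
    proof (rule mdomI)
      show "regular (sol h)" unfolding sol_def by (rule r(1))
      show "square_integrable (\<lambda>t. lam *\<^sub>C sol h t)" by (rule square_integrable_scaleC[OF Zsq])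
      show "AE t in lebesgue. t \<in> \<Delta> \<longrightarrow> dv (sol h) t = lam *\<^sub>C sol h t"
        using a(3)[of h] Zde
      proof eventually_elim
        case (elim t)
        have "sol h t = Z t h" if "t \<in> \<Delta>" using that by (simp add: sol_def zero_ext_def)
        then show ?case using elim r(3)[of t h] by (simp add: sol_def)
      qed
    qed (use Zsq in \<open>auto simp: sol_def zero_ext_def\<close>)
    then show "sol h \<in> mdom" "F (ev (sol h)) = 0" using abs_L2_arith(3)[OF Zsq[of h] Zsq[of h], where c = lam] by (auto simp: Fev)
  qed
  have Tsol: "T h = B (ev (sol h))" for h
  proof -
    have q: "qv j (sol h) 0 = qd (o\<^sub>L) j Z 0 h" if "j < 2 * n" for j
      unfolding sol_def using r(2)[OF zero_mem] a(2)[OF zero_mem that] by simp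
    have i: "pos i < 2 * n" "2 * n - 1 - pos i < 2 * n" for i :: 'n using pos_less[of i] n_eq by auto
    have "c1 (sol h) = column_apply (column1 (o\<^sub>L) \<Delta> p q Z 0) h" "c2 (sol h) = column_apply (column2 (o\<^sub>L) \<Delta> p q Z 0) h"
      using q[OF i(1)] q[OF i(2)] by (simp_all add: column_apply_def column1_def column2_def vec_eq_iff n_eq[symmetric])
    then show ?thesis unfolding T Bev by (simp add: sol_def)
  qed
  have kerL: "abs_L2 y \<in> op_ker (op_minus (max_op n \<Delta> p q) lam)" if "y \<in> mdom" "F (ev y) = 0" for y
    using that unfolding op_ker_def op_minus_def max_op_def restricted_op_def Fev by force
  have solE: "\<exists>h. y = sol h" if y: "y \<in> mdom" "F (ev y) = 0" for y
  proof -
    from Zun[OF y(1) kerL[OF y]] obtain h where "\<forall>t\<in>\<Delta>. y t = Z t h" by blast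
    then have "y = sol h" using mdomD(2)[OF y(1)] by (auto simp: sol_def zero_ext_def)
    then show ?thesis ..
  qed
  \<comment> \<open>The zero function is a solution, represented by the parameter 0; uniqueness of
    the parameter makes the parametrization injective.\<close>
  have sol_inj: "h = 0" if "sol h = (\<lambda>_. 0)" for h
  proof -
    have "abs_L2 (\<lambda>_. 0) \<in> op_ker (op_minus (max_op n \<Delta> p q) lam)"
      using mdom_zero by (intro kerL) (simp_all add: Fev abs_L2_zero)
    from Zun[OF conjunct1[OF mdom_zero] this] have u: "\<exists>!h. \<forall>t\<in>\<Delta>. 0 = Z t h" .
    have "0 = Z t h" if "t \<in> \<Delta>" for t using fun_cong[OF \<open>sol h = (\<lambda>_. 0)\<close>, of t] that by (simp add: sol_def zero_ext_def)
    moreover have "0 = Z t 0" for t by (simp add: blinfun.zero_right)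
    ultimately show "h = 0" using u by blast
  qed
  have sol0: "sol 0 = (\<lambda>_. 0)" by (simp add: sol_def zero_ext_def blinfun.zero_right fun_eq_iff)
  have rangeT: "Range (op_graph T) = B ` {e \<in> ev ` mdom. F e = 0}"
  proof
    show "Range (op_graph T) \<subseteq> B ` {e \<in> ev ` mdom. F e = 0}" using sol by (auto simp: op_graph_def Tsol)
    show "B ` {e \<in> ev ` mdom. F e = 0} \<subseteq> Range (op_graph T)" using solE by (force simp: op_graph_def Tsol)
  qed
  have T0: "T 0 = 0"
    using subspace_0[OF ev_subspace] real_operator_onD(2)[OF B ev_subspace _ _, of "ev (sol 0)" "ev (sol 0)" 0] sol(1)[of 0]
      ev_scaleC[OF sol(1)[of 0], of 0] by (simp add: Tsol sol0)
  have kerT: "op_ker (op_graph T) = {h. T h = 0}" by (auto simp: op_ker_def op_graph_def)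
  show "op_ker (op_minus A lam) = {0} \<longleftrightarrow> op_ker (op_graph T) = {0}"
  proof
    assume k: "op_ker (op_minus A lam) = {0}"
    have "h = 0" if "T h = 0" for h
    proof -
      have "abs_L2 (sol h) \<in> op_ker (op_minus A lam)" unfolding kerA using sol[of h] that Tsol[of h] by auto
      then have "abs_L2 (sol h) = abs_L2 (\<lambda>_. 0)" using k by (simp add: abs_L2_zero)
      from mdom_eqI[OF sol(1) conjunct1[OF mdom_zero] this] show "h = 0" by (rule sol_inj)
    qed
    then show "op_ker (op_graph T) = {0}" unfolding kerT using T0 by auto
  next
    assume k: "op_ker (op_graph T) = {0}"
    show "op_ker (op_minus A lam) = {0}"
    proof
      show "op_ker (op_minus A lam) \<subseteq> {0}"
      proof
        fix x assume "x \<in> op_ker (op_minus A lam)"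
        then obtain y where y: "y \<in> mdom" "B (ev y) = 0" "F (ev y) = 0" "x = abs_L2 y" unfolding kerA by blast
        obtain h where h: "y = sol h" using solE[OF y(1,3)] by blast
        then have "T h = 0" using y(2) Tsol by simp
        then have "h = 0" using k kerT by blast
        then show "x \<in> {0}" using y(4) h sol0 by (simp add: abs_L2_zero)
      qed
      have "abs_L2 (sol 0) \<in> op_ker (op_minus A lam)" unfolding kerA using sol[of 0] T0 Tsol[of 0] by auto
      then show "{0} \<subseteq> op_ker (op_minus A lam)" using sol0 by (simp add: abs_L2_zero)
    qed
  qed
  show "Range (op_minus A lam) = L2_on \<Delta> \<longleftrightarrow> Range (op_graph T) = UNIV"
    "closure (Range (op_minus A lam)) = L2_on \<Delta> \<longleftrightarrow> closure (Range (op_graph T)) = UNIV"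
    "closure (Range (op_minus A lam)) = Range (op_minus A lam) \<longleftrightarrow> closure (Range (op_graph T)) = Range (op_graph T)"
    unfolding rangeA rangeT using C by blast+
qed

end

theorem theorem4p7:
  fixes \<Delta> :: "real set" and b :: ereal
    and p q :: "nat \<Rightarrow> real \<Rightarrow> 'h::{complex_hilbert, second_countable_topology} \<Rightarrow>\<^sub>L 'h"
    and H1' :: "'a::complex_hilbert set"
    and \<Gamma>0 \<Gamma>1 :: "(real \<Rightarrow> 'h) \<Rightarrow> ('h, 'n::{finite, linorder}) vec \<times> 'a"
    and \<Gamma>0' \<Gamma>1' :: "(real \<Rightarrow> 'h) \<Rightarrow> 'a"
    and C0 C1 :: "('h, 'n) vec \<times> 'a \<Rightarrow> 'k::complex_hilbert"
    and Ch1 Ch2 :: "('h, 'n) vec \<Rightarrow> 'k" and C0' C1' :: "'a \<Rightarrow> 'k"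
    and A :: "('h L2 \<times> 'h L2) set"
    and lam :: complex
    and Z :: "real \<Rightarrow> 'k1::complex_hilbert \<Rightarrow>\<^sub>L 'h" and T :: "'k1 \<Rightarrow> 'k"
  assumes "is_interval_to \<Delta> b"
    and "coefficients CARD('n) \<Delta> p q"
    and "decomposing_D_triplet \<Delta> b p q H1' \<Gamma>0 \<Gamma>1 \<Gamma>0' \<Gamma>1'"
    and "operator_pair UNIV (UNIV \<times> H1') C0 C1"
    and "bounded_operator_on UNIV Ch1" and "bounded_operator_on UNIV Ch2"
    and "bounded_operator_on UNIV C0'" and "bounded_operator_on H1' C1'"
    and "\<And>x u. C0 (x, u) = Ch2 x + C0' u"
    and "\<And>x u. u \<in> H1' \<Longrightarrow> C1 (x, u) = - Ch1 x + C1' u"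
    and "A = restricted_op CARD('n) \<Delta> p q
           {y \<in> max_domain CARD('n) \<Delta> p q.
              Ch1 (column1 blinfun_apply \<Delta> p q y 0) + Ch2 (column2 blinfun_apply \<Delta> p q y 0)
              + C0' (\<Gamma>0' y) + C1' (\<Gamma>1' y) = 0}"
    and "A \<in> proper_extensions TYPE('n) \<Delta> b p q"
    and "fundamental_solution CARD('n) \<Delta> p q lam Z"
    and "\<And>h. T h = Ch1 (column_apply (column1 (o\<^sub>L) \<Delta> p q Z 0) h)
                  + Ch2 (column_apply (column2 (o\<^sub>L) \<Delta> p q Z 0) h)
                  + (C0' (\<Gamma>0' (zero_ext \<Delta> (\<lambda>t. Z t h)))
                     + C1' (\<Gamma>1' (zero_ext \<Delta> (\<lambda>t. Z t h))))"
    and "lam \<in> rho_hat (min_op TYPE('n) \<Delta> b p q)"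
  shows "(lam \<in> rho (L2_on \<Delta>) A \<longleftrightarrow> zero_in_rho UNIV (op_graph T))
    \<and> (lam \<in> sigma_p A \<longleftrightarrow> zero_in_sigma_p (op_graph T))
    \<and> (lam \<in> sigma_c (L2_on \<Delta>) A \<longleftrightarrow> zero_in_sigma_c UNIV (op_graph T))
    \<and> (lam \<in> sigma_r (L2_on \<Delta>) A \<longleftrightarrow> zero_in_sigma_r UNIV (op_graph T))
    \<and> (lam \<in> rho_hat A \<longleftrightarrow> zero_in_rho_hat (op_graph T))
    \<and> (closure (Range (op_minus A lam)) = Range (op_minus A lam)
        \<longleftrightarrow> closure (Range (op_graph T)) = Range (op_graph T))"
proof -
  have coeff: "quasi_coefficients \<Delta> CARD('n) p q"
    by (intro quasi_coefficients.intro half_interval_is_interval_to[OF assms(1)] quasi_coefficients_axioms.intro assms(2)) simp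
  have interval: "quasi_interval TYPE('n) \<Delta> CARD('n) p q b"
    by (intro quasi_interval.intro quasi_system.intro coeff quasi_system_axioms.intro quasi_interval_axioms.intro assms(1) refl)
  interpret boundary_triplet \<Delta> "CARD('n)" p q "TYPE('n)" b H1' \<Gamma>0' \<Gamma>1'
    by (intro boundary_triplet.intro interval boundary_triplet_axioms.intro)
      (use assms(3) in \<open>simp_all add: decomposing_D_triplet_def Let_def\<close>)
  note e = spectral_equivalence[OF assms(4-11,13-15)]
  \<comment> \<open>The regular type points are defined through closedness of the range, whereas the
    last equivalence is expressed by its closure.\<close>
  have "closed (Range (op_minus A lam)) \<longleftrightarrow> closed (Range (op_graph T))" using e(4) by (simp only: closure_eq)
  then show ?thesis
    using e by (simp add: rho_def sigma_p_def sigma_c_def sigma_r_def rho_hat_def zero_in_rho_def zero_in_rho_hat_def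
        zero_in_sigma_p_def zero_in_sigma_c_def zero_in_sigma_r_def)
qed

end
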